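(* Let $M$ be a connected hyperbolic three-manifold. (1) If $M$ is nice dodecahedral, then there is a connected complete finite-volume orientable hyperbolic four-manifold $W$ that contains $M$ as a geodesic hypersurface and such that $\mathrm{Vol}(W) \leq 13\cdot 2^{45}\cdot \mathrm{Vol}(M)$. (2) If $M$ is nice octahedral, then there is a connected complete finite-volume orientable hyperbolic four-manifold $W$ that contains $M$ as a geodesic hypersurface and such that $\mathrm{Vol}(W) \leq 1844\cdot \mathrm{Vol}(M)$.
   Context: A hyperbolic $(n+1)$-manifold $W$ contains a hyperbolic $n$-manifold $M$ as a geodesic hypersurface if there is an embedded totally geodesic hypersurface of $W$ isometric to $M$. $\mathrm{Vol}$ denotes hyperbolic volume. A complete, possibly non-orientable, finite-volume hyperbolic 3-manifold is called dodecahedral (respectively octahedral) if it may be tessellated into right-angled regular hyperbolic dodecahedra, which are compact (respectively right-angled regular ideal hyperbolic octahedra), i.e. it is obtained from (finitely many) such polyhedra by isometrically pairing their 2-dimensional faces. A dodecahedral manifold is nice if it can be decomposed into embedded right-angled dodecahedra; equivalently, if it has such a decomposition in which every vertex is adjacent to 8 distinct dodecahedra. An octahedral manifold is nice if it has a decomposition into right-angled ideal octahedra such that every ideal triangle of the decomposition is adjacent to two distinct ideal octahedra (the four octahedra incident at an edge are not required to be distinct, so the octahedra need not be embedded). *)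

theory Defs
  imports "HOL-Analysis.Analysis"
begin

section \<open>The Klein model of hyperbolic space\<close>

text \<open>
  Hyperbolic \<open>n\<close>-space (curvature \<open>-1\<close>) is the open unit ball \<open>ball 0 1\<close> of
  \<open>real ^ 'n\<close> with the Klein metric \<open>klein_dist\<close>. Its totally geodesic hypersurfaces are the
  traces of affine hyperplanes, hyperbolic polytopes are traces of Euclidean polytopes, and points
  of the unit sphere are ideal points. Two hyperplanes \<open>u \<bullet> x = b\<close> and \<open>v \<bullet> x = c\<close> that meet
  inside the ball are orthogonal iff \<open>u \<bullet> v = b * c\<close>.
\<close>

definition klein_dist :: "real ^ 'n \<Rightarrow> real ^ 'n \<Rightarrow> real" where
  "klein_dist x y =
     arcosh ((1 - x \<bullet> y) / (sqrt (1 - (norm x)\<^sup>2) * sqrt (1 - (norm y)\<^sup>2)))"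

definition klein_volume :: "(real ^ 'n) set \<Rightarrow> ennreal" where
  "klein_volume A =
     (\<integral>\<^sup>+ x \<in> A. ennreal ((1 - (norm x)\<^sup>2) powr (- (real CARD('n) + 1) / 2)) \<partial>lborel)"


section \<open>Hyperbolic manifolds\<close>

text \<open>
  A connected hyperbolic manifold is given by its Riemannian distance: a metric space that is
  locally isometric to hyperbolic space and in which the distance of two points is the infimum of
  the lengths of the curves joining them.

  Such a manifold of positive dimension has the cardinality of the continuum, so up to isometry
  its underlying set consists of real numbers. Existence of a manifold can thus be stated
  as existence of some \<open>W :: real metric\<close>, where the topology of \<open>real\<close> plays no role.
\<close>

definition curve_length :: "'a metric \<Rightarrow> (real \<Rightarrow> 'a) \<Rightarrow> ennreal" where
  "curve_length M \<gamma> =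
     (SUP ts \<in> {ts. sorted ts \<and> set ts \<subseteq> {0..1}}.
        \<Sum>i < length ts - 1. ennreal (mdist M (\<gamma> (ts ! i)) (\<gamma> (ts ! Suc i))))"

definition intrinsic_dist :: "'a metric \<Rightarrow> 'a set \<Rightarrow> 'a \<Rightarrow> 'a \<Rightarrow> ennreal" where
  "intrinsic_dist M S x y =
     (INF \<gamma> \<in> {\<gamma>. pathin (subtopology (mtopology_of M) S) \<gamma> \<and> \<gamma> 0 = x \<and> \<gamma> 1 = y}.
        curve_length M \<gamma>)"

definition hyperbolic_chart :: "'a metric \<Rightarrow> 'a set \<Rightarrow> ('a \<Rightarrow> real ^ 'n) \<Rightarrow> bool" where
  "hyperbolic_chart M U \<phi> \<longleftrightarrow>
     openin (mtopology_of M) U \<and> open (\<phi> ` U) \<and> \<phi> ` U \<subseteq> ball 0 1 \<and>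
     (\<forall>x\<in>U. \<forall>y\<in>U. klein_dist (\<phi> x) (\<phi> y) = mdist M x y)"

definition connected_hyperbolic_manifold :: "'n::finite itself \<Rightarrow> 'a metric \<Rightarrow> bool" where
  "connected_hyperbolic_manifold n M \<longleftrightarrow>
     mspace M \<noteq> {} \<and> connected_space (mtopology_of M) \<and>
     (\<forall>p\<in>mspace M. \<exists>U (\<phi> :: 'a \<Rightarrow> real ^ 'n). p \<in> U \<and> hyperbolic_chart M U \<phi>) \<and>
     (\<forall>x\<in>mspace M. \<forall>y\<in>mspace M. ennreal (mdist M x y) = intrinsic_dist M (mspace M) x y)"

text \<open>
  A hyperbolic manifold is a countable disjoint union of Borel sets that each lie in a chart
  domain, and its volume is the sum of the hyperbolic volumes of their images. This sum is the
  supremum over all finite families of disjoint Borel pieces.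
\<close>

definition hyperbolic_volume :: "'n::finite itself \<Rightarrow> 'a metric \<Rightarrow> ennreal" where
  "hyperbolic_volume n M =
     (SUP \<P> \<in> {\<P> :: ('a set \<times> ('a \<Rightarrow> real ^ 'n)) set.
          finite \<P> \<and> disjoint_family_on fst \<P> \<and>
          (\<forall>(A, \<phi>)\<in>\<P>. \<phi> ` A \<in> sets borel \<and> (\<exists>U. A \<subseteq> U \<and> hyperbolic_chart M U \<phi>))}.
        \<Sum>(A, \<phi>)\<in>\<P>. klein_volume (\<phi> ` A))"

definition complete_finite_volume_hyperbolic :: "'n::finite itself \<Rightarrow> 'a metric \<Rightarrow> bool" where
  "complete_finite_volume_hyperbolic n M \<longleftrightarrow>
     connected_hyperbolic_manifold n M \<and> mcomplete_of M \<and> hyperbolic_volume n M < \<infinity>"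

definition orientable_hyperbolic :: "'n::finite itself \<Rightarrow> 'a metric \<Rightarrow> bool" where
  "orientable_hyperbolic n M \<longleftrightarrow>
     (\<exists>\<A> :: ('a set \<times> ('a \<Rightarrow> real ^ 'n)) set.
        (\<forall>(U, \<phi>)\<in>\<A>. hyperbolic_chart M U \<phi>) \<and> (\<Union>(U, \<phi>)\<in>\<A>. U) = mspace M \<and>
        (\<forall>(U, \<phi>)\<in>\<A>. \<forall>(V, \<psi>)\<in>\<A>. \<forall>p \<in> U \<inter> V.
           \<exists>D. ((\<lambda>y. \<psi> (inv_into U \<phi> y)) has_derivative D) (at (\<phi> p)) \<and> det (matrix D) > 0))"

definition totally_geodesic_hypersurface :: "'n::finite itself \<Rightarrow> 'a metric \<Rightarrow> 'a set \<Rightarrow> bool" where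
  "totally_geodesic_hypersurface n W S \<longleftrightarrow>
     S \<subseteq> mspace W \<and>
     (\<forall>p\<in>S. \<exists>U (\<phi> :: 'a \<Rightarrow> real ^ 'n) a b.
        p \<in> U \<and> hyperbolic_chart W U \<phi> \<and> a \<noteq> 0 \<and> \<phi> ` (U \<inter> S) = \<phi> ` U \<inter> {x. a \<bullet> x = b})"

text \<open>\<open>S\<close> carries the length metric induced from \<open>W\<close>, not the restriction of the distance.\<close>

definition contains_as_geodesic_hypersurface ::
    "'n::finite itself \<Rightarrow> 'b metric \<Rightarrow> 'a metric \<Rightarrow> bool" where
  "contains_as_geodesic_hypersurface n W M \<longleftrightarrow>
     (\<exists>S f. totally_geodesic_hypersurface n W S \<and> bij_betw f (mspace M) S \<and>
        (\<forall>x\<in>mspace M. \<forall>y\<in>mspace M. ennreal (mdist M x y) = intrinsic_dist W S (f x) (f y)))"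


section \<open>Right-angled regular polyhedra\<close>

definition golden_ratio :: real where
  "golden_ratio = (1 + sqrt 5) / 2"

definition icosahedron_vertices :: "(real ^ 3) set" where
  "icosahedron_vertices =
     (\<Union>s\<in>{1, -1}. \<Union>t\<in>{1, -1}.
        {vector [0, s, t * golden_ratio], vector [t * golden_ratio, 0, s],
         vector [s, t * golden_ratio, 0]})"

text \<open>
  The regular dodecahedron is dual to the icosahedron: its twelve facets are orthogonal to the
  vectors \<open>u\<close> below, and two facets are adjacent iff \<open>u \<bullet> v = golden_ratio\<close>. By the
  orthogonality criterion above its dihedral angles are right exactly for the
  offset \<open>sqrt golden_ratio\<close>. It lies inside the open unit ball.
\<close>

definition right_angled_dodecahedron :: "(real ^ 3) set" where
  "right_angled_dodecahedron =
     {x. \<forall>u\<in>icosahedron_vertices. u \<bullet> x \<le> sqrt golden_ratio}"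

lemma icosahedron_adjacent:
  assumes "u \<in> icosahedron_vertices" "v \<in> icosahedron_vertices" "u \<noteq> v" "u \<bullet> v > 0"
  shows "u \<bullet> v = golden_ratio"
proof -
  have g: "golden_ratio * golden_ratio = golden_ratio + 1" "golden_ratio > 1"
    unfolding golden_ratio_def by (auto simp: field_simps)
  show ?thesis
    using assms g unfolding icosahedron_vertices_def
    by (auto simp: inner_vec_def sum_3 vector_3)
qed

text \<open>
  The octahedron has its six vertices on the unit sphere. Its facets lie in the
  planes \<open>u \<bullet> x = 1\<close> with \<open>u\<close> a sign vector, and \<open>u \<bullet> v = 1\<close> for adjacent facets.
\<close>

definition right_angled_ideal_octahedron :: "(real ^ 3) set" where
  "right_angled_ideal_octahedron = convex hull (Basis \<union> uminus ` Basis)"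


section \<open>Pairing the faces of finitely many polyhedra\<close>

text \<open>
  We glue the copies \<open>{i} \<times> (P \<inter> ball 0 1)\<close>, \<open>i < k\<close>, of a polyhedron. The facet \<open>(i, F)\<close> is
  paired with the facet \<open>\<sigma> (i, F)\<close> by the isometry \<open>g (i, F)\<close>.
\<close>

definition face_pairing ::
    "(real ^ 3) set \<Rightarrow> nat \<Rightarrow> (nat \<times> (real ^ 3) set \<Rightarrow> nat \<times> (real ^ 3) set) \<Rightarrow>
     (nat \<times> (real ^ 3) set \<Rightarrow> real ^ 3 \<Rightarrow> real ^ 3) \<Rightarrow> bool" where
  "face_pairing P k \<sigma> g \<longleftrightarrow>
     (\<forall>i F. i < k \<and> F facet_of P \<longrightarrow>
        (\<exists>j G. \<sigma> (i, F) = (j, G) \<and> j < k \<and> G facet_of P \<and> (j, G) \<noteq> (i, F) \<and>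
           \<sigma> (j, G) = (i, F) \<and>
           bij_betw (g (i, F)) (F \<inter> ball 0 1) (G \<inter> ball 0 1) \<and>
           (\<forall>x\<in>F \<inter> ball 0 1. \<forall>y\<in>F \<inter> ball 0 1.
              klein_dist (g (i, F) x) (g (i, F) y) = klein_dist x y) \<and>
           (\<forall>x\<in>F \<inter> ball 0 1. g (j, G) (g (i, F) x) = x)))"

definition glue_step ::
    "(real ^ 3) set \<Rightarrow> nat \<Rightarrow> (nat \<times> (real ^ 3) set \<Rightarrow> nat \<times> (real ^ 3) set) \<Rightarrow>
     (nat \<times> (real ^ 3) set \<Rightarrow> real ^ 3 \<Rightarrow> real ^ 3) \<Rightarrow>
     nat \<times> (real ^ 3) \<Rightarrow> nat \<times> (real ^ 3) \<Rightarrow> bool" where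
  "glue_step P k \<sigma> g p q \<longleftrightarrow>
     (\<exists>F. fst p < k \<and> F facet_of P \<and> snd p \<in> F \<inter> ball 0 1 \<and>
        q = (fst (\<sigma> (fst p, F)), g (fst p, F) (snd p)))"

text \<open>
  The quotient distance of the gluing is the infimum of the lengths of chains that
  alternate between moves inside one polyhedron and jumps between identified points.
\<close>

inductive glue_chain for P k \<sigma> g where
  refl: "i < k \<Longrightarrow> x \<in> P \<inter> ball 0 1 \<Longrightarrow> glue_chain P k \<sigma> g (i, x) (i, x) 0"
| jump: "glue_step P k \<sigma> g p q \<Longrightarrow> glue_chain P k \<sigma> g q r l \<Longrightarrow> glue_chain P k \<sigma> g p r l"
| move: "i < k \<Longrightarrow> x \<in> P \<inter> ball 0 1 \<Longrightarrow> y \<in> P \<inter> ball 0 1 \<Longrightarrow>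
    glue_chain P k \<sigma> g (i, y) r l \<Longrightarrow> glue_chain P k \<sigma> g (i, x) r (klein_dist x y + l)"

definition obtained_by_face_pairing ::
    "'a metric \<Rightarrow> (real ^ 3) set \<Rightarrow> nat \<Rightarrow>
     (nat \<times> (real ^ 3) set \<Rightarrow> nat \<times> (real ^ 3) set) \<Rightarrow>
     (nat \<times> (real ^ 3) set \<Rightarrow> real ^ 3 \<Rightarrow> real ^ 3) \<Rightarrow> (nat \<times> (real ^ 3) \<Rightarrow> 'a) \<Rightarrow> bool" where
  "obtained_by_face_pairing M P k \<sigma> g \<pi> \<longleftrightarrow>
     (let X = {..<k} \<times> (P \<inter> ball 0 1) in
        face_pairing P k \<sigma> g \<and> \<pi> ` X = mspace M \<and>
        (\<forall>p\<in>X. \<forall>q\<in>X. \<pi> p = \<pi> q \<longleftrightarrow> (glue_step P k \<sigma> g)\<^sup>*\<^sup>* p q) \<and>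
        (\<forall>p\<in>X. \<forall>q\<in>X. ennreal (mdist M (\<pi> p) (\<pi> q)) =
           (INF l \<in> {l. glue_chain P k \<sigma> g p q l}. ennreal l)))"

definition nice_dodecahedral :: "'a metric \<Rightarrow> bool" where
  "nice_dodecahedral M \<longleftrightarrow>
     complete_finite_volume_hyperbolic TYPE(3) M \<and>
     (\<exists>k \<sigma> g \<pi>. obtained_by_face_pairing M right_angled_dodecahedron k \<sigma> g \<pi> \<and>
        (\<forall>i<k. inj_on (\<lambda>x. \<pi> (i, x)) right_angled_dodecahedron))"

definition nice_octahedral :: "'a metric \<Rightarrow> bool" where
  "nice_octahedral M \<longleftrightarrow>
     complete_finite_volume_hyperbolic TYPE(3) M \<and>
     (\<exists>k \<sigma> g \<pi>. obtained_by_face_pairing M right_angled_ideal_octahedron k \<sigma> g \<pi> \<and>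
        (\<forall>i<k. \<forall>F. F facet_of right_angled_ideal_octahedron \<longrightarrow> fst (\<sigma> (i, F)) \<noteq> i))"

end

theory Submission
 imports Defs
begin

text \<open>
 \<open>M\<close> is glued from octahedra or dodecahedra \<open>P\<close>. The right-angled 24-cell or 120-cell \<open>Q\<close> has a facet
 isometric to \<open>P\<close>, and the facets of \<open>Q\<close> adjacent to it meet it in the facets of \<open>P\<close>. We glue copies of
 \<open>Q\<close> indexed by \<open>(i, s, v)\<close>, where \<open>i\<close> is a cell of \<open>M\<close>, \<open>s\<close> a sign and \<open>v\<close> a set of colours: crossing
 the base facet changes \<open>s\<close>, crossing a facet adjacent to the base follows the face pairing of \<open>M\<close>, and crossing
 any other facet (a cap) toggles the colours of that cap. As all dihedral angles are right, the gluing is a hyperbolic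
 manifold if it is commutative and free at each corner. Freeness holds if the colours of the caps that meet
 are linearly independent. Caps that are affected by the face pairing must be coloured by the points of \<open>M\<close>
 that they determine, and niceness of \<open>M\<close> makes adjacent caps determine different points; a greedy
 colouring of the resulting graph of bounded degree suffices. The sign \<open>s\<close> makes the gluing
 orientable, and the base facets of the copies with \<open>v = {}\<close> form the hypersurface \<open>M\<close>.
\<close>

section \<open>The hyperbolic metric in the Klein model\<close>

text \<open>\<open>M\<close> is known only as a quotient metric. An isometry between two facets
  extends to a linear symmetry of \<open>P\<close>, because the centre of a facet can be recognised
  by distances alone. Hyperbolicity of \<open>M\<close> then forces its gluing to be commutative and
  free: the cells at a corner are developed into a chart. Conversely, in a commutative and free
  gluing the commuting reflections unfold the 2^k cells at a corner with k walls, and chains lift to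
  the unfolded ball. All gluing maps fix the centre 0 of the cell, which keeps Cauchy sequences away
  from ideal vertices and gives completeness. The caps coloured by points of \<open>M\<close> belong
  to the facet centres of the octahedron (one wall, at most 2 representatives) or to the vertices of
  the dodecahedron (three walls, at most 8). Each representative has at most 3 neighbours, so the
  degree is at most 6 or 24. The 7 or 25 colours become odd subsets of 4 or 6 digits; the other caps
  take 1 or 25 more digits. Hence at most 2^6 or 2^32 copies of \<open>Q\<close> lie over a cell of
  \<open>M\<close>. \<open>Q\<close> is compared with its facet by cutting it into cones, without
  computing exact volumes.\<close>

abbreviation ub :: "(real ^ 'n) set" where
 "ub \<equiv> ball 0 1"

notation inner (infix ".*" 70)

abbreviation "kd \<equiv> klein_dist"
abbreviation "kvol \<equiv> klein_volume"
abbreviation "orth \<equiv> orthogonal_transformation"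

declare mem_ball_0 [simp del] mem_ball [simp del]

definition hq :: "real ^ 'n => real" where
 "hq x = sqrt (1 - x .* x)"

text \<open>The point \<open>x\<close> of the ball lifts to \<open>(1, x) / hq x\<close> on the
  hyperboloid; \<open>kch x y\<close> is minus the Lorentz product of two lifts, that is, cosh of
  the distance.\<close>

definition kch :: "real ^ 'n => real ^ 'n => real" where
 "kch x y = (1 - x .* y) / (hq x * hq y)"

lemma ball01_iff: "(x :: real ^ 'n) : ub \<longleftrightarrow> x .* x < 1" by (simp add: mem_ball_0 norm_eq_sqrt_inner)

lemma hq_pos: "x : ub ==> hq x > 0" by (simp add: hq_def ball01_iff)

lemma hq_power2: "x : ub ==> (hq x)^2 = 1 - x .* x" by (simp add: hq_def ball01_iff)

lemma hq_0 [simp]: "hq 0 = 1" by (simp add: hq_def)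

lemma klein_dist_eq: "kd x y = arcosh (kch x y)" by (simp add: klein_dist_def kch_def hq_def power2_norm_eq_inner)

lemma inner_lt_1:
 fixes x y :: "real ^ 'n"
 assumes "x : ub" "y : cball 0 1" shows "x .* y < 1"
proof -
 have "x .* y <= norm x * norm y" by (rule norm_cauchy_schwarz)
 also have "... <= norm x * 1" using assms by (intro mult_left_mono) auto
 finally show ?thesis using assms by (simp add: mem_ball_0)
qed

text \<open>Reversed Cauchy-Schwarz inequality for two timelike vectors. The defect is |x - y|^2
  minus the Gram determinant of \<open>x\<close> and \<open>y\<close>; that determinant does not
  change when \<open>y\<close> is replaced by \<open>x - y\<close>, so it is at most |x - y|^2
  |x|^2.\<close>

lemma kch_ge_1:
 assumes "x : ub" "y : ub" shows "kch x y >= 1"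
proof -
 have 1: "x .* y < 1" using inner_lt_1[of x y] assms ball_subset_cball by blast
 have "(hq x * hq y)^2 = (1 - x.*x) * (1 - y.*y)" using assms by (simp add: power_mult_distrib hq_power2)
 also have "... = (1 - x.*y)^2 - ((x - y) .* (x - y) - ((x.*x) * (y.*y) - (x.*y)^2))"
  by (simp add: inner_diff_left inner_diff_right inner_commute power2_eq_square algebra_simps)
 also have "(x.*x) * (y.*y) - (x.*y)^2 = ((x-y).*(x-y)) * (x.*x) - (x.*(x-y))^2"
  by (simp add: inner_diff_left inner_diff_right inner_commute power2_eq_square algebra_simps)
 also have "(1 - x.*y)^2 - ((x - y) .* (x - y) - ...) <= (1 - x.*y)^2"
 proof -
  have "(x - y) .* (x - y) * (x.*x) <= (x - y) .* (x - y) * 1" using assms by (intro mult_left_mono) (auto simp: ball01_iff)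
  thus ?thesis by (smt (verit) zero_le_power2)
 qed
 finally have "hq x * hq y <= 1 - x.*y" using 1 by (metis diff_gt_0_iff_gt less_eq_real_def power2_le_imp_le)
 thus ?thesis using hq_pos[OF assms(1)] hq_pos[OF assms(2)] by (simp add: kch_def)
qed

lemma kch_eq_1_iff:
 assumes "x : ub" "y : ub" shows "kch x y = 1 \<longleftrightarrow> x = y"
proof
 assume "kch x y = 1"
 hence "1 - x.*y = hq x * hq y" by (simp add: kch_def)
 hence "(1 - x.*y)^2 = (1 - x.*x) * (1 - y.*y)" using assms by (simp add: power_mult_distrib hq_power2)
 hence "(x - y) .* (x - y) * (1 - x.*x) = - ((x.*(x-y))^2)"
  by (simp add: inner_diff_left inner_diff_right inner_commute power2_eq_square algebra_simps)
 moreover have "(1 - x.*x) > 0" using assms by (simp add: ball01_iff)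
 ultimately have "(x - y) .* (x - y) <= 0" by (smt (verit) mult_pos_pos zero_le_power2)
 thus "x = y" by (metis eq_iff_diff_eq_0 inner_eq_zero_iff inner_ge_zero order_antisym)
next
 assume "x = y"
 thus "kch x y = 1" using hq_power2[OF assms(1)] assms(1) by (simp add: kch_def ball01_iff flip: power2_eq_square)
qed

lemma kch_sym: "kch x y = kch y x" by (simp add: kch_def inner_commute mult.commute)

lemma kd_sym: "kd x y = kd y x" by (simp add: klein_dist_eq kch_sym)

lemma kd_nonneg: "x : ub ==> y : ub ==> kd x y >= 0" by (simp add: klein_dist_eq kch_ge_1)

lemma kd_self [simp]: "x : ub ==> kd x x = 0" using kch_eq_1_iff[of x x] by (simp add: klein_dist_eq)

lemma kd_zero_iff: "x : ub ==> y : ub ==> kd x y = 0 \<longleftrightarrow> x = y" by (simp add: klein_dist_eq kch_ge_1 kch_eq_1_iff)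

lemma cosh_kd: "x : ub ==> y : ub ==> cosh (kd x y) = kch x y" by (simp add: klein_dist_eq kch_ge_1)

lemma kd_eq_iff:
 assumes "x : ub" "y : ub" "x' : ub" "y' : ub" shows "kd x y = kd x' y' \<longleftrightarrow> kch x y = kch x' y'"
  using assms by (metis cosh_kd klein_dist_eq)

lemma kd_le_arcosh:
 assumes "x : ub" "y : ub" "kch x y <= cosh l" "l >= 0" shows "kd x y <= l"
  using assms by (metis cosh_kd cosh_real_nonneg_le_iff kd_nonneg)

section \<open>Reflections and isometries\<close>

text \<open>Projective form of the Lorentz reflection in the vector \<open>(c, u)\<close>: the
  homogeneous point \<open>(1, x)\<close> is reflected and its first coordinate is scaled back to 1.
  The condition \<open>c^2 < u.*u\<close> says that this vector is spacelike, i.e. that the plane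
  \<open>u.*x = c\<close> meets the ball.\<close>

definition hrefl :: "real ^ 'n => real => real ^ 'n => real ^ 'n" where
 "hrefl u c x = (1 / (u.*u + c^2 - 2*c*(u.*x))) *\<^sub>R ((u.*u - c^2) *\<^sub>R x - (2*(u.*x - c)) *\<^sub>R u)"

lemma hrefl_den_pos:
 fixes u x :: "real ^ 'n"
 assumes "c^2 < u.*u" "x : ub" shows "u.*u + c^2 - 2*c*(u.*x) > 0"
proof -
 have "\<bar>c * (u.*x)\<bar> <= \<bar>c\<bar> * norm u"
 proof -
  have "\<bar>u.*x\<bar> <= norm u * norm x" by (rule Cauchy_Schwarz_ineq2)
  also have "... <= norm u * 1" using assms by (intro mult_left_mono) (auto simp: mem_ball_0)
  finally show ?thesis by (simp add: abs_mult mult_left_mono)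
 qed
 moreover have "\<bar>c\<bar> ~= norm u" using assms(1) by (metis dual_order.irrefl power2_abs power2_norm_eq_inner)
 hence "(\<bar>c\<bar> - norm u)^2 > 0" by simp
 hence "2 * \<bar>c\<bar> * norm u < c^2 + u.*u" by (simp add: power2_diff power2_norm_eq_inner)
 ultimately show ?thesis by linarith
qed

lemma hrefl_inner:
 fixes u x y :: "real ^ 'n"
 assumes u: "c^2 < u.*u" and x: "x : ub" and y: "y : ub"
 defines "dx \<equiv> u.*u + c^2 - 2*c*(u.*x)" and "dy \<equiv> u.*u + c^2 - 2*c*(u.*y)"
 shows "(1 - hrefl u c x .* hrefl u c y) * (dx * dy) = (u.*u - c^2)^2 * (1 - x.*y)"
proof -
 have d: "dx ~= 0" "dy ~= 0" using hrefl_den_pos[OF u x] hrefl_den_pos[OF u y] by (auto simp: dx_def dy_def)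
 define nx where "nx = (u.*u - c^2) *\<^sub>R x - (2*(u.*x - c)) *\<^sub>R u"
 define ny where "ny = (u.*u - c^2) *\<^sub>R y - (2*(u.*y - c)) *\<^sub>R u"
 have "(1 - hrefl u c x .* hrefl u c y) * (dx * dy) = dx * dy - nx .* ny"
 proof -
  have "hrefl u c x = (1/dx) *\<^sub>R nx" "hrefl u c y = (1/dy) *\<^sub>R ny" by (simp_all only: hrefl_def dx_def dy_def nx_def ny_def)
  thus ?thesis using d by (simp add: field_simps)
 qed
 also have "... = (u.*u - c^2)^2 * (1 - x.*y)"
  by (simp add: dx_def dy_def nx_def ny_def inner_diff_left inner_diff_right inner_commute[of x u] inner_commute[of y x] power2_eq_square algebra_simps)
 finally show ?thesis .
qed

lemma hrefl_ball:
 fixes u x :: "real ^ 'n"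
 assumes u: "c^2 < u.*u" and x: "x : ub" shows "hrefl u c x : ub"
proof -
 have "(1 - hrefl u c x .* hrefl u c x) * ((u.*u + c^2 - 2*c*(u.*x)) * (u.*u + c^2 - 2*c*(u.*x))) > 0"
  unfolding hrefl_inner[OF u x x] using u x by (intro mult_pos_pos) (auto simp: ball01_iff)
 hence "1 - hrefl u c x .* hrefl u c x > 0" using hrefl_den_pos[OF u x] by (metis mult_pos_pos zero_less_mult_pos2)
 thus ?thesis unfolding ball01_iff by simp
qed

lemma hq_hrefl:
 fixes u x :: "real ^ 'n"
 assumes u: "c^2 < u.*u" and x: "x : ub" shows "hq (hrefl u c x) = (u.*u - c^2) / (u.*u + c^2 - 2*c*(u.*x)) * hq x"
proof -
 define d where "d = u.*u + c^2 - 2*c*(u.*x)"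
 have d: "d > 0" using hrefl_den_pos[OF u x] by (simp add: d_def)
 have "(1 - hrefl u c x .* hrefl u c x) * (d * d) = (u.*u - c^2)^2 * (1 - x.*x)" unfolding d_def by (rule hrefl_inner[OF u x x])
 hence "1 - hrefl u c x .* hrefl u c x = ((u.*u - c^2) / d)^2 * (1 - x.*x)" using d by (simp add: field_simps power2_eq_square)
 thus ?thesis using d u by (simp add: hq_def real_sqrt_mult d_def)
qed

lemma kch_hrefl:
 fixes u x y :: "real ^ 'n"
 assumes u: "c^2 < u.*u" and x: "x : ub" and y: "y : ub" shows "kch (hrefl u c x) (hrefl u c y) = kch x y"
proof -
 define dx where "dx = u.*u + c^2 - 2*c*(u.*x)"
 define dy where "dy = u.*u + c^2 - 2*c*(u.*y)"
 have d: "dx > 0" "dy > 0" using hrefl_den_pos[OF u x] hrefl_den_pos[OF u y] by (simp_all add: dx_def dy_def)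
 define N where "N = u.*u - c^2"
 have N: "N > 0" using u by (simp add: N_def)
 have 1: "1 - hrefl u c x .* hrefl u c y = N^2 * (1 - x.*y) / (dx*dy)"
  using hrefl_inner[OF u x y, folded dx_def dy_def N_def] d by (simp add: field_simps)
 show ?thesis unfolding kch_def hq_hrefl[OF u x] hq_hrefl[OF u y] 1 dx_def[symmetric] dy_def[symmetric] N_def[symmetric]
  using d N hq_pos[OF x] hq_pos[OF y] by (simp add: field_simps power2_eq_square)
qed

lemma inner_hrefl:
 fixes u x v :: "real ^ 'n"
 assumes u: "c^2 < u.*u" and x: "x : ub" shows "v .* hrefl u c x - b =
  ((v.*x - b) * (u.*u - c^2) - 2 * (u.*x - c) * (u.*v - b * c)) / (u.*u + c^2 - 2*c*(u.*x))"
proof -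
 have "v .* hrefl u c x = ((u.*u - c^2) * (v.*x) - 2*(u.*x - c)*(u.*v)) / (u.*u + c^2 - 2*c*(u.*x))"
  by (simp add: hrefl_def inner_diff_right inner_commute)
 thus ?thesis using hrefl_den_pos[OF u x] by (simp add: divide_simps) (simp add: algebra_simps power2_eq_square)
qed

text \<open>The factor on the right is positive, so a reflection exchanges the sides of its own
  wall; the same factor, without the minus sign, occurs for an orthogonal wall, whose sides are
  kept.\<close>

lemma inner_hrefl_self:
 fixes u x :: "real ^ 'n"
 assumes u: "c^2 < u.*u" and x: "x : ub" shows "u .* hrefl u c x - c = - (u.*x - c) * ((u.*u - c^2) / (u.*u + c^2 - 2*c*(u.*x)))"
  unfolding inner_hrefl[OF u x] by (simp add: algebra_simps power2_eq_square)

lemma inner_hrefl_orth: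
 fixes u x :: "real ^ 'n"
 assumes u: "c^2 < u.*u" and x: "x : ub" and "u.*v = b * c"
 shows "v .* hrefl u c x - b = (v.*x - b) * ((u.*u - c^2) / (u.*u + c^2 - 2*c*(u.*x)))"
  unfolding inner_hrefl[OF u x] using assms(3) by simp

lemma hrefl_fix:
 fixes u x :: "real ^ 'n"
 assumes u: "c^2 < u.*u" and "u.*x = c" shows "hrefl u c x = x" using assms by (simp add: hrefl_def power2_eq_square)

lemma hrefl_hrefl:
 fixes u x :: "real ^ 'n"
 assumes u: "c^2 < u.*u" and x: "x : ub" shows "hrefl u c (hrefl u c x) = x"
proof -
 define d where "d = u.*u + c^2 - 2*c*(u.*x)"
 define N where "N = u.*u - c^2"
 define y where "y = hrefl u c x"
 have d: "d > 0" using hrefl_den_pos[OF u x] by (simp add: d_def)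
 have N: "N > 0" using u by (simp add: N_def)
 have y: "y = (1/d) *\<^sub>R (N *\<^sub>R x - (2*(u.*x - c)) *\<^sub>R u)" by (simp add: y_def hrefl_def d_def N_def)
 have uy: "u.*y - c = - (u.*x - c) * (N / d)" unfolding y_def using inner_hrefl_self[OF u x] by (simp add: d_def N_def)
 have "u.*u + c^2 - 2*c*(u.*y) = N - 2*c*(u.*y - c)" by (simp add: N_def algebra_simps power2_eq_square)
 also have "... = N * (d + 2*c*(u.*x - c)) / d" using d by (simp add: uy field_simps)
 also have "d + 2*c*(u.*x - c) = N" by (simp add: d_def N_def algebra_simps power2_eq_square)
 finally have d2: "u.*u + c^2 - 2*c*(u.*y) = N*N/d" .
 have "hrefl u c y = (d/(N*N)) *\<^sub>R (N *\<^sub>R y - (2*(u.*y - c)) *\<^sub>R u)" unfolding hrefl_def d2 N_def[symmetric] by simp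
 also have "N *\<^sub>R y - (2*(u.*y - c)) *\<^sub>R u = (N*N/d) *\<^sub>R x"
 proof -
  define K where "K = u.*x - c"
  show ?thesis unfolding uy K_def[symmetric] by (simp add: y K_def[symmetric] scaleR_diff_right algebra_simps)
 qed
 also have "(d/(N*N)) *\<^sub>R ... = x" using d N by simp
 finally show ?thesis by (simp add: y_def)
qed

lemma hrefl_commute:
 fixes u v x :: "real ^ 'n"
 assumes u: "c^2 < u.*u" and v: "b^2 < v.*v" and uv: "u.*v = b * c" and x: "x : ub"
 shows "hrefl u c (hrefl v b x) = hrefl v b (hrefl u c x)"
proof -
 \<comment> \<open>Orthogonality of the walls makes the composite symmetric in them, so this one
   formula, used in both orders, gives commutation.\<close>
 have *: "hrefl u c (hrefl v b x) =
   (1 / ((u.*u - c^2) * (v.*v - b^2) - 2*c*(u.*x - c) * (v.*v - b^2) - 2*b*(v.*x - b) * (u.*u - c^2))) *\<^sub>R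
   (((u.*u - c^2) * (v.*v - b^2)) *\<^sub>R x - (2*(u.*x - c) * (v.*v - b^2)) *\<^sub>R u - (2*(v.*x - b) * (u.*u - c^2)) *\<^sub>R v)"
  if u: "c^2 < u.*u" and v: "b^2 < v.*v" and uv: "u.*v = b * c" for u v :: "real^'n" and b c
 proof -
  define d where "d = v.*v + b^2 - 2*b*(v.*x)"
  define N where "N = v.*v - b^2"
  define M where "M = u.*u - c^2"
  define y where "y = hrefl v b x"
  have d: "d > 0" using hrefl_den_pos[OF v x] by (simp add: d_def)
  have uy: "u.*y - c = (u.*x - c) * (N / d)" unfolding y_def using inner_hrefl_orth[OF v x, of u c] uv
   by (simp add: d_def N_def inner_commute mult.commute)
  have "u.*u + c^2 - 2*c*(u.*y) = M - 2*c*(u.*y - c)" by (simp add: M_def algebra_simps power2_eq_square)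
  also have "... = (M * d - 2*c*(u.*x - c)*N) / d" using d by (simp add: uy field_simps)
  also have "d = N - 2*b*(v.*x-b)" by (simp add: d_def N_def algebra_simps power2_eq_square)
  finally have d2: "u.*u + c^2 - 2*c*(u.*y) = (M * N - 2*c*(u.*x - c)*N - 2*b*(v.*x-b)*M) / d"
   by (simp add: d_def N_def algebra_simps power2_eq_square)
  define E where "E = M * N - 2*c*(u.*x - c)*N - 2*b*(v.*x-b)*M"
  have y: "y = (1/d) *\<^sub>R (N *\<^sub>R x - (2*(v.*x - b)) *\<^sub>R v)" by (simp add: y_def hrefl_def d_def N_def)
  have "hrefl u c y = (d/E) *\<^sub>R (M *\<^sub>R y - (2*(u.*y - c)) *\<^sub>R u)" unfolding hrefl_def d2 M_def[symmetric] E_def[symmetric] by simp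
  also have "... = (1/E) *\<^sub>R (d *\<^sub>R (M *\<^sub>R y - (2*(u.*y - c)) *\<^sub>R u))" by simp
  also have "d *\<^sub>R (M *\<^sub>R y - (2*(u.*y - c)) *\<^sub>R u) = (M*N) *\<^sub>R x - (2*(u.*x - c) * N) *\<^sub>R u - (2*(v.*x - b) * M) *\<^sub>R v"
   unfolding uy using d by (simp add: y algebra_simps scaleR_diff_right)
  finally show ?thesis by (simp add: y_def E_def M_def N_def)
 qed
 have uv': "v.*u = c * b" using uv by (simp add: inner_commute mult.commute)
 show ?thesis unfolding *[OF u v uv] *[OF v u uv'] by (simp add: algebra_simps)
qed

text \<open>The wall is the perpendicular bisector of 0 and \<open>a\<close>: equating the distances
  to 0 and to \<open>a\<close> gives the plane \<open>a.*x = 1 - hq a\<close>.\<close>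

lemma hrefl_swap:
 fixes a :: "real ^ 'n"
 assumes a: "a : ub"
 obtains u c where "c^2 < u.*u" "hrefl u c a = 0" "hrefl u c 0 = a" | "a = 0"
proof (cases "a = 0")
 case False
 define h where "h = hq a"
 have h: "h > 0" "h^2 = 1 - a.*a" "h < 1" using a hq_pos hq_power2 False by (auto simp: h_def hq_def)
 define u where "u = a"
 define c where "c = 1 - h"
 have N: "u.*u - c^2 = 2*h*(1-h)" using h by (simp add: u_def c_def power2_eq_square algebra_simps)
 have N0: "2*h*(1-h) > 0" using h by simp
 have 1: "c^2 < u.*u" using N N0 by linarith
 have uc: "u.*u = 1 - h^2" "c = 1 - h" using h by (auto simp: u_def c_def)
 have "hrefl u c 0 = (1/(u.*u + c^2)) *\<^sub>R (2*c) *\<^sub>R a" by (simp add: hrefl_def u_def)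
 also have "u.*u + c^2 = 2*c" unfolding uc by (simp add: power2_eq_square algebra_simps)
 finally have 2: "hrefl u c 0 = a" using h by (simp add: c_def)
 hence 3: "hrefl u c a = 0" using hrefl_hrefl[OF 1, of 0] by simp
 show ?thesis by (rule that(1)[OF 1 3 2])
qed (rule that(2))

text \<open>Isometries are given by generators. The index is the orientation sign accumulated along
  the construction; that the map on the ball determines it is \<open>hiso_unique_sign\<close>, and
  that every local isometry arises in this way is \<open>kd_rigid\<close>.\<close>

inductive hiso :: "real => (real ^ 'n => real ^ 'n) => bool" where
 orth: "orth A ==> hiso (det (matrix A)) A"
| hrefl: "c^2 < u.*u ==> hiso (-1) (hrefl u c)"
| comp: "hiso s F ==> hiso t G ==> hiso (s * t) (%x. F (G x))"

lemma hiso_id: "hiso 1 (%x. x)" using hiso.orth[OF orthogonal_transformation_id] by (simp add: matrix_id_mat_1[unfolded id_def])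

lemma hiso_sign: "hiso s G ==> s = 1 | s = -1"
 by (induction rule: hiso.induct) (auto simp: orthogonal_transformation_matrix det_orthogonal_matrix)

lemma hiso_ball: "hiso s G ==> x : ub ==> G x : ub"
proof (induction arbitrary: x rule: hiso.induct)
 case (hrefl c u)
 thus ?case by (rule hrefl_ball)
qed (auto simp: orthogonal_transformation_norm mem_ball_0)

lemma hq_orth: "orth A ==> hq (A x) = hq x" by (simp add: hq_def orthogonal_transformation_def)

lemma kch_orth: "orth A ==> kch (A x) (A y) = kch x y" by (simp add: kch_def hq_orth orthogonal_transformation_def)

lemma hiso_kch: "hiso s G ==> x : ub ==> y : ub ==> kch (G x) (G y) = kch x y"
proof (induction arbitrary: x y rule: hiso.induct)
 case (orth A)
 thus ?case by (simp add: kch_orth)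
next
 case (hrefl c u)
 thus ?case by (simp add: kch_hrefl)
next
 case (comp s F t G)
 thus ?case using hiso_ball by metis
qed

lemma hiso_kd: "hiso s G ==> x : ub ==> y : ub ==> kd (G x) (G y) = kd x y" by (simp add: klein_dist_eq hiso_kch)

lemma hiso_inj: "hiso s G ==> inj_on G ub" by (rule inj_onI) (metis hiso_ball hiso_kd kd_zero_iff)

lemma hiso_inv:
 "hiso s G ==> EX H. hiso s H & (ALL x:ub. H (G x) = x & G (H x) = x)"
proof (induction rule: hiso.induct)
 case (orth A)
 have l: "linear A" and b: "bij A" using orth by (auto simp: orthogonal_transformation_linear orthogonal_transformation_bij)
 have i: "orth (inv A)" using orth by (rule orthogonal_transformation_inv)
 have "det (matrix A) * det (matrix (inv A)) = 1"
 proof -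
  show ?thesis using b matrix_compose[OF orthogonal_transformation_linear[OF i] l] bij_is_surj surj_iff[symmetric] matrix_id_mat_1
   by (metis det_I det_mul)
 qed
 moreover have "det (matrix A) = 1 | det (matrix A) = -1" using hiso_sign hiso.orth orth by blast
 ultimately have "det (matrix (inv A)) = det (matrix A)" by auto
 hence "hiso (det (matrix A)) (inv A)" using hiso.orth[OF i] by simp
 thus ?case using b by (metis bij_inv_eq_iff)
next
 case (hrefl c u)
 thus ?case using hiso.hrefl hrefl_hrefl by blast
next
 case (comp s F t G)
 then obtain F' G' where F: "hiso s F'" "ALL x:ub. F' (F x) = x & F (F' x) = x"
  and G: "hiso t G'" "ALL x:ub. G' (G x) = x & G (G' x) = x" by blast
 have "hiso (s*t) (%x. G' (F' x))" using hiso.comp[OF G(1) F(1)] by (simp add: mult.commute)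
 moreover have "ALL x:ub. G' (F' (F (G x))) = x & F (G (G' (F' x))) = x" using F G comp.hyps hiso_ball by metis
 ultimately show ?case by blast
qed

lemma swap_to_0:
 fixes a :: "real ^ 'n"
 assumes a: "a : ub"
 obtains s G where "hiso s G" "G a = 0" "G 0 = a" "ALL x:ub. G (G x) = x" using a
proof (rule hrefl_swap)
 fix u c assume "c^2 < u.*u" "hrefl u c a = 0" "hrefl u c 0 = a"
 thus ?thesis using that[OF hiso.hrefl] hrefl_hrefl by blast
next
 assume "a = 0" thus ?thesis using that[OF hiso_id] by simp
qed

section \<open>Triangle inequality and geodesic segments\<close>

lemma kch_0: "kch 0 x = 1 / hq x" "kch x 0 = 1 / hq x" by (simp_all add: kch_def)

lemma sinh_kd_0: assumes "x : ub" shows "sinh (kd 0 x) = norm x / hq x"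
proof -
 have "sinh (kd 0 x) = sqrt ((1 / hq x)^2 - 1)" using kch_ge_1[of 0 x] assms by (simp add: klein_dist_eq sinh_arcosh_real kch_0)
 also have "(1 / hq x)^2 - 1 = (norm x / hq x)^2"
  using hq_pos[OF assms] hq_power2[OF assms] by (simp add: field_simps power2_norm_eq_inner)
 also have "sqrt ... = norm x / hq x" using hq_pos[OF assms] by simp
 finally show ?thesis .
qed

lemma cosh_kd_add_0:
 assumes "x : ub" "y : ub" shows "cosh (kd x 0 + kd 0 y) = (1 + norm x * norm y) / (hq x * hq y)"
  using assms by (simp add: cosh_add kd_sym cosh_kd sinh_kd_0 kch_0 add_divide_distrib)

lemma kd_triangle_0:
 assumes "x : ub" "y : ub" shows "kd x y <= kd x 0 + kd 0 y"
proof (rule kd_le_arcosh[OF assms])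
 show "kch x y <= cosh (kd x 0 + kd 0 y)" using norm_cauchy_schwarz[of "-x" y] hq_pos[OF assms(1)] hq_pos[OF assms(2)]
  unfolding cosh_kd_add_0[OF assms] kch_def by (intro divide_right_mono) auto
qed (use assms in \<open>auto intro!: add_nonneg_nonneg kd_nonneg \<close>)

lemma kd_triangle:
 assumes "x : ub" "y : ub" "z : ub" shows "kd x z <= kd x y + kd y z"
proof -
 obtain s G where G: "hiso s G" "G y = 0" using swap_to_0[OF assms(2)] by metis
 have "kd (G x) (G z) <= kd (G x) (G y) + kd (G y) (G z)"
  unfolding G(2) by (rule kd_triangle_0) (use G(1) assms hiso_ball in blast)+
 thus ?thesis using G(1) assms by (simp add: hiso_kd)
qed

text \<open>Straight segments are geodesics: once \<open>z\<close> has been moved to 0, the images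
  of \<open>x\<close> and \<open>y\<close> lie on opposite rays, and there the Cauchy-Schwarz
  estimate of the triangle inequality is an equality.\<close>

lemma kd_segment:
 fixes x y z :: "real ^ 'n"
 assumes x: "x : ub" and y: "y : ub" and z: "z : closed_segment x y" shows "kd x z + kd z y = kd x y"
proof -
 have zb: "z : ub" using closed_segment_subset[OF x y] z by auto
 obtain t where t: "0 <= t" "t <= 1" "z = (1-t) *\<^sub>R x + t *\<^sub>R y" using z by (auto simp: closed_segment_def)
 obtain s G where G: "hiso s G" "G z = 0" and
  opp: "EX p q. p >= 0 & q >= 0 & p + q > 0 & p *\<^sub>R G x + q *\<^sub>R G y = 0" using zb
 proof (rule hrefl_swap)
  fix u c assume u: "c^2 < u.*u" "hrefl u c z = 0" "hrefl u c 0 = z"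
  define d where "d = (%x. u.*u + c^2 - 2*c*(u.*x))"
  \<comment> \<open>The numerator \<open>n\<close> of the reflection is affine in the point, so its
    vanishing at \<open>z\<close> is a nonnegative linear relation between the images of the two end
    points.\<close>
  define n where "n = (%x. (u.*u - c^2) *\<^sub>R x - (2*(u.*x - c)) *\<^sub>R u)"
  have dp: "d x > 0" "d y > 0" "d z > 0" using hrefl_den_pos[OF u(1)] x y zb by (auto simp: d_def)
  have r: "hrefl u c w = (1 / d w) *\<^sub>R n w" for w by (simp add: hrefl_def d_def n_def)
  have "n z = 0" using u(2) dp by (simp add: r)
  moreover have "n z = (1-t) *\<^sub>R n x + t *\<^sub>R n y" by (simp add: t(3) n_def inner_add_right algebra_simps)
  moreover have "n x = d x *\<^sub>R hrefl u c x" "n y = d y *\<^sub>R hrefl u c y" using dp by (simp_all add: r)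
  ultimately have "((1-t) * d x) *\<^sub>R hrefl u c x + (t * d y) *\<^sub>R hrefl u c y = 0" by simp
  moreover have "(1-t) * d x >= 0" "t * d y >= 0" using t dp by auto
  moreover have "(1-t) * d x + t * d y > 0" using t dp by (cases "t = 0") (auto intro: add_nonneg_pos)
  ultimately show ?thesis using that[OF hiso.hrefl[OF u(1)] u(2)] by blast
 next
  assume "z = 0"
  thus ?thesis using t that[OF hiso_id \<open>z = 0\<close>] by (metis add.commute diff_add_cancel diff_ge_0_iff_ge zero_less_one)
 qed
 obtain p q where pq: "p >= 0" "q >= 0" "p + q > 0" "p *\<^sub>R G x + q *\<^sub>R G y = 0" using opp by blast
 have inn: "G x .* G y = - (norm (G x) * norm (G y))"
 proof (cases "p = 0")
  case True thus ?thesis using pq by simp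
 next
  case False
  hence "G x = - ((q/p) *\<^sub>R G y)" using pq
   by (metis (no_types, lifting) add_eq_0_iff divide_inverse_commute eq_vector_fraction_iff minus_equation_iff scaleR_minus_right scaleR_scaleR inverse_eq_divide mult.commute)
  thus ?thesis using pq by (simp add: power2_norm_eq_inner[symmetric] power2_eq_square)
 qed
 have b: "G x : ub" "G y : ub" using G x y hiso_ball by blast+
 have "kch (G x) (G y) = cosh (kd (G x) 0 + kd 0 (G y))" unfolding cosh_kd_add_0[OF b] kch_def inn by simp
 moreover have "kd (G x) 0 + kd 0 (G y) >= 0" using b by (auto intro!: add_nonneg_nonneg kd_nonneg )
 ultimately have "kd (G x) (G y) = kd (G x) 0 + kd 0 (G y)" by (simp add: klein_dist_eq[of "G x" "G y"] arcosh_cosh_real)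
 thus ?thesis using G x y zb hiso_kd by metis
qed

section \<open>Derivatives and volume\<close>

text \<open>Matrix determinant lemma. An orthogonal change of coordinates makes \<open>u\<close> a
  multiple of a basis vector; then only one column differs from the identity matrix and Cramer's
  formula applies.\<close>

lemma det_rank1:
 fixes u q :: "real ^ 'n" shows "det (matrix (%h. h + (u .* h) *\<^sub>R q)) = 1 + u .* q"
proof -
 define k :: 'n where "k = undefined"
 have col: "det (matrix (%h :: real ^ 'n. h + (a * h $ k) *\<^sub>R p)) = 1 + a * p $ k" for a p
 proof -
  have "matrix (%h :: real ^ 'n. h + (a * h $ k) *\<^sub>R p) =
    (\<chi> i j. if j = k then (mat 1 *v (axis k 1 + a *\<^sub>R p)) $ i else (mat 1 :: real^'n^'n) $ i $ j)"
     by (simp add: matrix_def vec_eq_iff) (auto simp: axis_def mat_def)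
  thus ?thesis using cramer_lemma[of k "mat 1 :: real^'n^'n" "axis k 1 + a *\<^sub>R p"] by simp
 qed
 have "norm (axis k (norm u) :: real ^ 'n) = norm u" by (simp add: norm_eq_sqrt_inner inner_axis_axis)
 then obtain f where f: "orth f" "f (axis k (norm u)) = u" by (metis orthogonal_transformation_exists)
 define f' where "f' = inv f"
 have f': "orth f'" using f f'_def orthogonal_transformation_inv by auto
 have l: "linear f" "linear f'" using f f' by (auto simp: orthogonal_transformation_linear)
 have ff': "f (f' x) = x" "f' (f x) = x" for x using f by (auto simp: orthogonal_transformation_bij f'_def bij_is_surj surj_f_inv_f bij_is_inj)
 define g where "g = (%h. h + (u .* h) *\<^sub>R q)"
 have lg: "linear g" unfolding g_def by (auto intro!: linearI simp: inner_add_right algebra_simps)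
 have uf: "u .* f h = norm u * h $ k" for h
 proof -
  have "u .* f h = f (axis k (norm u)) .* f h" by (simp only: f(2))
  also have "... = axis k (norm u) .* h" using f(1) by (simp add: orthogonal_transformation_def)
  finally show ?thesis by (simp add: inner_axis')
 qed
 have conj: "f' \<circ> (g \<circ> f) = (%h. h + (norm u * h $ k) *\<^sub>R f' q)" using l(2) by (auto simp: g_def uf ff' linear_add linear_scale)
 have "f' \<circ> f = id" using ff' by auto
 hence "det (matrix f') * det (matrix f) = 1" using matrix_compose[OF l(1) l(2)] by (metis det_I det_mul matrix_id_mat_1)
 hence "det (matrix (f' \<circ> (g \<circ> f))) = det (matrix g)" using l lg by (simp add: matrix_compose linear_compose det_mul)
 moreover have "norm u * (f' q) $ k = u .* q" using uf[of "f' q"] ff' by simp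
 ultimately have "det (matrix g) = 1 + u .* q" using col[of "norm u" "f' q"] by (simp only: conj)
 thus ?thesis by (simp only: g_def)
qed

text \<open>The Klein density is \<open>1 / hq x ^ (CARD('n) + 1)\<close>. The formula therefore
  says that volume is preserved, and it makes the sign of the isometry readable from its
  Jacobian.\<close>

lemma hiso_derivative:
 fixes G :: "real ^ 'n => real ^ 'n"
 assumes "hiso s G" "x : ub" shows "EX D. (G has_derivative D) (at x) & det (matrix D) = s * (hq (G x) / hq x) ^ (CARD('n) + 1)"
  using assms
proof (induction arbitrary: x rule: hiso.induct)
 case (orth A)
 hence "(A has_derivative A) (at x)"
  by (intro bounded_linear_imp_has_derivative) (metis linear_conv_bounded_linear orthogonal_transformation_linear)
 moreover have "hq (A x) / hq x = 1" using orth hq_pos[of x] by (simp add: hq_orth)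
 ultimately show ?case by (intro exI[of _ A]) simp
next
 case (hrefl c u)
 define d where "d = u.*u + c^2 - 2*c*(u.*x)"
 define N where "N = u.*u - c^2"
 define y where "y = hrefl u c x"
 define n where "n = (%x. N *\<^sub>R x - (2*(u.*x - c)) *\<^sub>R u)"
 define q where "q = (1/N) *\<^sub>R ((2*c) *\<^sub>R y - 2 *\<^sub>R u)"
 have d: "d > 0" using hrefl_den_pos[OF hrefl] by (simp add: d_def)
 have N: "N > 0" using hrefl by (simp add: N_def)
 have yn: "y = (1/d) *\<^sub>R n x" by (simp add: y_def hrefl_def d_def N_def n_def)
 have "(hrefl u c has_derivative
   (%h. (1/d) *\<^sub>R (N *\<^sub>R h - (2*(u.*h)) *\<^sub>R u) + (2*c*(u.*h) / d^2) *\<^sub>R n x)) (at x)"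
 proof -
  have 1: "((%x. 1 / (u.*u + c^2 - 2*c*(u.*x))) has_derivative (%h. 2*c*(u.*h) / d^2)) (at x)" using d
   by (auto intro!: derivative_eq_intros simp: d_def power2_eq_square field_simps)
  have 2: "(n has_derivative (%h. N *\<^sub>R h - (2*(u.*h)) *\<^sub>R u)) (at x)" unfolding n_def by (auto intro!: derivative_eq_intros)
  have "hrefl u c = (%x. (1 / (u.*u + c^2 - 2*c*(u.*x))) *\<^sub>R n x)" by (auto simp: hrefl_def N_def n_def)
  thus ?thesis using has_derivative_scaleR[OF 1 2] by (simp add: d_def)
 qed
 \<comment> \<open>The two terms of the product rule combine to \<open>N/d\<close> times a rank-one
   perturbation of the identity, the form treated by \<open>det_rank1\<close>.\<close>
 moreover have "(1/d) *\<^sub>R (N *\<^sub>R h - (2*(u.*h)) *\<^sub>R u) + (2*c*(u.*h) / d^2) *\<^sub>R n x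
   = (N/d) *\<^sub>R (h + (u.*h) *\<^sub>R q)" for h using yn N by (simp add: q_def algebra_simps power2_eq_square)
 ultimately have der: "(hrefl u c has_derivative (%h. (N/d) *\<^sub>R (h + (u.*h) *\<^sub>R q))) (at x)" by simp
 have "u.*y - c = - (u.*x - c) * (N/d)" using inner_hrefl_self[OF hrefl] by (simp add: y_def N_def d_def)
 hence uy: "u.*y = c - (u.*x-c)*(N/d)" by (simp only: mult_minus_left)
 have "1 + u.*q = 1 + (2*c*(u.*y) - 2*(u.*u)) / N" by (simp add: q_def inner_diff_right diff_divide_distrib)
 also have "... = 1 + (2*c*(c - (u.*x-c)*(N/d)) - 2*(u.*u)) / N" by (simp only: uy)
 also have "... = - N/d"
 proof -
  have "1 + (2*c*(c - (u.*x-c)*(N/d)) - 2*(u.*u)) / N = (N * d + 2*c*(c*d - (u.*x-c)*N) - 2*(u.*u)*d) / (N*d)"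
   using d N by (simp add: field_simps)
  also have "N * d + 2*c*(c*d - (u.*x-c)*N) - 2*(u.*u)*d = - (N * N)" by (simp add: N_def d_def algebra_simps power2_eq_square)
  finally show ?thesis by simp
 qed
 finally have uq: "1 + u.*q = - N/d" .
 have lin: "linear (%h. h + (u.*h) *\<^sub>R q)" by (auto intro!: linearI simp: inner_add_right algebra_simps)
 have "(%h. (N/d) *\<^sub>R (h + (u.*h) *\<^sub>R q)) = (*\<^sub>R) (N/d) \<circ> (%h. h + (u.*h) *\<^sub>R q)" by auto
 hence "det (matrix (%h. (N/d) *\<^sub>R (h + (u.*h) *\<^sub>R q))) = (N/d) ^ CARD('n) * (1 + u.*q)"
  by (simp only: matrix_compose[OF lin linear_scale_self] det_mul det_matrix_scaleR det_rank1)
 also have "... = - 1 * (N/d) ^ (CARD('n) + 1)" by (simp add: uq)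
 finally have det: "det (matrix (%h. (N/d) *\<^sub>R (h + (u.*h) *\<^sub>R q))) = - 1 * (N/d) ^ (CARD('n) + 1)" .
 have "N/d = hq (hrefl u c x) / hq x" using hq_hrefl[OF hrefl] hq_pos[OF hrefl(2)] by (simp add: N_def d_def)
 thus ?case using der det by (metis (no_types, lifting))
next
 case (comp s F t G)
 obtain E where E: "(G has_derivative E) (at x)" "det (matrix E) = t * (hq (G x) / hq x) ^ (CARD('n) + 1)" using comp by blast
 have gx: "G x : ub" using comp hiso_ball by blast
 then obtain D where D: "(F has_derivative D) (at (G x))"
  "det (matrix D) = s * (hq (F (G x)) / hq (G x)) ^ (CARD('n) + 1)" using comp.IH(1) by blast
 have "(F \<circ> G has_derivative D \<circ> E) (at x)" using diff_chain_at[OF E(1) D(1)] .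
 moreover have "det (matrix (D \<circ> E)) = det (matrix D) * det (matrix E)"
  using E(1) D(1) by (simp add: matrix_compose has_derivative_linear det_mul)
 moreover have "hq (G x) ~= 0" using hq_pos[OF gx] by simp
 hence "det (matrix D) * det (matrix E) = s * t * (hq (F (G x)) / hq x) ^ (CARD('n) + 1)" unfolding D(2) E(2)
  by (simp add: power_mult_distrib[symmetric] mult_ac)
 ultimately show ?case unfolding o_def by (intro exI[of _ "%x. D (E x)"]) simp
qed

lemma hiso_continuous: "hiso s G ==> continuous_on ub G"
 by (meson continuous_at_imp_continuous_on has_derivative_continuous hiso_derivative)

definition kdens :: "real ^ 'n => real" where
 "kdens x = 1 / hq x ^ (CARD('n) + 1)"

lemma klein_density:
 fixes x :: "real ^ 'n"
 assumes "x : ub" shows "(1 - (norm x)^2) powr (- (real CARD('n) + 1) / 2) = kdens x"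
proof -
 have p: "1 - x.*x > 0" using assms by (simp add: ball01_iff)
 have "(1 - (norm x)^2) powr (- (real CARD('n) + 1) / 2) = (1 - x.*x) powr (1/2 * - real (CARD('n) + 1))"
  by (simp add: field_simps power2_norm_eq_inner)
 also have "... = (hq x) powr (- real (CARD('n) + 1))"
  by (subst powr_powr[symmetric]) (simp only: hq_def powr_half_sqrt[OF less_imp_le[OF p]])
 also have "... = kdens x" by (subst powr_minus_divide) (simp only: kdens_def powr_realpow[OF hq_pos[OF assms]])
 finally show ?thesis .
qed

lemma kdens_nonneg: "x : ub ==> kdens x >= 0" using hq_pos[of x] by (simp add: kdens_def)

lemma hq_measurable [measurable]: "hq : borel_measurable borel" unfolding hq_def by measurable

lemma kdens_measurable [measurable]: "kdens : borel_measurable borel" unfolding kdens_def by measurable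

lemma klein_volume_eq:
 fixes A :: "(real ^ 'n) set"
 assumes "A \<subseteq> ub" shows "kvol A = (\<integral>\<^sup>+ x. ennreal (kdens x) * indicator A x \<partial>lborel)" unfolding klein_volume_def
proof (rule nn_integral_cong)
 fix x :: "real ^ 'n"
 show "ennreal ((1 - (norm x)^2) powr (- (real CARD('n) + 1) / 2)) * indicator A x = ennreal (kdens x) * indicator A x"
 proof (cases "x : A")
  case True
  hence "x : ub" using assms by blast
  thus ?thesis by (simp only: klein_density)
 qed simp
qed

definition kmeasure :: "(real ^ 'n) measure" where
 "kmeasure = density lborel (%x. ennreal (kdens x))"

lemma sets_kmeasure [simp, measurable_cong]: "sets kmeasure = sets borel" by (simp add: kmeasure_def)

lemma klein_volume_emeasure:
 assumes "A \<subseteq> ub" "A : sets borel" shows "kvol A = emeasure kmeasure A"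
  unfolding kmeasure_def using assms by (simp add: klein_volume_eq emeasure_density)

lemma ub_borel [simp]: "ub : sets borel" by simp

lemma hiso_image_borel:
 fixes G :: "real ^ 'n => real ^ 'n"
 assumes "hiso s G" "A \<subseteq> ub" "A : sets borel" shows "G ` A : sets borel"
proof -
 obtain H where H: "hiso s H" "ALL x:ub. H (G x) = x & G (H x) = x" using hiso_inv[OF assms(1)] by blast
 have "G ` A = H -` A \<inter> ub"
 proof
  show "G ` A \<subseteq> H -` A \<inter> ub" using H assms hiso_ball[OF assms(1)] by auto
  show "H -` A \<inter> ub \<subseteq> G ` A"
  proof
   fix z assume "z : H -` A \<inter> ub"
   thus "z : G ` A" using H by (intro image_eqI[of _ _ "H z"]) auto
  qed
 qed
 moreover have "H -` A \<inter> ub : sets borel" using borel_measurable_continuous_on_restrict[OF hiso_continuous[OF H(1)]] assms(3)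
  by (metis (no_types, lifting) measurable_sets sets_restrict_space_iff space_borel
    space_restrict_space ub_borel Int_UNIV_right)
 ultimately show ?thesis by simp
qed

text \<open>The Jacobian cancels against the ratio of the Klein densities. An inequality is enough,
  since it can be applied to the inverse isometry as well.\<close>

lemma hiso_volume_le:
 fixes G :: "real ^ 'n::{finite,wellorder} => real ^ 'n::_"
 assumes G: "hiso s G" and S: "S \<subseteq> ub" "S : sets borel" shows "kvol (G ` S) <= kvol S"
proof (cases "kvol S = \<infinity>")
 case False
 then obtain b where b: "kvol S = ennreal b" "b >= 0" by (cases "kvol S") auto
 define D where "D = (%x. SOME D. (G has_derivative D) (at x) & det (matrix D) = s * (hq (G x) / hq x) ^ (CARD('n) + 1))"
 have D: "(G has_derivative D x) (at x)" "det (matrix (D x)) = s * (hq (G x) / hq x) ^ (CARD('n) + 1)" if "x : ub" for x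
  using someI_ex[OF hiso_derivative[OF G that]] by (auto simp: D_def)
 have dens: "\<bar>det (matrix (D x))\<bar> * kdens (G x) = kdens x" if "x : S" for x
 proof -
  have x: "x : ub" using that S by auto
  show ?thesis using hiso_sign[OF G] hq_pos[OF x] hq_pos[OF hiso_ball[OF G x]] by (auto simp: D(2)[OF x] abs_mult kdens_def power_divide)
 qed
 have "((%x. kdens x * indicator S x) has_integral b) UNIV"
 proof (rule nn_integral_has_integral)
  show "(%x. kdens x * indicator S x) : borel_measurable borel" using S by measurable
  show "0 <= kdens x * indicator S x" for x using S kdens_nonneg[of x] by (auto simp: indicator_def)
  have "(\<integral>\<^sup>+ x. ennreal (kdens x * indicator S x) \<partial>lborel) = kvol S"
   unfolding klein_volume_eq[OF S(1)] by (rule nn_integral_cong) (auto simp: indicator_def)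
  thus "(\<integral>\<^sup>+ x. ennreal (kdens x * indicator S x) \<partial>lborel) = ennreal b" using b by simp
 qed (use b in simp)
 moreover have "(%x. kdens x * indicator S x) = (%x. if x : S then kdens x else 0)" by (auto simp: indicator_def)
 ultimately have I: "(kdens has_integral b) S" by (simp add: has_integral_restrict_UNIV)
 have I': "((%x. \<bar>det (matrix (D x))\<bar> * kdens (G x)) has_integral b) S"
  using I by (rule has_integral_eq[rotated]) (simp add: dens)
 have A: "(%x. \<bar>det (matrix (D x))\<bar> * kdens (G x)) absolutely_integrable_on S"
 proof (rule nonnegative_absolutely_integrable_1)
  show "(%x. \<bar>det (matrix (D x))\<bar> * kdens (G x)) integrable_on S" using I' by auto
  show "0 <= \<bar>det (matrix (D x))\<bar> * kdens (G x)" if "x : S" for x using dens[OF that] kdens_nonneg[of x] S that by auto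
 qed
 have "(%x. \<bar>det (matrix (D x))\<bar> *\<^sub>R (vec (kdens (G x)) :: real^1)) absolutely_integrable_on S &
     integral S (%x. \<bar>det (matrix (D x))\<bar> *\<^sub>R (vec (kdens (G x)) :: real^1)) = vec b
  \<longleftrightarrow> (%x. vec (kdens x) :: real^1) absolutely_integrable_on (G ` S) & integral (G ` S) (%x. vec (kdens x) :: real^1) = vec b"
   by (rule has_absolute_integral_change_of_variables)
   (use S D hiso_inj[OF G] in \<open>auto intro: has_derivative_at_withinI inj_on_subset\<close>)
 hence I2: "(kdens has_integral b) (G ` S)" using A integral_unique[OF I']
  by (simp add: absolutely_integrable_on_1_iff integral_on_1_eq has_integral_iff absolutely_integrable_on_def)
 have GS: "G ` S \<subseteq> ub" using S hiso_ball[OF G] by auto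
 have "(\<integral>\<^sup>+ x. ennreal (kdens x) * indicator (G ` S) x \<partial>lborel) = ennreal b"
  by (rule nn_integral_has_integral_lebesgue'[OF _ I2]) (use GS kdens_nonneg in auto)
 thus ?thesis using b by (simp add: klein_volume_eq[OF GS])
qed simp

lemma hiso_volume:
 fixes G :: "real ^ 'n::{finite,wellorder} => real ^ 'n::_"
 assumes G: "hiso s G" and S: "S \<subseteq> ub" "S : sets borel" shows "kvol (G ` S) = kvol S"
proof (rule antisym)
 obtain H where H: "hiso s H" "ALL x:ub. H (G x) = x & G (H x) = x" using hiso_inv[OF G] by blast
 have "kvol (H ` G ` S) <= kvol (G ` S)" using H(1) S hiso_image_borel[OF G S] hiso_ball[OF G] by (intro hiso_volume_le) auto
 moreover have "H ` G ` S = S" using H(2) S(1) by (force simp: image_image)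
 ultimately show "kvol S <= kvol (G ` S)" by simp
qed (rule hiso_volume_le[OF assms])

section \<open>Rigidity\<close>

text \<open>Small multiples of the basis vectors lie in \<open>V\<close> and have orthogonal images
  of equal length, so they define an orthogonal map \<open>A\<close>; comparing inner products with
  these images yields |T x - A x|^2 = 0.\<close>

lemma inner_preserving_linear:
 fixes T :: "real ^ 'n => real ^ 'n"
 assumes V: "open V" "0 : V" and T: "!!x y. x : V ==> y : V ==> T x .* T y = x .* y"
 obtains A where "orth A" "!!x. x : V ==> T x = A x"
proof -
 obtain e where e: "e > 0" "ball 0 e \<subseteq> V" using V open_contains_ball by blast
 define w where "w = (%b. (2/e) *\<^sub>R T ((e/2) *\<^sub>R b))"
 have eb: "(e/2) *\<^sub>R b : V" if "b : Basis" for b :: "real^'n" using e that by (intro subsetD[OF e(2)]) (simp add: mem_ball_0)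
 have ww: "w b .* w b' = b .* b'" if "b : Basis" "b' : Basis" for b b'
  using T[OF eb[OF that(1)] eb[OF that(2)]] e by (simp add: w_def field_simps)
 define A where "A = (%h. SUM b:Basis. (h .* b) *\<^sub>R w b)"
 have lin: "linear A" by (auto intro!: linearI simp: A_def inner_add_left algebra_simps sum.distrib scaleR_sum_right)
 have Aw: "A h .* w b = h .* b" if "b : Basis" for h b
  using that by (simp add: A_def inner_sum_left ww inner_Basis if_distrib cong: if_cong)
 have AA: "A h .* A k = h .* k" for h k
 proof -
  have "A h .* A k = (SUM b:Basis. (k .* b) * (A h .* w b))" by (subst (2) A_def) (simp add: inner_sum_right)
  also have "... = (SUM b:Basis. (h .* b) * (k .* b))" by (intro sum.cong) (auto simp: Aw)
  also have "... = h .* k" by (rule euclidean_inner[symmetric])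
  finally show ?thesis .
 qed
 show ?thesis
 proof
  show "orth A" using lin AA by (simp add: orthogonal_transformation_def)
  fix x assume x: "x : V"
  have Tw: "T x .* w b = x .* b" if "b : Basis" for b using T[OF x eb[OF that]] e by (simp add: w_def field_simps)
  have "T x .* A x = (SUM b:Basis. (x .* b) * (T x .* w b))" by (simp add: A_def inner_sum_right)
  also have "... = (SUM b:Basis. (x .* b) * (x .* b))" by (intro sum.cong) (auto simp: Tw)
  also have "... = x .* x" by (rule euclidean_inner[symmetric])
  finally have "T x .* A x = x .* x" .
  hence "(T x - A x) .* (T x - A x) = 0" using T[OF x x] AA[of x x] by (simp add: inner_diff_left inner_diff_right inner_commute)
  thus "T x = A x" by simp
 qed
qed

lemma hiso_vimage_open:
 assumes "hiso s G" "open V" shows "open {x : ub. G x : V}"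
  using continuous_open_preimage[OF hiso_continuous[OF assms(1)] _ assms(2)] by (simp add: Int_def vimage_def)

lemma hiso_image_open:
 assumes G: "hiso s G" and V: "open V" "V \<subseteq> ub" shows "open (G ` V)"
proof -
 obtain H where H: "hiso s H" "ALL x:ub. H (G x) = x & G (H x) = x" using hiso_inv[OF G] by blast
 have "G ` V = {x : ub. H x : V}"
 proof
  show "G ` V \<subseteq> {x : ub. H x : V}" using H(2) V(2) hiso_ball[OF G] by auto
  show "{x : ub. H x : V} \<subseteq> G ` V"
  proof
   fix x assume "x : {x : ub. H x : V}"
   thus "x : G ` V" using H(2) by (intro image_eqI[of _ _ "H x"]) auto
  qed
 qed
 thus ?thesis using hiso_vimage_open[OF H(1) V(1)] by simp
qed

text \<open>After moving a point and its image to 0, distances to 0 show that \<open>hq\<close> is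
  preserved; then \<open>kch\<close> turns into the inner product and the map is linear on its
  domain.\<close>

theorem kd_rigid:
 fixes T :: "real ^ 'n => real ^ 'n"
 assumes V: "open V" "V ~= {}" "V \<subseteq> ub" and TV: "T ` V \<subseteq> ub"
  and T: "!!x y. x : V ==> y : V ==> kd (T x) (T y) = kd x y"
 obtains s G where "hiso s G" "!!x. x : V ==> T x = G x"
proof -
 obtain a where a: "a : V" using V by blast
 obtain s F where F: "hiso s F" "F a = 0" "F 0 = a" "ALL x:ub. F (F x) = x" using swap_to_0[OF subsetD[OF V(3) a]] by blast
 obtain t H where H: "hiso t H" "H (T a) = 0" "ALL x:ub. H (H x) = x" using swap_to_0[OF subsetD[OF TV imageI[OF a]]] by blast
 define V' where "V' = {x : ub. F x : V}"
 have z: "0 : V'" using F a by (simp add: V'_def)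
 have o: "open V'" unfolding V'_def by (rule hiso_vimage_open[OF F(1) V(1)])
 define T' where "T' = (%x. H (T (F x)))"
 have T'b: "T' x : ub" if "x : V'" for x using that TV hiso_ball[OF H(1)] by (auto simp: T'_def V'_def)
 have k: "kch (T' x) (T' y) = kch x y" if "x : V'" "y : V'" for x y
 proof -
  have "x : ub" "y : ub" "F x : V" "F y : V" using that by (auto simp: V'_def)
  moreover have "T (F x) : ub" "T (F y) : ub" "F x : ub" "F y : ub" using calculation TV V by auto
  ultimately show ?thesis using T[of "F x" "F y"] by (simp add: T'_def hiso_kch[OF H(1)] kd_eq_iff hiso_kch[OF F(1)])
 qed
 have T0: "T' 0 = 0" using F H by (simp add: T'_def)
 have hqT: "hq (T' x) = hq x" if "x : V'" for x using k[OF z that] by (simp add: T0 kch_0)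
 have inn: "T' x .* T' y = x .* y" if "x : V'" "y : V'" for x y
 proof -
  show ?thesis using that k[OF that] hq_pos[of x] hq_pos[of y] by (simp add: V'_def kch_def hqT that)
 qed
 obtain A where A: "orth A" "!!x. x : V' ==> T' x = A x" using inner_preserving_linear[OF o z inn] by blast
 show ?thesis
 proof (rule that)
  show "hiso (t * (det (matrix A) * s)) (%x. H (A (F x)))" by (intro hiso.comp H F) (rule hiso.orth[OF A(1)])
  fix x assume x: "x : V"
  hence xb: "x : ub" "T x : ub" using V TV by auto
  hence "H (A (F x)) = H (T' (F x))" using F x hiso_ball[OF F(1)] A by (simp add: V'_def)
  also have "... = T x" using xb F H by (simp add: T'_def)
  finally show "T x = H (A (F x))" by simp
 qed
qed

text \<open>Divided by \<open>hq q\<close>, equality of the distances to \<open>q\<close> is an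
  affine equation in \<open>q\<close>. Holding on an open set, it has zero coefficients, which makes
  the two lifts to the hyperboloid equal.\<close>

lemma equidistant_open:
 fixes z z' :: "real ^ 'n"
 assumes "open W" "W ~= {}" "W \<subseteq> ub" "z : ub" "z' : ub" "!!q. q : W ==> kd z q = kd z' q" shows "z = z'"
proof -
 define a where "a = 1 / hq z - 1 / hq z'"
 define b where "b = (1 / hq z) *\<^sub>R z - (1 / hq z') *\<^sub>R z'"
 have ab: "b .* q = a" if "q : W" for q
 proof -
  have q: "q : ub" using that assms by auto
  have "(1 - z.*q) / hq z / hq q = (1 - z'.*q) / hq z' / hq q" using assms(6)[OF that] kd_eq_iff[OF assms(4) q assms(5) q] by (simp add: kch_def)
  hence "(1 - z.*q) / hq z = (1 - z'.*q) / hq z'" using hq_pos[OF q] by (metis divide_cancel_right less_irrefl)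
  thus ?thesis by (simp add: a_def b_def inner_diff_left diff_divide_distrib)
 qed
 obtain p where p: "p : W" using assms by blast
 then obtain e where e: "e > 0" "ball p e \<subseteq> W" using assms open_contains_ball by blast
 have "b = 0"
 proof (rule ccontr)
  assume b: "b ~= 0"
  define q where "q = p + (e / (2 * norm b)) *\<^sub>R b"
  have "q : W" using e by (auto simp: q_def dist_norm mem_ball)
  hence "b .* (q - p) = 0" using ab[OF p] ab[of q] by (simp add: inner_diff_right)
  thus False using b e by (simp add: q_def)
 qed
 moreover hence "a = 0" using ab[OF p] by simp
 hence "hq z = hq z'" by (simp add: a_def)
 ultimately show ?thesis using hq_pos[OF assms(4)] by (simp add: b_def flip: scaleR_diff_right)
qed

lemma hiso_unique:
 fixes F G :: "real ^ 'n => real ^ 'n"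
 assumes F: "hiso s F" and G: "hiso t G" and O: "open V" "V ~= {}" "V \<subseteq> ub" "!!x. x : V ==> F x = G x"
  and z: "z : ub" shows "F z = G z"
proof (rule equidistant_open)
 show "open (F ` V)" by (rule hiso_image_open[OF F O(1) O(3)])
 show "F ` V ~= {}" using O by simp
 show "F ` V \<subseteq> ub" using O hiso_ball[OF F] by blast
 show "F z : ub" "G z : ub" using z hiso_ball F G by blast+
 fix q assume "q : F ` V"
 then obtain v where v: "v : V" "q = F v" by blast
 hence vb: "v : ub" using O by blast
 have "kd (F z) q = kd z v" using v vb z by (simp add: hiso_kd[OF F])
 also have "... = kd (G z) (G v)" using vb z by (simp add: hiso_kd[OF G])
 finally show "kd (F z) q = kd (G z) q" using v O by simp
qed

lemma hiso_unique_sign: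
 fixes F G :: "real ^ 'n => real ^ 'n"
 assumes F: "hiso s F" and G: "hiso t G" and O: "open V" "V ~= {}" "V \<subseteq> ub" "!!x. x : V ==> F x = G x" shows "s = t"
proof -
 obtain x where x: "x : V" using O by blast
 hence xb: "x : ub" using O by blast
 obtain D where D: "(F has_derivative D) (at x)" "det (matrix D) = s * (hq (F x) / hq x) ^ (CARD('n) + 1)"
  using hiso_derivative[OF F xb] by blast
 obtain E where E: "(G has_derivative E) (at x)" "det (matrix E) = t * (hq (G x) / hq x) ^ (CARD('n) + 1)"
  using hiso_derivative[OF G xb] by blast
 have "D = E" using has_derivative_transform_within_open[OF D(1) O(1) x] O(4) E(1) has_derivative_unique by blast
 thus ?thesis using hq_pos xb hiso_ball[OF F] D(2) E(2) O(4)[OF x] by fastforce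
qed

section \<open>Topology of the metric\<close>

lemma hq_continuous [continuous_intros]: "continuous_on S f ==> continuous_on S (%x. hq (f x))"
 unfolding hq_def by (intro continuous_intros)

lemma kd_continuous:
 assumes "continuous_on S f" "continuous_on S g" "f ` S \<subseteq> ub" "g ` S \<subseteq> ub" shows "continuous_on S (%x. kd (f x) (g x))"
proof -
 have nz: "hq (f x) ~= 0" "hq (g x) ~= 0" if "x : S" for x using hq_pos[of "f x"] hq_pos[of "g x"] that assms(3,4) by auto
 show ?thesis unfolding klein_dist_eq
 proof (rule continuous_on_compose2[OF continuous_on_arcosh _ order.refl])
  show "continuous_on S (%x. kch (f x) (g x))" unfolding kch_def by (intro continuous_intros assms) (use nz in auto)
  show "(%x. kch (f x) (g x)) ` S \<subseteq> {1..}" using assms(3,4) by (auto simp: image_subset_iff intro!: kch_ge_1)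
 qed
qed

definition KB :: "real ^ 'n => real => (real ^ 'n) set" where
 "KB x r = {z : ub. kd x z < r}"

lemma KB_sub: "KB x r \<subseteq> ub" by (auto simp: KB_def)

lemma centre_in_KB: "x : ub ==> r > 0 ==> x : KB x r" by (simp add: KB_def)

lemma open_KB: assumes "x : ub" shows "open (KB x r)"
proof -
 have "continuous_on ub (%z. kd x z)" using assms by (intro kd_continuous) auto
 hence "open (ub \<inter> (%z. kd x z) -` {..<r})" by (rule continuous_open_preimage) auto
 thus ?thesis by (simp add: KB_def Int_def vimage_def)
qed

lemma kd_0_small:
 fixes z :: "real ^ 'n"
 assumes z: "z : ub" and C: "kd 0 z <= C" shows "(norm z)^2 <= 1 - 1 / (cosh C)^2"
proof -
 have "cosh (kd 0 z) <= cosh C" using C kd_nonneg[of 0 z] z by (simp add: cosh_real_nonneg_le_iff)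
 hence "hq z >= 1 / cosh C" using z hq_pos[OF z] by (simp add: cosh_kd kch_0 field_simps cosh_real_pos)
 hence "(1 / cosh C)^2 <= (hq z)^2" by (intro power_mono) (auto simp: less_imp_le[OF cosh_real_pos])
 thus ?thesis using hq_power2[OF z] by (simp add: power_divide power2_norm_eq_inner)
qed

lemma KB_small:
 fixes x :: "real ^ 'n"
 assumes x: "x : ub" and O: "open V" "x : V"
 obtains r where "r > 0" "KB x r \<subseteq> V"
proof -
 obtain s G where G: "hiso s G" "G x = 0" "G 0 = x" "ALL z:ub. G (G z) = z" by (rule swap_to_0[OF x])
 have "0 : {z : ub. G z : V}" using G O by simp
 then obtain e where e: "e > 0" "ball 0 e \<subseteq> {z : ub. G z : V}" using hiso_vimage_open[OF G(1) O(1)] open_contains_ball by blast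
 define d where "d = min (e/2) (1/2)"
 have d: "0 < d" "d < e" "d < 1" using e by (auto simp: d_def)
 define r where "r = arcosh (1 / sqrt (1 - d^2))"
 have q: "0 < 1 - d^2" using d by (simp add: abs_square_less_1)
 have c: "1 / sqrt (1 - d^2) > 1" using d q by simp
 show ?thesis
 proof
  show "r > 0" using c d by (simp add: r_def)
  show "KB x r \<subseteq> V"
  proof
   fix z assume "z : KB x r"
   hence z: "z : ub" "kd x z < r" by (auto simp: KB_def)
   have "(norm (G z))^2 <= 1 - 1 / (cosh r)^2" using hiso_kd[OF G(1) x z(1)] z G hiso_ball[OF G(1) z(1)] by (intro kd_0_small) auto
   also have "cosh r = 1 / sqrt (1 - d^2)" using c by (simp add: r_def)
   also have "1 - 1 / (1 / sqrt (1 - d^2))^2 = d^2" using q by (simp add: power_divide)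
   finally have "norm (G z) <= d" using d by (metis less_imp_le power2_le_imp_le)
   hence "G z : ball 0 e" using d by (simp add: mem_ball_0)
   thus "z : V" using e G z by auto
  qed
 qed
qed

section \<open>Commuting involutions\<close>

definition commuting :: "('u => 's => 's) => 's set => 'u set => bool" where
 "commuting f S T \<longleftrightarrow> finite T & (ALL u:T. ALL s:S. f u s : S & f u (f u s) = s) &
  (ALL u:T. ALL v:T. ALL s:S. f u (f v s) = f v (f u s))"

text \<open>Commuting involutions generate an elementary abelian 2-group, whose elements are written
  as sets of generators. The test \<open>s : S\<close> makes the folded maps commute on all
  arguments, as a fold over a finite set demands.\<close>

definition act :: "('u => 's => 's) => 's set => 'u set => 's => 's" where
 "act f S w s = Finite_Set.fold (%u s. if s : S then f u s else s) s w"

definition toggle :: "'u => 'u set => 'u set" where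
 "toggle u w = (if u : w then w - {u} else insert u w)"

lemma toggle_subset [intro]: "u : T ==> w \<subseteq> T ==> toggle u w \<subseteq> T" by (auto simp: toggle_def)

lemma act_empty [simp]: "act f S {} s = s" by (simp add: act_def)

lemma act_insert:
 assumes c: "commuting f S T" and "w \<subseteq> T" "u : T" "u ~: w" "s : S"
 shows "act f S w s : S & act f S (insert u w) s = f u (act f S w s)"
proof -
 interpret comp_fun_commute_on T "%u s. if s : S then f u s else s"
  using c by unfold_locales (auto simp: commuting_def fun_eq_iff)
 have fin: "finite w" using c assms(2) finite_subset by (auto simp: commuting_def)
 have *: "act f S (insert u w) s = (if act f S w s : S then f u (act f S w s) else act f S w s)"
  unfolding act_def using fin assms by (subst fold_insert) auto
 have S: "act f S w s : S" using fin assms(2)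
 proof (induction w rule: finite_induct)
  case (insert v w)
  have "act f S (insert v w) s = (if act f S w s : S then f v (act f S w s) else act f S w s)"
   unfolding act_def using insert by (subst fold_insert) auto
  thus ?case using insert c by (auto simp: commuting_def)
 qed (use assms in simp)
 show ?thesis using * S by simp
qed

lemma act_in:
 assumes c: "commuting f S T" and "w \<subseteq> T" "s : S" shows "act f S w s : S"
proof (cases "w = {}")
 case False
 then obtain u where u: "u : w" by blast
 hence "act f S (insert u (w - {u})) s = f u (act f S (w - {u}) s)" "act f S (w - {u}) s : S"
  using act_insert[OF c, of "w - {u}" u s] assms by auto
 thus ?thesis using u assms by (auto simp: commuting_def insert_absorb)
qed (use assms in simp)

lemma act_toggle:
 assumes c: "commuting f S T" and w: "w \<subseteq> T" and u: "u : T" and s: "s : S" shows "act f S (toggle u w) s = f u (act f S w s)"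
proof (cases "u : w")
 case True
 have 1: "act f S (insert u (w - {u})) s = f u (act f S (w - {u}) s)" "act f S (w - {u}) s : S"
  using act_insert[OF c, of "w - {u}" u s] assms by auto
 moreover have "insert u (w - {u}) = w" using True by auto
 ultimately show ?thesis using c u True by (auto simp: toggle_def commuting_def)
next
 case False
 thus ?thesis using act_insert[OF c w u False s] by (simp add: toggle_def)
qed

lemma commuting_induct [consumes 2, case_names empty insert]:
 assumes "commuting f S T" "w \<subseteq> T" "P {}"
  "!!u w. u : T ==> w \<subseteq> T ==> u ~: w ==> P w ==> P (insert u w)" shows "P w"
proof -
 have "finite w" using assms finite_subset by (auto simp: commuting_def)
 thus ?thesis using assms(2) by (induction w rule: finite_induct) (use assms(3,4) in auto)
qed

section \<open>Right-angled polytopes\<close>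

text \<open>The walls are the planes \<open>u.*x = c\<close>. By \<open>angles\<close> two of them
  are orthogonal or disjoint in the ball; \<open>u.*v = 2 * c^2 - R\<close> is tangency at an ideal
  point.\<close>

locale right_angled =
 fixes N :: "(real ^ 'n) set" and c R :: real
 assumes finN: "finite N" and c_pos: "0 < c" and cR: "c^2 < R"
  and norm_N: "!!u. u : N ==> u.*u = R"
  and angles: "!!u v. u : N ==> v : N ==> u ~= v ==> u.*v = c^2 | u.*v <= 2 * c^2 - R"
begin

definition cell :: "(real ^ 'n) set" where
 "cell = {x : ub. ALL u:N. u.*x <= c}"

definition tight :: "real ^ 'n => (real ^ 'n) set" where
 "tight x = {u : N. u.*x = c}"

lemma cell_ub: "x : cell ==> x : ub" by (simp add: cell_def)

lemma tight_N: "u : tight x ==> u : N" by (simp add: tight_def)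

lemma tight_fin: "finite (tight x)" using finN by (simp add: tight_def)

lemma space_like: "u : N ==> c^2 < u.*u" using cR norm_N by simp

lemma zero_cell: "0 : cell" using c_pos by (simp add: cell_def)

text \<open>Two walls of the second kind have |u + v| <= 2c, whereas a common point \<open>x\<close>
  of the open ball would satisfy (u + v) . x = 2c.\<close>

lemma tight_orth:
 assumes x: "x : ub" and u: "u : tight x" and v: "v : tight x" and uv: "u ~= v" shows "u.*v = c^2"
proof (rule ccontr)
 assume "u.*v ~= c^2"
 hence le: "u.*v <= 2 * c^2 - R" using angles u v uv by (auto simp: tight_def)
 have "(norm (u + v))^2 = 2*R + 2*(u.*v)"
  using u v norm_N by (simp add: tight_def power2_norm_eq_inner inner_add_left inner_add_right inner_commute)
 also have "... <= (2*c)^2" using le by (simp add: power2_eq_square)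
 finally have n: "norm (u + v) <= 2*c" using c_pos by (meson less_imp_le mult_pos_pos power2_le_imp_le zero_less_numeral)
 have "2*c = (u + v) .* x" using u v by (simp add: tight_def inner_add_left)
 also have "... <= norm (u + v) * norm x" by (rule norm_cauchy_schwarz)
 also have "... <= 2*c * norm x" using n by (intro mult_right_mono) auto
 finally show False using x c_pos by (simp add: mem_ball_0)
qed

lemma refl_commuting:
 assumes x: "x : ub" and T: "T \<subseteq> tight x" shows "commuting (%u. hrefl u c) ub T" unfolding commuting_def
proof (intro conjI ballI)
 show "finite T" using T tight_fin finite_subset by blast
next
 fix u and s :: "real ^ 'n" assume "u : T" "s : ub"
 hence u: "c^2 < u.*u" using T tight_N space_like by blast
 show "hrefl u c s : ub" "hrefl u c (hrefl u c s) = s" using hrefl_ball[OF u] hrefl_hrefl[OF u] \<open>s : ub\<close> by blast+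
next
 fix u v and s :: "real ^ 'n" assume *: "u : T" "v : T" "s : ub"
 hence u: "c^2 < u.*u" "c^2 < v.*v" using T tight_N space_like by blast+
 show "hrefl u c (hrefl v c s) = hrefl v c (hrefl u c s)"
 proof (cases "u = v")
  case False
  hence "u.*v = c * c" using tight_orth[OF x] * T by (simp add: power2_eq_square subset_iff)
  thus ?thesis using hrefl_commute[OF u _ *(3)] by simp
 qed simp
qed

section \<open>Products of the wall reflections at a point\<close>

definition mref :: "(real ^ 'n) set => real ^ 'n => real ^ 'n" where
 "mref = act (%u. hrefl u c) ub"

lemma mref_empty [simp]: "mref {} y = y" by (simp add: mref_def)

context
 fixes x :: "real ^ 'n" and T
 assumes x: "x : ub" and T: "T \<subseteq> tight x"
begin

lemma cm: "commuting (%u. hrefl u c) ub T" by (rule refl_commuting[OF x T])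

lemma mref_ub: "w \<subseteq> T ==> y : ub ==> mref w y : ub" unfolding mref_def by (rule act_in[OF cm])

lemma mref_insert: "w \<subseteq> T ==> u : T ==> u ~: w ==> y : ub ==> mref (insert u w) y = hrefl u c (mref w y)"
 unfolding mref_def using act_insert[OF cm] by blast

lemma mref_toggle: "w \<subseteq> T ==> u : T ==> y : ub ==> mref (toggle u w) y = hrefl u c (mref w y)"
 unfolding mref_def using act_toggle[OF cm] by blast

lemma mref_hiso:
 assumes "w \<subseteq> T" shows "EX G. hiso ((-1) ^ card w) G & (ALL y:ub. mref w y = G y)" using cm assms
proof (induction w rule: commuting_induct)
 case empty
 show ?case using hiso_id by auto
next
 case (insert u w)
 then obtain G where G: "hiso ((-1) ^ card w) G" "ALL y:ub. mref w y = G y" by blast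
 have u: "c^2 < u.*u" using insert T tight_N space_like by blast
 have "hiso ((-1) ^ card (insert u w)) (%y. hrefl u c (G y))"
  using hiso.comp[OF hiso.hrefl[OF u] G(1)] finite_subset[OF subset_trans[OF insert(2) T] tight_fin] insert(3) by simp
 moreover have "ALL y:ub. mref (insert u w) y = hrefl u c (G y)" using G(2) mref_insert[OF insert(2,1,3)] by simp
 ultimately show ?case by blast
qed

lemma mref_kd:
 assumes "w \<subseteq> T" "y : ub" "z : ub" shows "kd (mref w y) (mref w z) = kd y z" using mref_hiso assms(1) hiso_kd assms(2,3) by metis

lemma mref_centre: "w \<subseteq> T ==> mref w x = x" using cm
proof (induction w rule: commuting_induct)
 case (insert u w)
 hence "u : N" "u.*x = c" using T tight_def by auto
 thus ?case using mref_insert[OF insert(2,1,3) x] insert hrefl_fix[OF space_like] by simp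
qed simp

text \<open>Reflections in the other walls, being orthogonal to \<open>v\<close>, only multiply
  \<open>v.*y - c\<close> by positive factors. Hence the signs at \<open>mref w y\<close> record the
  set \<open>w\<close>.\<close>

lemma mref_wall:
 assumes w: "w \<subseteq> T" and v: "v : T" and y: "y : ub" shows "EX k>0. v .* mref w y - c = (if v : w then - k else k) * (v.*y - c)"
  using cm w
proof (induction w rule: commuting_induct)
 case empty
 show ?case by (auto intro: exI[of _ 1])
next
 case (insert u w)
 then obtain k where k: "k > 0" "v .* mref w y - c = (if v : w then - k else k) * (v.*y - c)" by blast
 have u: "c^2 < u.*u" using insert T tight_N space_like by blast
 have m: "mref w y : ub" using mref_ub insert y by blast
 define d where "d = (u.*u - c^2) / (u.*u + c^2 - 2*c*(u.* mref w y))"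
 have d: "d > 0" unfolding d_def using u hrefl_den_pos[OF u m] by (intro divide_pos_pos) auto
 have e: "mref (insert u w) y = hrefl u c (mref w y)" using mref_insert insert y by blast
 show ?case
 proof (cases "v = u")
  case True
  have "v .* mref (insert u w) y - c = - (v .* mref w y - c) * d" unfolding e True d_def using inner_hrefl_self[OF u m] by simp
  also have "v .* mref w y - c = k * (v.*y - c)" using k(2) insert True by simp
  finally show ?thesis using k d True by (intro exI[of _ "k*d"]) (simp add: algebra_simps)
 next
  case False
  hence "v .* mref (insert u w) y - c = (v .* mref w y - c) * d" using tight_orth[OF x, of u v] insert v T inner_hrefl_orth[OF u m]
   unfolding e d_def by (auto simp: power2_eq_square)
  thus ?thesis using k d False by (intro exI[of _ "k*d"]) simp
 qed
qed

lemma mref_mref: "w \<subseteq> T ==> y : ub ==> mref w (mref w y) = y" using cm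
proof (induction w arbitrary: y rule: commuting_induct)
 case (insert u w)
 have u: "c^2 < u.*u" using insert T tight_N space_like by blast
 have comm: "mref w (hrefl u c z) = hrefl u c (mref w z)" if "z : ub" for z using cm insert(2) that
 proof (induction w rule: commuting_induct)
  case (insert v w)
  thus ?case using mref_insert[of w v] hrefl_ball[OF u] cm \<open>u : T\<close> mref_ub[of w z] by (simp add: commuting_def)
 qed simp
 have m: "mref w y : ub" using mref_ub insert by blast
 have "mref (insert u w) (mref (insert u w) y) = hrefl u c (mref w (hrefl u c (mref w y)))"
  using mref_insert[of w u] insert hrefl_ball[OF u] m by simp
 also have "... = hrefl u c (hrefl u c (mref w (mref w y)))" using comm m by simp
 also have "... = y" using insert hrefl_hrefl[OF u] by simp
 finally show ?case .
qed simp

lemma mref_toggle_fix: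
 assumes "w \<subseteq> T" "u : T" "y : ub" "u .* y = c" shows "mref (toggle u w) y = mref w y"
proof -
 show ?thesis using mref_wall[OF assms(1-3)] assms(4) mref_toggle[OF assms(1-3)] hrefl_fix space_like assms(2) T tight_N by fastforce
qed

end

end

section \<open>Gluing cells along facets\<close>

text \<open>Each facet gluing is the restriction of a linear symmetry \<open>tr i u\<close> of the
  one polytope. As \<open>tr i u\<close> carries the cell to the cell, the neighbour is laid beside
  the cell only after a further reflection in the wall \<open>u\<close>.\<close>

locale pregluing = right_angled N c R for N :: "(real ^ 'n) set" and c R :: real +
 fixes I :: "'i set" and nb :: "'i => real ^ 'n => 'i" and tr :: "'i => real ^ 'n => real ^ 'n => real ^ 'n"
 assumes finI: "finite I"
  and nb_in: "!!i u. i : I ==> u : N ==> nb i u : I"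
  and tr_orth: "!!i u. i : I ==> u : N ==> orth (tr i u)"
  and tr_N: "!!i u. i : I ==> u : N ==> tr i u ` N = N"
  and nb_nb: "!!i u. i : I ==> u : N ==> nb (nb i u) (tr i u u) = i"
  and tr_tr: "!!i u x. i : I ==> u : N ==> tr (nb i u) (tr i u u) (tr i u x) = x"
begin

inductive chain :: "'i \<times> (real ^ 'n) => 'i \<times> (real ^ 'n) => real => bool" where
 refl: "i : I ==> x : cell ==> chain (i, x) (i, x) 0"
| jump: "i : I ==> x : cell ==> u : N ==> u.*x = c ==> chain (nb i u, tr i u x) q l ==> chain (i, x) q l"
| move: "i : I ==> x : cell ==> y : cell ==> chain (i, y) q l ==> chain (i, x) q (kd x y + l)"

definition syms :: "(real ^ 'n => real ^ 'n) set" where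
 "syms = {A. orth A & A ` N = N}"

lemma syms_inner: "A : syms ==> A x .* A y = x .* y" by (simp add: syms_def orthogonal_transformation_def)

lemma syms_N: "A : syms ==> u : N ==> A u : N" by (auto simp: syms_def)

lemma syms_ub: "A : syms ==> A x : ub \<longleftrightarrow> x : ub" by (simp add: syms_inner ball01_iff)

lemma syms_kd: "A : syms ==> kd (A x) (A y) = kd x y" by (simp add: klein_dist_eq kch_orth syms_def)

lemma syms_cell: assumes "A : syms" shows "A x : cell \<longleftrightarrow> x : cell"
proof -
 have "(ALL u:N. u .* A x <= c) \<longleftrightarrow> (ALL u:N. A u .* A x <= c)" using assms by (auto simp: syms_def) (metis image_iff)
 thus ?thesis using assms by (simp add: cell_def syms_ub syms_inner)
qed

lemma tr_syms: "i : I ==> u : N ==> tr i u : syms" by (simp add: syms_def tr_orth tr_N)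

lemma syms_comp: "A : syms ==> B : syms ==> A \<circ> B : syms"
 unfolding syms_def mem_Collect_eq image_comp[symmetric] by (simp add: orthogonal_transformation_compose)

lemma id_syms [simp]: "id : syms" by (simp add: syms_def id_def)

lemma syms_surj: "A : syms ==> EX y. A y = x" using orthogonal_transformation_surj[of A] surjD[of A x] by (auto simp: syms_def)

lemma syms_inj: "A : syms ==> A x = A y ==> x = y"
 by (metis (no_types, lifting) injD mem_Collect_eq orthogonal_transformation_inj syms_def)

definition states :: "('i \<times> (real ^ 'n => real ^ 'n)) set" where "states = I \<times> syms"

text \<open>A state \<open>(j, A)\<close> is the cell \<open>j\<close> with its walls named through
  \<open>A\<close>. Crossing the wall named \<open>u\<close> carries the names along, so the walls
  through a corner of the starting cell keep their names, and \<open>op u\<close> is an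
  involution.\<close>

definition op :: "real ^ 'n => 'i \<times> (real ^ 'n => real ^ 'n) => 'i \<times> (real ^ 'n => real ^ 'n)" where
 "op u s = (nb (fst s) (snd s u), tr (fst s) (snd s u) \<circ> snd s)"

definition pt :: "'i \<times> (real ^ 'n => real ^ 'n) => real ^ 'n => 'i \<times> (real ^ 'n)" where
 "pt s x = (fst s, snd s x)"

lemma init_state [simp]: "i : I ==> (i, id) : states" by (simp add: states_def)

lemma op_state: "s : states ==> u : N ==> op u s : states"
 by (auto simp: states_def op_def nb_in syms_N intro!: syms_comp tr_syms)

lemma op_op: assumes "s : states" "u : N" shows "op u (op u s) = s"
 using assms syms_N by (auto simp: states_def op_def nb_nb tr_tr fun_eq_iff)

lemma chain_ends: "chain p q l ==> p : I \<times> cell & q : I \<times> cell" by (induction rule: chain.induct) auto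

lemma chain_nonneg: "chain p q l ==> l >= 0"
 by (induction rule: chain.induct) (auto intro!: add_nonneg_nonneg kd_nonneg dest: cell_ub)

lemma chain_trans: "chain p q l ==> chain q r m ==> chain p r (l + m)"
proof (induction rule: chain.induct)
 case (jump i x u q l)
 thus ?case using chain.jump by blast
next
 case (move i x y q l)
 thus ?case using chain.move[OF move.hyps(1-3)] by (simp add: add.assoc)
qed simp

lemma chain_jump1:
 assumes "i : I" "x : cell" "u : N" "u.*x = c" shows "chain (i, x) (nb i u, tr i u x) 0"
proof -
 show ?thesis using tr_syms syms_cell assms chain.jump[OF assms chain.refl[OF nb_in[OF assms(1,3)]]] by simp
qed

lemma chain_jump_back:
 assumes "i : I" "x : cell" "u : N" "u.*x = c" shows "chain (nb i u, tr i u x) (i, x) 0"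
proof -
 have t: "tr i u : syms" using tr_syms assms by blast
 have "chain (nb i u, tr i u x) (nb (nb i u) (tr i u u), tr (nb i u) (tr i u u) (tr i u x)) 0"
  by (rule chain_jump1) (use assms t in \<open>auto simp: nb_in syms_cell syms_N syms_inner\<close>)
 thus ?thesis using assms by (simp add: nb_nb tr_tr)
qed

lemma chain_move1: "i : I ==> x : cell ==> y : cell ==> chain (i, x) (i, y) (kd x y)"
 using chain.move[OF _ _ _ chain.refl] by fastforce

lemma chain_sym: "chain p q l ==> chain q p l"
proof (induction rule: chain.induct)
 case (jump i x u q l)
 thus ?case using chain_trans[OF jump.IH chain_jump_back] by fastforce
next
 case (move i x y q l)
 have "chain (i, y) (i, x) (kd x y)" using chain_move1[of i y x] move by (simp add: kd_sym)
 thus ?case using chain_trans[OF move.IH] by (metis add.commute)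
qed (rule chain.refl)

text \<open>Jumps are linear isometries and keep the distance from 0, so only moves change it. This
  is what later bounds the representatives of a Cauchy sequence.\<close>

lemma chain_radial: "chain p q l ==> kd 0 (snd q) <= kd 0 (snd p) + l"
proof (induction rule: chain.induct)
 case (jump i x u q l)
 have "kd 0 (tr i u x) = kd (tr i u 0) (tr i u x)"
  using tr_orth[OF jump(1,3)] by (simp add: linear_0 orthogonal_transformation_linear)
 also have "... = kd 0 x" using jump tr_syms syms_kd by blast
 finally show ?case using jump by simp
next
 case (move i x y q l)
 have "kd 0 y <= kd 0 x + kd x y" using move cell_ub by (intro kd_triangle) auto
 thus ?case using move by simp
qed simp

text \<open>A chain that starts in a ball met by no wall can jump only after it has left that
  ball.\<close>

lemma chain_interior:
 assumes "chain p q l" "fst p = i" "z0 : ub" "kd z0 (snd p) < r"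
  "!!z u. z : KB z0 r ==> u : N ==> u.*z < c" shows "l >= r - kd z0 (snd p) | fst q = i & kd (snd p) (snd q) <= l" using assms
proof (induction rule: chain.induct)
 case (refl i' x)
 thus ?case using cell_ub by simp
next
 case (jump i' x u q l)
 hence False using cell_ub jump.prems(4)[of x u] by (simp add: KB_def)
 thus ?case ..
next
 case (move i' x y q l)
 have b: "x : ub" "y : ub" "snd q : ub" using move chain_ends[OF move.hyps(4)] cell_ub by auto
 show ?case
  using move kd_triangle[OF move.prems(2) b(1) b(2)] kd_triangle move.prems(2) b(1) b(2) kd_triangle[OF b] b move.prems(1) chain_nonneg[OF move.hyps(4)] chain_nonneg move.hyps(4) by force
qed

end

text \<open>The cycle condition for right dihedral angles: four cells close up around each face of
  codimension two.\<close>

locale commuting_gluing = pregluing N c R I nb tr for N :: "(real ^ 'n) set" and c R :: real and I :: "'i set"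
  and nb :: "'i => real ^ 'n => 'i" and tr :: "'i => real ^ 'n => real ^ 'n => real ^ 'n" +
 assumes op_comm: "!!i u v. i : I ==> u : N ==> v : N ==> u.*v = c^2 ==> op u (op v (i, id)) = op v (op u (i, id))"
begin

lemma op_commute:
 assumes "s : states" "u : N" "v : N" "u.*v = c^2" shows "op u (op v s) = op v (op u s)"
proof -
 obtain i A where s: "s = (i, A)" "i : I" "A : syms" using assms by (auto simp: states_def)
 have A: "A u : N" "A v : N" "A u .* A v = c^2" using s assms syms_N syms_inner by auto
 have "op u (op v s) = (fst (op (A u) (op (A v) (i, id))), snd (op (A u) (op (A v) (i, id))) \<circ> A)" for u v
  by (simp add: s op_def comp_assoc)
 thus ?thesis using op_comm[OF s(2) A] by simp
qed

lemma op_commuting: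
 assumes x: "x : ub" shows "commuting op states (tight x)" unfolding commuting_def
proof (intro conjI ballI)
 fix u v s assume *: "u : tight x" "v : tight x" "s : states"
 show "op u (op v s) = op v (op u s)" using op_commute[OF *(3)] tight_orth[OF x *(1,2)] * tight_N by (cases "u = v") auto
qed (use tight_fin op_state op_op tight_N in auto)

end

text \<open>By \<open>free\<close>, the different sets of walls at a corner lead to different
  corners of cells, so that no two sectors of the local model are identified.\<close>

locale gluing = commuting_gluing N c R I nb tr for N :: "(real ^ 'n) set" and c R :: real and I :: "'i set"
  and nb :: "'i => real ^ 'n => 'i" and tr :: "'i => real ^ 'n => real ^ 'n => real ^ 'n" +
 assumes free: "!!i x w w'. i : I ==> x : cell ==> w \<subseteq> tight x ==> w' \<subseteq> tight x ==>
   fst (act op states w (i, id)) = fst (act op states w' (i, id)) ==>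
   snd (act op states w (i, id)) x = snd (act op states w' (i, id)) x ==> w = w'"
begin

text \<open>A point \<open>y\<close> of the sector beyond the walls \<open>w\<close> is folded into
  the standard cell by \<open>mref w\<close> and then placed in the cell reached by crossing
  \<open>w\<close>. Composed with the quotient map this parametrises a neighbourhood of the
  corner.\<close>

definition dev :: "'i => (real ^ 'n) set => real ^ 'n => 'i \<times> (real ^ 'n)" where
 "dev i w y = pt (act op states w (i, id)) (mref w y)"

definition walls :: "real ^ 'n => real => bool" where
 "walls x r \<longleftrightarrow> r > 0 & (ALL z:KB x r. ALL u:N - tight x. u.*z < c)"

definition good :: "real ^ 'n => real => (real ^ 'n) set => real ^ 'n => bool" where
 "good x r w y \<longleftrightarrow> w \<subseteq> tight x & y : KB x r & mref w y : cell"

text \<open>On such a ball the unfolding separates points, even between different sectors. Charts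
  use radius r/3: the geodesic between two points of the small ball, and every chain not longer than
  it, then stays in the large one.\<close>

definition star :: "'i => real ^ 'n => real => bool" where
 "star i x r \<longleftrightarrow> walls x r & (ALL w w' y y'. w \<subseteq> tight x --> w' \<subseteq> tight x --> y : KB x r --> y' : KB x r -->
  dev i w y = dev i w' y' --> y = y')"

definition sector :: "real ^ 'n => real ^ 'n => (real ^ 'n) set" where
 "sector x y = {u : tight x. u.*y > c}"

section \<open>Unfolding the cells around a corner\<close>

context
 fixes i x r
 assumes i: "i : I" and x: "x : cell" and walls: "walls x r"
begin

lemma xub: "x : ub" using x cell_ub by simp

lemmas ocm = op_commuting[OF xub]

lemma state_in: "w \<subseteq> tight x ==> act op states w (i, id) : states" by (rule act_in[OF ocm]) (simp_all add: i)

lemma mref_KB: "w \<subseteq> tight x ==> y : KB x r ==> mref w y : KB x r"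
 using mref_kd[OF xub order.refl, of w x y] mref_centre[OF xub order.refl] mref_ub[OF xub order.refl] xub by (auto simp: KB_def)

lemma good_iff:
 assumes w: "w \<subseteq> tight x" and y: "y : KB x r" shows "good x r w y \<longleftrightarrow> (ALL v:tight x. if v : w then v.*y >= c else v.*y <= c)"
proof -
 have yb: "y : ub" using y by (simp add: KB_def)
 have 1: "u .* mref w y < c" if "u : N - tight x" for u using walls mref_KB[OF w y] that by (auto simp: walls_def)
 have 2: "u .* mref w y <= c \<longleftrightarrow> (if u : w then u.*y >= c else u.*y <= c)" if "u : tight x" for u
 proof -
  obtain k where k: "k > 0" "u .* mref w y - c = (if u : w then - k else k) * (u.*y - c)"
   using mref_wall[OF xub order.refl w \<open>u : tight x\<close> yb] by blast
  have "u .* mref w y <= c \<longleftrightarrow> (if u : w then - k else k) * (u.*y - c) <= 0" using k(2) by linarith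
  thus ?thesis using k(1) by (simp add: mult_le_0_iff)
 qed
 show ?thesis using mref_KB[OF w y] 1 tight_N 2 w y by (fastforce simp: KB_def cell_def good_def)
qed

lemma good_sector: assumes "y : KB x r" shows "good x r (sector x y) y" using good_iff assms by (simp add: sector_def)

lemma good_centre: assumes "w \<subseteq> tight x" shows "good x r w x"
proof -
 show ?thesis using xub walls good_iff[OF assms] by (simp add: centre_in_KB walls_def tight_def)
qed

lemma dev_in: assumes "good x r w y" shows "dev i w y : I \<times> cell"
proof -
 have "act op states w (i, id) : states" using state_in assms by (simp add: good_def)
 thus ?thesis using assms by (auto simp: dev_def pt_def good_def states_def syms_cell)
qed

lemma dev_centre: "dev i {} x = (i, x)" by (simp add: dev_def pt_def)

lemma dev_jump:
 assumes g: "good x r w y" and u: "u : tight x" "u.*y = c" shows "good x r (toggle u w) y"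
  "dev i (toggle u w) y = (nb (fst (dev i w y)) (snd (act op states w (i, id)) u),
   tr (fst (dev i w y)) (snd (act op states w (i, id)) u) (snd (dev i w y)))"
proof -
 have w: "w \<subseteq> tight x" "y : ub" "y : KB x r" "mref w y : cell" using g by (auto simp: good_def KB_def)
 have m: "mref (toggle u w) y = mref w y" using mref_toggle_fix[OF xub order.refl w(1) u(1) w(2) u(2)] .
 thus "good x r (toggle u w) y" using w toggle_subset[OF u(1) w(1)] by (simp add: good_def)
 show "dev i (toggle u w) y = (nb (fst (dev i w y)) (snd (act op states w (i, id)) u),
 tr (fst (dev i w y)) (snd (act op states w (i, id)) u) (snd (dev i w y)))" using act_toggle[OF ocm w(1) u(1)] by (simp add: i dev_def pt_def op_def m)
qed

lemma dev_jump_chain: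
 assumes g: "good x r w y" and u: "u : tight x" "u.*y = c" shows "chain (dev i w y) (dev i (toggle u w) y) 0"
proof -
 have w: "w \<subseteq> tight x" "y : ub" using g by (auto simp: good_def KB_def)
 obtain j A where s: "act op states w (i, id) = (j, A)" "j : I" "A : syms" using state_in[OF w(1)] by (auto simp: states_def)
 have d: "dev i w y = (j, A (mref w y))" by (simp add: dev_def pt_def s)
 have "A (mref w y) : cell" using dev_in[OF g] d by simp
 thus ?thesis using mref_wall[OF xub order.refl w(1) u(1) w(2)] syms_inner[OF s(3)] s u tight_N syms_N
  unfolding dev_jump(2)[OF g u] d s fst_conv snd_conv by (intro chain_jump1) auto
qed

text \<open>Two admissible sectors of \<open>y\<close> differ only in walls through
  \<open>y\<close>, and each of these can be crossed at \<open>y\<close> by a jump of length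
  0.\<close>

lemma dev_rep_chain:
 assumes g: "good x r w y" "good x r w' y" shows "chain (dev i w y) (dev i w' y) 0"
proof -
 have fin: "finite e ==> good x r w y ==> e \<subseteq> {u : tight x. u.*y = c} ==>
   good x r ((w - e) \<union> (e - w)) y & chain (dev i w y) (dev i ((w - e) \<union> (e - w)) y) 0" for e w
 proof (induction e rule: finite_induct)
  case empty
  have "dev i w y : I \<times> cell" by (rule dev_in[OF empty(1)])
  thus ?case using empty chain.refl by (metis Diff_empty Un_empty_right empty_Diff mem_Times_iff prod.collapse)
 next
  case (insert u e)
  let ?w = "(w - e) \<union> (e - w)"
  have u: "u : tight x" "u.*y = c" using insert by auto
  have *: "good x r ?w y" "chain (dev i w y) (dev i ?w y) 0" using insert by auto
  have t: "toggle u ?w = (w - insert u e) \<union> (insert u e - w)" using insert(2) by (auto simp: toggle_def)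
  have "good x r (toggle u ?w) y" "chain (dev i w y) (dev i (toggle u ?w) y) 0"
   using dev_jump(1)[OF *(1) u] chain_trans[OF *(2) dev_jump_chain[OF *(1) u]] by auto
  thus ?case by (simp add: t)
 qed
 define e where "e = (w - w') \<union> (w' - w)"
 have w: "w \<subseteq> tight x" "w' \<subseteq> tight x" "y : KB x r" using g by (auto simp: good_def)
 have "e \<subseteq> {u : tight x. u.*y = c}"
 proof
  fix u assume u: "u : e"
  hence t: "u : tight x" using w by (auto simp: e_def)
  show "u : {u : tight x. u.*y = c}" using good_iff[OF w(1,3)] good_iff[OF w(2,3)] g t u by (fastforce simp: e_def)
 qed
 moreover have "finite e" using calculation tight_fin finite_subset by (metis (no_types, lifting) mem_Collect_eq subsetI)
 moreover have "(w - e) \<union> (e - w) = w'" by (auto simp: e_def)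
 ultimately show ?thesis using fin[of e w] g by simp
qed

text \<open>Induction on the number of walls that strictly separate the two points. A segment
  crossing such a wall is cut at the crossing point; both halves have fewer separating walls, and
  \<open>kd_segment\<close> adds their lengths.\<close>

lemma dev_chain:
 assumes "good x r w y" "good x r w' z" "closed_segment y z \<subseteq> KB x r" shows "chain (dev i w y) (dev i w' z) (kd y z)" using assms
proof (induction "card {u : tight x. (u.*y - c) * (u.*z - c) < 0}" arbitrary: w y w' z rule: less_induct)
 case less
 have yz: "y : KB x r" "z : KB x r" "y : ub" "z : ub" using less.prems by (auto simp: good_def KB_def)
 show ?case
 proof (cases "{u : tight x. (u.*y - c) * (u.*z - c) < 0} = {}")
  case True
  \<comment> \<open>No wall strictly separates the points, so one sector contains both and a single
    move joins them.\<close>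
  define w0 where "w0 = sector x y \<union> sector x z"
  have w0: "w0 \<subseteq> tight x" by (auto simp: w0_def sector_def)
  have ns: "(u.*y - c) * (u.*z - c) >= 0" if "u : tight x" for u using True that by force
  have gy: "good x r w0 y" unfolding good_iff[OF w0 yz(1)] using ns by (fastforce simp: w0_def sector_def zero_le_mult_iff)
  have gz: "good x r w0 z" unfolding good_iff[OF w0 yz(2)] using ns by (fastforce simp: w0_def sector_def zero_le_mult_iff)
  obtain j A where s: "act op states w0 (i, id) = (j, A)" "j : I" "A : syms" using state_in[OF w0] by (auto simp: states_def)
  have "chain (j, A (mref w0 y)) (j, A (mref w0 z)) (kd (A (mref w0 y)) (A (mref w0 z)))"
   by (rule chain_move1) (use s gy gz in \<open>auto simp: syms_cell good_def\<close>)
  thus ?thesis using mref_kd[OF xub order.refl w0 yz(3,4)] chain_trans[OF dev_rep_chain[OF less.prems(1) gy]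
  chain_trans[OF _ dev_rep_chain[OF gz less.prems(2)]]] by (simp add: dev_def pt_def s syms_kd)
 next
  case False
  then obtain u where u: "u : tight x" "(u.*y - c) * (u.*z - c) < 0" by blast
  define a where "a = u.*y - c"
  define b where "b = u.*z - c"
  have ab: "a * b < 0" "a - b ~= 0" using u by (auto simp: a_def b_def mult_less_0_iff)
  define t where "t = a / (a - b)"
  have t: "0 < t" "t < 1" using ab by (auto simp: t_def mult_less_0_iff divide_simps)
  define p where "p = (1 - t) *\<^sub>R y + t *\<^sub>R z"
  have pseg: "p : closed_segment y z" using t by (auto simp: p_def closed_segment_def)
  have "u.*p - c = (1 - t) * a + t * b" by (simp add: p_def a_def b_def inner_add_right algebra_simps)
  also have "... = 0" using ab(2) by (simp add: t_def field_simps)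
  finally have up: "u.*p = c" by simp
  have pk: "p : KB x r" using pseg less.prems(3) by blast
  have fin: "finite {u : tight x. (u.*y - c) * (u.*z - c) < 0}" using tight_fin by simp
  have vp: "v.*p - c = (1 - t) * (v.*y - c) + t * (v.*z - c)" for v by (simp add: p_def inner_add_right algebra_simps)
  have sub1: "{v : tight x. (v.*y - c) * (v.*p - c) < 0} \<subset> {u : tight x. (u.*y - c) * (u.*z - c) < 0}"
  proof (intro psubsetI subsetI)
   fix v assume v: "v : {v : tight x. (v.*y - c) * (v.*p - c) < 0}"
   have "(1 - t) * (v.*y - c)^2 >= 0" using t by simp
   hence "t * ((v.*y - c) * (v.*z - c)) < 0" using v unfolding vp by (simp add: algebra_simps power2_eq_square)
   thus "v : {u : tight x. (u.*y - c) * (u.*z - c) < 0}" using v t by (simp add: mult_less_0_iff)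
  qed (use u up in force)
  have sub2: "{v : tight x. (v.*p - c) * (v.*z - c) < 0} \<subset> {u : tight x. (u.*y - c) * (u.*z - c) < 0}"
  proof (intro psubsetI subsetI)
   fix v assume v: "v : {v : tight x. (v.*p - c) * (v.*z - c) < 0}"
   have "t * (v.*z - c)^2 >= 0" using t by simp
   hence "(1 - t) * ((v.*y - c) * (v.*z - c)) < 0" using v unfolding vp by (simp add: algebra_simps power2_eq_square)
   thus "v : {u : tight x. (u.*y - c) * (u.*z - c) < 0}" using v t by (simp add: mult_less_0_iff)
  qed (use u up in force)
  have seg: "closed_segment y p \<subseteq> KB x r" "closed_segment p z \<subseteq> KB x r"
   using pseg less.prems(3) by (meson ends_in_segment order_trans subset_closed_segment)+
  have gp: "good x r (sector x p) p" by (rule good_sector[OF pk])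
  show ?thesis using less.hyps[OF psubset_card_mono[OF fin sub1] less.prems(1) gp seg(1)] less.hyps[OF psubset_card_mono[OF fin sub2] gp less.prems(2) seg(2)] chain_trans kd_segment[OF yz(3,4) pseg] by fastforce
 qed
qed

text \<open>Lifting of chains to the ball around \<open>x\<close>: a jump toggles one wall of the
  sector, and a move is transported by \<open>mref w\<close>. Either the lift escapes from the ball,
  so that the chain is long, or it ends at a point whose distance from \<open>y\<close> is at most
  \<open>l\<close>.\<close>

lemma chain_unfold:
 assumes "chain p q l" "p = dev i w y" "good x r w y"
 shows "l >= r - kd x y | (EX w' y'. good x r w' y' & q = dev i w' y' & kd y y' <= l)" using assms
proof (induction arbitrary: w y rule: chain.induct)
 case (refl j q)
 hence "kd y y <= 0" by (simp add: good_def KB_def)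
 thus ?case using refl.prems by blast
next
 case (jump j q0 u' q l)
 have w: "w \<subseteq> tight x" "y : ub" "y : KB x r" using jump.prems by (auto simp: good_def KB_def)
 obtain k A where s: "act op states w (i, id) = (k, A)" "k : I" "A : syms" using state_in[OF w(1)] by (auto simp: states_def)
 have d: "j = k" "q0 = A (mref w y)" using jump.prems by (auto simp: dev_def pt_def s)
 obtain u where u: "u : N" "u' = A u" using jump.hyps s(3) by (auto simp: syms_def)
 have um: "u .* mref w y = c" using jump.hyps d u syms_inner[OF s(3)] by simp
 have ut: "u : tight x"
 proof (rule ccontr)
  assume "u ~: tight x"
  hence "u .* mref w y < c" using walls mref_KB[OF w(1,3)] u by (auto simp: walls_def)
  thus False using um by simp
 qed
 have uy: "u.*y = c" using mref_wall[OF xub order.refl w(1) ut w(2)] um by (auto split: if_splits)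
 have "dev i w y = (j, q0)" using jump.prems by simp
 hence "(nb j u', tr j u' q0) = dev i (toggle u w) y" unfolding dev_jump(2)[OF jump.prems(2) ut uy] by (simp add: s u)
 thus ?case using jump.IH dev_jump(1)[OF jump.prems(2) ut uy] by blast
next
 case (move j q0 q1 q l)
 have w: "w \<subseteq> tight x" "y : ub" "y : KB x r" using move.prems by (auto simp: good_def KB_def)
 obtain k A where s: "act op states w (i, id) = (k, A)" "k : I" "A : syms" using state_in[OF w(1)] by (auto simp: states_def)
 have d: "j = k" "q0 = A (mref w y)" using move.prems by (auto simp: dev_def pt_def s)
 obtain z where z: "A z = q1" using syms_surj[OF s(3)] by blast
 have zc: "z : cell" using move.hyps z syms_cell[OF s(3)] by auto
 hence zb: "z : ub" by (rule cell_ub)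
 define y2 where "y2 = mref w z"
 have y2: "y2 : ub" "mref w y2 = z"
  using mref_ub[OF xub order.refl w(1) zb] mref_mref[OF xub order.refl w(1) zb] by (auto simp: y2_def)
 have kd: "kd q0 q1 = kd y y2" using mref_kd[OF xub order.refl w(1,2) y2(1)] by (simp add: d z[symmetric] syms_kd[OF s(3)] y2(2))
 show ?case
 proof (cases "kd x y2 < r")
  case True
  hence g: "good x r w y2" using w y2 zc by (simp add: good_def KB_def)
  have IH: "r - kd x y2 <= l |
  (EX w' y'. good x r w' y' & q = dev i w' y' & kd y2 y' <= l)" using move.IH[of w y2] g by (simp add: dev_def pt_def s y2 d z)
  have t1: "kd x y2 <= kd x y + kd y y2" by (rule kd_triangle[OF xub w(2) y2(1)])
  from IH show ?thesis
  proof
   assume "EX w' y'. good x r w' y' & q = dev i w' y' & kd y2 y' <= l"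
   then obtain w' y' where *: "good x r w' y'" "q = dev i w' y'" "kd y2 y' <= l" by blast
   hence "kd y y' <= kd y y2 + kd y2 y'" using kd_triangle[OF w(2) y2(1)] by (simp add: good_def KB_def)
   thus ?thesis using * kd by (intro disjI2 exI[of _ w'] exI[of _ y']) auto
  qed (use t1 kd in auto)
 next
  case False
  thus ?thesis using kd_triangle[OF xub w(2) y2(1)] kd chain_nonneg[OF move.hyps(4)] by auto
 qed
qed

end

lemma ex_star:
 assumes i: "i : I" and x: "x : cell"
 obtains r where "star i x r"
proof -
 have xb: "x : ub" using x cell_ub by simp
 define V where "V = (INT u:N - tight x. {z. u.*z < c})"
 have "open V" unfolding V_def using finN by (intro open_INT) (auto intro: open_halfspace_lt)
 moreover have "x : V" using x by (auto simp: V_def cell_def tight_def order.strict_iff_order)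
 ultimately obtain r0 where r0: "r0 > 0" "KB x r0 \<subseteq> V" using KB_small[OF xb] by blast
 define S where "S = (%w. act op states w (i, id))"
 \<comment> \<open>The finitely many half distances between different positions of the corner
   \<open>x\<close>. Below their minimum two unfolded points can coincide only if the corner
   positions coincide, and then \<open>free\<close> makes the sectors equal.\<close>
 define E where "E = {kd (snd (S w) x) (snd (S w') x) / 2 |w w'. w \<subseteq> tight x & w' \<subseteq> tight x & snd (S w) x ~= snd (S w') x}"
 have "E \<subseteq> (%(w, w'). kd (snd (S w) x) (snd (S w') x) / 2) ` (Pow (tight x) \<times> Pow (tight x))"
 proof
  fix e assume "e : E"
  then obtain w w' where "e = kd (snd (S w) x) (snd (S w') x) / 2" "w \<subseteq> tight x" "w' \<subseteq> tight x" unfolding E_def by blast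
  thus "e : (%(w, w'). kd (snd (S w) x) (snd (S w') x) / 2) ` (Pow (tight x) \<times> Pow (tight x))"
   by (intro image_eqI[of _ _ "(w, w')"]) auto
 qed
 hence finE: "finite E" using tight_fin by (meson finite_Pow_iff finite_SigmaI finite_imageI finite_subset)
 have Ss: "S w : states" if "w \<subseteq> tight x" for w unfolding S_def by (rule act_in[OF op_commuting[OF xb] that]) (simp add: i)
 have Epos: "e > 0" if eE: "e : E" for e
 proof -
  obtain w w' where e: "e = kd (snd (S w) x) (snd (S w') x) / 2" "w \<subseteq> tight x" "w' \<subseteq> tight x"
   "snd (S w) x ~= snd (S w') x" using eE unfolding E_def by blast
  have b: "snd (S w) x : ub" "snd (S w') x : ub" using Ss[OF e(2)] Ss[OF e(3)] xb by (auto simp: states_def syms_ub)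
  thus ?thesis using e kd_nonneg[OF b] kd_zero_iff[OF b] by auto
 qed
 define r where "r = Min (insert r0 E)"
 have r: "r <= r0" "r > 0" "!!e. e : E ==> r <= e" using finE Epos r0 by (auto simp: r_def)
 have W: "walls x r" using r r0 by (auto simp: KB_def walls_def V_def)
 have "star i x r" unfolding star_def
 proof (intro conjI W allI impI)
  fix w w' y y' assume *: "w \<subseteq> tight x" "w' \<subseteq> tight x" "y : KB x r" "y' : KB x r" "dev i w y = dev i w' y'"
  have yb: "y : ub" "y' : ub" using * by (auto simp: KB_def)
  obtain j A where s: "S w = (j, A)" "A : syms" using Ss[OF *(1)] by (auto simp: states_def)
  obtain j' A' where s': "S w' = (j', A')" "A' : syms" using Ss[OF *(2)] by (auto simp: states_def)
  have e: "j = j'" "A (mref w y) = A' (mref w' y')"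
  proof -
   have "dev i w y = (j, A (mref w y))" using s(1) by (simp add: dev_def pt_def S_def)
   moreover have "dev i w' y' = (j', A' (mref w' y'))" using s'(1) by (simp add: dev_def pt_def S_def)
   ultimately show "j = j'" "A (mref w y) = A' (mref w' y')" using *(5) by auto
  qed
  have mb: "mref w y : ub" "mref w' y' : ub" using mref_ub[OF xb order.refl] * yb by auto
  have d: "kd (A x) (A (mref w y)) < r" "kd (A' x) (A' (mref w' y')) < r"
   using mref_kd[OF xb order.refl *(1) xb yb(1)] mref_kd[OF xb order.refl *(2) xb yb(2)]
    mref_centre[OF xb order.refl *(1)] mref_centre[OF xb order.refl *(2)] *(3,4) s s' by (auto simp: syms_kd KB_def)
  have "A x = A' x"
  proof (rule ccontr)
   assume ne: "A x ~= A' x"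
   hence "kd (A x) (A' x) / 2 : E" unfolding E_def mem_Collect_eq
    using *(1,2) s(1) s'(1) ne by (intro exI[of _ w] exI[of _ w']) simp
   hence "2 * r <= kd (A x) (A' x)" using r(3) by fastforce
   also have "... <= kd (A x) (A (mref w y)) + kd (A (mref w y)) (A' x)"
    by (rule kd_triangle) (use s s' xb mb in \<open>auto simp: syms_ub\<close>)
   also have "... < r + r" using d e kd_sym by (metis add_strict_mono)
   finally show False by simp
  qed
  hence "snd (S w) x = snd (S w') x" "fst (S w) = fst (S w')" using s(1) s'(1) e(1) by simp_all
  hence ww: "w = w'" unfolding S_def by (intro free[OF i x *(1,2)])
  hence "mref w y = mref w y'" using s(1) s'(1) e(2) syms_inj[OF s(2)] by simp
  thus "y = y'" by (metis arg_cong mref_mref[OF xb order.refl *(1) yb(1)] mref_mref[OF xb order.refl *(1) yb(2)])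
 qed
 thus ?thesis by (rule that)
qed

lemma star_walls: "star i x r ==> walls x r" by (simp add: star_def)

lemma star_inj:
 "star i x r ==> good x r w y ==> good x r w' y' ==> dev i w y = dev i w' y' ==> y = y'" by (auto simp: star_def good_def)

lemma star_chain:
 assumes i: "i : I" and x: "x : cell" and r: "star i x r"
  and y: "good x r w y" "kd x y < r/3" and z: "good x r w' z" "kd x z < r/3" shows "chain (dev i w y) (dev i w' z) (kd y z)"
  and "chain (dev i w y) (dev i w' z) l ==> kd y z <= l"
proof -
 note W = star_walls[OF r]
 have b: "x : ub" "y : ub" "z : ub" using x y z cell_ub by (auto simp: good_def KB_def)
 have yz: "kd y z < 2*r/3" using kd_triangle[of y x z] kd_sym[of y x] b y z by simp
 have "closed_segment y z \<subseteq> KB x r"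
 proof
  fix p assume p: "p : closed_segment y z"
  hence pb: "p : ub" using closed_segment_subset[OF b(2,3)] by auto
  have "kd x p <= kd x y + kd y p" by (rule kd_triangle[OF b(1,2) pb])
  also have "kd y p <= kd y z" using kd_segment[OF b(2,3) p] kd_nonneg[OF pb b(3)] by simp
  finally show "p : KB x r" using yz y pb by (simp add: KB_def)
 qed
 thus "chain (dev i w y) (dev i w' z) (kd y z)" by (rule dev_chain[OF i x W y(1) z(1)])
 assume c: "chain (dev i w y) (dev i w' z) l"
 consider "l >= r - kd x y" | w'' y'' where "good x r w'' y''" "dev i w' z = dev i w'' y''" "kd y y'' <= l"
  using chain_unfold[OF i x W c HOL.refl y(1)] by blast
 thus "kd y z <= l"
 proof cases
  case 1
  thus ?thesis using yz y by simp
 next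
  case 2
  thus ?thesis using star_inj[OF r z(1)] by blast
 qed
qed

end

section \<open>Curves in metric spaces\<close>

lemma pathin_metric:
 "pathin (subtopology (mtopology_of X) S) \<gamma> \<longleftrightarrow>
  (ALL t:{0..1}. \<gamma> t : S & \<gamma> t : mspace X &
    (ALL e>0. EX d>0. ALL s:{0..1}. \<bar>s - t\<bar> < d --> mdist X (\<gamma> t) (\<gamma> s) < e))"
proof -
 interpret Metric_space "mspace X" "mdist X" by simp
 have top: "mtopology_of X = mtopology" by (simp add: mtopology_of_def)
 have "pathin (subtopology (mtopology_of X) S) \<gamma> \<longleftrightarrow> pathin (mtopology_of X) \<gamma> & (ALL t:{0..1}. \<gamma> t : S)"
  by (rule pathin_subtopology)
 also have "pathin (mtopology_of X) \<gamma> \<longleftrightarrow> (ALL t:{0..1}. \<gamma> t : mspace X &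
    (ALL e>0. EX d>0. ALL s:{0..1}. \<bar>s - t\<bar> < d --> mdist X (\<gamma> t) (\<gamma> s) < e))" (is "?L \<longleftrightarrow> ?R")
 proof
  assume ?L
  hence c: "continuous_map (top_of_set {0..1}) mtopology \<gamma>" by (simp add: pathin_def top)
  show ?R
  proof (intro ballI conjI allI impI)
   fix t :: real assume t: "t : {0..1}"
   thus "\<gamma> t : mspace X" using c by (metis continuous_map_funspace funcset_mem topspace_mtopology topspace_euclidean_subtopology)
   fix e :: real assume "e > 0"
   then obtain U where U: "openin (top_of_set {0..1}) U" "t : U" "ALL y:U. \<gamma> y : mball (\<gamma> t) e"
    using c t unfolding continuous_map_to_metric by (metis topspace_euclidean_subtopology)
   then obtain d where d: "d > 0" "ALL s:{0..1}. dist s t < d --> s : U" unfolding openin_euclidean_subtopology_iff by metis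
   thus "EX d>0. ALL s:{0..1}. \<bar>s - t\<bar> < d --> mdist X (\<gamma> t) (\<gamma> s) < e" using U by (intro exI[of _ d]) (auto simp: dist_real_def)
  qed
 next
  assume R: ?R
  have "continuous_map (top_of_set {0..1}) mtopology \<gamma>" unfolding continuous_map_to_metric
  proof (intro ballI allI impI)
   fix t e :: real assume "t : topspace (top_of_set {0..1})" "e > 0"
   then obtain d where t: "t : {0..1}" and d: "d > 0" "ALL s:{0..1}. \<bar>s - t\<bar> < d --> mdist X (\<gamma> t) (\<gamma> s) < e"
    using R by (metis topspace_euclidean_subtopology)
   show "EX U. openin (top_of_set {0..1}) U & t : U & (ALL y:U. \<gamma> y : mball (\<gamma> t) e)"
    by (rule exI[of _ "{0..1} \<inter> ball t d"]) (use t d R in \<open>auto simp: mem_ball dist_real_def abs_minus_commute openin_open_Int\<close>)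
  qed
  thus ?L by (simp add: pathin_def top)
 qed
 finally show ?thesis by auto
qed

fun plen :: "('a => 'a => ennreal) => 'a list => ennreal" where
 "plen d (x # y # zs) = d x y + plen d (y # zs)"
| "plen d xs = 0"

lemma plen_sum:
 "(\<Sum>i < length ts - 1. d (\<gamma> (ts ! i)) (\<gamma> (ts ! Suc i))) = plen d (map \<gamma> ts)"
proof (induction ts rule: induct_list012)
 case (3 x y zs)
 have "(\<Sum>i < length (x # y # zs) - 1. d (\<gamma> ((x # y # zs) ! i)) (\<gamma> ((x # y # zs) ! Suc i)))
  = d (\<gamma> x) (\<gamma> y) + (\<Sum>i < length (y # zs) - 1. d (\<gamma> ((y # zs) ! i)) (\<gamma> ((y # zs) ! Suc i)))"
   by (simp add: sum.lessThan_Suc_shift del: sum.lessThan_Suc)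
 thus ?case using 3(2) by simp
qed auto

definition ed :: "'a metric => 'a => 'a => ennreal" where
 "ed X x y = ennreal (mdist X x y)"

lemma ed_triangle:
 assumes "x : mspace X" "y : mspace X" "z : mspace X" shows "ed X x z <= ed X x y + ed X y z"
  unfolding ed_def using assms mdist_triangle[of x X y z] by (simp flip: ennreal_plus)

lemma curve_length_plen:
 "curve_length X \<gamma> = (SUP ts \<in> {ts. sorted ts & set ts \<subseteq> {0..1}}. plen (ed X) (map \<gamma> ts))"
  unfolding curve_length_def plen_sum[symmetric] ed_def ..

lemma plen_le_curve_length: "sorted ts ==> set ts \<subseteq> {0..1} ==> plen (ed X) (map \<gamma> ts) <= curve_length X \<gamma>"
 unfolding curve_length_plen by (rule SUP_upper) auto

lemma curve_length_le:
 "(!!ts. sorted ts ==> set ts \<subseteq> {0..1} ==> plen (ed X) (map \<gamma> ts) <= B) ==> curve_length X \<gamma> <= B"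
  unfolding curve_length_plen by (rule SUP_least) auto

lemma plen_split:
 assumes "set xs \<subseteq> mspace X" "set ys \<subseteq> mspace X" "m : mspace X"
 shows "plen (ed X) (xs @ ys) <= plen (ed X) (xs @ [m]) + plen (ed X) (m # ys)" using assms
proof (induction xs rule: induct_list012)
 case 1
 show ?case by (cases ys) auto
next
 case (2 x)
 show ?case
 proof (cases ys)
  case (Cons y zs)
  thus ?thesis using ed_triangle[of x X m y] 2 by (simp add: add.assoc[symmetric] add_right_mono)
 qed simp
next
 case (3 x y zs)
 thus ?case by (simp add: add.assoc add_left_mono)
qed

lemma dist_le_curve_length: "ed X (\<gamma> 0) (\<gamma> 1) <= curve_length X \<gamma>" using plen_le_curve_length[of "[0, 1]" X \<gamma>] by simp

definition joined :: "(real => 'a) => (real => 'a) => real => 'a" where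
 "joined \<gamma> \<eta> t = (if t <= 1/2 then \<gamma> (2 * t) else \<eta> (2 * t - 1))"

lemma pathin_joined:
 assumes \<gamma>: "pathin (subtopology (mtopology_of X) S) \<gamma>" and \<eta>: "pathin (subtopology (mtopology_of X) S) \<eta>"
  and eq: "\<gamma> 1 = \<eta> 0" shows "pathin (subtopology (mtopology_of X) S) (joined \<gamma> \<eta>)" unfolding pathin_metric
proof (intro ballI conjI allI impI)
 fix t :: real assume t: "t : {0..1}"
 show "joined \<gamma> \<eta> t : S" "joined \<gamma> \<eta> t : mspace X" using \<gamma> \<eta> t by (auto simp: pathin_metric joined_def)
 fix e :: real assume e: "e > 0"
 have g: "EX d>0. ALL s:{0..1/2}. \<bar>s - t\<bar> < d --> mdist X (\<gamma> (2 * t)) (\<gamma> (2 * s)) < e" if "t <= 1/2"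
 proof -
  have "2 * t : {0..1}" using that t by auto
  then obtain d where d: "d > 0" "ALL s:{0..1}. \<bar>s - 2 * t\<bar> < d --> mdist X (\<gamma> (2 * t)) (\<gamma> s) < e"
   using \<gamma> e unfolding pathin_metric by blast
  show ?thesis
  proof (intro exI[of _ "d/2"] conjI ballI impI)
   fix s assume s: "s : {0..1/2}" "\<bar>s - t\<bar> < d/2"
   have "\<bar>2 * s - 2 * t\<bar> < d" using s(2) by (simp add: abs_if split: if_splits)
   thus "mdist X (\<gamma> (2 * t)) (\<gamma> (2 * s)) < e" using s d by simp
  qed (use d in simp)
 qed
 have h: "EX d>0. ALL s:{1/2..1}. \<bar>s - t\<bar> < d --> mdist X (\<eta> (2 * t - 1)) (\<eta> (2 * s - 1)) < e" if "t >= 1/2"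
 proof -
  have "2 * t - 1 : {0..1}" using that t by auto
  then obtain d where d: "d > 0" "ALL s:{0..1}. \<bar>s - (2 * t - 1)\<bar> < d --> mdist X (\<eta> (2 * t - 1)) (\<eta> s) < e"
   using \<eta> e unfolding pathin_metric by blast
  show ?thesis
  proof (intro exI[of _ "d/2"] conjI ballI impI)
   fix s assume s: "s : {1/2..1}" "\<bar>s - t\<bar> < d/2"
   have "\<bar>2 * s - 1 - (2 * t - 1)\<bar> < d" using s(2) by (simp add: abs_if split: if_splits)
   thus "mdist X (\<eta> (2 * t - 1)) (\<eta> (2 * s - 1)) < e" using s d by simp
  qed (use d in simp)
 qed
 consider "t < 1/2" | "t = 1/2" | "t > 1/2" by linarith
 thus "EX d>0. ALL s:{0..1}. \<bar>s - t\<bar> < d --> mdist X (joined \<gamma> \<eta> t) (joined \<gamma> \<eta> s) < e"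
 proof cases
  case 1
  then obtain d where "d > 0" "ALL s:{0..1/2}. \<bar>s - t\<bar> < d --> mdist X (\<gamma> (2 * t)) (\<gamma> (2 * s)) < e" using g by auto
  thus ?thesis using 1 by (intro exI[of _ "min d (1/2 - t)"]) (auto simp: joined_def)
 next
  case 2
  then obtain d d' where "d > 0" "ALL s:{0..1/2}. \<bar>s - t\<bar> < d --> mdist X (\<gamma> (2 * t)) (\<gamma> (2 * s)) < e"
   "d' > 0" "ALL s:{1/2..1}. \<bar>s - t\<bar> < d' --> mdist X (\<eta> (2 * t - 1)) (\<eta> (2 * s - 1)) < e" using g h by (metis order.refl)
  moreover have "2 * t = 1" "2 * t - 1 = 0" "t <= 1/2" using 2 by auto
  ultimately show ?thesis using eq by (intro exI[of _ "min d d'"]) (auto simp: joined_def)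
 next
  case 3
  then obtain d where "d > 0" "ALL s:{1/2..1}. \<bar>s - t\<bar> < d --> mdist X (\<eta> (2 * t - 1)) (\<eta> (2 * s - 1)) < e" using h by auto
  thus ?thesis using 3 by (intro exI[of _ "min d (t - 1/2)"]) (auto simp: joined_def)
 qed
qed

lemma curve_length_joined:
 assumes \<gamma>: "pathin (subtopology (mtopology_of X) S) \<gamma>" and \<eta>: "pathin (subtopology (mtopology_of X) S) \<eta>"
  and eq: "\<gamma> 1 = \<eta> 0" shows "curve_length X (joined \<gamma> \<eta>) <= curve_length X \<gamma> + curve_length X \<eta>"
proof (rule curve_length_le)
 fix ts :: "real list" assume ts: "sorted ts" "set ts \<subseteq> {0..1}"
 \<comment> \<open>The partition is split at 1/2 and the junction point is inserted, which by
   \<open>plen_split\<close> can only lengthen the polygon.\<close>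
 define as where "as = takeWhile (%t. t <= 1/2) ts"
 define bs where "bs = dropWhile (%t. t <= 1/2) ts"
 have ab: "ts = as @ bs" by (simp add: as_def bs_def)
 have as: "ALL t:set as. 0 <= t & t <= 1/2" using ts(2) unfolding as_def by (auto dest: set_takeWhileD)
 have sab: "sorted as" "sorted bs" using ts(1) by (auto simp: ab sorted_append)
 have bs: "ALL t:set bs. 1/2 < t & t <= 1"
 proof (cases bs)
  case (Cons b zs)
  have "~ b <= 1/2" using Cons hd_dropWhile[of "%t. t <= 1/2" ts] by (simp add: bs_def)
  moreover have "ALL t:set bs. b <= t" using sab Cons by auto
  moreover have "ALL t:set bs. t <= 1" using ts(2) ab by auto
  ultimately show ?thesis by force
 qed simp
 have m: "\<gamma> 1 : mspace X" using \<gamma> unfolding pathin_metric by simp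
 have inX: "ALL t:{0..1}. joined \<gamma> \<eta> t : mspace X" using pathin_joined[OF assms] unfolding pathin_metric by blast
 have "plen (ed X) (map (joined \<gamma> \<eta>) ts) = plen (ed X) (map (joined \<gamma> \<eta>) as @ map (joined \<gamma> \<eta>) bs)" by (simp add: ab)
 also have "... <= plen (ed X) (map (joined \<gamma> \<eta>) as @ [\<gamma> 1]) + plen (ed X) (\<gamma> 1 # map (joined \<gamma> \<eta>) bs)"
  by (rule plen_split) (use inX ts ab m in auto)
 also have "map (joined \<gamma> \<eta>) as @ [\<gamma> 1] = map \<gamma> (map ((*) 2) as @ [1])" using as by (auto simp: joined_def)
 also have "\<gamma> 1 # map (joined \<gamma> \<eta>) bs = map \<eta> (0 # map (%t. 2 * t - 1) bs)" using bs by (auto simp: joined_def eq)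
 also have "plen (ed X) (map \<gamma> (map ((*) 2) as @ [1])) <= curve_length X \<gamma>"
  by (rule plen_le_curve_length) (use as sab in \<open>auto simp: sorted_append sorted_map intro: sorted_wrt_mono_rel[rotated]\<close>)
 also have "plen (ed X) (map \<eta> (0 # map (%t. 2 * t - 1) bs)) <= curve_length X \<eta>"
  by (rule plen_le_curve_length) (use bs sab in \<open>auto simp: sorted_map less_imp_le intro: sorted_wrt_mono_rel[rotated]\<close>)
 finally show "plen (ed X) (map (joined \<gamma> \<eta>) ts) <= curve_length X \<gamma> + curve_length X \<eta>"
  by (simp add: add_left_mono add_right_mono)
qed

lemma intrinsic_triangle:
 "intrinsic_dist X S x z <= intrinsic_dist X S x y + intrinsic_dist X S y z"
proof (rule ennreal_le_epsilon)
 fix e :: real assume fin: "intrinsic_dist X S x y + intrinsic_dist X S y z < top" and e: "e > 0"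
 have "intrinsic_dist X S x y < intrinsic_dist X S x y + ennreal (e/2)"
 "intrinsic_dist X S y z < intrinsic_dist X S y z + ennreal (e/2)" using fin e by (auto simp: ennreal_add_left_cancel_less[of _ 0, simplified])
 then obtain \<gamma> \<eta> where \<gamma>: "pathin (subtopology (mtopology_of X) S) \<gamma>" "\<gamma> 0 = x" "\<gamma> 1 = y"
   "curve_length X \<gamma> < intrinsic_dist X S x y + ennreal (e/2)"
  and \<eta>: "pathin (subtopology (mtopology_of X) S) \<eta>" "\<eta> 0 = y" "\<eta> 1 = z"
   "curve_length X \<eta> < intrinsic_dist X S y z + ennreal (e/2)" by (subst (asm) (1 3) intrinsic_dist_def) (auto simp: INF_less_iff)
 have "intrinsic_dist X S x z <= curve_length X (joined \<gamma> \<eta>)" unfolding intrinsic_dist_def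
  by (rule INF_lower) (use pathin_joined[OF \<gamma>(1) \<eta>(1)] \<gamma> \<eta> in \<open>auto simp: joined_def\<close>)
 also have "... <= curve_length X \<gamma> + curve_length X \<eta>" by (rule curve_length_joined[OF \<gamma>(1) \<eta>(1)]) (use \<gamma> \<eta> in auto)
 also have "... <= (intrinsic_dist X S x y + ennreal (e/2)) + (intrinsic_dist X S y z + ennreal (e/2))"
  using \<gamma>(4) \<eta>(4) by (intro add_mono) auto
 also have "... = intrinsic_dist X S x y + intrinsic_dist X S y z + (ennreal (e/2) + ennreal (e/2))" by (simp add: ac_simps)
 also have "ennreal (e/2) + ennreal (e/2) = ennreal e" using e by (simp flip: ennreal_plus)
 finally show "intrinsic_dist X S x z <= intrinsic_dist X S x y + intrinsic_dist X S y z + ennreal e" .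
qed

lemma intrinsic_self:
 assumes "x : S" "x : mspace X" shows "intrinsic_dist X S x x = 0"
proof -
 have "curve_length X (%t. x) <= 0"
 proof (rule curve_length_le)
  fix ts :: "real list"
  show "plen (ed X) (map (%t. x) ts) <= 0" by (induction ts rule: induct_list012) (use assms in \<open>auto simp: ed_def\<close>)
 qed
 moreover have z: "mdist X x x = 0" using assms by simp
 have "pathin (subtopology (mtopology_of X) S) (%t. x)" using assms unfolding pathin_metric z by (simp add: gt_ex)
 ultimately have "intrinsic_dist X S x x <= 0" unfolding intrinsic_dist_def by (intro INF_lower2[of "%t. x"]) auto
 thus ?thesis by simp
qed

lemma dist_le_intrinsic: "ed X x y <= intrinsic_dist X S x y"
 unfolding intrinsic_dist_def by (rule INF_greatest) (use dist_le_curve_length in auto)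

section \<open>Metric spaces obtained by gluing\<close>

text \<open>The quotient metric without commutation or freeness, so that it also describes a given
  manifold before these properties of its gluing are known.\<close>

locale prerealized = pregluing N c R I nb tr for N :: "(real ^ 'n) set" and c R :: real and I :: "'i set"
  and nb :: "'i => real ^ 'n => 'i" and tr :: "'i => real ^ 'n => real ^ 'n => real ^ 'n" +
 fixes X :: "'a metric" and \<pi> :: "'i \<times> (real ^ 'n) => 'a"
 assumes pi_surj: "\<pi> ` (I \<times> cell) = mspace X"
  and pi_dist: "!!p q. p : I \<times> cell ==> q : I \<times> cell ==>
   ennreal (mdist X (\<pi> p) (\<pi> q)) = (INF l \<in> {l. chain p q l}. ennreal l)"
begin

lemma pi_in: "p : I \<times> cell ==> \<pi> p : mspace X" using pi_surj by blast

lemma mdist_le: assumes "chain p q l" shows "mdist X (\<pi> p) (\<pi> q) <= l"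
proof -
 have "ennreal (mdist X (\<pi> p) (\<pi> q)) <= ennreal l" using chain_ends[OF assms] assms by (subst pi_dist) (auto intro: INF_lower)
 thus ?thesis using chain_nonneg[OF assms] by simp
qed

lemma chain_less:
 assumes "p : I \<times> cell" "q : I \<times> cell" "mdist X (\<pi> p) (\<pi> q) < a"
 obtains l where "chain p q l" "l < a"
proof -
 have "(INF l \<in> {l. chain p q l}. ennreal l) < ennreal a"
  using assms by (subst pi_dist[symmetric]) (auto simp: ennreal_less_iff)
 then obtain l where "chain p q l" "ennreal l < ennreal a" by (auto simp: INF_less_iff)
 thus ?thesis using that chain_nonneg by (metis ennreal_less_iff)
qed

lemma pi_eq: "chain p q 0 ==> \<pi> p = \<pi> q" using mdist_le[of p q 0] chain_ends[of p q 0] pi_in[of p] pi_in[of q]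
 by (metis mdist_nonneg mdist_zero order_antisym_conv)

lemma pi_interior:
 assumes z: "z : cell" "!!u. u : N ==> u.*z < c" and i: "i : I" and q: "q : I \<times> cell" and eq: "\<pi> (i, z) = \<pi> q" shows "q = (i, z)"
proof -
 have zb: "z : ub" using z cell_ub by blast
 obtain r where r: "r > 0" "KB z r \<subseteq> (INT u:N. {z. u.*z < c})" using finN open_halfspace_lt KB_small[OF zb, of "INT u:N. {z. u.*z < c}"] z by blast
 have p: "(i, z) : I \<times> cell" using i z by simp
 have d0: "mdist X (\<pi> (i, z)) (\<pi> q) = 0" using eq pi_in[OF p] by simp
 have qb: "snd q : ub" using q cell_ub by auto
 have "fst q = i & kd z (snd q) <= e" if e: "e > 0" for e
 proof -
  obtain l where l: "chain (i, z) q l" "l < min r e" using chain_less[OF p q, of "min r e"] d0 r e by auto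
  show ?thesis using chain_interior[OF l(1), of i z r] zb r l by fastforce
 qed
 hence "fst q = i" "kd z (snd q) <= 0" using zero_less_one by (blast, auto intro: field_le_epsilon)
 thus ?thesis using kd_nonneg[OF zb qb] kd_zero_iff[OF zb qb] by (metis order_antisym prod.collapse)
qed

lemma mdist_segment: "i : I ==> x : cell ==> y : cell ==> mdist X (\<pi> (i, x)) (\<pi> (i, y)) <= kd x y"
 using mdist_le[OF chain_move1] .

lemma convex_cell: "convex cell"
proof -
 have "cell = ub \<inter> (INT u:N. {x. u.*x <= c})" by (auto simp: cell_def)
 thus ?thesis by (simp add: convex_Int convex_INT convex_halfspace_le)
qed

text \<open>The set \<open>S\<close> is left free because the estimate is used for the whole space
  and again for the hypersurface.\<close>

lemma intrinsic_segment:
 assumes i: "i : I" and x: "x : cell" and y: "y : cell"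
  and S: "!!z. z : closed_segment x y ==> \<pi> (i, z) : S" shows "intrinsic_dist X S (\<pi> (i, x)) (\<pi> (i, y)) <= ennreal (kd x y)"
proof -
 define s where "s = (%t::real. x + t *\<^sub>R (y - x))"
 have seg: "s t : closed_segment x y" if "t : {0..1}" for t
  using that by (auto simp: s_def closed_segment_def algebra_simps intro!: exI[of _ t])
 have cl: "s t : cell" if "t : {0..1}" for t using seg[OF that] closed_segment_subset[OF x y convex_cell] by auto
 have ubs: "s t : ub" if "t : {0..1}" for t using cl[OF that] cell_ub by blast
 have between: "s b : closed_segment (s a) (s d)" if "a <= b" "b <= d" for a b d
 proof (cases "a = d")
  case False
  define k where "k = (b - a) / (d - a)"
  have k: "0 <= k" "k <= 1" "b = a + k * (d - a)" using that by (auto simp: k_def divide_simps)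
  have "s b = (1 - k) *\<^sub>R s a + k *\<^sub>R s d" by (simp add: s_def k(3) algebra_simps)
  thus ?thesis using k by (auto simp: closed_segment_def)
 qed (use that in auto)
 have addk: "kd (s a) (s b) + kd (s b) (s d) = kd (s a) (s d)" if "a <= b" "b <= d" "a : {0..1}" "d : {0..1}" for a b d
  by (rule kd_segment) (use that ubs between in auto)
 define \<gamma> where "\<gamma> = (%t. \<pi> (i, s t))"
 have path: "pathin (subtopology (mtopology_of X) S) \<gamma>" unfolding pathin_metric
 proof (intro ballI conjI allI impI)
  fix t :: real assume t: "t : {0..1}"
  show "\<gamma> t : S" using S seg[OF t] by (simp add: \<gamma>_def)
  show "\<gamma> t : mspace X" using pi_in i cl[OF t] by (simp add: \<gamma>_def)
  fix e :: real assume e: "e > 0"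
  have "continuous_on {0..1} (%r. kd (s t) (s r))"
   by (rule kd_continuous) (use ubs t in \<open>auto simp: s_def intro!: continuous_intros\<close>)
  then obtain d where d: "d > 0" "ALL r:{0..1}. dist r t < d --> dist (kd (s t) (s r)) (kd (s t) (s t)) < e"
   using t e unfolding continuous_on_iff by metis
  show "EX d>0. ALL r:{0..1}. \<bar>r - t\<bar> < d --> mdist X (\<gamma> t) (\<gamma> r) < e"
  proof (intro exI[of _ d] conjI ballI impI d(1))
   fix r :: real assume r: "r : {0..1}" "\<bar>r - t\<bar> < d"
   thus "mdist X (\<gamma> t) (\<gamma> r) < e" using d ubs[OF t] mdist_segment[OF i cl[OF t] cl[OF r(1)]] by (auto simp: dist_real_def \<gamma>_def)
  qed
 qed
 have "curve_length X \<gamma> <= ennreal (kd x y)"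
 proof (rule curve_length_le)
  fix ts :: "real list" assume "sorted ts" "set ts \<subseteq> {0..1}"
  hence "plen (ed X) (map \<gamma> ts) <= (if ts = [] then 0 else ennreal (kd (s (hd ts)) (s (last ts))))"
  proof (induction ts rule: induct_list012)
   case (2 a)
   thus ?case by simp
  next
   case (3 a b zs)
   have m: "a : {0..1}" "b : {0..1}" "last (b # zs) : {0..1}" "a <= b" "b <= last (b # zs)"
    using 3(3,4) last_in_set[of "b # zs"] by auto
   have "ed X (\<gamma> a) (\<gamma> b) <= ennreal (kd (s a) (s b))" unfolding ed_def \<gamma>_def by (intro ennreal_leI mdist_segment i cl m)
   hence "plen (ed X) (map \<gamma> (a # b # zs)) <= ennreal (kd (s a) (s b)) + ennreal (kd (s b) (s (last (b # zs))))" using 3(2) 3(3,4)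
    by (simp add: add_mono)
   also have "... = ennreal (kd (s a) (s (last (b # zs))))"
    using addk[OF m(4,5,1,3)] kd_nonneg[OF ubs ubs] m by (simp flip: ennreal_plus)
   finally show ?case by simp
  qed simp
  also have "... <= ennreal (kd x y)"
  proof (cases "ts = []")
   case False
   have m: "hd ts : {0..1}" "last ts : {0..1}" "hd ts <= last ts"
    using hd_in_set[OF False] last_in_set[OF False] \<open>set ts \<subseteq> {0..1}\<close> \<open>sorted ts\<close> by (blast, blast, cases ts) auto
   have "kd (s 0) (s (hd ts)) + kd (s (hd ts)) (s 1) = kd (s 0) (s 1)"
    "kd (s (hd ts)) (s (last ts)) + kd (s (last ts)) (s 1) = kd (s (hd ts)) (s 1)" using addk m by auto
   moreover have "kd (s 0) (s (hd ts)) >= 0" "kd (s (last ts)) (s 1) >= 0" using kd_nonneg[OF ubs ubs] m by auto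
   ultimately have "kd (s (hd ts)) (s (last ts)) <= kd (s 0) (s 1)" by linarith
   thus ?thesis using False by (simp add: s_def ennreal_leI)
  qed simp
  finally show "plen (ed X) (map \<gamma> ts) <= ennreal (kd x y)" .
 qed
 moreover have "intrinsic_dist X S (\<pi> (i, x)) (\<pi> (i, y)) <= curve_length X \<gamma>"
  unfolding intrinsic_dist_def by (rule INF_lower) (use path in \<open>auto simp: \<gamma>_def s_def\<close>)
 ultimately show ?thesis by simp
qed

lemma intrinsic_le_chain: "chain p q l ==> intrinsic_dist X (mspace X) (\<pi> p) (\<pi> q) <= ennreal l"
proof (induction rule: chain.induct)
 case (refl i x)
 thus ?case using intrinsic_self[of "\<pi> (i, x)"] pi_in by simp
next
 case (jump i x u q l)
 thus ?case using pi_eq[OF chain_jump1] by simp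
next
 case (move i x y q l)
 have "intrinsic_dist X (mspace X) (\<pi> (i, x)) (\<pi> q) <=
   intrinsic_dist X (mspace X) (\<pi> (i, x)) (\<pi> (i, y)) + intrinsic_dist X (mspace X) (\<pi> (i, y)) (\<pi> q)" by (rule intrinsic_triangle)
 also have "... <= ennreal (kd x y) + ennreal l" using closed_segment_subset[OF move.hyps(2,3) convex_cell] pi_in move
  by (intro add_mono intrinsic_segment) auto
 also have "... = ennreal (kd x y + l)"
  using chain_nonneg[OF move.hyps(4)] kd_nonneg move.hyps cell_ub by (subst ennreal_plus) auto
 finally show ?case .
qed

lemma intrinsic_eq:
 assumes "x : mspace X" "y : mspace X" shows "ennreal (mdist X x y) = intrinsic_dist X (mspace X) x y"
proof (rule antisym)
 show "ennreal (mdist X x y) <= intrinsic_dist X (mspace X) x y" using dist_le_intrinsic[of X x y] by (simp add: ed_def)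
 obtain p q where pq: "p : I \<times> cell" "q : I \<times> cell" "x = \<pi> p" "y = \<pi> q" using assms pi_surj by blast
 show "intrinsic_dist X (mspace X) x y <= ennreal (mdist X x y)"
  unfolding pq(3,4) pi_dist[OF pq(1,2)] by (rule INF_greatest) (use intrinsic_le_chain in auto)
qed

lemma path_connected_X: "path_connected_space (mtopology_of X)" unfolding path_connected_space_def
proof (intro ballI)
 fix x y assume "x : topspace (mtopology_of X)" "y : topspace (mtopology_of X)"
 hence "intrinsic_dist X (mspace X) x y < top" using intrinsic_eq[of x y] by (metis ennreal_less_top topspace_mtopology_of)
 then obtain \<gamma> where "pathin (subtopology (mtopology_of X) (mspace X)) \<gamma>" "\<gamma> 0 = x" "\<gamma> 1 = y"
  unfolding intrinsic_dist_def INF_less_iff by auto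
 thus "EX g. pathin (mtopology_of X) g & g 0 = x & g 1 = y" using pathin_subtopology by blast
qed

text \<open>By \<open>chain_radial\<close> the representatives of a Cauchy sequence remain at
  bounded distance from the centres of their cells, even if the cells have ideal vertices.
  Infinitely many lie in one compact part \<open>K\<close> of one cell, and a subsequence
  converges.\<close>

lemma complete_X: "mcomplete_of X"
proof -
 interpret M: Metric_space "mspace X" "mdist X" by simp
 have "EX x. limitin M.mtopology \<sigma> x sequentially" if C: "M.MCauchy \<sigma>" for \<sigma>
 proof -
  have ran: "\<sigma> n : mspace X" for n using C by (auto simp: M.MCauchy_def)
  hence "EX p. p : I \<times> cell & \<sigma> n = \<pi> p" for n using pi_surj by (metis imageE)
  then obtain p where p: "!!n. p n : I \<times> cell" "!!n. \<sigma> n = \<pi> (p n)" by metis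
  obtain n0 where n0: "!!n n'. n >= n0 ==> n' >= n0 ==> mdist X (\<sigma> n) (\<sigma> n') < 1"
   using C unfolding M.MCauchy_def by (meson zero_less_one)
  define C where "C = kd 0 (snd (p n0)) + 1"
  have "kd 0 (snd (p n)) <= C" if n: "n >= n0" for n
  proof -
   obtain l where l: "chain (p n0) (p n) l" "l < 1" using chain_less[OF p(1) p(1), of n0 n 1] n0[of n0 n] n p(2) by auto
   thus ?thesis using chain_radial[OF l(1)] by (simp add: C_def)
  qed
  hence bnd: "(norm (snd (p n)))^2 <= 1 - 1 / (cosh C)^2" if "n >= n0" for n
   using kd_0_small[of "snd (p n)" C] p(1)[of n] that cell_ub by (auto simp: mem_Times_iff)
  define \<rho> where "\<rho> = 1 - 1 / (cosh C)^2"
  have \<rho>: "\<rho> < 1" by (simp add: \<rho>_def cosh_real_pos)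
  define K where "K = {x. x.*x <= \<rho> & (ALL u:N. u.*x <= c)}"
  have Kc: "K \<subseteq> cell" using \<rho> by (auto simp: K_def cell_def ball01_iff)
  have "K = (%x. x.*x) -` {..\<rho>} \<inter> (INT u:N. {x. u.*x <= c})" by (auto simp: K_def)
  moreover have "closed ((%x::real^'n. x.*x) -` {..\<rho>})" by (intro continuous_closed_vimage) (auto intro!: continuous_intros)
  ultimately have "closed K" by (auto intro!: closed_Int closed_INT closed_halfspace_le)
  moreover have "bounded K" unfolding bounded_iff
  proof (intro exI ballI)
   fix x assume "x : K"
   thus "norm x <= 1" using \<rho> by (simp add: K_def norm_eq_sqrt_inner)
  qed
  ultimately have K: "compact K" by (simp add: compact_eq_bounded_closed)
  define \<tau> where "\<tau> = (%n. p (n0 + n))"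
  have \<tau>K: "snd (\<tau> n) : K" "fst (\<tau> n) : I" for n
   using bnd[of "n0 + n"] p(1)[of "n0 + n"] by (auto simp: \<tau>_def K_def \<rho>_def cell_def mem_Times_iff power2_norm_eq_inner)
  obtain i where inf: "infinite {n. fst (\<tau> n) = i}" "i : I"
  proof -
   have "range (fst \<circ> \<tau>) \<subseteq> I" using \<tau>K by auto
   then obtain m where "infinite {n : UNIV. (fst \<circ> \<tau>) n = (fst \<circ> \<tau>) m}" using finI finite_subset pigeonhole_infinite[of UNIV "fst \<circ> \<tau>"] by auto
   thus ?thesis using that[of "fst (\<tau> m)"] \<tau>K by simp
  qed
  obtain r1 :: "nat => nat" where r1: "strict_mono r1" "!!n. fst (\<tau> (r1 n)) = i"
   using infinite_enumerate[OF inf(1)] by (metis (mono_tags, lifting) mem_Collect_eq)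
  obtain x and r2 :: "nat => nat" where r2: "x : K" "strict_mono r2" "(%n. snd (\<tau> (r1 (r2 n)))) \<longlonglongrightarrow> x"
   using K[unfolded compact_def, rule_format, of "%n. snd (\<tau> (r1 n))"] \<tau>K by (auto simp: o_def)
  define r where "r = (%n. n0 + r1 (r2 n))"
  have sr: "strict_mono r" using r1(1) r2(2) by (auto simp: r_def strict_mono_def)
  have xc: "x : cell" "x : ub" using r2(1) Kc cell_ub by auto
  have pr: "p (r n) = (i, snd (\<tau> (r1 (r2 n))))" for n using r1(2) by (metis r_def \<tau>_def prod.collapse)
  have kd0: "(%n. kd x (snd (\<tau> (r1 (r2 n))))) \<longlonglongrightarrow> kd x x"
  proof -
   have "continuous_on ub (%z. kd x z)" using xc by (intro kd_continuous) auto
   thus ?thesis using xc continuous_on_interior interior_ball r2(3) isCont_tendsto_compose by blast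
  qed
  have "limitin M.mtopology (\<sigma> \<circ> r) (\<pi> (i, x)) sequentially" unfolding M.limitin_metric
  proof (intro conjI allI impI)
   show px: "\<pi> (i, x) : mspace X" using pi_in inf xc by simp
   fix e :: real assume e: "e > 0"
   hence "\<forall>\<^sub>F n in sequentially. kd x (snd (\<tau> (r1 (r2 n)))) < e" using order_tendstoD(2)[OF kd0, of e] xc by simp
   thus "\<forall>\<^sub>F n in sequentially. (\<sigma> \<circ> r) n : mspace X & mdist X ((\<sigma> \<circ> r) n) (\<pi> (i, x)) < e"
   proof (eventually_elim)
    fix n assume n: "kd x (snd (\<tau> (r1 (r2 n)))) < e"
    have "snd (\<tau> (r1 (r2 n))) : cell" using \<tau>K Kc by auto
    thus "(\<sigma> \<circ> r) n : mspace X & mdist X ((\<sigma> \<circ> r) n) (\<pi> (i, x)) < e" using mdist_segment[OF inf(2) xc(1)] n ran p(2)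
     by (fastforce simp: pr M.commute)
   qed
  qed
  thus ?thesis using M.MCauchy_convergent_subsequence[OF C sr] by blast
 qed
 thus ?thesis by (auto simp: mcomplete_of_def M.mcomplete_def)
qed

end

section \<open>Charts\<close>

lemma inverse_chart:
 fixes \<psi> :: "real ^ 'n => 'a"
 assumes V: "open V" "V \<subseteq> ub" and U: "openin (mtopology_of X) (\<psi> ` V)"
  and iso: "!!y z. y : V ==> z : V ==> mdist X (\<psi> y) (\<psi> z) = kd y z"
 shows "inj_on \<psi> V" "hyperbolic_chart X (\<psi> ` V) (the_inv_into V \<psi>)"
proof -
 show inj: "inj_on \<psi> V"
 proof (rule inj_onI)
  fix y z assume yz: "y : V" "z : V" "\<psi> y = \<psi> z"
  have "mdist X (\<psi> y) (\<psi> z) = 0" using openin_subset[OF U] yz unfolding yz(3) by auto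
  thus "y = z" using iso[OF yz(1,2)] kd_zero_iff V yz by auto
 qed
 show "hyperbolic_chart X (\<psi> ` V) (the_inv_into V \<psi>)" using inj U V iso unfolding hyperbolic_chart_def by (auto simp: the_inv_into_f_f)
qed

lemma centre_in_mball_of: "p : mspace X ==> r > 0 ==> p : mball_of X p r" using mdist_zero[of p X p] by (metis in_mball_of)

lemma chart_inj:
 assumes "hyperbolic_chart X U \<phi>" shows "inj_on \<phi> U"
proof (rule inj_onI)
 fix x y assume xy: "x : U" "y : U" "\<phi> x = \<phi> y"
 have m: "x : mspace X" "y : mspace X" using assms xy openin_subset by (fastforce simp: hyperbolic_chart_def)+
 have "mdist X x y = 0" using assms xy unfolding hyperbolic_chart_def by fastforce
 thus "x = y" using m by simp
qed

locale realized = gluing N c R I nb tr + prerealized N c R I nb tr X \<pi>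
 for N :: "(real ^ 'n) set" and c R :: real and I :: "'i set"
  and nb :: "'i => real ^ 'n => 'i" and tr :: "'i => real ^ 'n => real ^ 'n => real ^ 'n"
  and X :: "'a metric" and \<pi> :: "'i \<times> (real ^ 'n) => 'a"
begin

lemma pi_cases:
 assumes "p : mspace X" obtains i x where "i : I" "x : cell" "p = \<pi> (i, x)"
proof -
 show ?thesis using assms pi_surj that by blast
qed

definition psi :: "'i => real ^ 'n => real ^ 'n => 'a" where
 "psi i x y = \<pi> (dev i (sector x y) y)"

context
 fixes i x r
 assumes i: "i : I" and x: "x : cell" and st: "star i x r"
begin

lemma W: "walls x r" by (rule star_walls[OF st])

lemma rpos: "r > 0" using W by (simp add: walls_def)

lemma xb: "x : ub" using x cell_ub by simp

lemma KB3: "y : KB x (r/3) ==> y : KB x r" using rpos by (simp add: KB_def)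

lemma psi_good: assumes "good x r w y" shows "psi i x y = \<pi> (dev i w y)"
proof -
 show ?thesis by (metis assms good_sector[OF i x W] pi_eq[OF dev_rep_chain[OF i x W _ assms]] good_def psi_def)
qed

lemma psi_dist:
 assumes "y : KB x (r/3)" "z : KB x (r/3)" shows "mdist X (psi i x y) (psi i x z) = kd y z"
proof -
 have g: "good x r (sector x y) y" "good x r (sector x z) z" using good_sector[OF i x W] KB3 assms by blast+
 have k: "kd x y < r/3" "kd x z < r/3" using assms by (auto simp: KB_def)
 have "~ mdist X (psi i x y) (psi i x z) < kd y z"
 proof
  assume "mdist X (psi i x y) (psi i x z) < kd y z"
  then obtain l where l: "chain (dev i (sector x y) y) (dev i (sector x z) z) l" "l < kd y z"
   unfolding psi_def by (rule chain_less[OF dev_in[OF i x W g(1)] dev_in[OF i x W g(2)]])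
  thus False using star_chain(2)[OF i x st g(1) k(1) g(2) k(2)] by fastforce
 qed
 thus ?thesis using mdist_le[OF star_chain(1)[OF i x st g(1) k(1) g(2) k(2)]] by (simp add: psi_def)
qed

text \<open>Chains of arbitrarily small length lead from one representative to the other; lifted by
  \<open>chain_unfold\<close> they end at unfolded points arbitrarily close to \<open>y\<close>, and
  \<open>star_inj\<close> forces these to be one and the same point.\<close>

lemma psi_rep:
 assumes q: "q : I \<times> cell" and y: "y : KB x (r/3)" and eq: "\<pi> q = psi i x y"
 obtains w where "good x r w y" "q = dev i w y"
proof -
 have g: "good x r (sector x y) y" using good_sector[OF i x W] KB3 y by blast
 have yb: "y : ub" "kd x y < r/3" using y by (auto simp: KB_def)
 let ?p = "dev i (sector x y) y"
 have p: "?p : I \<times> cell" by (rule dev_in[OF i x W g])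
 have d0: "mdist X (\<pi> ?p) (\<pi> q) = 0" using eq pi_in[OF p] by (simp add: psi_def)
 have ex: "EX w z. good x r w z & q = dev i w z & kd y z < e" if "0 < e" "e < r/3" for e
 proof -
  obtain l where l: "chain ?p q l" "l < e" using chain_less[OF p q, of e] d0 \<open>0 < e\<close> by auto
  thus ?thesis using chain_unfold[OF i x W l(1) HOL.refl g] yb that by fastforce
 qed
 obtain w z where w: "good x r w z" "q = dev i w z" using ex[of "r/6"] rpos by auto
 have zb: "z : ub" using w by (auto simp: good_def KB_def)
 have "kd y z <= 0"
 proof (rule field_le_epsilon)
  fix e :: real assume e: "e > 0"
  obtain w' z' where w': "good x r w' z'" "q = dev i w' z'" "kd y z' < min e (r/6)"
  proof -
   have "0 < min e (r/6)" "min e (r/6) < r/3" using e rpos by (auto simp: min_def)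
   thus ?thesis using ex[of "min e (r/6)"] that by blast
  qed
  thus "kd y z <= 0 + e" using star_inj[OF st w'(1) w(1)] w by simp
 qed
 thus ?thesis using kd_nonneg[OF yb(1) zb] kd_zero_iff[OF yb(1) zb] that w by simp
qed

lemma psi_centre: "psi i x x = \<pi> (i, x)" using psi_good[OF good_centre[OF i x W, of "{}"]] by (simp add: dev_centre[OF i x W])

lemma psi_in: "y : KB x r ==> psi i x y : mspace X" unfolding psi_def using dev_in[OF i x W good_sector[OF i x W]] pi_in by blast

lemma psi_image: "psi i x ` KB x (r/3) = mball_of X (\<pi> (i, x)) (r/3)"
proof
 have c: "x : KB x (r/3)" using xb rpos by (simp add: KB_def)
 show "psi i x ` KB x (r/3) \<subseteq> mball_of X (\<pi> (i, x)) (r/3)" using psi_dist c psi_in by (fastforce simp: psi_centre KB_def)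
 show "mball_of X (\<pi> (i, x)) (r/3) \<subseteq> psi i x ` KB x (r/3)"
 proof
  fix a assume "a : mball_of X (\<pi> (i, x)) (r/3)"
  hence a: "a : mspace X" "mdist X (\<pi> (i, x)) a < r/3" by auto
  obtain q where q: "q : I \<times> cell" "a = \<pi> q" using a pi_surj by blast
  obtain l where l: "chain (i, x) q l" "l < r/3" using chain_less[of "(i, x)" q "r/3"] i x q a by auto
  have "r - kd x x <= l | (EX w' y'. good x r w' y' & q = dev i w' y' & kd x y' <= l)"
   by (rule chain_unfold[OF i x W l(1), of "{}"]) (simp_all add: dev_centre[OF i x W] good_centre[OF i x W])
  then obtain w' y' where *: "good x r w' y'" "q = dev i w' y'" "kd x y' < r/3" using l rpos xb by fastforce
  hence "a = psi i x y'" "y' : KB x (r/3)" using q psi_good by (auto simp: good_def KB_def)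
  thus "a : psi i x ` KB x (r/3)" by blast
 qed
qed

lemma psi_open: "openin (mtopology_of X) (psi i x ` KB x (r/3))"
proof -
 interpret Metric_space "mspace X" "mdist X" by simp
 show ?thesis unfolding psi_image mball_of_def mtopology_of_def by (rule openin_mball)
qed

lemma psi_chart: "hyperbolic_chart X (psi i x ` KB x (r/3)) (the_inv_into (KB x (r/3)) (psi i x))"
 by (rule inverse_chart(2)[OF open_KB[OF xb] KB_sub psi_open psi_dist])

lemma psi_cell: "y : cell ==> y : KB x r ==> psi i x y = \<pi> (i, y)"
 using psi_good[of "{}" y] by (simp add: good_def dev_def pt_def)

end

lemma hyperbolic_manifold: "I ~= {} ==> connected_hyperbolic_manifold TYPE('n) X" unfolding connected_hyperbolic_manifold_def
proof (intro conjI ballI)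
 assume "I ~= {}"
 thus "mspace X ~= {}" using pi_surj zero_cell by blast
 show "connected_space (mtopology_of X)" by (rule path_connected_imp_connected_space[OF path_connected_X])
next
 fix p assume "p : mspace X"
 then obtain i x where p: "i : I" "x : cell" "p = \<pi> (i, x)" by (rule pi_cases)
 obtain r where r: "star i x r" using ex_star[OF p(1,2)] .
 have "p : mball_of X (\<pi> (i, x)) (r/3)" unfolding p(3)
  by (rule centre_in_mball_of) (use pi_in[of "(i, x)"] p rpos[OF p(1,2) r] in auto)
 thus "EX U (\<phi> :: 'a => real ^ 'n). p : U & hyperbolic_chart X U \<phi>" using psi_chart[OF p(1,2) r] psi_image[OF p(1,2) r] by metis
qed (rule intrinsic_eq)

text \<open>Two local sections of the developing map agree with the identity of a common cell near its
 interior points, which are dense in the cell.\<close>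

lemma orientable:
 assumes e: "!!i. i : I ==> \<epsilon> i = 1 | \<epsilon> i = -1"
  and en: "!!i u. i : I ==> u : N ==> \<epsilon> (nb i u) = - det (matrix (tr i u)) * (\<epsilon> i :: real)"
 shows "orientable_hyperbolic TYPE('n) X"
proof -
 define k :: 'n where "k = undefined"
 \<comment> \<open>Charts centred in cells of sign -1 are preceded by a coordinate reflection, so
   that all charts follow the same orientation.\<close>
 define S where "S = (%i::'i. if \<epsilon> i = 1 then (%z. z) else hrefl (axis k 1 :: real ^ 'n) 0)"
 have S: "hiso (\<epsilon> i) (S i)" "!!z. z : ub ==> S i (S i z) = z" if "i : I" for i
  using e[OF that] hiso_id hiso.hrefl[of 0 "axis k 1 :: real ^ 'n"] hrefl_hrefl[of 0 "axis k 1 :: real ^ 'n"]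
  by (auto simp: S_def inner_axis_axis)
 define V where "V = (%i x r. {z : ub. S i z : KB x (r/3)})"
 define \<Psi> where "\<Psi> = (%i x z. psi i x (S i z))"
 have Vo: "open (V i x r)" if "i : I" "x : ub" for i x r
  unfolding V_def by (rule hiso_vimage_open[OF S(1)[OF that(1)] open_KB[OF that(2)]])
 have Vs: "V i x r \<subseteq> ub" for i x r by (auto simp: V_def)
 have im: "\<Psi> i x ` V i x r = psi i x ` KB x (r/3)" if i: "i : I" for i x r
  using S i hiso_ball by (force simp: KB_def V_def \<Psi>_def)
 have iso: "mdist X (\<Psi> i x y) (\<Psi> i x z) = kd y z" if "i : I" "x : cell" "star i x r" "y : V i x r" "z : V i x r" for i x r y z
  using that psi_dist[OF that(1-3)] hiso_kd[OF S(1)] by (auto simp: V_def \<Psi>_def)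
 have chart: "hyperbolic_chart X (\<Psi> i x ` V i x r) (the_inv_into (V i x r) (\<Psi> i x))"
  and inj: "inj_on (\<Psi> i x) (V i x r)" if a: "i : I" "x : cell" "star i x r" for i x r
   using inverse_chart[of "V i x r" X "\<Psi> i x"] Vo[of i x r] Vs[of i x r] iso[OF a] psi_open[OF a] cell_ub[OF a(2)] a
  by (auto simp: im)
 \<comment> \<open>Each crossing contributes a factor -1 for its reflection and the determinant of
   the gluing map, which is the rule \<open>en\<close> for \<epsilon>.\<close>
 have sgn: "\<epsilon> (fst (act op states w (i, id))) = \<epsilon> i * (-1) ^ card w * det (matrix (snd (act op states w (i, id))))"
  if i: "i : I" and x: "x : ub" and w: "w \<subseteq> tight x" for i x w using op_commuting[OF x] w
 proof (induction w rule: commuting_induct)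
  case empty
  show ?case by (simp add: matrix_id_mat_1 matrix_id_mat_1[unfolded id_def])
 next
  case (insert u w)
  let ?s = "act op states w (i, id)"
  have s: "?s : states" "act op states (insert u w) (i, id) = op u ?s"
   using act_insert[OF op_commuting[OF x] insert(2,1,3)] i by auto
  have A: "fst ?s : I" "snd ?s : syms" using s by (auto simp: states_def)
  have u: "snd ?s u : N" using syms_N[OF A(2)] insert tight_N by blast
  have "det (matrix (tr (fst ?s) (snd ?s u) \<circ> snd ?s)) = det (matrix (tr (fst ?s) (snd ?s u))) * det (matrix (snd ?s))"
   using A tr_orth[OF A(1) u] by (simp add: matrix_compose det_mul orthogonal_transformation_linear syms_def)
  moreover have "fst (op u ?s) = nb (fst ?s) (snd ?s u)" "snd (op u ?s) = tr (fst ?s) (snd ?s u) \<circ> snd ?s"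
   by (simp_all add: op_def)
  ultimately have "\<epsilon> (fst (op u ?s)) = - det (matrix (tr (fst ?s) (snd ?s u))) * (\<epsilon> i * (-1) ^ card w * det (matrix (snd ?s)))"
    "det (matrix (snd (op u ?s))) = det (matrix (tr (fst ?s) (snd ?s u))) * det (matrix (snd ?s))"
     by (simp_all only: en[OF A(1) u] insert(4))
  moreover have "(-1 :: real) ^ card (insert u w) = - ((-1) ^ card w)" using insert tight_fin finite_subset by fastforce
  ultimately show ?case unfolding s(2) by (simp only: mult_minus_left mult_minus_right mult_ac)
 qed
 define \<A> where "\<A> = {(\<Psi> i x ` V i x r, the_inv_into (V i x r) (\<Psi> i x)) |i x r. i : I & x : cell & star i x r}"
 have main: "EX D. ((%y. the_inv_into (V i2 x2 r2) (\<Psi> i2 x2) (inv_into (\<Psi> i1 x1 ` V i1 x1 r1) (the_inv_into (V i1 x1 r1) (\<Psi> i1 x1)) y))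
   has_derivative D) (at (the_inv_into (V i1 x1 r1) (\<Psi> i1 x1) p)) & det (matrix D) > 0"
  if a1: "i1 : I" "x1 : cell" "star i1 x1 r1" and a2: "i2 : I" "x2 : cell" "star i2 x2 r2"
   and p: "p : \<Psi> i1 x1 ` V i1 x1 r1" "p : \<Psi> i2 x2 ` V i2 x2 r2" for i1 x1 r1 i2 x2 r2 p
 proof -
  let ?\<phi>1 = "the_inv_into (V i1 x1 r1) (\<Psi> i1 x1)" and ?\<phi>2 = "the_inv_into (V i2 x2 r2) (\<Psi> i2 x2)"
  let ?U1 = "\<Psi> i1 x1 ` V i1 x1 r1" and ?U2 = "\<Psi> i2 x2 ` V i2 x2 r2"
  define T where "T = (%y. ?\<phi>2 (inv_into ?U1 ?\<phi>1 y))"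
  define y1 where "y1 = ?\<phi>1 p"
  have xb: "x1 : ub" "x2 : ub" using a1 a2 cell_ub by auto
  have y1: "y1 : V i1 x1 r1" "\<Psi> i1 x1 y1 = p"
   unfolding y1_def using p(1) inj[OF a1] by (auto simp: the_inv_into_f_f f_the_inv_into_f)
  obtain y2 where y2: "y2 : V i2 x2 r2" "\<Psi> i2 x2 y2 = p" using p(2) by blast
  define Ov where "Ov = {y : V i1 x1 r1. \<Psi> i1 x1 y : ?U2}"
  have TO: "T y = ?\<phi>2 (\<Psi> i1 x1 y)" if "y : Ov" for y
  proof -
   have y: "y : V i1 x1 r1" using that by (simp add: Ov_def)
   have "inv_into ?U1 ?\<phi>1 (?\<phi>1 (\<Psi> i1 x1 y)) = \<Psi> i1 x1 y" by (rule inv_into_f_f[OF chart_inj[OF chart[OF a1]]]) (use y in blast)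
   thus ?thesis using the_inv_into_f_f[OF inj[OF a1] y] by (simp add: T_def)
  qed
  have U2: "openin (mtopology_of X) ?U2" using chart[OF a2] by (simp add: hyperbolic_chart_def)
  have "open Ov"
  proof (subst openin_subopen[of euclidean, unfolded open_openin[symmetric]], intro ballI)
   fix y assume y: "y : Ov"
   hence yV: "y : V i1 x1 r1" "\<Psi> i1 x1 y : ?U2" by (auto simp: Ov_def)
   obtain d where d: "d > 0" "mball_of X (\<Psi> i1 x1 y) d \<subseteq> ?U2"
    using iffD1[OF Metric_space.openin_mtopology[OF Metric_space_mspace_mdist] U2[unfolded mtopology_of_def]] yV(2)
    unfolding mball_of_def by metis
   have yb: "y : ub" using yV Vs by blast
   have "V i1 x1 r1 \<inter> KB y d \<subseteq> Ov"
   proof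
    fix z assume z: "z : V i1 x1 r1 \<inter> KB y d"
    hence "mdist X (\<Psi> i1 x1 y) (\<Psi> i1 x1 z) < d" using iso[OF a1 yV(1)] by (simp add: KB_def)
    moreover have "?U1 \<subseteq> mspace X" using chart[OF a1] openin_subset by (fastforce simp: hyperbolic_chart_def)
    hence "\<Psi> i1 x1 y : mspace X" "\<Psi> i1 x1 z : mspace X" using yV(1) z by blast+
    ultimately have "\<Psi> i1 x1 z : ?U2" using d by (auto simp: subset_iff)
    thus "z : Ov" using z by (simp add: Ov_def)
   qed
   moreover have "open (V i1 x1 r1 \<inter> KB y d)" using Vo[OF a1(1) xb(1)] open_KB[OF yb] by blast
   ultimately show "EX T. open T & y : T & T \<subseteq> Ov" using yV centre_in_KB[OF yb d(1)] by blast
  qed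
  moreover have y1Ov: "y1 : Ov" using y1 p by (simp add: Ov_def)
  moreover have Os: "Ov \<subseteq> ub" using Vs by (auto simp: Ov_def)
  moreover have "T ` Ov \<subseteq> ub" using TO chart a2 by (fastforce simp: Ov_def hyperbolic_chart_def)
  moreover have "kd (T y) (T z) = kd y z" if "y : Ov" "z : Ov" for y z
   using chart[OF a2] that iso[OF a1, of y z] unfolding TO[OF that(1)] TO[OF that(2)] hyperbolic_chart_def Ov_def by auto
  ultimately obtain s G where G: "hiso s G" "!!y. y : Ov ==> T y = G y" using kd_rigid[of Ov T] by (metis empty_iff)
  note W1 = star_walls[OF a1(3)] and W2 = star_walls[OF a2(3)]
  have z1: "S i1 y1 : KB x1 (r1/3)" and z2: "S i2 y2 : KB x2 (r2/3)" using y1 y2 by (auto simp: V_def)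
  define w1 where "w1 = sector x1 (S i1 y1)"
  have g1: "good x1 r1 w1 (S i1 y1)" unfolding w1_def by (rule good_sector[OF a1(1,2) W1 KB3[OF a1 z1]])
  obtain w2 where g2: "good x2 r2 w2 (S i2 y2)" and dd: "dev i1 w1 (S i1 y1) = dev i2 w2 (S i2 y2)"
   using y1(2) y2(2) psi_good[OF a1 g1] psi_rep[OF a2 dev_in[OF a1(1,2) W1 g1] z2] by (auto simp: \<Psi>_def)
  have w: "w1 \<subseteq> tight x1" "w2 \<subseteq> tight x2" using g1 g2 by (auto simp: good_def)
  obtain j A1 where s1: "act op states w1 (i1, id) = (j, A1)" "j : I" "A1 : syms"
   using state_in[OF a1(1,2) W1 w(1)] by (auto simp: states_def)
  obtain j2 A2 where s2: "act op states w2 (i2, id) = (j2, A2)" "A2 : syms"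
   using state_in[OF a2(1,2) W2 w(2)] by (auto simp: states_def)
  have j2: "j2 = j" and q2: "A1 (mref w1 (S i1 y1)) = A2 (mref w2 (S i2 y2))" using dd by (auto simp: dev_def pt_def s1 s2)
  define q where "q = A1 (mref w1 (S i1 y1))"
  have qc: "q : cell" using dev_in[OF a1(1,2) W1 g1] by (simp add: dev_def pt_def s1 q_def)
  hence qb: "q : ub" by (rule cell_ub)
  \<comment> \<open>Near the common point both charts are seen from the same cell \<open>j\<close>.
    Each inverse section is an isometry whose sign works out to \<open>\<epsilon> j\<close>, so the
    transition map has sign 1.\<close>
  have param: "EX P. hiso (\<epsilon> j) P & (ALL y. y : V i x r --> good x r w (S i y) --> P (A (mref w (S i y))) = y) &
    (ALL z:ub. P z : V i x r --> A (mref w (S i (P z))) = z)"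
   if a: "i : I" "x : cell" "star i x r" "w \<subseteq> tight x" "act op states w (i, id) = (j, A)" "A : syms" for i x r w A
  proof -
   have xb: "x : ub" using a cell_ub by simp
   obtain H where H: "hiso (det (matrix A)) H" "ALL x:ub. H (A x) = x & A (H x) = x"
    using hiso_inv[OF hiso.orth, of A] a(6) by (auto simp: syms_def)
   obtain Q where Q: "hiso ((-1) ^ card w) Q" "ALL y:ub. mref w y = Q y" using mref_hiso[OF xb order.refl a(4)] by blast
   have "hiso (\<epsilon> i * ((-1) ^ card w * det (matrix A))) (%z. S i (Q (H z)))" by (intro hiso.comp S H Q a)
   hence 1: "hiso (\<epsilon> j) (%z. S i (Q (H z)))" using sgn[OF a(1) xb a(4)] a(5) by (simp add: mult.assoc)
   have QQ: "Q (Q y) = y" if "y : ub" for y using mref_mref[OF xb order.refl a(4) that] Q(2) hiso_ball[OF Q(1) that] that by simp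
   show ?thesis
   proof (intro exI[of _ "%z. S i (Q (H z))"] conjI allI ballI impI 1)
    fix y assume y: "y : V i x r"
    hence "y : ub" "S i y : ub" using KB_sub by (auto simp: V_def)
    thus "S i (Q (H (A (mref w (S i y))))) = y" using H(2) Q(2) QQ hiso_ball[OF Q(1)] S(2)[OF a(1)] by simp
   next
    fix z :: "real ^ 'n" assume z: "z : ub"
    thus "A (mref w (S i (S i (Q (H z))))) = z" using hiso_ball[OF H(1)] hiso_ball[OF Q(1)] H(2) Q(2) QQ S(2)[OF a(1)] by simp
   qed
  qed
  obtain P1 where P1: "hiso (\<epsilon> j) P1" "ALL y. y : V i1 x1 r1 --> good x1 r1 w1 (S i1 y) --> P1 (A1 (mref w1 (S i1 y))) = y"
   "ALL z:ub. P1 z : V i1 x1 r1 --> A1 (mref w1 (S i1 (P1 z))) = z" using param[OF a1 w(1) s1(1,3)] by blast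
  obtain P2 where P2: "hiso (\<epsilon> j) P2" "ALL y. y : V i2 x2 r2 --> good x2 r2 w2 (S i2 y) --> P2 (A2 (mref w2 (S i2 y))) = y"
   "ALL z:ub. P2 z : V i2 x2 r2 --> A2 (mref w2 (S i2 (P2 z))) = z" using param[OF a2 w(2) s2(1)[unfolded j2] s2(2)] by blast
  define \<Omega> where "\<Omega> = {z : ub. P1 z : V i1 x1 r1} \<inter> {z : ub. P2 z : V i2 x2 r2}"
  define \<Omega>0 where "\<Omega>0 = \<Omega> \<inter> (INT u:N. {z. u.*z < c})"
  have o\<Omega>: "open \<Omega>" unfolding \<Omega>_def by (intro open_Int hiso_vimage_open[OF P1(1)] hiso_vimage_open[OF P2(1)] Vo a1(1) a2(1) xb)
  have o\<Omega>0: "open \<Omega>0" unfolding \<Omega>0_def using finN by (intro open_Int o\<Omega> open_INT) (auto intro: open_halfspace_lt)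
  have q\<Omega>: "q : \<Omega>" using P1(2) P2(2) y1(1) y2(1) g1 g2 qb q2 by (auto simp: \<Omega>_def q_def)
  have "\<Omega>0 ~= {}"
  proof -
   obtain d where d: "d > 0" "ball q d \<subseteq> \<Omega>" using o\<Omega> q\<Omega> open_contains_ball by blast
   \<comment> \<open>Shrinking \<open>q\<close> slightly towards 0 moves it strictly inside all
     walls.\<close>
   define t where "t = min (1/2) (d/2)"
   have t: "0 < t" "t < 1" "t < d" using d by (auto simp: t_def)
   have "dist q ((1-t) *\<^sub>R q) = t * norm q" using t by (simp add: dist_norm algebra_simps)
   also have "... <= t * 1" using qb t by (intro mult_left_mono) (auto simp: mem_ball_0)
   finally have "(1-t) *\<^sub>R q : \<Omega>" using t by (intro subsetD[OF d(2)]) (simp add: mem_ball)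
   moreover have "u .* ((1-t) *\<^sub>R q) < c" if "u : N" for u
   proof -
    have "(1-t) * (u.*q) <= (1-t) * c" using qc that t by (intro mult_left_mono) (auto simp: cell_def)
    also have "... < c" using t c_pos by (simp add: algebra_simps)
    finally show ?thesis by simp
   qed
   ultimately show ?thesis by (auto simp: \<Omega>0_def)
  qed
  moreover have eqP: "G (P1 z) = P2 z" if z: "z : \<Omega>0" for z
  proof -
   have zb: "z : ub" "P1 z : V i1 x1 r1" "P2 z : V i2 x2 r2" using z by (auto simp: \<Omega>0_def \<Omega>_def)
   have zc: "z : cell" using z zb(1) by (auto simp: \<Omega>0_def cell_def intro: less_imp_le)
   have e1: "A1 (mref w1 (S i1 (P1 z))) = z" "A2 (mref w2 (S i2 (P2 z))) = z" using P1(3) P2(3) zb by blast+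
   have k: "S i1 (P1 z) : KB x1 (r1/3)" "S i2 (P2 z) : KB x2 (r2/3)" using zb by (auto simp: V_def)
   have g: "good x1 r1 w1 (S i1 (P1 z))" "good x2 r2 w2 (S i2 (P2 z))"
    unfolding good_def using w KB3[OF a1 k(1)] KB3[OF a2 k(2)] e1 zc syms_cell[OF s1(3)] syms_cell[OF s2(2)] by metis+
   have eq: "\<Psi> i1 x1 (P1 z) = \<Psi> i2 x2 (P2 z)" using psi_good[OF a1 g(1)] psi_good[OF a2 g(2)] e1 by (simp add: \<Psi>_def dev_def pt_def s1 s2 j2)
   hence P1O: "P1 z : Ov" using zb by (auto simp: Ov_def)
   have "G (P1 z) = ?\<phi>2 (\<Psi> i2 x2 (P2 z))" using G(2)[OF P1O] TO[OF P1O] unfolding eq by (simp only:)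
   also have "... = P2 z" by (rule the_inv_into_f_f[OF inj[OF a2] zb(3)])
   finally show ?thesis .
  qed
  ultimately have "s * \<epsilon> j = \<epsilon> j" by (intro hiso_unique_sign[OF hiso.comp[OF G(1) P1(1)] P2(1) o\<Omega>0]) (auto simp: \<Omega>0_def \<Omega>_def)
  hence s: "s = 1" using e[OF s1(2)] by auto
  have y1b: "y1 : ub" using y1Ov Os by blast
  obtain D where D: "(G has_derivative D) (at y1)" "det (matrix D) = s * (hq (G y1) / hq y1) ^ (CARD('n) + 1)"
   using hiso_derivative[OF G(1) y1b] by blast
  have "(T has_derivative D) (at y1)" by (rule has_derivative_transform_within_open[OF D(1) \<open>open Ov\<close> y1Ov]) (simp add: G(2))
  moreover have "det (matrix D) > 0" unfolding D(2) s using hq_pos[OF y1b] hq_pos[OF hiso_ball[OF G(1) y1b]] by simp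
  ultimately show ?thesis unfolding T_def y1_def by blast
 qed
 show ?thesis unfolding orientable_hyperbolic_def
 proof (intro exI[of _ \<A>] conjI)
  show "ALL (U, \<phi>):\<A>. hyperbolic_chart X U \<phi>" using chart by (auto simp: \<A>_def)
  show "(UN (U, \<phi>):\<A>. U) = mspace X"
  proof
   show "(UN (U, \<phi>):\<A>. U) \<subseteq> mspace X"
   proof
    fix p assume "p : (UN (U, \<phi>):\<A>. U)"
    then obtain i x r where a: "i : I" "x : cell" "star i x r" "p : \<Psi> i x ` V i x r" by (auto simp: \<A>_def)
    hence "openin (mtopology_of X) (\<Psi> i x ` V i x r)" using chart by (simp add: hyperbolic_chart_def)
    thus "p : mspace X" using a(4) openin_subset by fastforce
   qed
   show "mspace X \<subseteq> (UN (U, \<phi>):\<A>. U)"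
   proof
    fix p assume "p : mspace X"
    then obtain i x where p: "i : I" "x : cell" "p = \<pi> (i, x)" by (rule pi_cases)
    obtain r where r: "star i x r" using ex_star[OF p(1,2)] .
    have "p : \<Psi> i x ` V i x r" unfolding im[OF p(1)] psi_image[OF p(1,2) r] p(3)
     by (rule centre_in_mball_of) (use pi_in[of "(i, x)"] p rpos[OF p(1,2) r] in auto)
    thus "p : (UN (U, \<phi>):\<A>. U)" using p r by (auto simp: \<A>_def)
   qed
  qed
  have "EX D. ((%y. \<psi> (inv_into U \<phi> y)) has_derivative D) (at (\<phi> p)) & 0 < det (matrix D)"
   if A: "(U, \<phi>) : \<A>" "(U', \<psi>) : \<A>" and p: "p : U" "p : U'" for U \<phi> U' \<psi> p
  proof -
   obtain i x r where a: "i : I" "x : cell" "star i x r" and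
    U: "U = \<Psi> i x ` V i x r" "\<phi> = the_inv_into (V i x r) (\<Psi> i x)" using A(1) unfolding \<A>_def by blast
   obtain j y t where b: "j : I" "y : cell" "star j y t" and
    U': "U' = \<Psi> j y ` V j y t" "\<psi> = the_inv_into (V j y t) (\<Psi> j y)" using A(2) unfolding \<A>_def by blast
   show ?thesis unfolding U U' by (rule main[OF a b p[unfolded U U']])
  qed
  thus "ALL (U, \<phi>):\<A>. ALL (V, \<psi>):\<A>. ALL p:U \<inter> V. EX D. ((%y. \<psi> (inv_into U \<phi> y)) has_derivative D) (at (\<phi> p)) & 0 < det (matrix D)"
   by auto
 qed
qed

end

section \<open>Volume\<close>

lemma klein_volume_subadd:
 fixes B :: "nat => (real ^ 'n) set"
 assumes "!!m. B m \<subseteq> ub" "!!m. B m : sets borel" shows "kvol (\<Union>m. B m) <= (\<Sum>m. kvol (B m))"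
proof -
 have "kvol (\<Union>m. B m) = emeasure kmeasure (\<Union>m. B m)" by (rule klein_volume_emeasure) (use assms in auto)
 also have "... <= (\<Sum>m. emeasure kmeasure (B m))" by (rule emeasure_subadditive_countably) (use assms in auto)
 also have "... = (\<Sum>m. kvol (B m))" using assms by (simp add: klein_volume_emeasure)
 finally show ?thesis .
qed

context right_angled begin

definition inner_cell :: "(real ^ 'n) set" where
 "inner_cell = {z : ub. ALL u:N. u.*z < c}"

lemma inner_cell_sub: "inner_cell \<subseteq> cell" by (auto simp: inner_cell_def cell_def less_imp_le)

lemma inner_cell_eq: "inner_cell = ub \<inter> (INT u:N. {z. u.*z < c})" by (auto simp: inner_cell_def)

lemma open_inner_cell: "open inner_cell"
 unfolding inner_cell_eq using finN by (intro open_Int open_INT) (auto intro: open_halfspace_lt)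

lemma cell_eq: "cell = ub \<inter> (INT u:N. {z. u.*z <= c})" by (auto simp: cell_def)

lemma cell_borel: "cell : sets borel" unfolding cell_eq
 by (intro sets.Int borel_open borel_closed closed_INT) (auto intro: closed_halfspace_le)

lemma inner_cell_borel: "inner_cell : sets borel" using open_inner_cell by simp

lemma inner_cell_volume: "kvol inner_cell = kvol cell"
proof -
 have sub: "inner_cell \<subseteq> ub" "cell \<subseteq> ub" by (auto simp: inner_cell_def cell_def)
 have "(UN u:N. {z. u.*z = c}) : null_sets lebesgue"
 proof (intro null_sets_UN' countable_finite finN)
  fix u assume "u : N"
  thus "{z. u.*z = c} : null_sets lebesgue" using space_like[of u] negligible_hyperplane[of u c] negligible_iff_null_sets by fastforce
 qed
 moreover have "(UN u:N. {z. u.*z = c}) : sets borel"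
  using finN by (intro sets.finite_UN) (auto intro!: borel_closed closed_hyperplane)
 ultimately have "(UN u:N. {z. u.*z = c}) : null_sets lborel" by (auto simp: null_sets_def)
 hence ae: "AE z in lborel. z ~: (UN u:N. {z. u.*z = c})" by (rule AE_not_in)
 show ?thesis unfolding klein_volume_eq[OF sub(1)] klein_volume_eq[OF sub(2)]
 proof (rule nn_integral_cong_AE)
  show "AE x in lborel. ennreal (kdens x) * indicator inner_cell x = ennreal (kdens x) * indicator cell x"
   using ae by eventually_elim (auto simp: indicator_def inner_cell_def cell_def less_le)
 qed
qed

end

lemma countable_KB_cover:
 assumes "!!x. x : D ==> x : ub & \<rho> x > 0" "D ~= {}"
 obtains x :: "nat => real ^ 'n" where "!!m. x m : D" "D \<subseteq> (\<Union>m. KB (x m) (\<rho> (x m)))"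
proof -
 define F where "F = (%x. KB x (\<rho> x)) ` D"
 obtain F' where F': "F' \<subseteq> F" "countable F'" "\<Union>F' = \<Union>F" using assms open_KB Lindelof[of F] F_def by blast
 have cov: "D \<subseteq> \<Union>F'" unfolding F'(3) using assms centre_in_KB by (force simp: F_def)
 hence "F' ~= {}" using assms(2) by auto
 define f where "f = from_nat_into F'"
 have f: "range f = F'" unfolding f_def by (rule range_from_nat_into[OF \<open>F' ~= {}\<close> F'(2)])
 obtain x where "ALL m. x m : D & f m = KB (x m) (\<rho> (x m))" using F'(1) f choice[of "%m x. x : D & f m = KB x (\<rho> x)"] F_def by blast
 hence x: "!!m. x m : D & f m = KB (x m) (\<rho> (x m))" by blast
 show ?thesis
 proof (rule that[of x])
  show "!!m. x m : D" using x by blast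
  have "\<Union>F' = (\<Union>m. f m)" unfolding f[symmetric] by simp
  also have "... = (\<Union>m. KB (x m) (\<rho> (x m)))" using x by simp
  finally show "D \<subseteq> (\<Union>m. KB (x m) (\<rho> (x m)))" using cov by simp
 qed
qed

context realized begin

text \<open>Interior points lie in one cell only, so the pieces taken from different cells are disjoint.\<close>

lemma volume_ge: "of_nat (card I) * kvol cell <= hyperbolic_volume TYPE('n) X"
proof (cases "I = {}")
 case False
 then obtain i0 where i0: "i0 : I" by blast
 have icu: "inner_cell \<subseteq> ub" by (auto simp: inner_cell_def)
 define r where "r = (%i x. SOME r. star i x r)"
 have r: "star i x (r i x)" if "i : I" "x : cell" for i x unfolding r_def using ex_star[OF that] by (metis someI)
 define K where "K = (%i x. KB x (r i x / 3))"
 have ne: "inner_cell ~= {}" using c_pos by (auto simp: inner_cell_def intro!: exI[of _ 0])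
 have "EX x. (ALL m::nat. x m : inner_cell) & inner_cell \<subseteq> (\<Union>m. K i (x m))" if "i : I" for i
 proof -
  have "x : ub & r i x / 3 > 0" if "x : inner_cell" for x using rpos[OF \<open>i : I\<close> _ r[OF \<open>i : I\<close>]] that inner_cell_sub icu by auto
  then obtain x where "!!m::nat. x m : inner_cell" "inner_cell \<subseteq> (\<Union>m. KB (x m) (r i (x m) / 3))"
   by (rule countable_KB_cover[OF _ ne, of "%x. r i x / 3"]) auto
  thus ?thesis unfolding K_def by blast
 qed
 then obtain x where x: "!!i m. i : I ==> x i m : inner_cell" "!!i. i : I ==> inner_cell \<subseteq> (\<Union>m::nat. K i (x i m))" by metis
 have xc: "x i m : cell" if "i : I" for i m using x(1)[OF that] inner_cell_sub by blast
 define B where "B = (%i. disjointed (%m. inner_cell \<inter> K i (x i m)))"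
 have Bsub: "B i m \<subseteq> inner_cell \<inter> K i (x i m)" for i m using disjointed_subset by (fastforce simp: B_def)
 have Kb: "K i (x i m) : sets borel" if "i : I" for i m unfolding K_def using open_KB[OF cell_ub[OF xc[OF that]]] by simp
 have Bb: "B i m : sets borel" if "i : I" for i m unfolding B_def by (rule sets.range_disjointed_sets[THEN subsetD, OF _ rangeI])
   (use Kb[OF that] inner_cell_borel in auto)
 have Bun: "(\<Union>m. B i m) = inner_cell" if "i : I" for i unfolding B_def UN_disjointed_eq using x(2)[OF that] by auto
 have Bdis: "disjoint_family (B i)" for i unfolding B_def by (rule disjoint_family_disjointed)
 have kvB: "kvol (B i m) = emeasure kmeasure (B i m)" if "i : I" for i m
  using Bsub[of i m] Bb[OF that] icu by (intro klein_volume_emeasure) auto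
 have sumB: "(\<Sum>m. kvol (B i m)) = kvol cell" if "i : I" for i
 proof -
  have "(\<Sum>m. kvol (B i m)) = emeasure kmeasure (\<Union>m. B i m)"
   using suminf_emeasure[of "B i" kmeasure] Bb[OF that] Bdis kvB[OF that] by (auto simp: image_subset_iff)
  also have "... = kvol inner_cell"
   unfolding Bun[OF that] by (rule klein_volume_emeasure[symmetric]) (use inner_cell_borel icu in auto)
  finally show ?thesis by (simp add: inner_cell_volume)
 qed
 define \<Psi> where "\<Psi> = (%i m. psi i (x i m))"
 define V where "V = (%i m. K i (x i m))"
 define \<phi> where "\<phi> = (%i m. the_inv_into (V i m) (\<Psi> i m))"
 have inj: "inj_on (\<Psi> i m) (V i m)" and chart: "hyperbolic_chart X (\<Psi> i m ` V i m) (\<phi> i m)" if "i : I" for i m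
  using inverse_chart[OF open_KB[OF cell_ub[OF xc[OF that]]] KB_sub psi_open[OF that xc[OF that] r[OF that xc[OF that]]]
    psi_dist[OF that xc[OF that] r[OF that xc[OF that]]], of m] unfolding \<Psi>_def V_def K_def \<phi>_def by simp_all
 have \<Psi>pi: "\<Psi> i m z = \<pi> (i, z)" if "i : I" "z : B i m" for i m z unfolding \<Psi>_def
  by (rule psi_cell[OF that(1) xc[OF that(1)] r[OF that(1) xc[OF that(1)]]])
   (use Bsub[of i m] that inner_cell_sub KB3[OF that(1) xc[OF that(1)] r[OF that(1) xc[OF that(1)]], of z m] in \<open>auto simp: K_def\<close>)
 define A where "A = (%(i, m). (%z. \<pi> (i, z)) ` B i m)"
 have \<phi>A: "\<phi> i m ` A (i, m) = B i m" if i: "i : I" for i m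
 proof -
  have "\<phi> i m (\<pi> (i, z)) = z" if "z : B i m" for z unfolding \<Psi>pi[OF i that, symmetric] \<phi>_def
   by (rule the_inv_into_f_f[OF inj[OF i]]) (use Bsub[of i m] that in \<open>auto simp: V_def\<close>)
  thus ?thesis by (force simp: A_def image_image)
 qed
 have AU: "A (i, m) \<subseteq> \<Psi> i m ` V i m" if i: "i : I" for i m using \<Psi>pi[OF i] Bsub[of i m] by (force simp: A_def V_def)
 have Adis: "A (i, m) \<inter> A (j, n) = {}" if "i : I" "j : I" "(i, m) ~= (j, n)" for i j m n
 proof (rule ccontr)
  assume "A (i, m) \<inter> A (j, n) ~= {}"
  then obtain z z' where z: "z : B i m" "z' : B j n" "\<pi> (i, z) = \<pi> (j, z')" by (auto simp: A_def)
  have "z : inner_cell" "z' : inner_cell" using z Bsub by blast+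
  hence "(j, z') = (i, z)" using z that by (intro pi_interior) (auto simp: inner_cell_def cell_def less_imp_le)
  thus False using z that Bdis[of i] by (auto simp: disjoint_family_on_def)
 qed
 have fin: "(SUM i:I. \<Sum>m<n. kvol (B i m)) <= hyperbolic_volume TYPE('n) X" for n
 proof -
  define Z where "Z = {(i, m) : I \<times> {..<n}. B i m ~= {}}"
  have finZ: "finite Z" using finI by (auto simp: Z_def intro: finite_subset[of _ "I \<times> {..<n}"])
  define \<P> where "\<P> = (%(i, m). (A (i, m), \<phi> i m)) ` Z"
  have injP: "inj_on (%(i, m). (A (i, m), \<phi> i m)) Z"
  proof (rule inj_onI, clarsimp)
   fix i m j n' assume *: "(i, m) : Z" "(j, n') : Z" "A (i, m) = A (j, n')" "\<phi> i m = \<phi> j n'"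
   have "A (i, m) ~= {}" using * by (auto simp: Z_def A_def)
   thus "i = j & m = n'" using Adis[of i j m n'] * by (auto simp: Z_def)
  qed
  have "(SUM i:I. \<Sum>m<n. kvol (B i m)) = (SUM (i, m):I \<times> {..<n}. kvol (B i m))" by (rule sum.cartesian_product)
  also have "... = (SUM (i, m):Z. kvol (B i m))"
   by (rule sum.mono_neutral_right) (use finI in \<open>auto simp: Z_def klein_volume_def\<close>)
  also have "... = (SUM (A, \<phi>):\<P>. kvol (\<phi> ` A))" unfolding \<P>_def sum.reindex[OF injP] by (rule sum.cong) (auto simp: \<phi>A Z_def)
  also have "... <= hyperbolic_volume TYPE('n) X" unfolding hyperbolic_volume_def
  proof (rule SUP_upper, simp, intro conjI)
   show "finite \<P>" using finZ by (simp add: \<P>_def)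
   show "disjoint_family_on fst \<P>" unfolding disjoint_family_on_def
   proof (intro ballI impI)
    fix P Q assume "P : \<P>" "Q : \<P>" "P ~= Q"
    then obtain i m j n' where "(i, m) : Z" "(j, n') : Z" "P = (A (i, m), \<phi> i m)" "Q = (A (j, n'), \<phi> j n')" "(i, m) ~= (j, n')"
     by (auto simp: \<P>_def)
    thus "fst P \<inter> fst Q = {}" using Adis[of i j m n'] by (auto simp: Z_def)
   qed
   have "\<phi> i m ` A (i, m) : sets borel & (EX U. A (i, m) \<subseteq> U & hyperbolic_chart X U (\<phi> i m))" if "(i, m) : Z" for i m
   proof -
    have i: "i : I" using that by (simp add: Z_def)
    show ?thesis unfolding \<phi>A[OF i] using Bb[OF i] AU[OF i] chart[OF i] by blast
   qed
   thus "ALL (A, \<phi>):\<P>. \<phi> ` A : sets borel & (EX U. A \<subseteq> U & hyperbolic_chart X U \<phi>)" by (auto simp: \<P>_def)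
  qed
  finally show ?thesis .
 qed
 have "of_nat (card I) * kvol cell = (SUM i:I. \<Sum>m. kvol (B i m))" by (simp add: sumB)
 also have "... = (\<Sum>m. SUM i:I. kvol (B i m))" by (rule suminf_sum[symmetric]) simp
 also have "... <= hyperbolic_volume TYPE('n) X"
 proof (rule suminf_le_const[OF summableI])
  fix n show "(\<Sum>m<n. SUM i:I. kvol (B i m)) <= hyperbolic_volume TYPE('n) X" using fin[of n] by (simp add: sum.swap[of _ I])
 qed
 finally show ?thesis .
qed simp

end

text \<open>The index type is well-ordered because \<open>hiso_volume\<close>, which rests on the
  substitution rule, is proved for such types.\<close>

locale realized_wo = realized N c R I nb tr X \<pi> for N :: "(real ^ 'n::{finite,wellorder}) set" and c R :: real and I :: "'i set"
  and nb and tr and X :: "'a metric" and \<pi>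
begin

text \<open>Near each point of the cell \<open>\<phi>\<close> composed with \<open>psi\<close>
  preserves distances on an open set and is an \<open>hiso\<close> there by \<open>kd_rigid\<close>.
  Countably many such neighbourhoods cover \<open>Q\<close>, and disjoint pieces of them keep their
  volume.\<close>

lemma piece_volume:
 fixes \<phi> :: "'a => real ^ 'n::_"
 assumes i: "i : I" and ch: "hyperbolic_chart X U \<phi>" and AU: "A \<subseteq> U" and Ab: "\<phi> ` A : sets borel"
 defines "Q \<equiv> {z : cell. \<pi> (i, z) : A}" shows "Q : sets borel" "(%z. \<phi> (\<pi> (i, z))) ` Q : sets borel"
  "kvol ((%z. \<phi> (\<pi> (i, z))) ` Q) <= kvol Q"
proof -
 define f where "f = (%z. \<phi> (\<pi> (i, z)))"
 define D where "D = {z : cell. \<pi> (i, z) : U}"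
 have Uo: "openin (mtopology_of X) U" and \<phi>ub: "\<phi> ` U \<subseteq> ub"
  and \<phi>d: "!!a b. a : U ==> b : U ==> kd (\<phi> a) (\<phi> b) = mdist X a b" using ch by (auto simp: hyperbolic_chart_def)
 have Dub: "D \<subseteq> ub" "D \<subseteq> cell" by (auto simp: D_def cell_def)
 have nbhd: "EX d>0. ALL b:mspace X. mdist X a b < d --> b : U" if a: "a : U" for a
  using iffD1[OF Metric_space.openin_mtopology[OF Metric_space_mspace_mdist] Uo[unfolded mtopology_of_def]] Metric_space_mspace_mdist a subset_iff Metric_space.in_mball by metis
 have "EX d>0. ALL y:cell. kd z y < d --> y : D" if z: "z : D" for z
 proof -
  obtain d where d: "d > 0" "ALL b:mspace X. mdist X (\<pi> (i, z)) b < d --> b : U" using nbhd[of "\<pi> (i, z)"] z by (auto simp: D_def)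
  show ?thesis using d mdist_segment i z pi_in by (force simp: D_def)
 qed
 then obtain d where d: "!!z. z : D ==> d z > 0 & (ALL y:cell. kd z y < d z --> y : D)" by metis
 have "D = cell \<inter> (UN z:D. KB z (d z))" using d Dub(1) Dub(2) by (force simp: KB_def)
 moreover have "open (UN z:D. KB z (d z))" using Dub open_KB by blast
 ultimately have Db: "D : sets borel" using cell_borel by (metis borel_open sets.Int)
 have contf: "continuous_on D f" unfolding continuous_on_iff
 proof (intro ballI allI impI)
  fix z e assume z: "z : D" and e: "(e::real) > 0"
  have fz: "f z : ub" "\<pi> (i, z) : U" using z \<phi>ub by (auto simp: D_def f_def)
  obtain \<rho> where \<rho>: "\<rho> > 0" "KB (f z) \<rho> \<subseteq> ball (f z) e" using KB_small[OF fz(1), of "ball (f z) e"] e by auto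
  obtain \<delta> where \<delta>: "\<delta> > 0" "ball z \<delta> \<subseteq> KB z \<rho>" using open_KB centre_in_KB \<rho> z Dub open_contains_ball by blast
  show "EX \<delta>>0. ALL y:D. dist y z < \<delta> --> dist (f y) (f z) < e"
  proof (intro exI[of _ \<delta>] conjI ballI impI \<delta>(1))
   fix y assume y: "y : D" "dist y z < \<delta>"
   hence k: "kd z y < \<rho>" using \<delta>(2) by (auto simp: mem_ball dist_commute KB_def subset_iff)
   have fy: "f y : ub" "\<pi> (i, y) : U" using y \<phi>ub by (auto simp: D_def f_def)
   have "kd (f z) (f y) = mdist X (\<pi> (i, z)) (\<pi> (i, y))" unfolding f_def by (rule \<phi>d[OF fz(2) fy(2)])
   also have "... < \<rho>" using mdist_segment[OF i, of z y] z y k by (auto simp: D_def)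
   finally have "f y : KB (f z) \<rho>" using fy by (simp add: KB_def)
   thus "dist (f y) (f z) < e" using \<rho> by (auto simp: mem_ball dist_commute)
  qed
 qed
 have QD: "Q \<subseteq> D" using AU by (auto simp: Q_def D_def)
 have "Q = D \<inter> f -` (\<phi> ` A)" using inj_onD chart_inj[OF ch] AU by (fastforce simp: Q_def f_def D_def)
 also have "... : sets borel"
 proof -
  have "f -` (\<phi> ` A) \<inter> space (restrict_space borel D) : sets (restrict_space borel D)"
   using borel_measurable_continuous_on_restrict[OF contf] Ab by (rule measurable_sets)
  thus ?thesis using Db by (auto simp: sets_restrict_space_iff space_restrict_space Int_commute)
 qed
 finally show Qb: "Q : sets borel" .
 have "f ` Q : sets borel & kvol (f ` Q) <= kvol Q"
 proof (cases "D = {}")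
  case True
  thus ?thesis using QD by simp
 next
  case False
  define r where "r = (%x. SOME r. star i x r)"
  have r: "star i x (r x)" if "x : cell" for x unfolding r_def using ex_star[OF i that] by (metis someI)
  obtain x where x: "!!m::nat. x m : D" "D \<subseteq> (\<Union>m. KB (x m) (r (x m) / 3))"
  proof (rule countable_KB_cover[of D "%x. r x / 3"])
   show "y : ub & 0 < r y / 3" if "y : D" for y using that Dub rpos[OF i _ r] by auto
  qed (use False in auto)
  have xc: "x m : cell" for m using x(1) Dub by blast
  define K where "K = (%m. KB (x m) (r (x m) / 3))"
  have Ko: "open (K m)" for m unfolding K_def using open_KB[OF cell_ub[OF xc]] .
  have Ks: "K m \<subseteq> ub" for m by (simp add: K_def KB_sub)
  have "EX s G. hiso s G & (ALL z:Q \<inter> K m. f z = G z)" for m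
  proof -
   define V where "V = {y : K m. psi i (x m) y : U}"
   have iso: "mdist X (psi i (x m) y) (psi i (x m) z) = kd y z" if "y : K m" "z : K m" for y z
    using psi_dist[OF i xc r[OF xc]] that by (simp add: K_def)
   have "open V"
   proof (subst openin_subopen[of euclidean, unfolded open_openin[symmetric]], intro ballI)
    fix y assume "y : V"
    hence y: "y : K m" "psi i (x m) y : U" by (auto simp: V_def)
    obtain d where d: "d > 0" "ALL b:mspace X. mdist X (psi i (x m) y) b < d --> b : U" using nbhd[OF y(2)] by blast
    have yb: "y : ub" using y Ks by blast
    have "K m \<inter> KB y d \<subseteq> V" using iso y psi_in[OF i xc r[OF xc] KB3[OF i xc r[OF xc]]] d by (auto simp: KB_def K_def V_def)
    moreover have "open (K m \<inter> KB y d)" using Ko open_KB[OF yb] by blast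
    ultimately show "EX T. open T & y : T & T \<subseteq> V" using y centre_in_KB[OF yb d(1)] by blast
   qed
   moreover have "x m : V"
   proof -
    show ?thesis using rpos[OF i xc r[OF xc]] cell_ub[OF xc] psi_centre[OF i xc r[OF xc]] x(1) by (simp add: K_def KB_def V_def D_def)
   qed
   moreover have "V \<subseteq> ub" using Ks by (auto simp: V_def)
   moreover have "(%y. \<phi> (psi i (x m) y)) ` V \<subseteq> ub" using \<phi>ub by (auto simp: V_def)
   moreover have "kd (\<phi> (psi i (x m) y)) (\<phi> (psi i (x m) z)) = kd y z" if "y : V" "z : V" for y z
    using \<phi>d iso that by (simp add: V_def)
   ultimately obtain s G where G: "hiso s G" "!!y. y : V ==> \<phi> (psi i (x m) y) = G y"
    using kd_rigid[of V "%y. \<phi> (psi i (x m) y)"] by (metis empty_iff)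
   have "f z = G z" if z: "z : Q \<inter> K m" for z
   proof -
    have "psi i (x m) z = \<pi> (i, z)" by (rule psi_cell[OF i xc r[OF xc]]) (use z KB3[OF i xc r[OF xc]] in \<open>auto simp: Q_def K_def\<close>)
    moreover have "z : V" using z AU calculation by (auto simp: V_def Q_def)
    ultimately show ?thesis using G(2) by (metis f_def)
   qed
   thus ?thesis using G(1) by blast
  qed
  then obtain s G where G: "!!m. hiso (s m) (G m)" "!!m z. z : Q \<inter> K m ==> f z = G m z" by metis
  define B where "B = disjointed (%m. Q \<inter> K m)"
  have Bsub: "B m \<subseteq> Q \<inter> K m" for m using disjointed_subset by (fastforce simp: B_def)
  have Bb: "B m : sets borel" for m
   unfolding B_def by (rule sets.range_disjointed_sets[THEN subsetD, OF _ rangeI]) (use Ko Qb in auto)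
  have Bu: "B m \<subseteq> ub" for m using Bsub Ks by blast
  have BQ: "(\<Union>m. B m) = Q"
  proof -
   have "(\<Union>m. B m) = (\<Union>m. Q \<inter> K m)" unfolding B_def by (rule UN_disjointed_eq)
   also have "... = Q" using x(2) QD by (auto simp: K_def)
   finally show ?thesis .
  qed
  have fB: "f ` B m = G m ` B m" for m by (rule image_cong[OF HOL.refl G(2)[OF subsetD[OF Bsub]]])
  have fBb: "f ` B m : sets borel" "f ` B m \<subseteq> ub" for m
   unfolding fB using hiso_image_borel[OF G(1) Bu Bb] hiso_ball[OF G(1), of _ m] Bu[of m] by blast+
  have fQ: "f ` Q = (\<Union>m. f ` B m)" using BQ by auto
  have "kvol (f ` Q) <= (\<Sum>m. kvol (f ` B m))" unfolding fQ by (rule klein_volume_subadd[OF fBb(2) fBb(1)])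
  also have "... = (\<Sum>m. emeasure kmeasure (B m))"
   unfolding fB by (simp add: hiso_volume[OF G(1) Bu Bb] klein_volume_emeasure[OF Bu Bb])
  also have "... = emeasure kmeasure Q" using suminf_emeasure[of B kmeasure] Bb disjoint_family_disjointed[of "%m. Q \<inter> K m"]
   by (simp add: BQ B_def[symmetric] image_subset_iff)
  also have "... = kvol Q" using Qb QD Dub by (intro klein_volume_emeasure[symmetric]) auto
  finally show ?thesis using fQ fBb by auto
 qed
 thus "(%z. \<phi> (\<pi> (i, z))) ` Q : sets borel" "kvol ((%z. \<phi> (\<pi> (i, z))) ` Q) <= kvol Q" by (auto simp: f_def)
qed

text \<open>The pieces pull back to disjoint Borel subsets of every cell, and each piece is covered
  by the images of its pullbacks. Overlaps along facets do no harm to an upper bound.\<close>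

lemma volume_le: "hyperbolic_volume TYPE('n) X <= of_nat (card I) * kvol cell" unfolding hyperbolic_volume_def
proof (rule SUP_least, clarify)
 fix \<P> :: "('a set \<times> ('a => real ^ 'n::_)) set"
 assume fin: "finite \<P>" and dis: "disjoint_family_on fst \<P>"
  and P: "ALL (A, \<phi>):\<P>. \<phi> ` A : sets borel & (EX U. A \<subseteq> U & hyperbolic_chart X U \<phi>)"
 define Q where "Q = (%i (P :: 'a set \<times> ('a => real ^ 'n::_)). {z : cell. \<pi> (i, z) : fst P})"
 have Q: "Q i P : sets borel" "Q i P \<subseteq> ub" if "i : I" "P : \<P>" for i P
 proof -
  obtain A \<phi> where A: "P = (A, \<phi>)" by (cases P)
  then obtain U where U: "A \<subseteq> U" "hyperbolic_chart X U \<phi>" "\<phi> ` A : sets borel" using P \<open>P : \<P>\<close> by auto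
  show "Q i P : sets borel" using piece_volume(1)[OF \<open>i : I\<close> U(2,1,3)] by (simp add: Q_def A)
 qed (auto simp: Q_def cell_def)
 have "kvol (\<phi> ` A) <= (SUM i:I. kvol (Q i (A, \<phi>)))" if AP: "(A, \<phi>) : \<P>" for A \<phi>
 proof -
  obtain U where U: "A \<subseteq> U" "hyperbolic_chart X U \<phi>" "\<phi> ` A : sets borel" using P AP by auto
  have Am: "A \<subseteq> mspace X" using U openin_subset by (fastforce simp: hyperbolic_chart_def)
  define F where "F = (%i. (%z. \<phi> (\<pi> (i, z))) ` Q i (A, \<phi>))"
  have F: "F i : sets borel" "F i \<subseteq> ub" "kvol (F i) <= kvol (Q i (A, \<phi>))" if "i : I" for i
   using piece_volume[OF that U(2,1,3)] U by (auto simp: F_def Q_def hyperbolic_chart_def)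
  have "\<phi> ` A = (UN i:I. F i)"
  proof
   show "\<phi> ` A \<subseteq> (UN i:I. F i)"
   proof
    fix b assume "b : \<phi> ` A"
    then obtain a where a: "a : A" "b = \<phi> a" by blast
    then obtain i z where "i : I" "z : cell" "a = \<pi> (i, z)" using pi_cases Am by blast
    thus "b : (UN i:I. F i)" using a by (auto simp: F_def Q_def)
   qed
  qed (auto simp: F_def Q_def)
  hence "kvol (\<phi> ` A) = emeasure kmeasure (UN i:I. F i)" using F U by (subst klein_volume_emeasure[symmetric]) auto
  also have "... <= (SUM i:I. emeasure kmeasure (F i))" by (rule emeasure_subadditive_finite) (use F finI in auto)
  also have "... = (SUM i:I. kvol (F i))" using F by (intro sum.cong) (auto simp: klein_volume_emeasure)
  also have "... <= (SUM i:I. kvol (Q i (A, \<phi>)))" using F by (intro sum_mono) auto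
  finally show ?thesis .
 qed
 hence "(SUM (A, \<phi>):\<P>. kvol (\<phi> ` A)) <= (SUM P:\<P>. SUM i:I. kvol (Q i P))" by (intro sum_mono) auto
 also have "... = (SUM i:I. SUM P:\<P>. kvol (Q i P))" by (rule sum.swap)
 also have "... <= (SUM i:I. kvol cell)"
 proof (rule sum_mono)
  fix i assume i: "i : I"
  have "(SUM P:\<P>. kvol (Q i P)) = (SUM P:\<P>. emeasure kmeasure (Q i P))"
   using Q[OF i] by (intro sum.cong) (auto simp: klein_volume_emeasure)
  also have "... = emeasure kmeasure (UN P:\<P>. Q i P)"
  proof (rule sum_emeasure)
   show "disjoint_family_on (Q i) \<P>" using dis unfolding disjoint_family_on_def Q_def by blast
  qed (use Q[OF i] fin in auto)
  also have "... <= emeasure kmeasure cell" by (rule emeasure_mono) (use cell_borel in \<open>auto simp: Q_def\<close>)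
  also have "... = kvol cell" by (rule klein_volume_emeasure[symmetric]) (use cell_borel in \<open>auto simp: cell_def\<close>)
  finally show "(SUM P:\<P>. kvol (Q i P)) <= kvol cell" .
 qed
 also have "... = of_nat (card I) * kvol cell" by simp
 finally show "(SUM (A, \<phi>):\<P>. kvol (\<phi> ` A)) <= of_nat (card I) * kvol cell" .
qed

end

section \<open>The edge relations of a hyperbolic manifold\<close>

lemma act_commute:
 assumes c: "commuting f S T" and w: "w \<subseteq> T" and u: "u : T" and s: "s : S" shows "act f S w (f u s) = f u (act f S w s)" using c w
proof (induction w rule: commuting_induct)
 case (insert v w)
 have fs: "f u s : S" using c u s by (simp add: commuting_def)
 have "act f S (insert v w) (f u s) = f v (f u (act f S w s))" using act_insert[OF c insert(2,1,3) fs] insert by simp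
 also have "... = f u (f v (act f S w s))" using c u insert act_in[OF c insert(2) s] by (simp add: commuting_def)
 also have "f v (act f S w s) = act f S (insert v w) s" using act_insert[OF c insert(2,1,3) s] by simp
 finally show ?case .
qed simp

text \<open>The vector \<open>e\<close> is the pole of the wall. Equal distances to a piece of the
  wall put \<open>z'\<close> on the line through \<open>z\<close> and \<open>e\<close>; the value of
  \<open>hq z'\<close> then gives a quadratic equation for the ratio \<open>l\<close>, with root 1
  for \<open>z\<close> and the other root for its mirror image.\<close>

lemma mirror_points:
 fixes u y z z' :: "real ^ 'n"
 assumes u: "c^2 < u.*u" "c > 0" and z: "z : ub" "z' : ub" and y: "u.*y = c" and d: "d > 0"
  and B: "!!q. q : ball y d ==> u.*q = c ==> q : ub & kd z q = kd z' q" shows "z' = z | z' = hrefl u c z"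
proof -
 define l where "l = hq z' / hq z"
 have l: "l > 0" using hq_pos[OF z(1)] hq_pos[OF z(2)] by (simp add: l_def)
 define e where "e = (1/c) *\<^sub>R u"
 define b where "b = e - z' - l *\<^sub>R (e - z)"
 have bq: "b .* q = 0" if q: "q : ball y d" "u.*q = c" for q
 proof -
  have qb: "q : ub" "kd z q = kd z' q" using B[OF q] by auto
  hence "(1 - z.*q) / hq z / hq q = (1 - z'.*q) / hq z' / hq q" using z by (simp add: kd_eq_iff kch_def)
  hence "(1 - z.*q) / hq z = (1 - z'.*q) / hq z'" using hq_pos[OF qb(1)] by (metis divide_cancel_right less_irrefl)
  hence "(1 - z'.*q) = l * (1 - z.*q)" using hq_pos[OF z(2)] by (simp add: l_def field_simps)
  thus ?thesis using q u by (simp add: e_def b_def inner_diff_left)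
 qed
 define p where "p = b - ((u.*b)/(u.*u)) *\<^sub>R u"
 have up: "u.*p = 0" using u(1) by (simp add: p_def inner_diff_right)
 have yb: "b.*y = 0" using bq y d by simp
 have "p = 0"
 proof (rule ccontr)
  assume p: "p ~= 0"
  define q where "q = y + (d / (2 * norm p)) *\<^sub>R p"
  have "b .* p = 0" using p d y up bq[of q] yb by (simp add: q_def dist_norm mem_ball inner_add_right)
  moreover have "p.*p = b.*p - ((u.*b)/(u.*u)) * (u.*p)" by (simp add: p_def inner_diff_left)
  ultimately show False using p up by simp
 qed
 hence bu: "b = ((u.*b)/(u.*u)) *\<^sub>R u" by (simp add: p_def)
 hence "((u.*b)/(u.*u)) * c = 0" using yb y by (metis inner_scaleR_left)
 hence "b = 0" using bu u by auto
 moreover have "z' = e - l *\<^sub>R (e - z) - b" by (simp add: b_def)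
 ultimately have z': "z' = e - l *\<^sub>R (e - z)" by (simp only: diff_zero)
 have "1 - z'.*z' = l^2 * (1 - z.*z)" unfolding hq_power2[OF z(1), symmetric] hq_power2[OF z(2), symmetric] l_def
  using hq_pos[OF z(1)] by (simp add: power_divide)
 hence "1 - (e - l *\<^sub>R (e - z)) .* (e - l *\<^sub>R (e - z)) = l^2 * (1 - z.*z)" by (simp only: z'[symmetric])
 hence q: "(l - 1) * (l * (1 + e.*e - 2 * (e.*z)) - (e.*e - 1)) = 0"
  by (simp add: inner_diff_left inner_diff_right inner_commute[of z e] power2_eq_square algebra_simps)
 show ?thesis
 proof (cases "l = 1")
  case True
  thus ?thesis using z' by simp
 next
  case False
  define D where "D = u.*u + c^2 - 2*c*(u.*z)"
  have D: "D > 0" unfolding D_def by (rule hrefl_den_pos[OF u(1) z(1)])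
  have "c^2 * (l * (1 + e.*e - 2 * (e.*z))) = c^2 * (e.*e - 1)" using q False by simp
  moreover have "c^2 * (l * (1 + e.*e - 2 * (e.*z))) = l * D" "c^2 * (e.*e - 1) = u.*u - c^2"
   using u(2) by (simp_all add: e_def D_def power2_eq_square field_simps)
  ultimately have lD: "l * D = u.*u - c^2" by simp
  have "hrefl u c z = (1/D) *\<^sub>R ((l * D) *\<^sub>R z - (2*(u.*z - c)) *\<^sub>R u)" by (simp add: hrefl_def D_def[symmetric] lD)
  also have "... = l *\<^sub>R z - (2*(u.*z - c)/D) *\<^sub>R u" using D by (simp add: scaleR_diff_right)
  also have "2*(u.*z - c)/D = - (1 - l)/c" using lD D u(2) by (simp add: D_def algebra_simps power2_eq_square field_simps)
  also have "l *\<^sub>R z - (- (1 - l)/c) *\<^sub>R u = z'" by (simp add: z' e_def algebra_simps diff_divide_distrib)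
  finally show ?thesis by simp
 qed
qed

lemma linear_eq_on_open:
 fixes A B :: "real ^ 'n => real ^ 'n"
 assumes "linear A" "linear B" "open V" "V ~= {}" "!!z. z : V ==> A z = B z" shows "A = B"
proof
 fix h
 obtain z where z: "z : V" using assms by blast
 obtain e where e: "e > 0" "ball z e \<subseteq> V" using assms z open_contains_ball by blast
 show "A h = B h"
 proof (cases "h = 0")
  case True
  thus ?thesis using assms by (simp add: linear_0)
 next
  case False
  define k where "k = e / (2 * norm h)"
  have k: "k > 0" using e False by (simp add: k_def)
  have "A (z + k *\<^sub>R h) = B (z + k *\<^sub>R h)" using e assms by (simp add: dist_norm k_def mem_ball subset_iff)
  thus ?thesis using assms z k by (simp add: linear_add linear_scale)
 qed
qed

context right_angled begin

lemma off_facet: "u : N ==> v : N ==> u ~= v ==> u.*v <= c^2" using angles[of u v] cR by fastforce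

lemma facet_centre:
 assumes u: "u : N" shows "(c/R) *\<^sub>R u : cell" "u .* ((c/R) *\<^sub>R u) = c" "!!v. v : N ==> v ~= u ==> v .* ((c/R) *\<^sub>R u) < c"
proof -
 have R: "R > 0" using cR by (smt (verit) zero_le_power2)
 show 1: "u .* ((c/R) *\<^sub>R u) = c" using norm_N[OF u] R by simp
 show 2: "v .* ((c/R) *\<^sub>R u) < c" if "v : N" "v ~= u" for v
 proof -
  have "v.*u <= c^2" using off_facet that u by blast
  hence "(c/R) * (v.*u) < (c/R) * R" using cR c_pos R by (intro mult_strict_left_mono) auto
  thus ?thesis using R by simp
 qed
 have "((c/R) *\<^sub>R u) .* ((c/R) *\<^sub>R u) = c^2 / R" using norm_N[OF u] by (simp add: power2_eq_square)
 also have "... < 1" using cR R by simp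
 finally have n: "((c/R) *\<^sub>R u) .* ((c/R) *\<^sub>R u) < 1" .
 have "v .* ((c/R) *\<^sub>R u) <= c" if "v : N" for v
 proof (cases "v = u")
  case True
  show ?thesis unfolding True 1 by simp
 next
  case False
  show ?thesis by (rule less_imp_le[OF 2[OF that False]])
 qed
 thus "(c/R) *\<^sub>R u : cell" using n unfolding cell_def ball01_iff by blast
qed

lemma adjacent_facets_meet:
 assumes u: "u : N" "v : N" "u.*v = c^2"
 obtains x where "x : cell" "u : tight x" "v : tight x"
proof
 \<comment> \<open>The witness is the common point of the two walls nearest to 0.\<close>
 define k where "k = c / (R + c^2)"
 have R: "R + c^2 > 0" using cR by (smt (verit) zero_le_power2)
 have k: "k > 0" "k * (R + c^2) = c" using R c_pos by (auto simp: k_def)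
 define x where "x = k *\<^sub>R (u + v)"
 have ux: "u.*x = c" "v.*x = c" using u norm_N k by (simp_all add: x_def inner_add_right inner_commute add.commute)
 have "x.*x = k * ((u + v).*x)" by (subst (1) x_def) (simp only: inner_scaleR_left)
 also have "... = k * (u.*x + v.*x)" by (simp only: inner_add_left)
 also have "... = 2 * c^2 / (R + c^2)" by (simp add: ux k_def power2_eq_square)
 also have "... < 1" using cR R by simp
 finally have "x : ub" by (simp add: ball01_iff)
 moreover have "w.*x <= c" if w: "w : N" for w
 proof (cases "w = u | w = v")
  case False
  hence "k * (w.*u + w.*v) <= k * (R + c^2)" using off_facet[of w u] off_facet[of w v] w u cR k by (intro mult_left_mono) auto
  thus ?thesis using k by (simp add: x_def inner_add_right)
 qed (use ux in auto)
 ultimately show "x : cell" by (simp add: cell_def)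
 show "u : tight x" "v : tight x" using ux u by (auto simp: tight_def)
qed

end

text \<open>The converse situation: the quotient is assumed to be locally hyperbolic, and
  commutation and freeness are to be derived. \<open>no_fold\<close> expresses that no facet is
  paired with itself.\<close>

locale hyperbolic_gluing = prerealized N c R I nb tr X \<pi> for N :: "(real ^ 'n) set" and c R :: real and I :: "'i set"
  and nb :: "'i => real ^ 'n => 'i" and tr :: "'i => real ^ 'n => real ^ 'n => real ^ 'n"
  and X :: "'a metric" and \<pi> :: "'i \<times> (real ^ 'n) => 'a" +
 assumes charts: "!!p. p : mspace X ==> EX U (\<phi> :: 'a => real ^ 'n). p : U & hyperbolic_chart X U \<phi>"
  and no_fold: "!!i u. i : I ==> u : N ==> nb i u = i ==> tr i u u ~= u"
begin

lemma pt_wall: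
 assumes s: "s : states" and z: "z : cell" and u: "u : N" "u.*z = c" shows "\<pi> (pt (op u s) z) = \<pi> (pt s z)"
proof -
 obtain j A where jA: "s = (j, A)" "j : I" "A : syms" using s by (auto simp: states_def)
 have "chain (j, A z) (nb j (A u), tr j (A u) (A z)) 0"
  by (rule chain_jump1) (use jA u z in \<open>auto simp: syms_cell syms_N syms_inner\<close>)
 thus ?thesis using pi_eq by (fastforce simp: pt_def op_def jA)
qed

lemma pt_interior_inj:
 assumes "s : states" "s' : states" "z : inner_cell" "z' : cell" "\<pi> (pt s z) = \<pi> (pt s' z')" shows "pt s z = pt s' z'"
proof -
 obtain j A where s: "s = (j, A)" "j : I" "A : syms" using assms by (auto simp: states_def)
 obtain j' A' where s': "s' = (j', A')" "j' : I" "A' : syms" using assms by (auto simp: states_def)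
 have "u .* A z < c" if u: "u : N" for u
 proof -
  obtain v where "v : N" "u = A v" using u s by (auto simp: syms_def)
  thus ?thesis using assms s by (simp add: syms_inner inner_cell_def)
 qed
 hence "pt s' z' = (j, A z)" using assms s s' inner_cell_sub by (intro pi_interior) (auto simp: pt_def syms_cell)
 thus ?thesis by (simp add: pt_def s)
qed

section \<open>Developing the cells at a corner into a chart\<close>

context
 fixes i x U d e and \<phi> :: "'a => real ^ 'n"
 assumes i: "i : I" and x: "x : cell" and ch: "hyperbolic_chart X U \<phi>"
  and d: "!!b. b : mspace X ==> mdist X (\<pi> (i, x)) b < d ==> b : U"
  and e: "e > 0" "ball x e \<subseteq> KB x d"
begin

definition near :: "(real ^ 'n) set" where "near = cell \<inter> ball x e"
definition near0 :: "(real ^ 'n) set" where "near0 = inner_cell \<inter> ball x e"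
definition fol :: "'i \<times> (real ^ 'n => real ^ 'n) => real ^ 'n => real ^ 'n" where "fol s z = \<phi> (\<pi> (pt s z))"
text \<open>\<open>F\<close> describes where the chart sees the copy \<open>s\<close> of the cell
  near the corner; an isometry of the whole ball is used so that it can be composed with
  reflections.\<close>

definition developed :: "'i \<times> (real ^ 'n => real ^ 'n) => (real ^ 'n => real ^ 'n) => bool" where
 "developed s F \<longleftrightarrow> s : states & \<pi> (pt s x) = \<pi> (i, x) & (ALL z:near. fol s z = F z) &
  (EX \<sigma> G. hiso \<sigma> G & (ALL z:ub. F z = G z))"

lemma xub': "x : ub" using x cell_ub by simp

lemma near_sub: "near0 \<subseteq> near" "near \<subseteq> ub" "near \<subseteq> cell" "near0 \<subseteq> inner_cell" "near0 \<subseteq> ub"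
 using inner_cell_sub by (auto simp: near_def near0_def cell_def inner_cell_def)

lemma open_near0: "open near0" unfolding near0_def using open_inner_cell by blast

lemma near0_shrink:
 assumes "z : near" obtains t0 where "t0 > 0" "!!t. 0 < t ==> t < t0 ==> (1-t) *\<^sub>R z : near0"
proof -
 obtain \<delta> where \<delta>: "\<delta> > 0" "ball z \<delta> \<subseteq> ball x e" using assms open_contains_ball[of "ball x e"] by (auto simp: near_def)
 have zb: "z : ub" "z : cell" using assms near_sub by auto
 show ?thesis
 proof (rule that[of "min \<delta> 1"])
  fix t assume t: "0 < t" "t < min \<delta> 1"
  have "dist z ((1-t) *\<^sub>R z) = t * norm z" using t by (simp add: dist_norm algebra_simps)
  also have "... <= t * 1" using zb t by (intro mult_left_mono) (auto simp: mem_ball_0)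
  finally have "(1-t) *\<^sub>R z : ball x e" using t by (intro subsetD[OF \<delta>(2)]) (simp add: mem_ball)
  moreover have "norm ((1-t) *\<^sub>R z) <= norm z" using t by (simp add: mult_left_le_one_le)
  hence "(1-t) *\<^sub>R z : ub" using zb by (simp add: mem_ball_0)
  moreover have "u .* ((1-t) *\<^sub>R z) < c" if u: "u : N" for u
  proof -
   have "(1-t) * (u.*z) <= (1-t) * c" using zb t u by (intro mult_left_mono) (auto simp: cell_def)
   also have "... < c" using t c_pos by (simp add: algebra_simps)
   finally show ?thesis by simp
  qed
  ultimately show "(1-t) *\<^sub>R z : near0" by (simp add: near0_def inner_cell_def)
 qed (use \<delta> in simp)
qed

lemma x_near: "x : near" using x e by (simp add: near_def)

lemma near0_ne: "near0 ~= {}"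
proof -
 obtain t0 where t0: "t0 > 0" "!!t. 0 < t ==> t < t0 ==> (1-t) *\<^sub>R x : near0" using near0_shrink[OF x_near] by blast
 thus ?thesis using t0(2)[of "t0/2"] by fastforce
qed

lemma convex_near0: "convex near0"
 unfolding near0_def inner_cell_eq by (intro convex_Int convex_INT convex_ball convex_halfspace_lt)

lemma pt_U:
 assumes s: "s : states" "\<pi> (pt s x) = \<pi> (i, x)" and z: "z : near" shows "\<pi> (pt s z) : U"
proof -
 obtain j A where jA: "s = (j, A)" "j : I" "A : syms" using s by (auto simp: states_def)
 have zc: "z : cell" "z : KB x d" using z e by (auto simp: near_def)
 have "mdist X (\<pi> (j, A x)) (\<pi> (j, A z)) <= kd (A x) (A z)" by (rule mdist_segment) (use jA x zc in \<open>auto simp: syms_cell\<close>)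
 also have "... < d" using zc jA by (simp add: syms_kd KB_def)
 finally have "mdist X (\<pi> (i, x)) (\<pi> (pt s z)) < d" using s by (simp add: pt_def jA)
 moreover have "\<pi> (pt s z) : mspace X" using jA zc by (intro pi_in) (simp add: pt_def syms_cell)
 ultimately show ?thesis using d by blast
qed

lemma fol_kd:
 assumes s: "s : states" "\<pi> (pt s x) = \<pi> (i, x)" and s': "s' : states" "\<pi> (pt s' x) = \<pi> (i, x)"
  and z: "z : near" and z': "z' : near" shows "kd (fol s z) (fol s' z') = mdist X (\<pi> (pt s z)) (\<pi> (pt s' z'))" "fol s z : ub"
proof -
 show "kd (fol s z) (fol s' z') = mdist X (\<pi> (pt s z)) (\<pi> (pt s' z'))"
  using ch pt_U[OF s z] pt_U[OF s' z'] by (simp add: hyperbolic_chart_def fol_def)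
 show "fol s z : ub" using ch pt_U[OF s z] unfolding hyperbolic_chart_def fol_def by blast
qed

lemma fol_inj:
 assumes s: "s : states" "\<pi> (pt s x) = \<pi> (i, x)" and s': "s' : states" "\<pi> (pt s' x) = \<pi> (i, x)"
  and z: "z : near0" and z': "z' : near" and eq: "fol s z = fol s' z'" shows "pt s z = pt s' z'"
proof -
 have "\<pi> (pt s z) = \<pi> (pt s' z')"
  by (rule inj_onD[OF chart_inj[OF ch]]) (use eq pt_U[OF s] pt_U[OF s'] z z' near_sub in \<open>auto simp: fol_def\<close>)
 thus ?thesis by (rule pt_interior_inj[OF s(1) s'(1) subsetD[OF near_sub(4) z] subsetD[OF near_sub(3) z']])
qed

lemma fol_lipschitz:
 assumes s: "s : states" "\<pi> (pt s x) = \<pi> (i, x)" and z: "z : near" "z' : near" shows "kd (fol s z) (fol s z') <= kd z z'"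
proof -
 obtain j A where jA: "s = (j, A)" "j : I" "A : syms" using s by (auto simp: states_def)
 have "mdist X (\<pi> (j, A z)) (\<pi> (j, A z')) <= kd (A z) (A z')"
  by (rule mdist_segment) (use jA z near_sub in \<open>auto simp: syms_cell\<close>)
 thus ?thesis using fol_kd(1)[OF s s z] jA by (simp add: pt_def syms_kd)
qed

text \<open>Around an interior point a chain shorter than the direct distance would have to leave
  the cell, which \<open>chain_interior\<close> excludes for close points; so the quotient map is
  isometric there and \<open>kd_rigid\<close> applies.\<close>

lemma fol_local:
 assumes s: "s : states" "\<pi> (pt s x) = \<pi> (i, x)" and z0: "z0 : near0"
 obtains V \<sigma> G where "open V" "z0 : V" "V \<subseteq> near0" "hiso \<sigma> G" "!!z. z : V ==> fol s z = G z"
proof -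
 obtain j A where jA: "s = (j, A)" "j : I" "A : syms" using s by (auto simp: states_def)
 have z0b: "z0 : ub" "z0 : inner_cell" using z0 near_sub by auto
 obtain r where r: "r > 0" "KB z0 r \<subseteq> near0" using KB_small[OF z0b(1) open_near0 z0] by blast
 define V where "V = KB z0 (r/3)"
 have V: "open V" "z0 : V" "V \<subseteq> near0" "V \<subseteq> ub"
 proof -
  show "open V" unfolding V_def by (rule open_KB[OF z0b(1)])
  show "z0 : V" unfolding V_def by (rule centre_in_KB[OF z0b(1)]) (use r in simp)
  show "V \<subseteq> near0" "V \<subseteq> ub" using r by (auto simp: V_def KB_def)
 qed
 have iso: "kd (fol s z) (fol s z') = kd z z'" if z: "z : V" "z' : V" for z z'
 proof (rule antisym)
  have n: "z : near" "z' : near" using V near_sub z by blast+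
  have b: "z : ub" "z' : ub" using V z by blast+
  show "kd (fol s z) (fol s z') <= kd z z'" by (rule fol_lipschitz[OF s n])
  have "~ mdist X (\<pi> (j, A z)) (\<pi> (j, A z')) < kd z z'"
  proof
   assume "mdist X (\<pi> (j, A z)) (\<pi> (j, A z')) < kd z z'"
   then obtain l where l: "chain (j, A z) (j, A z') l" "l < kd z z'"
   proof (rule chain_less[rotated 2])
    show "(j, A z) : I \<times> cell" "(j, A z') : I \<times> cell" using n near_sub jA syms_cell by auto
   qed
   have int: "u .* w < c" if w: "w : KB (A z0) r" and u: "u : N" for w u
   proof -
    obtain w' where w': "w = A w'" using syms_surj[OF jA(3)] by metis
    obtain u' where u': "u' : N" "u = A u'" using u jA by (auto simp: syms_def)
    show ?thesis using w w' jA r near_sub u' by (auto simp: KB_def syms_kd syms_ub syms_inner inner_cell_def)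
   qed
   show False using chain_interior[OF l(1), of j "A z0" r] z kd_sym[of z z0] kd_triangle[OF b(1) z0b(1) b(2)] r z0b jA int l
    by (simp add: V_def KB_def syms_ub syms_kd)
  qed
  thus "kd z z' <= kd (fol s z) (fol s z')" unfolding fol_kd(1)[OF s s n] by (simp add: pt_def jA)
 qed
 have "fol s ` V \<subseteq> ub" using fol_kd(2)[OF s s] V near_sub by blast
 then obtain \<sigma> G where "hiso \<sigma> G" "!!z. z : V ==> fol s z = G z"
  using kd_rigid[OF V(1) _ V(4), of "fol s"] iso V(2) by (metis empty_iff)
 thus ?thesis using that V by blast
qed

text \<open>The local isometries agree on overlaps, hence on all of the convex set
  \<open>near0\<close>; as \<open>fol s\<close> does not increase distances, the formula passes to
  boundary points of the cell.\<close>

lemma developed_ex: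
 assumes s: "s : states" "\<pi> (pt s x) = \<pi> (i, x)"
 obtains \<sigma> G where "hiso \<sigma> G" "developed s G"
proof -
 obtain z1 where z1: "z1 : near0" using near0_ne by blast
 obtain V1 \<sigma> G where V1: "open V1" "z1 : V1" "V1 \<subseteq> near0" "hiso \<sigma> G" "!!z. z : V1 ==> fol s z = G z"
  using fol_local[OF s z1] by metis
 define P where "P = (%z. EX V. open V & z : V & V \<subseteq> near0 & (ALL y:V. fol s y = G y))"
 have "P z" if z: "z : near0" for z
 proof (rule connected_induction_simple[OF convex_connected[OF convex_near0] z1 z])
  show "P z1" using V1 by (auto simp: P_def)
  fix a assume a: "a : near0"
  obtain V \<tau> H where V: "open V" "a : V" "V \<subseteq> near0" "hiso \<tau> H" "!!z. z : V ==> fol s z = H z" using fol_local[OF s a] by metis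
  show "EX T. openin (top_of_set near0) T & a : T & (ALL x:T. ALL y:T. P x --> P y)"
  proof (intro exI[of _ V] conjI ballI impI V(2))
   show "openin (top_of_set near0) V" using V by (meson open_subset)
   fix y y' assume y: "y : V" "y' : V" "P y"
   obtain W where W: "open W" "y : W" "W \<subseteq> near0" "ALL z:W. fol s z = G z" using y(3) by (auto simp: P_def)
   have "G z = H z" if "z : ub" for z by (rule hiso_unique[OF V1(4) V(4), of "V \<inter> W"]) (use V W y near_sub that in auto)
   hence "ALL z:V. fol s z = G z" using V near_sub by auto
   thus "P y'" using V y by (auto simp: P_def)
  qed
 qed
 hence fG0: "fol s z = G z" if "z : near0" for z using that by (auto simp: P_def)
 have fG: "fol s z = G z" if z: "z : near" for z
 proof -
  obtain t0 where t0: "t0 > 0" "!!t. 0 < t ==> t < t0 ==> (1-t) *\<^sub>R z : near0" using near0_shrink[OF z] by blast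
  have zb: "z : ub" "fol s z : ub" "G z : ub" using z near_sub fol_kd(2)[OF s s z x_near] hiso_ball[OF V1(4)] by auto
  have "kd (fol s z) (G z) <= 0"
  proof (rule field_le_epsilon)
   fix \<epsilon> :: real assume \<epsilon>: "\<epsilon> > 0"
   have "open (KB z (\<epsilon>/2))" "z : KB z (\<epsilon>/2)" using open_KB[OF zb(1)] centre_in_KB[OF zb(1)] \<epsilon> by auto
   then obtain \<delta> where \<delta>: "\<delta> > 0" "ball z \<delta> \<subseteq> KB z (\<epsilon>/2)" using open_contains_ball by blast
   define t where "t = min t0 (min \<delta> 1) / 2"
   have t: "0 < t" "t < t0" "t < \<delta>" "t < 1" using t0 \<delta> by (auto simp: t_def min_def)
   let ?y = "(1-t) *\<^sub>R z"
   have y: "?y : near0" "?y : near" using t0 t near_sub by blast+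
   have "dist z ?y = t * norm z" using t by (simp add: dist_norm algebra_simps)
   also have "... <= t * 1" using zb t by (intro mult_left_mono) (auto simp: mem_ball_0)
   finally have "?y : KB z (\<epsilon>/2)" using t by (intro subsetD[OF \<delta>(2)]) (simp add: mem_ball)
   hence k: "kd z ?y < \<epsilon>/2" "?y : ub" by (auto simp: KB_def)
   have "kd (fol s z) (G z) <= kd (fol s z) (fol s ?y) + kd (fol s ?y) (G z)"
    using zb fol_kd(2)[OF s s y(2) x_near] by (intro kd_triangle)
   also have "kd (fol s ?y) (G z) = kd ?y z" unfolding fG0[OF y(1)] by (rule hiso_kd[OF V1(4) k(2) zb(1)])
   also have "kd (fol s z) (fol s ?y) <= kd z ?y" by (rule fol_lipschitz[OF s z y(2)])
   finally show "kd (fol s z) (G z) <= 0 + \<epsilon>" using k kd_sym[of z ?y] by simp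
  qed
  thus ?thesis using kd_nonneg[OF zb(2,3)] kd_zero_iff[OF zb(2,3)] by simp
 qed
 show ?thesis by (rule that[OF V1(4)]) (use s fG V1(4) in \<open>auto simp: developed_def\<close>)
qed

text \<open>The two copies share the facet \<open>u\<close>, on which their developments agree. By
  \<open>mirror_points\<close> the neighbour is therefore developed by \<open>F\<close> itself or by
  \<open>F\<close> after the reflection; the first would lay two copies over each other, against
  injectivity of the chart.\<close>

lemma developed_op:
 assumes dv: "developed s F" and u: "u : tight x" shows "developed (op u s) (%z. F (hrefl u c z))"
proof -
 have s: "s : states" "\<pi> (pt s x) = \<pi> (i, x)" and F: "!!z. z : near ==> fol s z = F z" using dv by (auto simp: developed_def)
 obtain \<sigma> G where G: "hiso \<sigma> G" "!!z. z : ub ==> F z = G z" using dv by (auto simp: developed_def)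
 have uN: "u : N" "u.*x = c" and us: "c^2 < u.*u" using u space_like by (auto simp: tight_def)
 have s': "op u s : states" "\<pi> (pt (op u s) x) = \<pi> (i, x)" using op_state[OF s(1) uN(1)] pt_wall[OF s(1) x uN] s by auto
 obtain \<sigma>' G' where G': "hiso \<sigma>' G'" "developed (op u s) G'" using developed_ex[OF s'] by metis
 hence G'f: "!!z. z : near ==> fol (op u s) z = G' z" by (auto simp: developed_def)
 define b where "b = (c/R) *\<^sub>R u"
 note fc = facet_centre[OF uN(1), folded b_def]
 define t where "t = min (1/2) (e/4)"
 have t: "0 < t" "t < 1" "t <= e/4" using e by (auto simp: t_def)
 \<comment> \<open>A point close to \<open>x\<close> that lies on the wall \<open>u\<close> and on
   no other wall.\<close>
 define y where "y = (1-t) *\<^sub>R x + t *\<^sub>R b"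
 have bb: "b : ub" using fc cell_ub by blast
 have uy: "u.*y = c" using uN fc by (simp add: y_def inner_add_right algebra_simps)
 have vy: "v.*y < c" if v: "v : N" "v ~= u" for v
 proof -
  have "(1-t) * (v.*x) + t * (v.*b) < (1-t) * c + t * c"
   using t x v fc(3)[OF v] by (intro add_le_less_mono mult_left_mono mult_strict_left_mono) (auto simp: cell_def)
  thus ?thesis by (simp add: y_def inner_add_right algebra_simps)
 qed
 have "x - y = t *\<^sub>R (x - b)" by (simp add: y_def algebra_simps)
 hence "dist x y = t * norm (x - b)" using t by (simp add: dist_norm)
 also have "... <= t * 2" using t xub' bb norm_triangle_ineq4[of x b] by (intro mult_left_mono) (auto simp: mem_ball_0)
 also have "... < e" using t by simp
 finally have ye: "y : ball x e" by (simp add: mem_ball)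
 \<comment> \<open>In this neighbourhood of \<open>y\<close> the value at \<open>u\<close> is
   strictly the largest of all wall values; this detects a symmetry that permutes walls.\<close>
 define Y where "Y = ub \<inter> ball x e \<inter> (INT v:N - {u}. {z. v.*z < c} \<inter> {z. (v - u).*z < 0})"
 have "open Y" unfolding Y_def using finN by (intro open_Int open_INT) (auto intro!: open_Int open_halfspace_lt)
 moreover have "y : Y" using convexD[OF convex_ball[of 0 1] xub' bb, of "1-t" t] t ye uy vy by (simp add: y_def Y_def inner_diff_left)
 ultimately obtain \<delta> where \<delta>: "\<delta> > 0" "ball y \<delta> \<subseteq> Y" using open_contains_ball by blast
 have Yn: "z : near" if "z : Y" "u.*z <= c" for z
  using that by (auto simp: Y_def near_def cell_def) (metis (no_types) DiffI less_imp_le singletonD)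
 have Yn0: "z : near0" if "z : Y" "u.*z < c" for z using that by (auto simp: Y_def near0_def inner_cell_def)
 have mir: "G' z = G (hrefl u c z)" if z: "z : ball y \<delta>" "u.*z < c" for z
 proof -
  have zY: "z : Y" using \<delta> z by blast
  have zn: "z : near0" "z : near" "z : ub" using Yn0[OF zY z(2)] near_sub by auto
  obtain H where H: "hiso \<sigma> H" "ALL x:ub. H (G x) = x & G (H x) = x" using hiso_inv[OF G(1)] by blast
  have G'z: "G' z : ub" using hiso_ball[OF G'(1) zn(3)] .
  have HG: "H (G' z) : ub" using hiso_ball[OF H(1) G'z] .
  have "H (G' z) = z | H (G' z) = hrefl u c z"
  proof (rule mirror_points[OF us c_pos zn(3) HG uy \<delta>(1)])
   fix q assume q: "q : ball y \<delta>" "u.*q = c"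
   hence qn: "q : near" using \<delta> Yn by auto
   hence qb: "q : ub" "q : cell" using near_sub by auto
   have "G' q = fol (op u s) q" using G'f[OF qn] by simp
   also have "... = fol s q" using pt_wall[OF s(1) qb(2) uN(1) q(2)] by (simp add: fol_def)
   also have "... = G q" using F[OF qn] G(2)[OF qb(1)] by simp
   finally have Gq: "G' q = G q" .
   have "kd z q = kd (G' z) (G q)" using hiso_kd[OF G'(1) zn(3) qb(1)] by (simp add: Gq)
   also have "... = kd (H (G' z)) (H (G q))" using hiso_kd[OF H(1) G'z hiso_ball[OF G(1) qb(1)]] by simp
   finally show "q : ub & kd z q = kd (H (G' z)) q" using H qb by simp
  qed
  \<comment> \<open>Otherwise \<open>z\<close> would be the same point of the same cell in both
    copies. By \<open>no_fold\<close> the gluing map then moves \<open>u\<close> to a different wall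
    \<open>v\<close> with the same value at \<open>z\<close>, which \<open>Y\<close>
    excludes.\<close>
  moreover have "H (G' z) ~= z"
  proof
   assume "H (G' z) = z"
   hence eq: "pt (op u s) z = pt s z" using H G'z G'f[OF zn(2)] F[OF zn(2)] G(2)[OF zn(3)] fol_inj[OF s' s zn(1,2)] by auto
   obtain j A where jA: "s = (j, A)" "j : I" "A : syms" using s by (auto simp: states_def)
   define u' where "u' = A u"
   have u': "u' : N" using jA uN syms_N by (simp add: u'_def)
   have e1: "nb j u' = j" "tr j u' (A z) = A z" using eq by (auto simp: pt_def op_def jA u'_def)
   obtain v where v: "v : N" "tr j u' u' = A v" using tr_N[OF jA(2) u'] u' jA by (auto simp: syms_def)
   have "v.*z = A v .* A z" using syms_inner[OF jA(3)] by simp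
   also have "... = tr j u' u' .* tr j u' (A z)" using v e1 by simp
   also have "... = u' .* A z" using syms_inner[OF tr_syms[OF jA(2) u']] .
   also have "... = u.*z" using syms_inner[OF jA(3)] by (simp add: u'_def)
   finally have "v.*z = u.*z" .
   moreover have "v ~= u" using no_fold[OF jA(2) u' e1(1)] v by (auto simp: u'_def)
   hence "(v - u).*z < 0" using zY v by (auto simp: Y_def)
   ultimately show False by (simp add: inner_diff_left)
  qed
  ultimately have "H (G' z) = hrefl u c z" by blast
  thus ?thesis using H G'z by metis
 qed
 have eqG: "G' z = G (hrefl u c z)" if "z : ub" for z
 proof (rule hiso_unique[OF G'(1) hiso.comp[OF G(1) hiso.hrefl[OF us]]])
  show "open (ball y \<delta> \<inter> {z. u.*z < c})" by (intro open_Int open_ball open_halfspace_lt)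
  show "ball y \<delta> \<inter> {z. u.*z < c} ~= {}"
  proof -
   have nu: "norm u > 0" using us by (metis inner_zero_left norm_eq_zero not_less zero_less_norm_iff zero_le_power2)
   define z where "z = y - (\<delta> / (2 * norm u)) *\<^sub>R u"
   have "dist y z = \<delta>/2" using nu \<delta> by (simp add: z_def dist_norm)
   moreover have "u.*z = c - \<delta> / (2 * norm u) * (u.*u)" by (simp add: z_def inner_diff_right uy)
   hence "u.*z < c" using nu \<delta> us by (smt (verit) divide_pos_pos mult_pos_pos zero_le_power2)
   ultimately have "z : ball y \<delta> \<inter> {z. u.*z < c}" using \<delta>(1) by (simp add: mem_ball)
   thus ?thesis by blast
  qed
  show "ball y \<delta> \<inter> {z. u.*z < c} \<subseteq> ub" using \<delta> by (auto simp: Y_def)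
 qed (use mir that in auto)
 show ?thesis unfolding developed_def
 proof (intro conjI s' ballI)
  fix z assume z: "z : near"
  thus "fol (op u s) z = F (hrefl u c z)" using near_sub G'f[OF z] eqG G(2)[OF hrefl_ball[OF us]] by auto
 next
  show "EX \<sigma> G. hiso \<sigma> G & (ALL z:ub. F (hrefl u c z) = G z)"
   using hiso.comp[OF G(1) hiso.hrefl[OF us]] G(2)[OF hrefl_ball[OF us]] by blast
 qed
qed

lemma developed_unique:
 assumes "developed s F" "developed s' F" shows "s = s'"
proof -
 have s: "s : states" "\<pi> (pt s x) = \<pi> (i, x)" "s' : states" "\<pi> (pt s' x) = \<pi> (i, x)" using assms by (auto simp: developed_def)
 have "pt s z = pt s' z" if z: "z : near0" for z
 proof (rule fol_inj[OF s(1,2,3,4) z])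
  show "z : near" using z near_sub by blast
  thus "fol s z = fol s' z" using assms by (simp add: developed_def)
 qed
 hence eq: "fst s = fst s'" "!!z. z : near0 ==> snd s z = snd s' z" using near0_ne by (auto simp: pt_def)
 have "snd s = snd s'" using s eq(2) open_near0 near0_ne
  by (intro linear_eq_on_open[of _ _ near0]) (auto simp: states_def syms_def orthogonal_transformation_linear)
 thus ?thesis using eq(1) by (simp add: prod_eq_iff)
qed

lemma developed_start: obtains F where "developed (i, id) F" using developed_ex[of "(i, id)"] i by (auto simp: pt_def)

lemma developed_cong: "developed s F ==> (!!z. z : ub ==> F z = F' z) ==> developed s F'"
 using near_sub by (auto simp: developed_def subset_iff)

text \<open>Reflections in walls through \<open>x\<close> commute, so both orders of crossing are
  developed by the same isometry, and a development determines its state.\<close>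

lemma op_comm_at:
 assumes "u : tight x" "v : tight x" shows "op u (op v (i, id)) = op v (op u (i, id))"
proof -
 obtain F where F: "developed (i, id) F" using developed_start by blast
 have 1: "developed (op u (op v (i, id))) (%z. F (hrefl v c (hrefl u c z)))"
  using developed_op[OF developed_op[OF F assms(2)] assms(1)] by simp
 have 2: "developed (op v (op u (i, id))) (%z. F (hrefl u c (hrefl v c z)))"
  using developed_op[OF developed_op[OF F assms(1)] assms(2)] by simp
 have comm: "hrefl u c (hrefl v c z) = hrefl v c (hrefl u c z)" if "z : ub" for z
  using refl_commuting[OF xub' order.refl] assms that by (simp add: commuting_def)
 have "developed (op v (op u (i, id))) (%z. F (hrefl v c (hrefl u c z)))" using developed_cong[OF 2] by (simp add: comm)
 thus ?thesis by (rule developed_unique[OF 1])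
qed

text \<open>If two sectors ended in the same cell with the same corner, an interior point of one
  copy near that corner would belong to the other copy as well. Injectivity of the development
  equates its two unfolded positions, and their signs at the walls give the same set.\<close>

lemma free_at:
 assumes c: "commuting op states (tight x)" and w: "w \<subseteq> tight x" "w' \<subseteq> tight x"
  and eq: "fst (act op states w (i, id)) = fst (act op states w' (i, id))"
   "snd (act op states w (i, id)) x = snd (act op states w' (i, id)) x" shows "w = w'"
proof -
 obtain F where F: "developed (i, id) F" using developed_start by blast
 define s0 where "s0 = (i, id :: real ^ 'n => real ^ 'n)"
 have s0: "developed s0 F" "s0 : states" using F i by (simp_all only: s0_def init_state)
 have dev: "developed (act op states w s0) (%z. F (mref w z))" if "w \<subseteq> tight x" for w using c that
 proof (induction w rule: commuting_induct)
  case empty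
  show ?case using s0 by simp
 next
  case (insert u w)
  have 1: "developed (op u (act op states w s0)) (%z. F (mref w (hrefl u c z)))" using developed_op[OF insert(4,1)] by simp
  have 2: "act op states (insert u w) s0 = op u (act op states w s0)" using act_insert[OF c insert(2,1,3) s0(2)] by simp
  show ?case unfolding 2
  proof (rule developed_cong[OF 1])
   fix z :: "real ^ 'n" assume z: "z : ub"
   show "F (mref w (hrefl u c z)) = F (mref (insert u w) z)"
    using act_commute[OF refl_commuting[OF xub' order.refl] insert(2,1) z] mref_insert[OF xub' order.refl insert(2,1,3) z] by (simp add: mref_def)
  qed
 qed
 obtain j A where s: "act op states w (i, id) = (j, A)" "j : I" "A : syms"
  using act_in[OF c w(1), of "(i, id)"] i by (auto simp: states_def)
 obtain j' A' where s': "act op states w' (i, id) = (j', A')" "A' : syms"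
  using act_in[OF c w(2), of "(i, id)"] i by (auto simp: states_def)
 obtain z where z: "z : near0" using near0_ne by blast
 obtain z' where z': "A' z' = A z" using syms_surj[OF s'(2)] by blast
 have zc: "z : ub" "z : inner_cell" "z : near" using z near_sub by auto
 have inn: "z' : inner_cell"
 proof -
  have "z' : ub" using z' zc syms_ub[OF s(3)] syms_ub[OF s'(2)] by metis
  moreover have "u.*z' < c" if u: "u : N" for u
  proof -
   obtain v where v: "v : N" "A' u = A v" using syms_N[OF s'(2) u] s by (auto simp: syms_def)
   have "u.*z' = A' u .* A' z'" using syms_inner[OF s'(2)] by simp
   also have "... = v.*z" unfolding z' v(2) by (rule syms_inner[OF s(3)])
   finally show ?thesis using v zc by (simp add: inner_cell_def)
  qed
  ultimately show ?thesis by (simp add: inner_cell_def)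
 qed
 have "norm (z' - x) = norm (z - x)"
 proof -
  have "norm (z' - x) = norm (A' z' - A' x)"
   using s'(2) by (metis (no_types, lifting) linear_diff mem_Collect_eq orthogonal_transformation_linear orthogonal_transformation_norm syms_def)
  also have "... = norm (A z - A x)" using z' eq(2) s s' by simp
  also have "... = norm (z - x)"
   using s(3) by (metis (no_types, lifting) linear_diff mem_Collect_eq orthogonal_transformation_linear orthogonal_transformation_norm syms_def)
  finally show ?thesis .
 qed
 hence zc': "z' : ub" "z' : inner_cell" "z' : near" using z inn near_sub by (auto simp: near0_def mem_ball dist_norm norm_minus_commute)
 have "F (mref w z) = F (mref w' z')" using eq(1) z' dev[OF w(1), unfolded s0_def] dev[OF w(2), unfolded s0_def] zc zc'
  unfolding s(1) s'(1) developed_def by (auto simp: pt_def fol_def)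
 moreover obtain \<sigma> G where G: "hiso \<sigma> G" "!!z. z : ub ==> F z = G z" using F by (auto simp: developed_def)
 moreover have mb: "mref w z : ub" "mref w' z' : ub" using mref_ub[OF xub' order.refl] w zc zc' by auto
 ultimately have m: "mref w z = mref w' z'" using hiso_inj[OF G(1)] by (simp add: inj_on_def)
 have "u : w \<longleftrightarrow> u : w'" if u: "u : tight x" for u
 proof -
  obtain k where k: "k > 0" "u .* mref w z - c = (if u : w then - k else k) * (u.*z - c)"
   using mref_wall[OF xub' order.refl w(1) u zc(1)] by blast
  obtain k' where k': "k' > 0" "u .* mref w' z' - c = (if u : w' then - k' else k') * (u.*z' - c)"
   using mref_wall[OF xub' order.refl w(2) u zc'(1)] by blast
  have p: "k * (u.*z - c) < 0" "k' * (u.*z' - c) < 0" using k(1) k'(1) zc zc' u tight_N by (auto simp: inner_cell_def mult_pos_neg)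
  show ?thesis using k(2) k'(2) m p by (auto split: if_splits)
 qed
 thus ?thesis using w by blast
qed

end

lemma nearby:
 assumes i: "i : I" and x: "x : cell"
 obtains U d e and \<phi> :: "'a => real ^ 'n" where "hyperbolic_chart X U \<phi>"
  "!!b. b : mspace X ==> mdist X (\<pi> (i, x)) b < d ==> b : U" "e > 0" "ball x e \<subseteq> KB x d"
proof -
 have p: "\<pi> (i, x) : mspace X" using pi_in i x by simp
 obtain U \<phi> where U: "\<pi> (i, x) : U" "hyperbolic_chart X U (\<phi> :: 'a => real ^ 'n)" using charts[OF p] by blast
 have Uo: "openin (mtopology_of X) U" using U by (simp add: hyperbolic_chart_def)
 obtain d where d: "d > 0" "Metric_space.mball (mspace X) (mdist X) (\<pi> (i, x)) d \<subseteq> U"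
  using iffD1[OF Metric_space.openin_mtopology[OF Metric_space_mspace_mdist] Uo[unfolded mtopology_of_def]] U(1) by metis
 have xb: "x : ub" using x cell_ub by simp
 obtain e where e: "e > 0" "ball x e \<subseteq> KB x d" using open_KB[OF xb] centre_in_KB[OF xb d(1)] open_contains_ball by blast
 show ?thesis
 proof (rule that)
  show "hyperbolic_chart X U \<phi>" "e > 0" "ball x e \<subseteq> KB x d" using U e by auto
  show "b : U" if "b : mspace X" "mdist X (\<pi> (i, x)) b < d" for b
   using d(2) p that by (auto simp: Metric_space.in_mball[OF Metric_space_mspace_mdist] subset_iff)
 qed
qed

lemma gluing: "gluing N c R I nb tr"
proof
 fix i u v assume *: "i : I" "u : N" "v : N" "u.*v = c^2"
 obtain x where x: "x : cell" "u : tight x" "v : tight x" using adjacent_facets_meet[OF *(2-4)] .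
 obtain U d e and \<phi> :: "'a => real ^ 'n" where n: "hyperbolic_chart X U \<phi>"
  "!!b. b : mspace X ==> mdist X (\<pi> (i, x)) b < d ==> b : U" "e > 0" "ball x e \<subseteq> KB x d" using nearby[OF *(1) x(1)] by metis
 show "op u (op v (i, id)) = op v (op u (i, id))" by (rule op_comm_at[OF *(1) x(1) n x(2,3)])
next
 fix i x w w' assume *: "i : I" "x : cell" and w: "w \<subseteq> tight x" "w' \<subseteq> tight x"
  and eq: "fst (act op states w (i, id)) = fst (act op states w' (i, id))"
   "snd (act op states w (i, id)) x = snd (act op states w' (i, id)) x"
 have comm: "op u (op v (j, id)) = op v (op u (j, id))" if j: "j : I" and uv: "u : N" "v : N" "u.*v = c^2" for j u v
 proof -
  obtain y where y: "y : cell" "u : tight y" "v : tight y" using adjacent_facets_meet[OF uv] .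
  obtain U d e and \<phi> :: "'a => real ^ 'n" where n: "hyperbolic_chart X U \<phi>"
   "!!b. b : mspace X ==> mdist X (\<pi> (j, y)) b < d ==> b : U" "e > 0" "ball y e \<subseteq> KB y d" using nearby[OF j y(1)] by metis
  show ?thesis by (rule op_comm_at[OF j y(1) n y(2,3)])
 qed
 have xb: "x : ub" using * cell_ub by blast
 have c: "commuting op states (tight x)" unfolding commuting_def
 proof (intro conjI ballI)
  fix u v s assume a: "u : tight x" "v : tight x" "s : states"
  show "op u (op v s) = op v (op u s)"
  proof (cases "u = v")
   case False
   hence uv: "u.*v = c^2" using tight_orth[OF xb a(1,2)] by simp
   obtain k A where s: "s = (k, A)" "k : I" "A : syms" using a by (auto simp: states_def)
   have A: "A u : N" "A v : N" "A u .* A v = c^2" using s a tight_N syms_N syms_inner uv by auto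
   have "op u (op v s) = (fst (op (A u) (op (A v) (k, id))), snd (op (A u) (op (A v) (k, id))) \<circ> A)" for u v
    by (simp add: s op_def comp_assoc)
   thus ?thesis using comm[OF s(2) A] by simp
  qed simp
 qed (use tight_fin op_state op_op tight_N in auto)
 obtain U d e and \<phi> :: "'a => real ^ 'n" where n: "hyperbolic_chart X U \<phi>"
  "!!b. b : mspace X ==> mdist X (\<pi> (i, x)) b < d ==> b : U" "e > 0" "ball x e \<subseteq> KB x d" using nearby[OF *] by metis
 show "w = w'" by (rule free_at[OF * n c w eq])
qed

end

section \<open>Isometries between facets\<close>

lemma gram_extend:
 fixes g :: "real ^ 'n => real ^ 'n"
 assumes span: "span S = UNIV" and g: "!!x y. x : S ==> y : S ==> g x .* g y = x .* y"
 obtains A where "orth A" "!!x. x : S ==> A x = g x"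
proof -
 obtain B where B: "B \<subseteq> S" "independent B" "S \<subseteq> span B" using maximal_independent_subset[of S] by blast
 have sB: "span B = UNIV" using B(1,3) span by (metis span_mono span_span top.extremum_uniqueI)
 define A where "A = construct B g"
 have lin: "linear A" unfolding A_def by (rule linear_construct[OF B(2)])
 have Ab: "A b = g b" if "b : B" for b unfolding A_def by (rule construct_basis[OF B(2) that])
 have bil: "bilinear (%x y. A x .* A y)" "bilinear (%x y :: real ^ 'n. x .* y)"
  using lin by (auto simp: bilinear_def linear_iff inner_add_left inner_add_right)
 have inner: "A x .* A y = x .* y" for x y
  by (rule bilinear_eq[OF bil, of UNIV B UNIV B]) (use sB B(1) Ab g in \<open>auto simp: subset_iff\<close>)
 hence orth: "orth A" using lin by (simp add: orthogonal_transformation_def)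
 show ?thesis
 proof (rule that[OF orth])
  fix x assume x: "x : S"
  have "(A x - g x) .* A z = 0" for z
  proof (rule linear_eq_on_span[of "%z. (A x - g x) .* A z" "%z. 0" B])
   show "linear (%z. (A x - g x) .* A z)" using lin by (auto simp: linear_iff inner_add_right)
   show "(A x - g x) .* A b = 0" if "b : B" for b
   proof -
    show ?thesis using inner[of x b] Ab[OF that] g[OF x, of b] that B(1) unfolding inner_diff_left by auto
   qed
  qed (use sB in \<open>auto simp: linear_iff\<close>)
  moreover obtain z where "A z = A x - g x" using orthogonal_transformation_surj[OF orth] by (metis surjD)
  ultimately have "(A x - g x) .* (A x - g x) = 0" by metis
  thus "A x = g x" by simp
 qed
qed

text \<open>\<open>second_layer\<close> says that a facet which does not meet a given facet is cut off by two of its neighbours.\<close>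

locale facet_symmetric = right_angled N c R for N :: "(real ^ 'n) set" and c R :: real +
 fixes \<mu> :: real
 assumes neg_N: "u : N ==> - u : N"
  and inner_N: "u : N ==> v : N ==> u = v | u = - v | u.*v = c^2 | u.*v = - (c^2)"
  and second_layer: "u : N ==> v : N ==> u.*v = - (c^2) ==>
   EX j:N. EX k:N. u.*j = c^2 & u.*k = c^2 & v = \<mu> *\<^sub>R (j + k) - u"
  and mu: "0 <= \<mu>" "\<mu> <= 1"
  and bounded: "(!!u. u : N ==> u.*x <= c) ==> norm x <= 1"
begin

definition poly :: "(real ^ 'n) set" where "poly = {x. ALL u:N. u.*x <= c}"
definition face :: "real ^ 'n => (real ^ 'n) set" where "face u = poly \<inter> {x. u.*x = c}"
definition adj :: "real ^ 'n => (real ^ 'n) set" where "adj u = {v:N. u.*v = c^2}"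
definition ctr :: "real ^ 'n => real ^ 'n" where "ctr u = (c/R) *\<^sub>R u"
definition rim :: "real ^ 'n => (real ^ 'n) set" where "rim u = {x : face u \<inter> ub. EX v:adj u. v.*x = c}"

lemma Rpos: "R > 0" using cR by (smt (verit) zero_le_power2)

lemma poly_cell: "poly \<inter> ub = cell" by (auto simp: poly_def cell_def)

lemma poly_cball: "poly \<subseteq> cball 0 1" using bounded by (auto simp: poly_def)

text \<open>A facet is cut out by its neighbours: \<open>second_layer\<close> bounds the value of
  each remaining normal by those of two adjacent ones.\<close>

lemma face_adj: assumes u: "u : N" "u.*x = c" and a: "!!v. v : adj u ==> v.*x <= c" shows "x : face u"
proof -
 have "v.*x <= c" if v: "v : N" for v
 proof -
  consider "u = v" | "u = - v" | "v : adj u" | "u.*v = - (c^2)" using inner_N[OF u(1) v] v by (auto simp: adj_def)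
  thus ?thesis
  proof cases
   case 4
   then obtain j k where jk: "j : adj u" "k : adj u" "v = \<mu> *\<^sub>R (j + k) - u" using second_layer[OF u(1) v] by (auto simp: adj_def)
   have "v.*x = \<mu> * (j.*x + k.*x) - c" unfolding jk(3) using u(2) by (simp add: inner_diff_left inner_add_left)
   also have "\<mu> * (j.*x + k.*x) <= \<mu> * (2 * c)" using a[OF jk(1)] a[OF jk(2)] mu by (intro mult_left_mono) auto
   also have "... <= 1 * (2 * c)" using mu c_pos by (intro mult_right_mono) auto
   finally show ?thesis by simp
  qed (use u a c_pos in auto)
 qed
 thus ?thesis using u by (simp add: face_def poly_def)
qed

lemma ctr_face: assumes "u : N" shows "ctr u : face u \<inter> ub" "!!v. v : N ==> v ~= u ==> v .* ctr u < c"
 using facet_centre[OF assms] poly_cell unfolding ctr_def face_def by auto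

lemma facets: "F facet_of poly \<longleftrightarrow> (EX u:N. F = face u)"
proof -
 define H where "H = (%u. {x. u.*x <= c}) ` N"
 define a where "a = (%h. SOME u. u : N & h = {x. u.*x <= c})"
 have inj: "u = v" if uv: "u : N" "v : N" "{x. u.*x <= c} \<subseteq> {x. v.*x <= c}" for u v
 proof (rule ccontr)
  assume ne: "u ~= v"
  have R: "R + c^2 > 0" using Rpos by (simp add: add_pos_nonneg)
  have "u .* ((c/R) *\<^sub>R v) <= c" using facet_centre(3)[OF uv(2,1)] ne by fastforce
  moreover have "{x. u.*x <= c} \<subseteq> {x. v.*x <= c}" by (rule uv)
  moreover have "u .* (((c/R) *\<^sub>R v) + e *\<^sub>R v) <= c ==> e <= 0" for e
  proof -
   assume "u .* (((c/R) *\<^sub>R v) + e *\<^sub>R v) <= c"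
   hence "v .* (((c/R) *\<^sub>R v) + e *\<^sub>R v) <= c" using uv(3) by blast
   thus "e <= 0" using norm_N[OF uv(2)] Rpos by (simp add: inner_add_right mult_le_0_iff)
  qed
  moreover have lt: "u .* ((c/R) *\<^sub>R v) < c" using facet_centre(3)[OF uv(2,1)] ne by fastforce
  ultimately have *: "!!e. u .* (((c/R) *\<^sub>R v) + e *\<^sub>R v) <= c ==> e <= 0" by blast
  define e where "e = (c - u .* ((c/R) *\<^sub>R v)) / (1 + \<bar>u.*v\<bar>)"
  have e: "e > 0" unfolding e_def using lt by (intro divide_pos_pos) auto
  have "e * (u.*v) <= e * (1 + \<bar>u.*v\<bar>)" using e by (intro mult_left_mono) auto
  also have "... = c - u .* ((c/R) *\<^sub>R v)" unfolding e_def by (simp add: add_nonneg_eq_0_iff)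
  finally have "u .* (((c/R) *\<^sub>R v) + e *\<^sub>R v) <= c" by (simp add: inner_add_right)
  thus False using * e by fastforce
 qed
 have a: "a {x. u.*x <= c} = u" if "u : N" for u
 proof -
  have "EX v. v : N & {x. u.*x <= c} = {x. v.*x <= c}" using that by blast
  hence "a {x. u.*x <= c} : N & {x. u.*x <= c} = {x. a {x. u.*x <= c} .* x <= c}" unfolding a_def by (rule someI_ex)
  thus ?thesis using inj[of u "a {x. u.*x <= c}"] that by (metis order.refl)
 qed
 have "ball 0 (c / (1 + sqrt R)) \<subseteq> poly"
 proof
  fix x :: "real ^ 'n" assume "x : ball 0 (c / (1 + sqrt R))"
  hence x: "norm x < c / (1 + sqrt R)" by (simp add: mem_ball_0)
  show "x : poly" unfolding poly_def mem_Collect_eq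
  proof
   fix u assume u: "u : N"
   have "u.*x <= norm u * norm x" by (rule norm_cauchy_schwarz)
   also have "norm u = sqrt R" using norm_N[OF u] by (simp add: norm_eq_sqrt_inner)
   also have "sqrt R * norm x <= (1 + sqrt R) * norm x" by (intro mult_right_mono) auto
   also have "... <= (1 + sqrt R) * (c / (1 + sqrt R))" using x Rpos by (intro mult_left_mono) auto
   also have "... = c" using Rpos by (simp add: add_nonneg_eq_0_iff)
   finally show "u.*x <= c" .
  qed
 qed
 moreover have "c / (1 + sqrt R) > 0" using c_pos Rpos by (intro divide_pos_pos) (auto intro: add_pos_nonneg)
 ultimately have "interior poly ~= {}" by (metis ball_eq_empty interior_maximal open_ball subset_empty not_le)
 hence aff: "affine hull poly = UNIV" by (rule affine_hull_nonempty_interior)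
 have "F facet_of poly \<longleftrightarrow> (EX h. h : H & F = poly \<inter> {x. a h .* x = c})"
 proof (rule facet_of_polyhedron_explicit[of H poly a "%_. c"])
  show "finite H" using finN by (simp add: H_def)
  show "poly = affine hull poly \<inter> \<Inter> H" unfolding aff by (auto simp: poly_def H_def)
  fix h assume "h : H"
  then obtain u where u: "u : N" "h = {x. u.*x <= c}" by (auto simp: H_def)
  thus "a h ~= 0 & h = {x. a h .* x <= c}" using a[OF u(1)] norm_N[OF u(1)] Rpos by auto
 next
  \<comment> \<open>Irredundancy of the description: a point slightly beyond the centre of the facet
    \<open>u\<close> violates this wall only.\<close>
  fix H' assume H': "H' \<subset> H"
  then obtain u where u: "u : N" "{x. u.*x <= c} ~: H'" by (auto simp: H_def)
  define V where "V = (INT v:N - {u}. {x. v.*x < c})"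
  have "open V" unfolding V_def using finN by (intro open_INT) (auto intro: open_halfspace_lt)
  moreover have cV: "ctr u : V" using ctr_face(2)[OF u(1)] by (simp add: V_def)
  ultimately obtain e where e: "e > 0" "ball (ctr u) e \<subseteq> V" by (meson openE)
  have un: "norm u > 0" using norm_N[OF u(1)] Rpos by auto
  define y where "y = ctr u + (e / (2 * norm u)) *\<^sub>R u"
  have "y : V" using e by (intro subsetD[OF e(2)]) (simp add: y_def dist_norm mem_ball)
  hence "y : \<Inter> H'" using H' u by (force simp: V_def H_def)
  moreover have "u.*y = c + e / (2 * norm u) * R"
   using ctr_face(1)[OF u(1)] norm_N[OF u(1)] by (simp add: y_def inner_add_right face_def)
  hence "u.*y > c" using e un Rpos by simp
  hence "y ~: poly" using u(1) by (auto simp: poly_def not_le)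
  moreover have "poly \<subseteq> \<Inter> H'" using H' by (auto simp: poly_def H_def)
  ultimately show "poly \<subset> affine hull poly \<inter> \<Inter> H'" unfolding aff by blast
 qed
 thus ?thesis using a by (auto simp: H_def face_def)
qed

lemma span_N: "span N = UNIV"
proof (rule ccontr)
 assume "span N ~= UNIV"
 then obtain a where a: "a ~= 0" "ALL x:span N. a.*x = 0" using span_not_UNIV_orthogonal by blast
 have "norm ((2 / norm a) *\<^sub>R a) <= 1" using a c_pos by (intro bounded) (simp add: span_base inner_commute)
 thus False using a by simp
qed

text \<open>The foot of the perpendicular from 0, and also from \<open>ctr u\<close>, to the
  intersection of the walls \<open>u\<close> and \<open>v\<close>.\<close>

definition foot :: "real ^ 'n => real ^ 'n => real ^ 'n" where "foot u v = (c / (R + c^2)) *\<^sub>R (u + v)"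

lemma R2: "R + c^2 > 0" using Rpos by (simp add: add_pos_nonneg)

lemma adj_N: "v : adj u ==> v : N" "v : adj u ==> u.*v = c^2" by (auto simp: adj_def)

lemma foot_inner:
 assumes u: "u : N" and v: "v : adj u" shows "u .* foot u v = c" "v .* foot u v = c" "foot u v .* foot u v = 2 * c^2 / (R + c^2)"
proof -
 have *: "u.*u = R" "v.*v = R" "u.*v = c^2" "v.*u = c^2" using u v norm_N by (auto simp: adj_def inner_commute)
 show "u .* foot u v = c" "v .* foot u v = c" using R2 by (simp_all add: foot_def inner_add_right * add.commute)
 hence "(c / (R + c^2)) * ((u + v) .* foot u v) = 2 * c^2 / (R + c^2)" by (simp add: inner_add_left power2_eq_square)
 thus "foot u v .* foot u v = 2 * c^2 / (R + c^2)" by (simp add: foot_def)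
qed

lemma rim_norm:
 assumes u: "u : N" "u.*x = c" and v: "v : adj u" "v.*x = c"
 shows "x.*x >= 2 * c^2 / (R + c^2)" "x.*x = 2 * c^2 / (R + c^2) ==> x = foot u v"
proof -
 have "foot u v .* x = 2 * c^2 / (R + c^2)" using u v by (simp add: foot_def inner_add_left power2_eq_square)
 hence e: "(x - foot u v) .* (x - foot u v) = x.*x - 2 * c^2 / (R + c^2)"
  using foot_inner(3)[OF u(1) v(1)] by (simp add: inner_diff_left inner_diff_right inner_commute)
 show "x.*x >= 2 * c^2 / (R + c^2)" using e inner_ge_zero[of "x - foot u v"] by linarith
 show "x = foot u v" if "x.*x = 2 * c^2 / (R + c^2)" using e that by simp
qed

lemma foot_rim: assumes u: "u : N" and v: "v : adj u" shows "foot u v : rim u"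
proof -
 have "w .* foot u v <= c" if w: "w : adj u" for w
 proof (cases "w = v")
  case False
  hence "w.*v <= c^2" using off_facet v w adj_N by blast
  hence "(c / (R + c^2)) * (w.*u + w.*v) <= (c / (R + c^2)) * (R + c^2)"
   using w cR c_pos R2 by (intro mult_left_mono) (auto simp: adj_def inner_commute)
  thus ?thesis using R2 by (simp add: foot_def inner_add_right)
 qed (use foot_inner u v in auto)
 hence "foot u v : face u" using face_adj foot_inner u v by blast
 moreover have "foot u v : ub" unfolding ball01_iff foot_inner(3)[OF u v] using R2 cR by simp
 ultimately show ?thesis using foot_inner(2)[OF u v] v by (auto simp: rim_def)
qed

section \<open>Recognising the centre of a facet by its distances to the rim\<close>

lemma ctr_inner: "u : N ==> u.*x = c ==> ctr u .* x = c^2 / R" "u : N ==> ctr u .* ctr u = c^2 / R"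
 using norm_N by (auto simp: ctr_def power2_eq_square)

lemma kch_ctr: assumes u: "u : N" "u.*x = c" shows "kch (ctr u) x = sqrt (1 - c^2 / R) / hq x"
proof -
 have "kch (ctr u) x = (1 - c^2/R) / (sqrt (1 - c^2/R) * hq x)" using ctr_inner u by (simp add: kch_def hq_def)
 also have "... = sqrt (1 - c^2 / R) / hq x" using cR Rpos by (simp add: real_div_sqrt flip: divide_divide_eq_left)
 finally show ?thesis .
qed

text \<open>The hyperbolic cosine of the inradius of a facet, i.e. of the distance from its centre
  to the feet.\<close>

definition kap :: real where "kap = sqrt (1 - c^2 / R) / sqrt (1 - 2 * c^2 / (R + c^2))"

lemma kap2: "kap^2 = 1 + c^2 / R" "kap > 0" using cR R2 by (auto simp: kap_def field_simps power_divide)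

lemma kch_ctr_rim: assumes "u : N" "x : rim u" shows "kch (ctr u) x >= kap"
 "kch (ctr u) x = kap \<longleftrightarrow> (EX v:adj u. x = foot u v)"
proof -
 obtain v where v: "v : adj u" "v.*x = c" and ux: "u.*x = c" and xb: "x : ub" using assms by (auto simp: rim_def face_def)
 have h: "1 - c^2 / R > 0" using cR Rpos by simp
 have p: "hq x > 0" "hq x <= sqrt (1 - 2 * c^2 / (R + c^2))"
  using hq_pos[OF xb] rim_norm(1)[OF assms(1) ux v] by (auto simp: hq_def)
 hence "0 < sqrt (1 - 2 * c^2 / (R + c^2))" by linarith
 thus "kch (ctr u) x >= kap" unfolding kch_ctr[OF assms(1) ux] kap_def using p h by (intro divide_left_mono mult_pos_pos) auto
 show "kch (ctr u) x = kap \<longleftrightarrow> (EX v:adj u. x = foot u v)"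
 proof
  assume "kch (ctr u) x = kap"
  thus "EX v:adj u. x = foot u v" using p rim_norm(2)[OF assms(1) ux v] v unfolding kch_ctr[OF assms(1) ux] kap_def
   by (auto simp: field_simps hq_def)
 next
  assume "EX v:adj u. x = foot u v"
  thus "kch (ctr u) x = kap" using foot_inner(3) assms unfolding kch_ctr[OF assms(1) ux] kap_def by (auto simp: hq_def)
 qed
qed

text \<open>Foot of the perpendicular from a point of a facet to an edge of that facet.\<close>

lemma rim_distance:
 assumes u: "u : N" and v: "v : adj u" and x: "x : face u \<inter> ub"
 obtains y where "y : rim u" "(kch x y)^2 = 1 + (c - v.*x)^2 / ((R - c^2) * (1 - x.*x))"
proof -
 have xp: "w.*x <= c" if "w : N" for w using x that by (simp add: face_def poly_def)
 have R1: "R - c^2 > 0" using cR by simp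
 define k where "k = (c - v.*x) / (R - c^2)"
 have k: "k >= 0" "k * (R - c^2) = c - v.*x" using xp[of v] v R1 by (auto simp: k_def adj_def)
 have kc: "1 + k * c > 0" using k c_pos by (simp add: add_pos_nonneg)
 define y where "y = (1 / (1 + k * c)) *\<^sub>R (x + k *\<^sub>R v)"
 have iy: "w.*y = (w.*x + k * (w.*v)) / (1 + k * c)" for w by (simp add: y_def inner_add_right)
 have vy: "v.*y = c"
 proof -
  have "v.*x + k * (v.*v) = c * (1 + k * c)" using k(2) norm_N[of v] v by (simp add: adj_def algebra_simps power2_eq_square)
  thus ?thesis unfolding iy using kc by simp
 qed
 have uy: "u.*y = c"
 proof -
  have "u.*x + k * (u.*v) = c * (1 + k * c)" using x v by (simp add: face_def adj_def algebra_simps power2_eq_square)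
  thus ?thesis unfolding iy using kc by simp
 qed
 have wy: "w.*y <= c" if w: "w : N" for w
 proof (cases "w = v")
  case False
  hence "k * (w.*v) <= k * c^2" using off_facet[OF w _ False] v k by (intro mult_left_mono) (auto simp: adj_def)
  thus ?thesis using xp[OF w] kc unfolding iy by (simp add: algebra_simps power2_eq_square divide_le_eq)
 qed (use vy in simp)
 define D where "D = 1 - x.*x + k^2 * (R - c^2)"
 have xb: "1 - x.*x > 0" using x by (simp add: ball01_iff)
 have D: "D > 0" unfolding D_def using xb R1 by (simp add: add_pos_nonneg)
 have xy: "x.*y = (x.*x + k * (v.*x)) / (1 + k * c)" unfolding iy by (simp add: inner_commute)
 have e1: "(1 + k * c) - (x.*x + k * (v.*x)) = D"
 proof -
  have "k^2 * (R - c^2) = k * (c - v.*x)" using k(2) by (simp add: power2_eq_square)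
  thus ?thesis by (simp add: D_def algebra_simps)
 qed
 have "1 - x.*y = ((1 + k * c) - (x.*x + k * (v.*x))) / (1 + k * c)" unfolding xy using kc by (simp add: field_simps)
 hence n1: "1 - x.*y = D / (1 + k * c)" unfolding e1 .
 have yy: "y.*y * (1 + k * c) = y.*x + k * c" using iy[of y] kc unfolding inner_commute[of y v] vy by (simp add: eq_divide_eq)
 have "(1 - y.*y) * (1 + k * c) = 1 - x.*y" using yy by (simp add: algebra_simps inner_commute)
 hence "1 - y.*y = (D / (1 + k * c)) / (1 + k * c)" unfolding n1 using kc by (subst eq_divide_eq) simp
 hence n2: "1 - y.*y = D / (1 + k * c)^2" by (simp add: power2_eq_square)
 have yb: "y : ub" unfolding ball01_iff using n2 D kc by (metis diff_gt_0_iff_gt divide_pos_pos zero_less_power)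
 have "(kch x y)^2 = (1 - x.*y)^2 / ((1 - x.*x) * (1 - y.*y))"
  using xb yb by (simp add: kch_def power_divide power_mult_distrib hq_def ball01_iff)
 also have "... = D / (1 - x.*x)" unfolding n1 n2 using kc by (simp add: power2_eq_square)
 also have "... = 1 + k^2 * (R - c^2) / (1 - x.*x)" unfolding D_def using xb by (simp add: add_divide_distrib)
 also have "k^2 * (R - c^2) = (c - v.*x)^2 / (R - c^2)" unfolding k_def using R1 by (simp add: power_divide power2_eq_square)
 finally have "(kch x y)^2 = 1 + (c - v.*x)^2 / ((R - c^2) * (1 - x.*x))" by simp
 moreover have "y : rim u" using wy uy yb vy v by (auto simp: face_def poly_def rim_def)
 ultimately show ?thesis by (rule that[rotated])
qed

text \<open>Otherwise the facet would reach, in the direction \<open>w\<close>, a point outside the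
  closed unit ball, against \<open>bounded\<close>. The constant is the slope for which the wall is
  met exactly where the ray from \<open>ctr u\<close> hits the unit sphere.\<close>

lemma steep:
 assumes u: "u : N" and w: "w ~= 0" "u.*w = 0" shows "EX v:adj u. v.*w >= c * sqrt (1 - c^2/R) * norm w"
proof (rule ccontr)
 define h where "h = sqrt (1 - c^2/R)"
 have h: "h > 0" "h^2 = 1 - c^2/R" using cR Rpos by (auto simp: h_def)
 assume "~ (EX v:adj u. v.*w >= c * sqrt (1 - c^2/R) * norm w)"
 hence lt: "v.*w < c * h * norm w" if "v : adj u" for v using that h_def by force
 define w0 where "w0 = (h / norm w) *\<^sub>R w"
 define V where "V = (INT v:adj u. {x. v.*x < c * h^2})"
 have "open V" unfolding V_def using finN by (intro open_INT) (auto intro: open_halfspace_lt simp: adj_def)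
 moreover have "v.*w0 < c * h^2" if "v : adj u" for v
 proof -
  have "v.*w0 = (h / norm w) * (v.*w)" by (simp add: w0_def)
  also have "... < (h / norm w) * (c * h * norm w)" using lt[OF that] h w by (intro mult_strict_left_mono) auto
  also have "... = c * h^2" using w by (simp add: power2_eq_square)
  finally show ?thesis .
 qed
 hence "w0 : V" by (simp add: V_def)
 ultimately obtain e where e: "e > 0" "ball w0 e \<subseteq> V" by (meson openE)
 have nw: "norm w0 = h" using w h by (simp add: w0_def)
 define s where "s = 1 + e / (2 * h)"
 have s: "s > 1" using e h by (simp add: s_def)
 have "dist w0 (s *\<^sub>R w0) = norm ((s - 1) *\<^sub>R w0)" by (simp add: dist_norm norm_minus_commute algebra_simps)
 also have "... = e / 2" using nw e h by (simp add: s_def)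
 finally have "s *\<^sub>R w0 : V" using e by (intro subsetD[OF e(2)]) (simp add: mem_ball)
 hence sV: "v .* (s *\<^sub>R w0) < c * h^2" if "v : adj u" for v using that by (simp add: V_def)
 define x where "x = ctr u + s *\<^sub>R w0"
 have ux: "u.*x = c" using ctr_face(1)[OF u] w by (simp add: x_def inner_add_right w0_def face_def)
 have "v.*x <= c" if v: "v : adj u" for v
  using v sV by (fastforce simp: ctr_def adj_def inner_commute x_def inner_add_right h algebra_simps)
 hence "x.*x <= 1" using face_adj[OF u ux] poly_cball by (auto simp: face_def norm_eq_sqrt_inner)
 moreover have "ctr u .* w0 = 0" using w by (simp add: ctr_def w0_def)
 hence "x.*x = c^2/R + s^2 * (w0.*w0)" using ctr_inner(2)[OF u]
  by (simp add: x_def inner_add_left inner_add_right inner_commute power2_eq_square)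
 moreover have "w0.*w0 = h^2" using nw by (simp flip: power2_norm_eq_inner)
 moreover have "s^2 * h^2 > 1 * h^2" using s h(1) by (intro mult_strict_right_mono) (auto simp: power2_eq_square less_1_mult)
 ultimately show False using h(2) by simp
qed

text \<open>For any other point a wall that is steep in the direction away from the centre comes
  closer than the inradius. This characterises the centre by distances, so facet isometries preserve
  it.\<close>

lemma incentre_unique:
 assumes u: "u : N" and x: "x : face u \<inter> ub" and far: "!!y. y : rim u ==> kch x y >= kap" shows "x = ctr u"
proof (rule ccontr)
 assume ne: "x ~= ctr u"
 define h where "h = sqrt (1 - c^2/R)"
 have h: "h > 0" "h^2 = 1 - c^2/R" using cR Rpos by (auto simp: h_def)
 define w where "w = x - ctr u"
 have w: "w ~= 0" "u.*w = 0" using ne x ctr_face(1)[OF u] by (auto simp: w_def inner_diff_right face_def)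
 obtain v where v: "v : adj u" "v.*w >= c * h * norm w" using steep[OF u w] h_def by metis
 have xx: "x.*x = c^2/R + (norm w)^2"
 proof -
  have "x = ctr u + w" by (simp add: w_def)
  thus ?thesis using w ctr_inner(2)[OF u] by (simp add: ctr_def inner_add_left inner_add_right inner_commute power2_norm_eq_inner)
 qed
 \<comment> \<open>The offset from the centre measured against the distance \<open>h\<close> from
   there to the unit sphere; the estimates end in \<open>1 <= (1 - t)^2 / (1 - t^2)\<close>,
   impossible for 0 < t < 1.\<close>
 define t where "t = norm w / h"
 have t: "t > 0" "norm w = t * h" using w h by (auto simp: t_def)
 have h1: "1 - x.*x = h^2 * (1 - t^2)" using h by (simp add: xx t(2) algebra_simps power_mult_distrib)
 have t1: "t^2 < 1" using x h1 by (simp add: ball01_iff) (smt (verit) mult_nonneg_nonpos zero_le_power2)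
 have "v.*x = c * (c^2 / R) + v.*w" using v by (simp add: ctr_def adj_def inner_commute w_def inner_diff_right)
 moreover have "c * h * norm w = c * h^2 * t" unfolding t(2) by (simp add: power2_eq_square)
 moreover have "c - c * (c^2 / R) = c * h^2" unfolding h by (simp add: algebra_simps)
 moreover have "c * h^2 * (1 - t) = c * h^2 - c * h^2 * t" by (simp add: right_diff_distrib)
 ultimately have le: "c - v.*x <= c * h^2 * (1 - t)" using v(2) by linarith
 have ge: "c - v.*x >= 0" using x v by (simp add: face_def poly_def adj_def)
 obtain y where y: "y : rim u" "(kch x y)^2 = 1 + (c - v.*x)^2 / ((R - c^2) * (1 - x.*x))" by (rule rim_distance[OF u v(1) x])
 have "kap^2 <= (kch x y)^2" using far[OF y(1)] kap2(2) by (intro power_mono) auto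
 hence "c^2 / R <= (c - v.*x)^2 / ((R - c^2) * (1 - x.*x))" using y(2) kap2(1) by simp
 also have "... <= (c * h^2 * (1 - t))^2 / ((R - c^2) * (1 - x.*x))"
  using le ge x cR by (intro divide_right_mono power_mono) (auto simp: ball01_iff)
 also have "R - c^2 = R * h^2" unfolding h using Rpos by (simp add: field_simps)
 also have "(c * h^2 * (1 - t))^2 / (R * h^2 * (1 - x.*x)) = c^2 / R * ((1 - t)^2 / (1 - t^2))"
  using h(1) by (simp add: power_mult_distrib power2_eq_square mult_ac h1)
 finally have "(c^2 / R) * 1 <= (c^2 / R) * ((1 - t)^2 / (1 - t^2))" by simp
 moreover have "c^2 / R > 0" using c_pos Rpos by simp
 ultimately have "1 <= (1 - t)^2 / (1 - t^2)" using mult_le_cancel_left_pos by blast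
 hence "t * (1 - t) <= 0" using t1 by (simp add: power2_eq_square algebra_simps)
 thus False using t1 t by (simp add: power2_less_1_iff mult_le_0_iff)
qed

section \<open>Facet isometries respect the rim and extend linearly\<close>

definition relint :: "real ^ 'n => (real ^ 'n) set" where
 "relint u = {x : ub. u.*x = c & (ALL v:adj u. v.*x < c)}"

lemma relint_eq: assumes "u : N" shows "relint u = face u \<inter> ub - rim u"
proof -
 have "x : face u" if "x : relint u" for x using that by (intro face_adj[OF assms]) (auto simp: relint_def less_imp_le)
 moreover have "v.*x <= c" if "x : face u" "v : adj u" for x v using that by (auto simp: face_def poly_def adj_def)
 ultimately show ?thesis by (auto simp: relint_def rim_def face_def order.strict_iff_order)
qed

text \<open>By invariance of domain the image of the relative interior is open in the plane of the
  other facet, and no rim point has a neighbourhood in that plane contained in the facet.\<close>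

lemma relint_image:
 assumes u: "u : N" and v: "v : N" and g: "inj_on g (face u \<inter> ub)" "g ` (face u \<inter> ub) \<subseteq> face v \<inter> ub"
  and iso: "!!x y. x : face u \<inter> ub ==> y : face u \<inter> ub ==> kd (g x) (g y) = kd x y" shows "g ` relint u \<subseteq> relint v"
proof -
 have sub: "relint u \<subseteq> face u \<inter> ub" using relint_eq[OF u] by blast
 define U where "U = {x. u.*x = c}"
 define V where "V = {x. v.*x = c}"
 have nz: "u ~= 0" "v ~= 0" using norm_N[OF u] norm_N[OF v] Rpos by auto
 have eq: "relint u = U \<inter> (ub \<inter> (INT w:adj u. {x. w.*x < c}))" by (auto simp: relint_def U_def)
 have "openin (top_of_set U) (relint u)" unfolding eq using finN
  by (intro openin_open_Int open_Int open_INT) (auto simp: adj_def intro: open_halfspace_lt)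
 moreover have "affine U" "affine V" by (auto simp: U_def V_def affine_hyperplane)
 moreover have "aff_dim V <= aff_dim U" using nz by (simp add: U_def V_def)
 moreover have "continuous_on (relint u) g" unfolding continuous_on_iff
 proof (intro ballI allI impI)
  fix x and e :: real assume x: "x : relint u" and e: "e > 0"
  have xf: "x : face u \<inter> ub" "g x : ub" using x sub g(2) by (blast, blast)
  have "g x : ball (g x) e" using e by (simp add: mem_ball)
  then obtain r where r: "r > 0" "KB (g x) r \<subseteq> ball (g x) e" using KB_small[OF xf(2) open_ball] by blast
  obtain d where d: "d > 0" "ball x d \<subseteq> KB x r" using open_KB centre_in_KB r xf openE by blast
  show "EX d>0. ALL x':relint u. dist x' x < d --> dist (g x') (g x) < e"
  proof (intro exI[of _ d] conjI ballI impI d(1))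
   fix y assume y: "y : relint u" "dist y x < d"
   hence yf: "y : face u \<inter> ub" using sub by blast
   have "g y : KB (g x) r" using d y iso[OF xf(1) yf] g yf by (fastforce simp: mem_ball dist_commute KB_def)
   thus "dist (g y) (g x) < e" using r by (auto simp: mem_ball dist_commute)
  qed
 qed
 moreover have "face v \<inter> ub \<subseteq> V" by (auto simp: V_def face_def)
 hence "g : relint u \<rightarrow> V" using g(2) sub by blast
 moreover have "inj_on g (relint u)" using g(1) sub by (rule inj_on_subset)
 ultimately have op: "openin (top_of_set V) (g ` relint u)" by (rule invariance_of_domain_affine_sets)
 show ?thesis
 proof
  fix y assume y: "y : g ` relint u"
  have yf: "y : face v \<inter> ub" using y sub g by blast
  obtain e where e: "e > 0" "ball y e \<inter> V \<subseteq> g ` relint u" using op y unfolding openin_contains_ball by blast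
  have "w.*y < c" if w: "w : adj v" for w
  proof (rule ccontr)
   assume "~ w.*y < c"
   moreover have "w.*y <= c" using yf w by (auto simp: face_def poly_def adj_def)
   ultimately have wy: "w.*y = c" by simp
   \<comment> \<open>The component of \<open>w\<close> orthogonal to \<open>v\<close>: moving along
     it stays in the plane of the facet and crosses the wall \<open>w\<close>.\<close>
   define d where "d = w - (c^2 / R) *\<^sub>R v"
   have vw: "v.*v = R" "w.*w = R" "v.*w = c^2" "w.*v = c^2" using v w norm_N by (auto simp: adj_def inner_commute)
   have "c^2 * c^2 < R * R" using cR Rpos by (intro mult_strict_mono) auto
   hence wd: "w.*d > 0" using vw Rpos by (simp add: d_def inner_diff_right field_simps)
   hence nd: "norm d > 0" by auto
   define z where "z = y + (e / (2 * norm d)) *\<^sub>R d"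
   have "z : ball y e \<inter> V" using e vw Rpos yf by (simp add: d_def inner_diff_right z_def mem_ball dist_norm V_def inner_add_right face_def)
   hence "w.*z <= c" using e g sub w face_def poly_def adj_def by blast
   thus False using e wd wy by (simp add: z_def inner_add_right mult_le_0_iff divide_le_0_iff)
  qed
  thus "y : relint v" using yf by (auto simp: relint_def face_def)
 qed
qed

lemma rim_image:
 assumes u: "u : N" and v: "v : N" and g: "bij_betw g (face u \<inter> ub) (face v \<inter> ub)"
  and iso: "!!x y. x : face u \<inter> ub ==> y : face u \<inter> ub ==> kd (g x) (g y) = kd x y" shows "g ` rim u = rim v"
proof -
 define h where "h = inv_into (face u \<inter> ub) g"
 have h: "bij_betw h (face v \<inter> ub) (face u \<inter> ub)" unfolding h_def by (rule bij_betw_inv_into[OF g])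
 have gh: "g (h y) = y" "h y : face u \<inter> ub" if "y : face v \<inter> ub" for y
  using that bij_betw_inv_into_right[OF g] bij_betwE[OF h] by (auto simp: h_def)
 have hg: "h (g x) = x" if "x : face u \<inter> ub" for x using that bij_betw_inv_into_left[OF g] by (auto simp: h_def)
 have "kd (h x) (h y) = kd x y" if "x : face v \<inter> ub" "y : face v \<inter> ub" for x y
  using iso[OF gh(2)[OF that(1)] gh(2)[OF that(2)]] gh(1) that by simp
 hence im': "h ` relint v \<subseteq> relint u" using relint_image[OF v u bij_betw_imp_inj_on[OF h]] bij_betw_imp_surj_on[OF h] by blast
 have "relint v \<subseteq> g ` relint u"
 proof
  fix y assume y: "y : relint v"
  hence "y = g (h y)" using gh relint_eq[OF v] by simp
  thus "y : g ` relint u" using im' y by blast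
 qed
 hence "g ` relint u = relint v" using relint_image[OF u v bij_betw_imp_inj_on[OF g] _ iso] bij_betw_imp_surj_on[OF g] by blast
 moreover have "rim u = face u \<inter> ub - relint u" "rim v = face v \<inter> ub - relint v"
  using relint_eq[OF u] relint_eq[OF v] by (auto simp: rim_def)
 moreover have "relint u \<subseteq> face u \<inter> ub" using relint_eq[OF u] by blast
 ultimately show ?thesis using inj_on_image_set_diff[OF bij_betw_imp_inj_on[OF g], of "face u \<inter> ub" "relint u"]
   bij_betw_imp_surj_on[OF g] by auto
qed

lemma rim_sub: "rim u \<subseteq> face u \<inter> ub" by (auto simp: rim_def)

lemma span_facet: assumes u: "u : N" shows "span (face u \<inter> ub) = UNIV"
proof -
 let ?S = "span (face u \<inter> ub)"
 have c: "c / R ~= 0" "c / (R + c^2) ~= 0" using c_pos Rpos R2 by auto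
 have su: "u : ?S" using span_scale[OF span_base[OF ctr_face(1)[OF u]], of "R / c"] c_pos Rpos by (simp add: ctr_def)
 have vS: "v : ?S" if v: "v : adj u" for v
 proof -
  have "(1 / (c / (R + c^2))) *\<^sub>R foot u v : ?S" using foot_rim[OF u v] rim_sub span_base span_scale by blast
  thus ?thesis using c su span_diff unfolding foot_def by fastforce
 qed
 hence "v : ?S" if v: "v : N" for v
 proof -
  consider "u = v" | "u = - v" | "v : adj u" | "- v : adj u" using inner_N[OF u v] v neg_N[OF v] by (auto simp: adj_def)
  thus ?thesis
  proof cases
   case 2
   thus ?thesis using span_neg[OF su] by simp
  next
   case 4
   thus ?thesis using span_neg[OF vS[OF 4]] by simp
  qed (use su vS in auto)
 qed
 thus ?thesis using span_N span_minimal by blast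
qed

text \<open>The centre is preserved by \<open>incentre_unique\<close>, hence so is the distance to
  it, hence \<open>hq\<close>, and \<open>kch\<close> yields inner products;
  \<open>gram_extend\<close> gives a linear map. The feet are the rim points nearest to the centre,
  so adjacent normals go to adjacent normals.\<close>

theorem facet_isometry:
 assumes u: "u : N" and v: "v : N" and g: "bij_betw g (face u \<inter> ub) (face v \<inter> ub)"
  and iso: "!!x y. x : face u \<inter> ub ==> y : face u \<inter> ub ==> kd (g x) (g y) = kd x y"
 obtains A where "orth A" "A ` N = N" "A u = v" "!!x. x : face u \<inter> ub ==> A x = g x"
proof -
 have gim: "g x : face v \<inter> ub" if "x : face u \<inter> ub" for x using bij_betwE[OF g] that by blast
 have gk: "kch (g x) (g y) = kch x y" if "x : face u \<inter> ub" "y : face u \<inter> ub" for x y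
  using iso[OF that] kd_eq_iff[of "g x" "g y" x y] gim that by blast
 note rim = rim_image[OF u v g iso]
 have cu: "ctr u : face u \<inter> ub" by (rule ctr_face(1)[OF u])
 have gc: "g (ctr u) = ctr v"
 proof (rule incentre_unique[OF v gim[OF cu]])
  fix y assume "y : rim v"
  then obtain x where x: "x : rim u" "y = g x" using rim by blast
  thus "kch (g (ctr u)) y >= kap" using rim_sub gk[OF cu, of x] kch_ctr_rim(1)[OF u x(1)] by fastforce
 qed
 have p: "1 - c^2 / R > 0" using cR Rpos by simp
 have hq: "hq (g x) = hq x" if x: "x : face u \<inter> ub" for x
  using gk[OF cu x] x gc gim kch_ctr u v p by (auto simp: face_def frac_eq_eq)
 have gg: "g x .* g y = x .* y" if xy: "x : face u \<inter> ub" "y : face u \<inter> ub" for x y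
 proof -
  show ?thesis using xy hq_pos gk[OF xy] hq by (fastforce simp: kch_def)
 qed
 obtain A where A: "orth A" "!!x. x : face u \<inter> ub ==> A x = g x" using gram_extend[OF span_facet[OF u] gg] by blast
 have lin: "linear A" by (rule orthogonal_transformation_linear[OF A(1)])
 have Au: "A u = v" using A(2)[OF cu] gc c_pos Rpos by (simp add: ctr_def linear_scale[OF lin])
 have adj: "A w : adj v" if w: "w : adj u" for w
 proof -
  have fr: "foot u w : rim u" by (rule foot_rim[OF u w])
  hence ff: "foot u w : face u \<inter> ub" using rim_sub by blast
  obtain w' where w': "w' : adj v" "g (foot u w) = foot v w'" using rim fr gk[OF cu ff] gc kch_ctr_rim(2)[OF u fr] w kch_ctr_rim(2)[OF v]
   by fastforce
  show ?thesis using A(2)[OF ff] w' c_pos R2 by (simp add: foot_def linear_scale[OF lin] linear_add[OF lin] Au)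
 qed
 have "A w : N" if w: "w : N" for w
 proof -
  consider "u = w" | "u = - w" | "w : adj u" | "- w : adj u" using inner_N[OF u w] w neg_N[OF w] by (auto simp: adj_def)
  thus ?thesis
  proof cases
   case 2
   thus ?thesis using Au linear_neg[OF lin, of w] neg_N[OF v] by auto
  next
   case 4
   thus ?thesis using adj[of "- w"] linear_neg[OF lin, of w] neg_N by (fastforce simp: adj_def)
  qed (use Au v adj adj_N in auto)
 qed
 hence "A ` N \<subseteq> N" by blast
 thus ?thesis using card_image[OF inj_on_subset[OF orthogonal_transformation_inj[OF A(1)]], of N] card_subset_eq[OF finN] that A Au by blast
qed

end

section \<open>Face pairings\<close>

context
 fixes M :: "'a metric" and P :: "(real ^ 3) set" and k \<sigma> g \<pi> and N3 :: "(real ^ 3) set" and c R \<mu>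
 assumes fs: "facet_symmetric N3 c R \<mu>" and P: "P = facet_symmetric.poly N3 c"
  and M: "connected_hyperbolic_manifold TYPE(3) M"
  and ob: "obtained_by_face_pairing M P k \<sigma> g \<pi>"
begin

interpretation facet_symmetric N3 c R \<mu> by (rule fs)

lemma fp: "face_pairing P k \<sigma> g" "\<pi> ` ({..<k} \<times> cell) = mspace M"
 "!!p q. p : {..<k} \<times> cell ==> q : {..<k} \<times> cell ==>
  ennreal (mdist M (\<pi> p) (\<pi> q)) = (INF l \<in> {l. glue_chain P k \<sigma> g p q l}. ennreal l)"
   using ob unfolding obtained_by_face_pairing_def Let_def P poly_cell by auto

definition pair_nb :: "nat => real ^ 3 => nat" where "pair_nb i u = fst (\<sigma> (i, face u))"
definition pair_tr :: "nat => real ^ 3 => real ^ 3 => real ^ 3" where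
 "pair_tr i u = (SOME A. orth A & A ` N3 = N3 & \<sigma> (i, face u) = (pair_nb i u, face (A u)) &
  (ALL x:face u \<inter> ub. A x = g (i, face u) x))"

lemma pair_tr:
 assumes i: "i < k" and u: "u : N3" shows "pair_nb i u < k" "orth (pair_tr i u)" "pair_tr i u ` N3 = N3"
  "\<sigma> (i, face u) = (pair_nb i u, face (pair_tr i u u))"
  "!!x. x : face u \<inter> ub ==> pair_tr i u x = g (i, face u) x"
  "\<sigma> (i, face u) ~= (i, face u)"
  "\<sigma> (pair_nb i u, face (pair_tr i u u)) = (i, face u)"
  "!!x. x : face u \<inter> ub ==> g (\<sigma> (i, face u)) (g (i, face u) x) = x"
proof -
 obtain j G where jG: "\<sigma> (i, face u) = (j, G)" "j < k" "G facet_of P" "(j, G) ~= (i, face u)"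
 "\<sigma> (j, G) = (i, face u)" "bij_betw (g (i, face u)) (face u \<inter> ub) (G \<inter> ub)"
 "ALL x:face u \<inter> ub. ALL y:face u \<inter> ub. kd (g (i, face u) x) (g (i, face u) y) = kd x y"
 "ALL x:face u \<inter> ub. g (j, G) (g (i, face u) x) = x" using facets P u fp(1)[unfolded face_pairing_def, rule_format, OF conjI[OF i], of "face u"] by metis
 obtain v where v: "v : N3" "G = face v" using jG facets P by auto
 obtain A where "orth A" "A ` N3 = N3" "A u = v" "!!x. x : face u \<inter> ub ==> A x = g (i, face u) x"
  using facet_isometry[OF u v(1) jG(6)[unfolded v(2)]] jG(7) by blast
 hence "EX A. orth A & A ` N3 = N3 & \<sigma> (i, face u) = (pair_nb i u, face (A u)) &
  (ALL x:face u \<inter> ub. A x = g (i, face u) x)" using jG v by (auto simp: pair_nb_def)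
 from someI_ex[OF this, folded pair_tr_def]
 show *: "orth (pair_tr i u)" "pair_tr i u ` N3 = N3"
  "\<sigma> (i, face u) = (pair_nb i u, face (pair_tr i u u))"
  "!!x. x : face u \<inter> ub ==> pair_tr i u x = g (i, face u) x" by blast+
 show "pair_nb i u < k" using jG by (simp add: pair_nb_def)
 show "\<sigma> (i, face u) ~= (i, face u)" "\<sigma> (pair_nb i u, face (pair_tr i u u)) = (i, face u)" using jG *(3) by auto
 show "!!x. x : face u \<inter> ub ==> g (\<sigma> (i, face u)) (g (i, face u) x) = x" using jG by auto
qed

lemma pair_pregluing: "pregluing N3 c R {..<k} pair_nb pair_tr"
proof
 show "finite {..<k}" by simp
 fix i u assume iu: "i : {..<k}" "u : N3"
 hence i: "i < k" by simp
 note t = pair_tr[OF i iu(2)]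
 show "pair_nb i u : {..<k}" "orth (pair_tr i u)" "pair_tr i u ` N3 = N3" using t by auto
 have w: "pair_tr i u u : N3" using t(3) iu(2) by blast
 show nn: "pair_nb (pair_nb i u) (pair_tr i u u) = i" using t(7) by (simp add: pair_nb_def[of "pair_nb i u"])
 fix x
 let ?A = "pair_tr i u" and ?B = "pair_tr (pair_nb i u) (pair_tr i u u)"
 note t' = pair_tr[OF t(1) w]
 have "linear ?A" "linear ?B" using t(2) t'(2) orthogonal_transformation_linear by auto
 moreover have "?B (?A y) = y" if y: "y : face u \<inter> ub" for y
 proof -
  have "?A y : face (?A u) \<inter> ub"
  proof -
   have "bij_betw (g (i, face u)) (face u \<inter> ub) (snd (\<sigma> (i, face u)) \<inter> ub)" using facets P iu(2) fp(1) i unfolding face_pairing_def by fastforce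
   thus ?thesis using t(4) t(5)[OF y] y bij_betwE by fastforce
  qed
  thus ?thesis using t'(5) t(4) t(5)[OF y] t(8)[OF y] by simp
 qed
 ultimately show "?B (?A x) = x" using linear_eq_on_span[of "%x. ?B (?A x)" "%x. x" "face u \<inter> ub" x] span_facet[OF iu(2)]
  by (simp add: linear_compose[unfolded o_def] linear_id[unfolded id_def])
qed

interpretation pregluing N3 c R "{..<k}" pair_nb pair_tr by (rule pair_pregluing)

lemma cell_face: "u : N3 ==> x : cell ==> u.*x = c ==> x : face u \<inter> ub" using poly_cell by (auto simp: face_def)

lemma glue_chain_iff: "glue_chain P k \<sigma> g p q l \<longleftrightarrow> chain p q l"
proof
 show "glue_chain P k \<sigma> g p q l ==> chain p q l"
 proof (induction rule: glue_chain.induct)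
  case (refl i x)
  thus ?case using poly_cell P by (intro chain.refl) auto
 next
  case (jump p q r l)
  then obtain F where F: "fst p < k" "F facet_of P" "snd p : F \<inter> ub" "q = (fst (\<sigma> (fst p, F)), g (fst p, F) (snd p))"
   by (auto simp: glue_step_def)
  then obtain u where u: "u : N3" "F = face u" using facets P by auto
  have c: "snd p : cell" "u .* snd p = c" using F u poly_cell by (auto simp: face_def)
  have "q = (pair_nb (fst p) u, pair_tr (fst p) u (snd p))" using F u pair_tr(5)[OF F(1) u(1)] by (simp add: pair_nb_def)
  thus ?case using chain.jump[of "fst p" "snd p" u] F c u jump.IH by simp
 next
  case (move i x y r l)
  thus ?case using poly_cell P by (intro chain.move) auto
 qed
 show "chain p q l ==> glue_chain P k \<sigma> g p q l"
 proof (induction rule: chain.induct)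
  case (refl i x)
  thus ?case using poly_cell P by (intro glue_chain.refl) auto
 next
  case (jump i x u q l)
  have "glue_step P k \<sigma> g (i, x) (pair_nb i u, pair_tr i u x)" using cell_face jump pair_tr(5)[of i u x] facets P unfolding glue_step_def
   by (intro exI[of _ "face u"]) (auto simp: pair_nb_def)
  thus ?case by (rule glue_chain.jump[OF _ jump.IH])
 next
  case (move i x y q l)
  thus ?case using poly_cell P by (intro glue_chain.move) auto
 qed
qed

lemma pair_hyperbolic_gluing: "hyperbolic_gluing N3 c R {..<k} pair_nb pair_tr M \<pi>"
proof
 show "\<pi> ` ({..<k} \<times> cell) = mspace M" by (rule fp(2))
 show "ennreal (mdist M (\<pi> p) (\<pi> q)) = (INF l \<in> {l. chain p q l}. ennreal l)"
  if "p : {..<k} \<times> cell" "q : {..<k} \<times> cell" for p q using fp(3)[OF that] by (simp add: glue_chain_iff)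
 show "EX U (\<phi> :: 'a => real ^ 3). p : U & hyperbolic_chart M U \<phi>" if "p : mspace M" for p
  using M that unfolding connected_hyperbolic_manifold_def by blast
 show "pair_tr i u u ~= u" if "i : {..<k}" "u : N3" "pair_nb i u = i" for i u using pair_tr(4,6)[of i u] that by auto
qed

lemma face_pairing_realized:
 obtains nb tr where "realized N3 c R {..<k} nb tr M \<pi>" "{..<k} ~= {}"
  "!!i u. i < k ==> u : N3 ==> nb i u = fst (\<sigma> (i, P \<inter> {x. u.*x = c}))"
  "!!i u. i < k ==> u : N3 ==> nb i u = i ==> tr i u u ~= u"
proof
 interpret h: hyperbolic_gluing N3 c R "{..<k}" pair_nb pair_tr M \<pi> by (rule pair_hyperbolic_gluing)
 show "realized N3 c R {..<k} pair_nb pair_tr M \<pi>" using h.gluing h.prerealized_axioms by (simp add: realized_def)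
 show "{..<k} ~= {}" using M fp(2) by (auto simp: connected_hyperbolic_manifold_def)
 show "pair_nb i u = fst (\<sigma> (i, P \<inter> {x. u.*x = c}))" if "i < k" "u : N3" for i u by (simp add: pair_nb_def face_def P)
 show "pair_tr i u u ~= u" if "i < k" "u : N3" "pair_nb i u = i" for i u using h.no_fold that by simp
qed

end

section \<open>The 24-cell and the 120-cell\<close>

text \<open>A pair \<open>(a, b)\<close> of integers stands for \<open>a + b * golden_ratio\<close>, and vectors are scaled by 2.\<close>

type_synonym zt = "int \<times> int"
type_synonym zt4 = "zt \<times> zt \<times> zt \<times> zt"

fun zadd :: "zt => zt => zt" where "zadd (a, b) (c, d) = (a + c, b + d)"
fun zsub :: "zt => zt => zt" where "zsub (a, b) (c, d) = (a - c, b - d)"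
fun zmul :: "zt => zt => zt" where "zmul (a, b) (c, d) = (a * c + b * d, a * d + b * c + b * d)"
fun zneg :: "zt => zt" where "zneg (a, b) = (- a, - b)"
fun zdot :: "zt4 => zt4 => zt" where
 "zdot (x, y, z, w) (x', y', z', w') = zadd (zadd (zmul x x') (zmul y y')) (zadd (zmul z z') (zmul w w'))"
fun zhalf :: "zt => zt" where "zhalf (a, b) = (a div 2, b div 2)"
fun zeven :: "zt => bool" where "zeven (a, b) = (a mod 2 = 0 & b mod 2 = 0)"
text \<open>Because vectors are doubled, \<open>zdot\<close> is four times the inner product and the
  coefficient 2 (g . x) of the reflection is half of it. \<open>zclosed\<close> checks that this
  half is exact.\<close>

fun zrefl :: "zt4 => zt4 => zt4" where
 "zrefl (x, y, z, w) (x', y', z', w') = (let k = zhalf (zdot (x, y, z, w) (x', y', z', w')) in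
  (zsub x' (zmul k x), zsub y' (zmul k y), zsub z' (zmul k z), zsub w' (zmul k w)))"

text \<open>Kinds 0 to 4 are, up to sign, the values 0, 1, \<tau>, \<tau> - 1 and 2 of the doubled
  coordinates; kind 5 collects everything else.\<close>

fun zkind :: "zt => nat" where
 "zkind x = (if x = (0, 0) then 0 else if x = (1, 0) | x = (-1, 0) then 1 else if x = (0, 1) | x = (0, -1) then 2
  else if x = (-1, 1) | x = (1, -1) then 3 else if x = (2, 0) | x = (-2, 0) then 4 else 5)"

definition zvals :: "nat => zt list" where
 "zvals k = (if k = 0 then [(0, 0)] else if k = 1 then [(1, 0), (-1, 0)] else if k = 2 then [(0, 1), (0, -1)]
  else if k = 3 then [(-1, 1), (1, -1)] else if k = 4 then [(2, 0), (-2, 0)] else [])"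

type_synonym pattern = "nat \<times> nat \<times> nat \<times> nat"

fun zpattern :: "zt4 => pattern" where
 "zpattern (x, y, z, w) = (zkind x, zkind y, zkind z, zkind w)"

text \<open>An executable universal quantifier over \<open>zcell\<close>, sound by
  \<open>zall_zcell\<close>; working with patterns keeps the set-based statements away from explicit
  lists of vectors.\<close>

fun zall :: "(zt4 => bool) => pattern list => bool" where
 "zall P [] = True"
| "zall P ((a, b, c, d) # ps) = (list_all (%x. list_all (%y. list_all (%z. list_all (%w. P (x, y, z, w))
  (zvals d)) (zvals c)) (zvals b)) (zvals a) & zall P ps)"

definition pats24 :: "pattern list" where
 "pats24 = [(4, 0, 0, 0), (0, 4, 0, 0), (0, 0, 4, 0), (0, 0, 0, 4), (1, 1, 1, 1)]"

text \<open>The normals of the 120-cell are the 120 unit icosians: the 24 of the 24-cell and, with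
  all signs, the even permutations of (\<tau>, 0, \<tau> - 1, 1), all doubled.\<close>

definition pats120 :: "pattern list" where
 "pats120 = pats24 @ [(2, 0, 3, 1), (2, 3, 1, 0), (2, 1, 0, 3), (0, 2, 1, 3), (0, 3, 2, 1), (0, 1, 3, 2),
  (3, 2, 0, 1), (3, 0, 1, 2), (3, 1, 2, 0), (1, 2, 3, 0), (1, 0, 2, 3), (1, 3, 0, 2)]"

definition zcell :: "pattern list => zt4 set" where
 "zcell ps = {x. zpattern x : set ps}"

lemma zkind_vals: "zkind x < 5 ==> x : set (zvals (zkind x))" by (auto simp: zvals_def split: if_splits)

lemma zall_zcell:
 assumes "zall P ps" "x : zcell ps" "list_all (%(a, b, c, d). a < 5 & b < 5 & c < 5 & d < 5) ps" shows "P x" using assms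
proof (induction P ps rule: zall.induct)
 case (2 P a b c d ps)
 obtain x1 x2 x3 x4 where x: "x = (x1, x2, x3, x4)" by (metis prod_cases4)
 show ?case
 proof (cases "zpattern x = (a, b, c, d)")
  case True
  thus ?thesis using zkind_vals[of x1] zkind_vals[of x2] zkind_vals[of x3] zkind_vals[of x4] 2(4) 2(2) by (auto simp: x list_all_iff)
 next
  case False
  thus ?thesis using 2 by (auto simp: zcell_def simp del: zkind.simps)
 qed
qed (simp add: zcell_def)

definition zclosed :: "zt4 list => pattern list => bool" where
 "zclosed G ps \<longleftrightarrow> list_all (%g. zall (%x. zeven (zdot g x) & zpattern (zrefl g x) : set ps) ps) G"

definition zlist :: "pattern list => zt4 list" where
 "zlist ps = concat (map (%(a, b, c, d). concat (map (%x. concat (map (%y. concat (map (%z. map (%w. (x, y, z, w))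
  (zvals d)) (zvals c))) (zvals b))) (zvals a))) ps)"

lemma zall_mono: "zall P ps ==> (!!x. P x ==> Q x) ==> zall Q ps" by (induction P ps rule: zall.induct) (auto simp: list_all_iff)

lemma zall_set: "zall (%x. x : set (zlist ps)) ps"
proof (induction ps)
 case (Cons p ps)
 obtain a b c d where p: "p = (a, b, c, d)" by (metis prod_cases4)
 show ?case using zall_mono[OF Cons, of "%x. x : set (zlist (p # ps))"] by (auto simp: p zlist_def list_all_iff)
qed simp

lemma zcell_finite:
 assumes "list_all (%(a, b, c, d). a < 5 & b < 5 & c < 5 & d < 5) ps"
 shows "finite (zcell ps)" "card (zcell ps) <= length (zlist ps)" "zcell ps \<subseteq> set (zlist ps)"
proof -
 show *: "zcell ps \<subseteq> set (zlist ps)" using zall_zcell[OF zall_set _ assms] by blast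
 thus "finite (zcell ps)" using finite_subset by blast
 show "card (zcell ps) <= length (zlist ps)" using card_mono[OF _ *] card_length[of "zlist ps"] by simp
qed

section \<open>From integer pairs to real vectors\<close>

abbreviation "\<tau> \<equiv> golden_ratio"

lemma tau2: "\<tau> * \<tau> = \<tau> + 1" unfolding golden_ratio_def by (simp add: field_simps)

lemma tau_bounds: "1.61 < \<tau>" "\<tau> < 1.62"
proof -
 have "sqrt 5 > 2.22" "sqrt 5 < 2.24" by (rule real_less_rsqrt, simp add: power2_eq_square) (rule real_less_lsqrt, auto simp: power2_eq_square)
 thus "1.61 < \<tau>" "\<tau> < 1.62" by (simp_all add: golden_ratio_def)
qed

fun ev :: "zt => real" where "ev (a, b) = of_int a + of_int b * \<tau>"
fun vv :: "zt4 => real ^ 4" where "vv (x, y, z, w) = vector [ev x / 2, ev y / 2, ev z / 2, ev w / 2]"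

lemma ev_add: "ev (zadd x y) = ev x + ev y" by (cases x; cases y) (simp add: algebra_simps)
lemma ev_sub: "ev (zsub x y) = ev x - ev y" by (cases x; cases y) (simp add: algebra_simps)
lemma ev_mul: "ev (zmul x y) = ev x * ev y"
proof (cases x; cases y)
 fix a b c d assume "x = (a, b)" "y = (c, d)"
 moreover have "of_int b * (of_int d * (\<tau> * \<tau>)) = of_int b * (of_int d * (\<tau> + 1))" by (simp add: tau2)
 ultimately show ?thesis by (simp add: algebra_simps)
qed
lemma ev_half: "zeven x ==> ev (zhalf x) = ev x / 2" by (cases x) (auto simp: elim!: evenE simp flip: even_iff_mod_2_eq_zero)

lemma vector_4:
 "(vector [x, y, z, w] :: real ^ 4) $ 1 = x" "(vector [x, y, z, w] :: real ^ 4) $ 2 = y"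
 "(vector [x, y, z, w] :: real ^ 4) $ 3 = z" "(vector [x, y, z, w] :: real ^ 4) $ 4 = w" by (simp_all add: vector_def)

lemma inner_4: "(x :: real ^ 4) .* y = x$1 * y$1 + x$2 * y$2 + x$3 * y$3 + x$4 * y$4" by (simp add: inner_vec_def sum_4)

lemma inner_3: "(x :: real ^ 3) .* y = x$1 * y$1 + x$2 * y$2 + x$3 * y$3" by (simp add: inner_vec_def sum_3)

lemma ev_dot: "ev (zdot x y) = 4 * (vv x .* vv y)"
 by (cases x; cases y) (auto simp: ev_add ev_mul inner_4 vector_4 simp del: ev.simps zmul.simps zadd.simps)

lemma vv_1: "vv x $ 1 = ev (fst x) / 2" by (cases x) (simp add: vector_4)

definition srefl :: "real ^ 'n => real ^ 'n => real ^ 'n" where "srefl g x = x - (2 * (g.*x)) *\<^sub>R g"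

lemma vv_refl: assumes "zeven (zdot g x)" shows "vv (zrefl g x) = srefl (vv g) (vv x)"
proof -
 obtain g1 g2 g3 g4 x1 x2 x3 x4 where gx: "g = (g1, g2, g3, g4)" "x = (x1, x2, x3, x4)" by (metis prod_cases4)
 show ?thesis using ev_half[OF assms] ev_dot[of g x] unfolding vec_eq_iff forall_4
  by (simp add: gx Let_def srefl_def vector_4 ev_sub ev_mul field_simps del: ev.simps zsub.simps zmul.simps zdot.simps zhalf.simps)
qed

lemma srefl_orth: assumes "g.*g = 1" shows "orth (srefl g)"
 using assms by (simp add: linear_iff srefl_def inner_add_right algebra_simps inner_diff_left inner_diff_right inner_commute orthogonal_transformation_def)

lemma srefl_srefl: assumes "g.*g = 1" shows "srefl g (srefl g x) = x" using assms by (simp add: srefl_def inner_diff_right)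

text \<open>The normals of \<open>Q\<close> are obtained as the orbit of the base normal under the
  reflections in the base and side normals. Transitivity then reduces statements about pairs of
  facets to pairs that contain the base.\<close>

inductive_set orbit :: "(real ^ 'n) set => real ^ 'n => (real ^ 'n) set" for G e where
 base: "e : orbit G e"
| refl: "x : orbit G e ==> g : G ==> srefl g x : orbit G e"

lemma orbit_transitive:
 assumes G: "!!g. g : G ==> g.*g = 1" and u: "u : orbit G e" shows "EX B. orth B & B ` orbit G e = orbit G e & B e = u" using u
proof (induction rule: orbit.induct)
 case base
 show ?case by (rule exI[of _ id]) (simp add: orthogonal_transformation_id[unfolded id_def] id_def)
next
 case (refl x g)
 then obtain B where B: "orth B" "B ` orbit G e = orbit G e" "B e = x" by blast
 have "srefl g ` orbit G e = orbit G e"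
 proof
  show "srefl g ` orbit G e \<subseteq> orbit G e" using refl orbit.refl by blast
  show "orbit G e \<subseteq> srefl g ` orbit G e"
  proof
   fix y assume "y : orbit G e"
   thus "y : srefl g ` orbit G e" using refl orbit.refl srefl_srefl[OF G[OF refl(2)]] by (metis imageI)
  qed
 qed
 hence "(srefl g \<circ> B) ` orbit G e = orbit G e" using B(2) by (simp only: image_comp[symmetric])
 moreover have "orth (srefl g \<circ> B)" by (rule orthogonal_transformation_compose[OF srefl_orth[OF G[OF refl(2)]] B(1)])
 moreover have "(srefl g \<circ> B) e = srefl g x" using B(3) by simp
 ultimately show ?case by blast
qed

lemma orbit_map:
 assumes L: "orth L" "L ` G \<subseteq> G" "L e = e" and u: "u : orbit G e" shows "L u : orbit G e" using u
proof (induction rule: orbit.induct)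
 case base
 show ?case using L(3) orbit.base by metis
next
 case (refl x g)
 have "L (srefl g x) = srefl (L g) (L x)"
  using L(1) by (simp add: srefl_def linear_diff linear_scale orthogonal_transformation_def)
 thus ?case using refl L(2) orbit.refl[of "L x" G e "L g"] by auto
qed

lemma orbit_zcell:
 assumes cl: "zclosed gs ps" and G: "G = vv ` set gs" and e: "e = vv z" "z : zcell ps"
  and ps: "list_all (%(a, b, c, d). a < 5 & b < 5 & c < 5 & d < 5) ps" and u: "u : orbit G e" shows "u : vv ` zcell ps" using u
proof (induction rule: orbit.induct)
 case (refl x g)
 then obtain y g' where y: "x = vv y" "y : zcell ps" "g = vv g'" "g' : set gs" using G by auto
 have "zall (%x. zeven (zdot g' x) & zpattern (zrefl g' x) : set ps) ps" using cl y(4) by (auto simp: zclosed_def list_all_iff)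
 from zall_zcell[OF this y(2) ps] have "zeven (zdot g' y)" "zrefl g' y : zcell ps" by (auto simp: zcell_def)
 thus ?case using vv_refl[of g' y] y by (metis imageI)
qed (use e in simp)

section \<open>Hyperbolic polytopes with a given facet\<close>

definition emb :: "real => real ^ 3 => real ^ 4" where "emb r y = vector [r, y$1, y$2, y$3]"
definition tail :: "real ^ 4 => real ^ 3" where "tail x = vector [x$2, x$3, x$4]"
definition lft :: "(real ^ 3 => real ^ 3) => real ^ 4 => real ^ 4" where "lft A x = emb (x$1) (A (tail x))"
abbreviation e0 :: "real ^ 4" where "e0 \<equiv> emb 1 0"

lemma emb_simps [simp]: "emb r y $ 1 = r" "tail (emb r y) = y" "emb (x$1) (tail x) = x"
 by (simp_all add: emb_def tail_def vector_4 vec_eq_iff forall_4 forall_3)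

lemma emb_inner: "emb r y .* emb s z = r * s + y.*z" by (simp add: emb_def inner_4 inner_3 vector_4)

lemma inner_head_tail: "x .* y = x$1 * y$1 + tail x .* tail y" by (simp add: tail_def inner_4 inner_3)

lemma emb_eq [simp]: "emb r y = emb s z \<longleftrightarrow> r = s & y = z" by (metis emb_simps(1,2))

lemma emb_linear: "emb (r + s) (y + z) = emb r y + emb s z" "emb (k * r) (k *\<^sub>R y) = k *\<^sub>R emb r y"
 "emb (r - s) (y - z) = emb r y - emb s z" by (simp_all add: emb_def vec_eq_iff forall_4 vector_4)

lemma tail_linear: "tail (x + y) = tail x + tail y" "tail (k *\<^sub>R x) = k *\<^sub>R tail x" "tail (x - y) = tail x - tail y"
 by (simp_all add: tail_def vec_eq_iff forall_3)

lemma lft_emb [simp]: "lft A (emb r y) = emb r (A y)" by (simp add: lft_def)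

lemma lft_head_tail [simp]: "lft A x $ 1 = x $ 1" "tail (lft A x) = A (tail x)" by (simp_all add: lft_def)

lemma lft_comp: "lft A (lft B x) = lft (A \<circ> B) x" by (simp add: lft_def)

lemma lft_orth: assumes "orth A" shows "orth (lft A)"
proof -
 have l: "linear A" by (rule orthogonal_transformation_linear[OF assms])
 have "linear (lft A)" by (rule linearI) (simp_all add: lft_def tail_linear linear_add[OF l] linear_scale[OF l] emb_linear)
 moreover have "lft A x .* lft A y = x.*y" for x y
  using assms by (simp add: inner_head_tail[of "lft A x"] inner_head_tail[of x] orthogonal_transformation_def)
 ultimately show ?thesis by (simp add: orthogonal_transformation_def)
qed

text \<open>\<open>Q\<close> has unit normals and offset \<open>sqrt a\<close>, so \<open>a\<close>
  is the inner product of orthogonal facets. By \<open>wall\<close> its slice at height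
  \<open>sqrt a\<close>, rescaled by \<open>sqrt (1 - a)\<close>, is the given three-dimensional
  cell; \<open>first\<close>, moved around by the symmetries, gives the angle condition for all
  pairs.\<close>

locale prism = facet_symmetric N c R \<mu> for N :: "(real ^ 3) set" and c R \<mu> :: real +
 fixes a b :: real
 assumes ab: "0 < a" "a < 1" "b > 0" and unit: "a^2 + b^2 * R = 1" and wall: "c^2 * b^2 = a - a^2"
  and fin_orbit: "finite (orbit (insert e0 ((%n. emb a (b *\<^sub>R n)) ` N)) e0)"
  and first: "u : orbit (insert e0 ((%n. emb a (b *\<^sub>R n)) ` N)) e0 ==> u$1 = 1 | u$1 = a | u$1 <= 2 * a - 1"
  and vertical: "u : orbit (insert e0 ((%n. emb a (b *\<^sub>R n)) ` N)) e0 ==> u$1 = a ==> u : (%n. emb a (b *\<^sub>R n)) ` N"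
  and ver_orbit: "n : N ==> emb a (b *\<^sub>R n) : orbit (insert e0 ((%n. emb a (b *\<^sub>R n)) ` N)) e0"
begin

definition ver :: "real ^ 3 => real ^ 4" where "ver n = emb a (b *\<^sub>R n)"
definition Q :: "(real ^ 4) set" where "Q = orbit (insert e0 (ver ` N)) e0"

lemma ver_eta: "(%n. emb a (b *\<^sub>R n)) = ver" by (simp add: ver_def fun_eq_iff)

lemmas Q_facts = fin_orbit[unfolded ver_eta, folded Q_def] first[unfolded ver_eta, folded Q_def]
 vertical[unfolded ver_eta, folded Q_def] ver_orbit[folded ver_def, unfolded ver_eta, folded Q_def]

lemma finQ: "finite Q" by (rule Q_facts)
lemma verQ: "n : N ==> ver n : Q" by (rule Q_facts)
lemma e0Q: "e0 : Q" unfolding Q_def by (rule orbit.base)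

lemma inner_ver: "ver n .* x = a * x$1 + b * (n .* tail x)" by (simp add: ver_def inner_head_tail[of "emb a (b *\<^sub>R n)"])

lemma inner_e0: "e0 .* x = x$1" "x .* e0 = x$1" by (simp_all add: inner_head_tail[of e0] inner_head_tail[of x])

lemma gen_unit: "g : insert e0 (ver ` N) ==> g.*g = 1"
 using unit norm_N by (auto simp: inner_ver inner_e0 power2_eq_square) (simp add: ver_def power2_eq_square)

lemma Q_transitive: assumes "u : Q" obtains B where "orth B" "B ` Q = Q" "B e0 = u"
 using orbit_transitive[OF gen_unit assms[unfolded Q_def]] unfolding Q_def by blast

lemma Q_unit: assumes "u : Q" shows "u.*u = 1"
proof -
 obtain B where "orth B" "B e0 = u" using Q_transitive[OF assms] .
 thus ?thesis using inner_e0(1)[of e0] by (auto simp: orthogonal_transformation_def)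
qed

lemma unit_e0: assumes "u.*u = 1" "u$1 = 1" shows "u = e0" using assms inner_head_tail[of u u] emb_simps(3)[of u] by simp

lemma Q_inner: assumes "u : Q" "v : Q" shows "u = v | u.*v = a | u.*v <= 2 * a - 1"
proof -
 obtain B where B: "orth B" "B ` Q = Q" "B e0 = u" using Q_transitive[OF assms(1)] .
 obtain w where w: "w : Q" "v = B w" using assms(2) B(2) by blast
 show ?thesis using B w inner_e0(1)[of w] Q_facts(2)[OF w(1)] unit_e0[OF Q_unit[OF w(1)]] by (auto simp: orthogonal_transformation_def)
qed

sublocale cap: right_angled Q "sqrt a" 1
proof
 fix u v assume "u : Q" "v : Q" "u ~= v"
 thus "u.*v = (sqrt a)^2 | u.*v <= 2 * (sqrt a)^2 - 1" using Q_inner ab by auto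
qed (use finQ Q_unit ab in auto)

lemma lft_Q: assumes A: "orth A" "A ` N = N" shows "lft A ` Q = Q"
proof -
 have l: "linear A" by (rule orthogonal_transformation_linear[OF A(1)])
 have e: "lft A e0 = e0" by (simp add: linear_0[OF l])
 have "lft A ` insert e0 (ver ` N) \<subseteq> insert e0 (ver ` N)" using A(2) e by (fastforce simp: ver_def linear_scale[OF l])
 from orbit_map[OF lft_orth[OF A(1)] this e] have "lft A ` Q \<subseteq> Q" unfolding Q_def by blast
 thus ?thesis using card_image[OF inj_on_subset[OF orthogonal_transformation_inj[OF lft_orth[OF A(1)]]]] card_subset_eq[OF finQ] by blast
qed

lemma ver_inj: "ver m = ver n \<longleftrightarrow> m = n" using ab by (simp add: ver_def)

lemma vertical_iff: "u : Q ==> u$1 = a \<longleftrightarrow> u : ver ` N" using Q_facts(3)[of u] by (auto simp: ver_def)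

lemma lft_ver: "linear A ==> lft A (ver n) = ver (A n)" by (simp add: ver_def linear_scale)

end

text \<open>The facets of \<open>Q\<close> other than \<open>e0\<close> and the vertical ones are called caps. The caps at height \<open>s0\<close>
 are coloured by the gluing, all others by \<open>h\<close>.\<close>

locale capped = prism N c R \<mu> a b for N :: "(real ^ 3) set" and c R \<mu> a b :: real +
 fixes s0 :: real and h :: "real ^ 4 => nat" and H t :: nat
 assumes s0: "s0 < a" and spread: "(a - a^2) * (1 - s0^2) < (a - a * s0)^2"
  and h_less: "u : Q ==> u$1 ~: {1, a, s0} ==> h u < H"
  and h_adj: "u : Q ==> v : Q ==> u$1 ~: {1, a, s0} ==> v$1 ~: {1, a, s0} ==> u.*v = a ==> h u ~= h v"
  and h_lft: "u : Q ==> u$1 ~: {1, a, s0} ==> n : N ==> ver n .* u = a ==> w : Q ==> w$1 = u$1 ==> h w = h u"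
  and special_degree: "u : Q ==> u$1 = s0 ==> card {v : Q. v$1 = s0 & u.*v = a} <= 3"
  and special_free: "u : Q ==> v : Q ==> w : Q ==> u$1 = s0 ==> v$1 = s0 ==> w$1 = s0 ==>
   u.*v = a ==> u.*w = a ==> v.*w ~= a"
  and special_tight: "u : Q ==> u$1 = s0 ==> card {n : N. ver n .* u = a} <= t"

section \<open>From finite checks to the properties of the polytopes\<close>

fun zneg4 :: "zt4 => zt4" where "zneg4 (x, y, z, w) = (zneg x, zneg y, zneg z, zneg w)"
fun zadd4 :: "zt4 => zt4 => zt4" where "zadd4 (x, y, z, w) (x', y', z', w') = (zadd x x', zadd y y', zadd z z', zadd w w')"
fun zscale4 :: "zt => zt4 => zt4" where "zscale4 k (x, y, z, w) = (zmul k x, zmul k y, zmul k z, zmul k w)"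

definition v3 :: "zt4 => real ^ 3" where "v3 x = 2 *\<^sub>R tail (vv x)"

lemma v3_tuple: "v3 (x, y, z, w) = vector [ev y, ev z, ev w]" by (simp add: v3_def tail_def vec_eq_iff forall_3 vector_4)

lemma ev_neg: "ev (zneg x) = - ev x" by (cases x) simp

lemma v3_neg: "v3 (zneg4 x) = - v3 x" by (cases x) (simp add: v3_tuple vec_eq_iff forall_3 ev_neg del: ev.simps zneg.simps)
lemma v3_add: "v3 (zadd4 x y) = v3 x + v3 y"
 by (cases x; cases y) (simp add: v3_tuple vec_eq_iff forall_3 ev_add del: ev.simps zadd.simps)
lemma v3_scale: "v3 (zscale4 k x) = ev k *\<^sub>R v3 x"
 by (cases x) (simp add: v3_tuple vec_eq_iff forall_3 ev_mul del: ev.simps zmul.simps)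

lemma v3_inner: assumes "fst x = (0, 0)" shows "v3 x .* v3 y = ev (zdot x y)"
proof -
 show ?thesis using assms inner_head_tail[of "vv x" "vv y"] by (simp add: vv_1 v3_def ev_dot)
qed

definition znormals :: "zt4 list => zt => zt => zt => bool" where
 "znormals Nl R C m \<longleftrightarrow> list_all (%x. fst x = (0, 0) & zneg4 x : set Nl & zdot x x = R & list_all (%y.
  (zdot x y = R & x = y) | zdot x y = C | (zdot x y = zneg R & y = zneg4 x) |
  (zdot x y = zneg C & list_ex (%j. zdot x j = C & list_ex (%k. zdot x k = C &
    zadd4 y x = zscale4 m (zadd4 j k)) Nl) Nl)) Nl) Nl"

definition gens :: "zt => zt => zt4 list => zt4 list" where
 "gens A B Nl = map (%(x, y, z, w). (A, zmul B y, zmul B z, zmul B w)) Nl"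

definition zheads :: "zt list" where
 "zheads = [(2, 0), (0, 1), (1, 0), (-1, 1), (0, 0), (1, -1), (-1, 0), (0, -1), (-2, 0)]"

text \<open>Irrationality of \<tau>: a nontrivial relation would give
  \<open>(2 * n - r)^2 = r^2 * 5\<close>, where the multiplicity of 5 is even on the left and odd on
  the right.\<close>

lemma ev_eq_iff [simp]: "ev x = ev y \<longleftrightarrow> x = y"
proof
 assume e: "ev x = ev y"
 obtain p q p' q' where xy: "x = (p, q)" "y = (p', q')" by (metis surj_pair)
 define n r :: int where "n = p - p'" and "r = q' - q"
 have "of_int n = of_int r * \<tau>" using e by (simp add: xy n_def r_def algebra_simps)
 hence "(of_int (2 * n - r))^2 = (of_int r)^2 * (5 :: real)" by (simp add: golden_ratio_def algebra_simps power_mult_distrib)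
 hence sq: "(2 * n - r)^2 = r^2 * 5" by (metis of_int_eq_iff of_int_mult of_int_numeral of_int_power)
 have "r = 0"
 proof (rule ccontr)
  assume r: "r ~= 0"
  hence r2: "2 * n - r ~= 0" using sq by auto
  have pr: "prime_elem (5 :: int)" by (simp add: prime_imp_prime_elem)
  have "multiplicity 5 (r^2 * 5) = 2 * multiplicity 5 r + 1"
   using r by (simp add: prime_elem_multiplicity_mult_distrib prime_elem_multiplicity_power_distrib multiplicity_self)
  hence "2 * multiplicity 5 (2 * n - r) = 2 * multiplicity 5 r + 1" by (metis pr r2 sq prime_elem_multiplicity_power_distrib)
  thus False by presburger
 qed
 thus "x = y" using sq by (simp add: xy n_def r_def)
qed simp

definition e4 :: zt4 where "e4 = ((2, 0), (0, 0), (0, 0), (0, 0))"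

lemma vv_e4: "vv e4 = e0" by (simp add: e4_def emb_def)

lemma vv_gens: "vv ` set (gens A B Nl) = (%n. emb (ev A / 2) ((ev B / 2) *\<^sub>R n)) ` v3 ` set Nl"
proof -
 have "vv (case x of (x, y, z, w) => (A, zmul B y, zmul B z, zmul B w)) = emb (ev A / 2) ((ev B / 2) *\<^sub>R v3 x)" for x
  by (cases x) (simp add: v3_tuple emb_def ev_mul vec_eq_iff forall_4 vector_4 del: ev.simps zmul.simps)
 thus ?thesis by (simp add: gens_def image_image)
qed

definition adjacent :: "zt => zt4 => zt4 => bool" where "adjacent A x y \<longleftrightarrow> zdot x y = zadd A A"

definition zspec :: "zt => pattern list => zt4 list" where "zspec s ps = filter (%x. fst x = s) (zlist ps)"

definition zspecial :: "zt => zt4 list => zt4 list => nat => bool" where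
 "zspecial A sl gs t \<longleftrightarrow> list_all (%x. length (filter (adjacent A x) sl) <= 3 & length (filter (%g. adjacent A g x) gs) <= t &
  list_all (%y. adjacent A x y --> list_all (%z. adjacent A x z --> ~ adjacent A y z) sl) sl) sl"

definition zcolour :: "zt => zt => zt => (zt4 => nat) => nat => zt4 list => pattern list => bool" where
 "zcolour A s l zc H gs ps \<longleftrightarrow> zall (%x. fst x ~: set [(2, 0), A, s] -->
  zc x < H & (fst x = l --> zc x = 0) &
  (fst x ~= l --> list_all (%g. ~ adjacent A g x) gs) &
  zall (%y. fst y ~: set [(2, 0), A, s] --> zc x = zc y --> ~ adjacent A x y) ps) ps"

definition zfacets :: "zt => zt4 list => pattern list => bool" where
 "zfacets A gs ps \<longleftrightarrow> zall (%x. fst x : set zheads & (fst x = A --> x : set gs)) ps &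
  list_all (%(a, b, c, d). a < 5 & b < 5 & c < 5 & d < 5) ps"

text \<open>The requirements of \<open>capped\<close> are separated into finite checks over pairs of
  integers and a few real estimates. \<open>dihedral\<close> serves to show that the side normals
  lie in the orbit of the base normal.\<close>

locale zprism =
 fixes Nl :: "zt4 list" and ps :: "pattern list" and A B C R m s l :: zt and c :: real and zc :: "zt4 => nat" and H t :: nat
 assumes normals: "znormals Nl R C m" and closed: "zclosed (e4 # gens A B Nl) ps" "zpattern e4 : set ps"
  and facets: "zfacets A (gens A B Nl) ps"
  and special: "zspecial A (zspec s ps) (gens A B Nl) t"
  and colour: "zcolour A s l zc H (gens A B Nl) ps"
  and heads: "{A, s, l} \<subseteq> set zheads"
  and c: "c > 0" "c^2 = ev C" "ev C < ev R" "2 * ev C - ev R >= - ev C" and m: "0 <= ev m" "ev m <= 1"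
  and bounded: "!!x. (!!u. u : v3 ` set Nl ==> u.*x <= c) ==> norm x <= 1"
  and ab: "0 < ev A" "ev A < 2" "0 < ev B" "(ev A / 2)^2 + (ev B / 2)^2 * ev R = 1" "c^2 * (ev B / 2)^2 = ev A / 2 - (ev A / 2)^2"
  and first: "!!x. x : set zheads ==> x : fst ` zcell ps ==> x ~: {(2, 0), A} ==> ev x <= 2 * ev A - 2"
  and dihedral: "!!G (e :: real ^ 4) v. e : G ==> v : G ==> e.*e = 1 ==> v.*v = 1 ==> e.*v = ev A / 2 ==> v : orbit G e"
  and s: "ev s < ev A" "(ev A / 2 - (ev A / 2)^2) * (1 - (ev s / 2)^2) < (ev A / 2 - ev A / 2 * (ev s / 2))^2"
begin

definition "N = v3 ` set Nl"

lemma zfst: "x : set Nl ==> fst x = (0, 0)" using normals by (auto simp: znormals_def list_all_iff)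

lemma zpair:
 assumes "x : set Nl" "y : set Nl"
 shows "(v3 x .* v3 y = ev R & v3 x = v3 y) | v3 x .* v3 y = ev C | (v3 x .* v3 y = - ev R & v3 y = - v3 x) |
  (v3 x .* v3 y = - ev C & (EX j:N. EX k:N. v3 x .* j = ev C & v3 x .* k = ev C & v3 y = ev m *\<^sub>R (j + k) - v3 x))"
proof -
 consider "zdot x y = R" "x = y" | "zdot x y = C" | "zdot x y = zneg R" "y = zneg4 x"
  | j k where "zdot x y = zneg C" "j : set Nl" "k : set Nl" "zdot x j = C" "zdot x k = C" "zadd4 y x = zscale4 m (zadd4 j k)"
   using normals assms unfolding znormals_def list_all_iff list_ex_iff by blast
 thus ?thesis
 proof cases
  case 4
  have "v3 y = ev m *\<^sub>R (v3 j + v3 k) - v3 x" using arg_cong[OF 4(6), of v3] by (simp add: v3_add v3_scale algebra_simps)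
  moreover have "v3 x .* v3 y = - ev C" "v3 x .* v3 j = ev C" "v3 x .* v3 k = ev C"
   using 4(1,4,5) zfst[OF assms(1)] by (simp_all add: v3_inner ev_neg)
  moreover have "v3 j : N" "v3 k : N" using 4(2,3) by (auto simp: N_def)
  ultimately show ?thesis by blast
 next
  case 3
  show ?thesis using 3 zfst[OF assms(1)] v3_neg[of x] v3_inner[of x y] ev_neg[of R] by simp
 qed (use zfst[OF assms(1)] in \<open>auto simp: v3_inner\<close>)
qed

lemma zself: assumes "x : set Nl" shows "v3 x .* v3 x = ev R"
proof -
 show ?thesis using normals assms v3_inner[OF zfst[OF assms], of x] by (simp add: znormals_def list_all_iff)
qed

sublocale poly: facet_symmetric N c "ev R" "ev m"
proof
 show "finite N" by (simp add: N_def)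
 show "0 < c" "c^2 < ev R" "0 <= ev m" "ev m <= 1" using c m by auto
 fix u assume u: "u : N"
 thus "u.*u = ev R" using zself by (auto simp: N_def)
 show "- u : N" using u normals v3_neg unfolding N_def znormals_def list_all_iff by (metis (no_types, lifting) imageE imageI)
 fix v assume v: "v : N"
 have *: "(u.*v = ev R & u = v) | u.*v = ev C | (u.*v = - ev R & v = - u) |
  (u.*v = - ev C & (EX j:N. EX k:N. u.*j = ev C & u.*k = ev C & v = ev m *\<^sub>R (j + k) - u))"
 proof -
  obtain x y where "x : set Nl" "y : set Nl" "u = v3 x" "v = v3 y" using u v unfolding N_def by blast
  thus ?thesis using zpair[of x y] by simp
 qed
 show "u = v | u = - v | u.*v = c^2 | u.*v = - (c^2)" using * c by auto
 show "u ~= v ==> u.*v = c^2 | u.*v <= 2 * c^2 - ev R" using * c by auto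
 show "u.*v = - (c^2) ==> EX j:N. EX k:N. u.*j = c^2 & u.*k = c^2 & v = ev m *\<^sub>R (j + k) - u" using * c by (auto simp: \<open>u.*u = ev R\<close>)
qed (use bounded in \<open>auto simp: N_def\<close>)

lemma vv_gen: "vv ` set (e4 # gens A B Nl) = insert e0 ((%n. emb (ev A / 2) ((ev B / 2) *\<^sub>R n)) ` N)"
 by (simp add: vv_gens vv_e4 N_def)

lemma pats: "list_all (%(a, b, c, d). a < 5 & b < 5 & c < 5 & d < 5) ps" using facets by (simp add: zfacets_def)

lemma zheads: "x : zcell ps ==> fst x : set zheads & (fst x = A --> x : set (gens A B Nl))"
 by (rule zall_zcell[OF conjunct1[OF facets[unfolded zfacets_def]] _ pats])

abbreviation "Q0 \<equiv> orbit (insert e0 ((%n. emb (ev A / 2) ((ev B / 2) *\<^sub>R n)) ` N)) e0"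

lemma Q0_sub: "Q0 \<subseteq> vv ` zcell ps"
 using orbit_zcell[OF closed(1) vv_gen[symmetric] vv_e4[symmetric] _ pats] closed(2) by (auto simp: zcell_def)

sublocale prism N c "ev R" "ev m" "ev A / 2" "ev B / 2"
proof
 show "finite Q0" using finite_subset[OF Q0_sub] zcell_finite(1)[OF pats] by simp
 fix u assume "u : Q0"
 then obtain x where x: "x : zcell ps" "u = vv x" using Q0_sub by blast
 have u1: "u$1 = ev (fst x) / 2" using x by (simp add: vv_1)
 show "u$1 = 1 | u$1 = ev A / 2 | u$1 <= 2 * (ev A / 2) - 1"
  using first[of "fst x"] zheads[OF x(1)] x(1) unfolding u1 by (cases "fst x = (2, 0)"; cases "fst x = A") auto
 assume "u$1 = ev A / 2"
 thus "u : (%n. emb (ev A / 2) ((ev B / 2) *\<^sub>R n)) ` N" using zheads[OF x(1)] vv_gens[of A B Nl] x unfolding u1 by (auto simp: N_def)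
next
 fix n assume n: "n : N"
 show "emb (ev A / 2) ((ev B / 2) *\<^sub>R n) : Q0" using n poly.norm_N ab by (intro dihedral) (auto simp: emb_inner power2_eq_square)
qed (use ab in auto)

definition rep :: "real ^ 4 => zt4" where "rep u = (SOME x. x : zcell ps & vv x = u)"

lemma rep: assumes "u : Q" shows "rep u : zcell ps" "vv (rep u) = u" "u$1 = ev (fst (rep u)) / 2" "fst (rep u) : set zheads"
proof -
 have "EX x. x : zcell ps & vv x = u" using assms Q0_sub unfolding Q_def ver_eta[symmetric] by blast
 from someI_ex[OF this] show *: "rep u : zcell ps" "vv (rep u) = u" unfolding rep_def by auto
 show "u$1 = ev (fst (rep u)) / 2" using vv_1[of "rep u"] * by simp
 show "fst (rep u) : set zheads" using zheads[OF *(1)] by simp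
qed

lemma rep_head: assumes "u : Q" "k : set zheads" shows "u$1 = ev k / 2 \<longleftrightarrow> fst (rep u) = k" using rep(3,4)[OF assms(1)] by auto

lemma adjacent_iff: "vv x .* vv y = ev A / 2 \<longleftrightarrow> adjacent A x y"
proof -
 have "vv x .* vv y = ev A / 2 \<longleftrightarrow> ev (zdot x y) = ev (zadd A A)" unfolding ev_dot ev_add by auto
 thus ?thesis by (simp add: adjacent_def)
qed

lemma rep_special: "u : Q ==> u$1 = ev s / 2 ==> rep u : set (zspec s ps)"
 using rep_head[of u s] rep(1) heads zcell_finite(3)[OF pats] by (auto simp: zspec_def)

lemma gens_rep: assumes "n : N" obtains g where "g : set (gens A B Nl)" "vv g = ver n"
proof -
 have "ver n : vv ` set (gens A B Nl)" using assms by (auto simp: vv_gens N_def ver_def)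
 thus ?thesis using that by force
qed

lemma colours:
 assumes "x : zcell ps" "fst x ~: {(2, 0), A, s}" shows "zc x < H" "fst x = l ==> zc x = 0"
  "fst x ~= l ==> g : set (gens A B Nl) ==> ~ adjacent A g x"
  "y : zcell ps ==> fst y ~: {(2, 0), A, s} ==> zc x = zc y ==> ~ adjacent A x y"
proof -
 from zall_zcell[OF colour[unfolded zcolour_def] assms(1) pats] assms(2)
 have *: "zc x < H" "fst x = l --> zc x = 0"
  "fst x ~= l --> list_all (%g. ~ adjacent A g x) (gens A B Nl)"
  "zall (%y. fst y ~: set [(2, 0), A, s] --> zc x = zc y --> ~ adjacent A x y) ps" by auto
 show "zc x < H" "fst x = l ==> zc x = 0" using * by auto
 show "fst x ~= l ==> g : set (gens A B Nl) ==> ~ adjacent A g x" using *(3) by (simp add: list_all_iff)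
 show "y : zcell ps ==> fst y ~: {(2, 0), A, s} ==> zc x = zc y ==> ~ adjacent A x y"
  using zall_zcell[OF *(4) _ pats, of y] by simp
qed

lemma specials:
 assumes "x : set (zspec s ps)"
 shows "length (filter (adjacent A x) (zspec s ps)) <= 3" "length (filter (%g. adjacent A g x) (gens A B Nl)) <= t"
  "y : set (zspec s ps) ==> z : set (zspec s ps) ==> adjacent A x y ==> adjacent A x z ==> ~ adjacent A y z"
   using special assms unfolding zspecial_def list_all_iff by blast+

lemma rep_free: "u : Q ==> u$1 ~: {1, ev A / 2, ev s / 2} ==> fst (rep u) ~: {(2, 0), A, s}" using rep(3)[of u] by auto

sublocale capped N c "ev R" "ev m" "ev A / 2" "ev B / 2" "ev s / 2" "%u. zc (rep u)" H t
proof
 show "ev s / 2 < ev A / 2" using s by simp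
 show "(ev A / 2 - (ev A / 2)^2) * (1 - (ev s / 2)^2) < (ev A / 2 - ev A / 2 * (ev s / 2))^2" by (rule s(2))
next
 fix u assume u: "u : Q" "u$1 ~: {1, ev A / 2, ev s / 2}"
 note ru = colours[OF rep(1)[OF u(1)] rep_free[OF u]]
 show "zc (rep u) < H" by (rule ru(1))
 show "zc (rep u) ~= zc (rep v)" if v: "v : Q" "v$1 ~: {1, ev A / 2, ev s / 2}" "u.*v = ev A / 2" for v
 proof
  assume "zc (rep u) = zc (rep v)"
  from ru(4)[OF rep(1)[OF v(1)] rep_free[OF v(1,2)] this] adjacent_iff[of "rep u" "rep v"] v(3) u v
  show False by (simp add: rep(2))
 qed
 fix n w assume n: "n : N" "ver n .* u = ev A / 2" and w: "w : Q" "w$1 = u$1"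
 obtain g where g: "g : set (gens A B Nl)" "vv g = ver n" by (rule gens_rep[OF n(1)])
 have ul: "fst (rep u) = l"
 proof (rule ccontr)
  assume "fst (rep u) ~= l"
  from ru(3)[OF this g(1)] adjacent_iff[of g "rep u"] n(2) g(2) u show False by (simp add: rep(2))
 qed
 thus "zc (rep w) = zc (rep u)" using rep(3)[OF u(1)] rep_head[OF w(1), of l] heads u w ru(2) colours(2)[OF rep(1)[OF w(1)] rep_free[OF w(1)]] by simp
next
 fix u assume u: "u : Q" "u$1 = ev s / 2"
 have ru: "rep u : set (zspec s ps)" by (rule rep_special[OF u])
 have "{v : Q. v$1 = ev s / 2 & u.*v = ev A / 2} \<subseteq> vv ` set (filter (adjacent A (rep u)) (zspec s ps))"
 proof
  fix v assume v: "v : {v : Q. v$1 = ev s / 2 & u.*v = ev A / 2}"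
  hence rv: "rep v : set (zspec s ps)" using rep_special by simp
  have "adjacent A (rep u) (rep v)" using u v by (simp add: rep(2) flip: adjacent_iff)
  hence "rep v : set (filter (adjacent A (rep u)) (zspec s ps))" using rv by simp
  thus "v : vv ` set (filter (adjacent A (rep u)) (zspec s ps))" using rep(2)[of v] v by (metis (no_types, lifting) imageI mem_Collect_eq)
 qed
 hence "card {v : Q. v$1 = ev s / 2 & u.*v = ev A / 2} <= card (vv ` set (filter (adjacent A (rep u)) (zspec s ps)))"
  by (intro card_mono) auto
 also have "... <= length (filter (adjacent A (rep u)) (zspec s ps))" by (rule order_trans[OF card_image_le card_length]) simp
 finally show "card {v : Q. v$1 = ev s / 2 & u.*v = ev A / 2} <= 3" using specials(1)[OF ru] by simp
 have "ver ` {n : N. ver n .* u = ev A / 2} \<subseteq> vv ` set (filter (%g. adjacent A g (rep u)) (gens A B Nl))"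
 proof
  fix v assume "v : ver ` {n : N. ver n .* u = ev A / 2}"
  then obtain n where n: "n : N" "v = ver n" "ver n .* u = ev A / 2" by auto
  obtain g where g: "g : set (gens A B Nl)" "vv g = ver n" by (rule gens_rep[OF n(1)])
  have "adjacent A g (rep u)" using u n g by (simp add: rep(2) flip: adjacent_iff)
  thus "v : vv ` set (filter (%g. adjacent A g (rep u)) (gens A B Nl))" using g n by force
 qed
 hence "card (ver ` {n : N. ver n .* u = ev A / 2}) <= card (vv ` set (filter (%g. adjacent A g (rep u)) (gens A B Nl)))"
  by (intro card_mono) auto
 also have "... <= length (filter (%g. adjacent A g (rep u)) (gens A B Nl))"
  by (rule order_trans[OF card_image_le card_length]) simp
 also have "card (ver ` {n : N. ver n .* u = ev A / 2}) = card {n : N. ver n .* u = ev A / 2}"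
  by (rule card_image) (auto simp: inj_on_def ver_inj)
 finally show "card {n : N. ver n .* u = ev A / 2} <= t" using specials(2)[OF ru] by simp
 fix v w assume v: "v : Q" "v$1 = ev s / 2" "u.*v = ev A / 2" and w: "w : Q" "w$1 = ev s / 2" "u.*w = ev A / 2"
 have rv: "rep v : set (zspec s ps)" and rw: "rep w : set (zspec s ps)" using rep_special v w by auto
 show "v.*w ~= ev A / 2" using specials(3)[OF ru rv rw] u v w by (simp add: rep(2) flip: adjacent_iff)
qed

lemma card_Q: "card Q <= length (zlist ps)"
proof -
 have "card Q <= card (vv ` zcell ps)" using Q0_sub zcell_finite(1)[OF pats] unfolding Q_def ver_eta[symmetric] by (intro card_mono) auto
 also have "... <= card (zcell ps)" using zcell_finite(1)[OF pats] by (rule card_image_le)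
 finally show ?thesis using zcell_finite(2)[OF pats] by simp
qed

end

section \<open>Data and checks for the 24-cell and the 120-cell\<close>

definition oct_normals :: "zt4 list" where
 "oct_normals = concat (map (%x. concat (map (%y. map (%z. ((0, 0), x, y, z)) (zvals 1)) (zvals 1))) (zvals 1))"

definition ico_normals :: "zt4 list" where
 "ico_normals = concat (map (%x. concat (map (%y.
  [((0, 0), (0, 0), x, y), ((0, 0), y, (0, 0), x), ((0, 0), x, y, (0, 0))]) (zvals 2))) (zvals 1))"

text \<open>Colours of the caps at one height: those with a coordinate of modulus \<open>1 / golden_ratio\<close> are
 distinguished by its position and its sign.\<close>

fun zcol :: "zt4 => nat" where
 "zcol (x, y, z, w) =
  (if x = (-1, 1) then 0 else if x = (1, -1) then 1 else if x = (-2, 0) then 2 else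
   (let base = (if x = (0, 0) then 3 else if x = (-1, 0) then 12 else 19);
     other = (if y = (0, 0) then if z = (0, 0) then 6 else 7 else 8) in
   base + (if y = (-1, 1) then 0 else if y = (1, -1) then 1 else if z = (-1, 1) then 2 else if z = (1, -1) then 3
    else if w = (-1, 1) then 4 else if w = (1, -1) then 5 else if x = (0, 0) then other else 6)))"

lemma oct_checks:
 "znormals oct_normals (3, 0) (1, 0) (1, 0)"
 "zclosed (e4 # gens (1, 0) (1, 0) oct_normals) pats24" "zpattern e4 : set pats24"
 "zfacets (1, 0) (gens (1, 0) (1, 0) oct_normals) pats24"
 "zspecial (1, 0) (zspec (-1, 0) pats24) (gens (1, 0) (1, 0) oct_normals) 1"
 "zcolour (1, 0) (-1, 0) (0, 0) (%x. 0) 1 (gens (1, 0) (1, 0) oct_normals) pats24" by code_simp+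

lemma ico_checks:
 "znormals ico_normals (2, 1) (0, 1) (-1, 1)"
 "zclosed (e4 # gens (0, 1) (-1, 1) ico_normals) pats120" "zpattern e4 : set pats120"
 "zfacets (0, 1) (gens (0, 1) (-1, 1) ico_normals) pats120"
 "zspecial (0, 1) (zspec (1, 0) pats120) (gens (0, 1) (-1, 1) ico_normals) 3" by code_simp+

lemma ico_colour: "zcolour (0, 1) (1, 0) (-1, 1) zcol 25 (gens (0, 1) (-1, 1) ico_normals) pats120" by code_simp

text \<open>The angle is \<pi>/3, so the reflections generate a dihedral group of order 6;
  alternating them leads through e, e - v, -v, v.\<close>

lemma dihedral_3:
 fixes e v :: "real ^ 'n"
 assumes "e : G" "v : G" "e.*e = 1" "v.*v = 1" "e.*v = 1/2" shows "v : orbit G e"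
proof -
 have "e - v : orbit G e" using orbit.refl[OF orbit.base assms(2), of e] assms by (simp add: srefl_def inner_commute)
 from orbit.refl[OF this assms(1)] have "- v : orbit G e" using assms by (simp add: srefl_def inner_diff_right)
 from orbit.refl[OF this assms(2)] show ?thesis using assms by (simp add: srefl_def scaleR_2)
qed

text \<open>The angle is \<pi>/5, since \<tau>/2 is its cosine; alternating the reflections reaches
  \<open>- v\<close> after four steps and \<open>v\<close> after the fifth.\<close>

lemma dihedral_5:
 fixes e v :: "real ^ 'n"
 assumes "e : G" "v : G" "e.*e = 1" "v.*v = 1" "e.*v = \<tau>/2" shows "v : orbit G e"
proof -
 have t: "\<tau> * \<tau> = \<tau> + 1" by (rule tau2)
 have i: "v.*e = \<tau>/2" using assms by (simp add: inner_commute)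
 have "2 * (e .* (e - \<tau> *\<^sub>R v)) = 1 - \<tau>" using t unfolding inner_diff_right inner_scaleR_right assms by (simp add: field_simps)
 hence "e - \<tau> *\<^sub>R v - (1 - \<tau>) *\<^sub>R e : orbit G e" using orbit.refl[OF orbit.base assms(2), of e] i orbit.refl[OF _ assms(1)]
  unfolding srefl_def by (fastforce simp: srefl_def)
 hence "\<tau> *\<^sub>R e - \<tau> *\<^sub>R v : orbit G e" by (simp add: algebra_simps)
 moreover have "2 * (v .* (\<tau> *\<^sub>R e - \<tau> *\<^sub>R v)) = 1 - \<tau>" using t unfolding inner_diff_right inner_scaleR_right assms i by (simp add: field_simps)
 ultimately have "\<tau> *\<^sub>R e - \<tau> *\<^sub>R v - (1 - \<tau>) *\<^sub>R v : orbit G e" using orbit.refl[OF _ assms(2)] unfolding srefl_def by metis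
 hence "- v : orbit G e" using assms orbit.refl[OF _ assms(1)] unfolding srefl_def by (fastforce simp: algebra_simps inner_diff_right)
 from orbit.refl[OF this assms(2)] show ?thesis using assms by (simp add: srefl_def scaleR_2)
qed

lemma oct_head: assumes "x : zcell pats24" shows "fst x : set [(2, 0), (1, 0), (0, 0), (-1, 0), (-2, 0)]"
proof -
 have "zall (%x. fst x : set [(2, 0), (1, 0), (0, 0), (-1, 0), (-2, 0)]) pats24"
  "list_all (%(a, b, c, d). a < 5 & b < 5 & c < 5 & d < 5) pats24" by code_simp+
 thus ?thesis using zall_zcell[OF _ assms, of "%x. fst x : set [(2, 0), (1, 0), (0, 0), (-1, 0), (-2, 0)]"] by blast
qed

lemma oct_sum:
 assumes "!!u. u : v3 ` set oct_normals ==> u.*x <= 1" shows "\<bar>x$1\<bar> + \<bar>x$2\<bar> + \<bar>x$3\<bar> <= 1"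
proof -
 have "p * x$1 + q * x$2 + r * x$3 <= 1" if pqr: "p : {1, -1}" "q : {1, -1}" "r : {1, -1}" for p q r :: real
 proof -
  have "vector [p, q, r] : v3 ` set oct_normals" using pqr by (auto simp: oct_normals_def zvals_def v3_tuple image_Un)
  from assms[OF this] show ?thesis by (simp add: inner_3)
 qed
 from this[of "if x$1 >= 0 then 1 else -1" "if x$2 >= 0 then 1 else -1" "if x$3 >= 0 then 1 else -1"]
 have "(if x$1 >= 0 then 1 else -1) * x$1 + (if x$2 >= 0 then 1 else -1) * x$2 + (if x$3 >= 0 then 1 else -1) * x$3 <= 1" by simp
 thus ?thesis by (simp split: if_splits)
qed

lemma norm_le_sum_3: "norm (x :: real ^ 3) <= \<bar>x$1\<bar> + \<bar>x$2\<bar> + \<bar>x$3\<bar>" using norm_le_l1_cart[of x] by (simp add: sum_3)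

lemma oct_zprism: "zprism oct_normals pats24 (1, 0) (1, 0) (1, 0) (3, 0) (1, 0) (-1, 0) (0, 0) 1 (%x. 0) 1 1"
proof
 show "norm x <= 1" if "!!u. u : v3 ` set oct_normals ==> u.*x <= 1" for x using oct_sum[OF that] norm_le_sum_3[of x] by simp
 show "ev x <= 2 * ev (1, 0) - 2" if "x : fst ` zcell pats24" "x ~: {(2, 0), (1, 0)}" for x using that oct_head by fastforce
 show "v : orbit G e" if "e : G" "v : G" "e.*e = 1" "v.*v = 1" "e.*v = ev (1, 0) / 2" for G and e v :: "real ^ 4"
  using dihedral_3[OF that(1-4)] that(5) by simp
qed (use oct_checks in \<open>auto simp: zheads_def power2_eq_square\<close>)

text \<open>The three facet inequalities, weighted by the absolute values of the coordinates and
  added, bound a quadratic form. Absorbing the linear term by 2 s k <= s^2 + k^2 leaves (2 \<tau> -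
  1) |x|^2 <= \<tau> < 2 \<tau> - 1.\<close>

lemma ico_bound:
 assumes "!!u. u : v3 ` set ico_normals ==> u.*x <= sqrt \<tau>" shows "norm x < 1"
proof -
 have pq: "p * x$2 + q * \<tau> * x$3 <= sqrt \<tau>" "q * \<tau> * x$1 + p * x$3 <= sqrt \<tau>" "p * x$1 + q * \<tau> * x$2 <= sqrt \<tau>"
  if pq: "p : {1, -1}" "q : {1, -1}" for p q :: real
 proof -
  have "vector [0, p, q * \<tau>] : v3 ` set ico_normals" "vector [q * \<tau>, 0, p] : v3 ` set ico_normals"
   "vector [p, q * \<tau>, 0] : v3 ` set ico_normals" using pq by (auto simp: ico_normals_def zvals_def v3_tuple image_Un)
  from this[THEN assms] show "p * x$2 + q * \<tau> * x$3 <= sqrt \<tau>" "q * \<tau> * x$1 + p * x$3 <= sqrt \<tau>" "p * x$1 + q * \<tau> * x$2 <= sqrt \<tau>"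
   by (simp_all add: inner_3)
 qed
 define A B D k where "A = \<bar>x$1\<bar>" and "B = \<bar>x$2\<bar>" and "D = \<bar>x$3\<bar>" and "k = sqrt \<tau>"
 have sg: "(if y >= 0 then 1 else -1) * y = \<bar>y\<bar>" "(if y >= 0 then 1 else -1) * \<tau> * y = \<tau> * \<bar>y\<bar>" for y :: real by auto
 have le: "B + \<tau> * D <= k" "\<tau> * A + D <= k" "A + \<tau> * B <= k"
  using pq(1)[of "if x$2 >= 0 then 1 else -1" "if x$3 >= 0 then 1 else -1"]
   pq(2)[of "if x$3 >= 0 then 1 else -1" "if x$1 >= 0 then 1 else -1"]
   pq(3)[of "if x$1 >= 0 then 1 else -1" "if x$2 >= 0 then 1 else -1"] unfolding sg A_def B_def D_def k_def by simp_all
 have nn: "A >= 0" "B >= 0" "D >= 0" by (auto simp: A_def B_def D_def)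
 have "A * (\<tau> * A + D) + B * (A + \<tau> * B) + D * (B + \<tau> * D) <= A * k + B * k + D * k"
  using le nn by (intro add_mono mult_left_mono) auto
 moreover have "(2 * \<tau> - 1) * (A^2 + B^2 + D^2) + (A + B + D)^2 = 2 * (A * (\<tau> * A + D) + B * (A + \<tau> * B) + D * (B + \<tau> * D))"
  by (simp add: algebra_simps power2_eq_square)
 moreover have "(A + B + D) * k = A * k + B * k + D * k" by (simp add: algebra_simps)
 moreover have "2 * ((A + B + D) * k) <= (A + B + D)^2 + k^2"
  using zero_le_power2[of "A + B + D - k"] by (simp add: power2_eq_square algebra_simps)
 moreover have "k^2 = \<tau>" using tau_bounds by (simp add: k_def)
 moreover have "X <= w" if "F <= Y" "X + q = 2 * F" "Z = Y" "2 * Z <= q + p" "p = w" for X F Y q Z p w :: real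
  using that by linarith
 ultimately have "(2 * \<tau> - 1) * (A^2 + B^2 + D^2) <= \<tau>" by blast
 moreover have "\<tau> < (2 * \<tau> - 1) * 1" using tau_bounds by simp
 ultimately have "(2 * \<tau> - 1) * (A^2 + B^2 + D^2) < (2 * \<tau> - 1) * 1" by linarith
 thus ?thesis using tau_bounds by (simp add: mult_less_cancel_left inner_3 A_def B_def D_def power2_eq_square norm_eq_sqrt_inner)
qed

lemma ico_zprism: "zprism ico_normals pats120 (0, 1) (-1, 1) (0, 1) (2, 1) (-1, 1) (1, 0) (-1, 1) (sqrt \<tau>) zcol 25 3"
proof
 have t: "\<tau> * \<tau> = \<tau> + 1" by (rule tau2)
 show "norm x <= 1" if "!!u. u : v3 ` set ico_normals ==> u.*x <= sqrt \<tau>" for x using ico_bound[OF that] by simp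
 show "ev x <= 2 * ev (0, 1) - 2" if "x : set zheads" "x ~: {(2, 0), (0, 1)}" for x
  using that tau_bounds by (auto simp: zheads_def)
 show "v : orbit G e" if "e : G" "v : G" "e.*e = 1" "v.*v = 1" "e.*v = ev (0, 1) / 2" for G and e v :: "real ^ 4"
  using dihedral_5[OF that(1-4)] that(5) by simp
 show "(ev (0, 1) / 2)^2 + (ev (-1, 1) / 2)^2 * ev (2, 1) = 1"
 proof -
  show ?thesis unfolding t by (simp add: power2_eq_square algebra_simps t) (simp add: field_simps)
 qed
 show "(sqrt \<tau>)^2 * (ev (-1, 1) / 2)^2 = ev (0, 1) / 2 - (ev (0, 1) / 2)^2"
 proof -
  show ?thesis using tau_bounds unfolding t by (simp add: power2_eq_square algebra_simps t) (simp add: field_simps)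
 qed
 show "(ev (0, 1) / 2 - (ev (0, 1) / 2)^2) * (1 - (ev (1, 0) / 2)^2) < (ev (0, 1) / 2 - ev (0, 1) / 2 * (ev (1, 0) / 2))^2"
  using tau_bounds by (simp add: power2_eq_square algebra_simps t) (simp add: field_simps)
qed (use ico_checks ico_colour tau_bounds in \<open>auto simp: zheads_def\<close>)

lemma oct_poly: "{x. ALL u : v3 ` set oct_normals. u.*x <= 1} = right_angled_ideal_octahedron"
proof
 show "right_angled_ideal_octahedron \<subseteq> {x. ALL u : v3 ` set oct_normals. u.*x <= 1}" unfolding right_angled_ideal_octahedron_def
 proof (rule hull_minimal)
  have "{x. ALL u : v3 ` set oct_normals. u.*x <= 1} = (INT u: v3 ` set oct_normals. {x. u.*x <= 1})" by auto
  thus "convex {x. ALL u : v3 ` set oct_normals. u.*x <= 1}" by (simp add: convex_INT convex_halfspace_le)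
  have mem: "u$i : {1, -1}" if "u : v3 ` set oct_normals" for u i
   using that exhaust_3[of i] by (auto simp: oct_normals_def zvals_def v3_tuple)
  have "u .* axis i 1 <= 1" "u .* - axis i 1 <= 1" if "u : v3 ` set oct_normals" for u i using mem[OF that, of i]
   by (auto simp: inner_axis minus_le_iff)
  thus "Basis \<union> uminus ` Basis \<subseteq> {x :: real ^ 3. ALL u : v3 ` set oct_normals. u.*x <= 1}" unfolding Basis_vec_def by auto
 qed
 show "{x. ALL u : v3 ` set oct_normals. u.*x <= 1} \<subseteq> right_angled_ideal_octahedron"
 proof
  fix x :: "real ^ 3" assume "x : {x. ALL u : v3 ` set oct_normals. u.*x <= 1}"
  hence s: "\<bar>x$1\<bar> + \<bar>x$2\<bar> + \<bar>x$3\<bar> <= 1" by (intro oct_sum) blast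
  let ?P = "right_angled_ideal_octahedron"
  have cv: "convex ?P" by (simp add: right_angled_ideal_octahedron_def)
  have ax: "axis i (1::real) : ?P" "- axis i (1::real) : ?P" for i
   unfolding right_angled_ideal_octahedron_def by (auto intro!: hull_inc simp: Basis_vec_def)
  \<comment> \<open>Index 0 stands for the origin, which receives the mass that the three signed
    axis vectors leave over.\<close>
  define f where "f = (%j::nat. if j = 0 then 0 else let i = (of_nat j :: 3) in sgn (x$i) *\<^sub>R axis i (1::real))"
  define w where "w = (%j::nat. if j = 0 then 1 - (\<bar>x$1\<bar> + \<bar>x$2\<bar> + \<bar>x$3\<bar>) else \<bar>x$(of_nat j :: 3)\<bar>)"
  have "(SUM j:{0,1,2,3}. w j *\<^sub>R f j) : ?P"
  proof (rule convex_sum[OF _ cv])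
   show "(SUM j:{0,1,2,3}. w j) = 1" by (simp add: w_def)
   show "w j >= 0" if "j : {0,1,2,3}" for j using s by (simp add: w_def)
   show "f j : ?P" if "j : {0,1,2,3}" for j using convexD[OF cv ax(1)[of 1] ax(2)[of 1], of "1/2" "1/2"] ax by (auto simp: f_def sgn_if Let_def)
  qed simp
  also have "(SUM j:{0,1,2,3}. w j *\<^sub>R f j) = x"
   by (simp add: w_def f_def Let_def vec_eq_iff forall_3 axis_def abs_mult_sgn sgn_if)
  finally show "x : ?P" .
 qed
qed

lemma ico_poly: "v3 ` set ico_normals = icosahedron_vertices"
 by (auto simp: ico_normals_def icosahedron_vertices_def zvals_def v3_tuple image_Un)

lemma zlist_lengths: "length (zlist pats24) = 24" "length (zlist pats120) = 120" by code_simp+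

section \<open>Colourings and path pseudometrics\<close>

lemma greedy_colouring:
 assumes "finite V" and "!!x. x : V ==> card {y : V. E x y} <= d"
  and sym: "!!x y. E x y ==> E y x" and irr: "!!x. x : V ==> ~ E x x"
 shows "EX f :: 'a => nat. (ALL x:V. f x <= d) & (ALL x:V. ALL y:V. E x y --> f x ~= f y)" using assms(1,2,4)
proof (induction V rule: finite_induct)
 case (insert x V)
 have "card {z : V. E y z} <= d" if "y : V" for y
 proof -
  have "card {z : V. E y z} <= card {z : insert x V. E y z}" using insert(1) by (intro card_mono) auto
  also have "... <= d" using insert(4)[of y] that by simp
  finally show ?thesis .
 qed
 then obtain f :: "'a => nat" where f: "ALL x:V. f x <= d" "ALL x:V. ALL y:V. E x y --> f x ~= f y" using insert by auto
 have "card (f ` {y : V. E x y}) <= card {y : V. E x y}" using insert(1) by (intro card_image_le) auto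
 also have "... <= card {y : insert x V. E x y}" using insert(1) by (intro card_mono) auto
 also have "... <= d" using insert(4) by simp
 finally have "card (f ` {y : V. E x y}) < card {..d}" by simp
 then obtain k where k: "k <= d" "k ~: f ` {y : V. E x y}" using insert(1) card_mono[of "f ` {y : V. E x y}" "{..d}"] by auto
 have "ALL y:insert x V. ALL z:insert x V. E y z --> (f(x := k)) y ~= (f(x := k)) z"
  using f k insert(2) insert(5)[of x] by (auto simp: image_iff) (metis sym)
 moreover have "ALL y:insert x V. (f(x := k)) y <= d" using f k by auto
 ultimately show ?case by blast
qed simp

text \<open>Provides room for the quotient space inside the real numbers.\<close>

lemma ex_inj_vec4_real: "EX f :: nat \<times> (real ^ 4) => real. inj f"
proof -
 obtain p :: "real \<times> real => real" where p: "bij_betw p (UNIV \<times> UNIV) UNIV"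
  using card_of_ordIso[THEN iffD2, OF card_of_Times_same_infinite[OF infinite_UNIV_char_0[where ?'a = real]]] by (elim exE)
 hence pi: "p x = p y \<longleftrightarrow> x = y" for x y using inj_eq by (fastforce simp: bij_betw_def)
 have "inj (%(n::nat, x::real ^ 4). p (real n, p (x$1, p (x$2, p (x$3, x$4)))))" by (auto simp: inj_on_def pi vec_eq_iff forall_4)
 thus ?thesis by blast
qed

text \<open>The infimum of chain lengths is a pseudometric, finite because chains exist between all
  points. Its metric quotient is placed in the given type by choosing a representative in each class
  and applying \<open>h\<close>.\<close>

lemma (in pregluing) ex_prerealized:
 fixes h :: "'i \<times> (real ^ 'n) => 'a"
 assumes h: "inj_on h (I \<times> cell)" and con: "!!p q. p : I \<times> cell ==> q : I \<times> cell ==> EX l. chain p q l"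
 shows "EX (X :: 'a metric) \<pi>. prerealized N c R I nb tr X \<pi>"
proof -
 define dd where "dd = (%p q. Inf {l. chain p q l})"
 have bdd: "bdd_below {l. chain p q l}" for p q using chain_nonneg by (intro bdd_belowI[of _ 0]) auto
 have ne: "{l. chain p q l} ~= {}" if "p : I \<times> cell" "q : I \<times> cell" for p q using con[OF that] by auto
 have le: "dd p q <= l" if "chain p q l" for p q l unfolding dd_def using that by (intro cInf_lower bdd) simp
 have less: "EX l. chain p q l & l < dd p q + e" if "p : I \<times> cell" "q : I \<times> cell" "e > 0" for p q e
  using cInf_lessD[OF ne[OF that(1,2)], of "dd p q + e"] that by (auto simp: dd_def)
 have nn: "0 <= dd p q" if "p : I \<times> cell" "q : I \<times> cell" for p q
  unfolding dd_def using chain_nonneg by (intro cInf_greatest ne that) auto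
 have self: "dd p p = 0" if "p : I \<times> cell" for p
 proof -
  obtain i x where "p = (i, x)" "i : I" "x : cell" using \<open>p : I \<times> cell\<close> by auto
  thus ?thesis using le[OF chain.refl[of i x]] nn[OF that that] by simp
 qed
 have sym: "dd p q = dd q p" for p q unfolding dd_def by (rule arg_cong[of _ _ Inf]) (auto dest: chain_sym)
 have tri: "dd p r <= dd p q + dd q r" if p: "p : I \<times> cell" and q: "q : I \<times> cell" and r: "r : I \<times> cell" for p q r
 proof (rule field_le_epsilon)
  fix e :: real assume "e > 0"
  then obtain l m where lm: "chain p q l" "l < dd p q + e/2" "chain q r m" "m < dd q r + e/2"
   using less[OF p q, of "e/2"] less[OF q r, of "e/2"] by auto
  show "dd p r <= dd p q + dd q r + e" using le[OF chain_trans[OF lm(1,3)]] lm by simp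
 qed
 \<comment> \<open>Points at distance 0 define the same predicate, so the choice operator returns
   the same representative for them.\<close>
 define rp where "rp = (%p. SOME q. q : I \<times> cell & dd p q = 0)"
 have rp: "rp p : I \<times> cell" "dd p (rp p) = 0" if "p : I \<times> cell" for p
 proof -
  have "EX q. q : I \<times> cell & dd p q = 0" using self[OF that] that by blast
  from someI_ex[OF this] show "rp p : I \<times> cell" "dd p (rp p) = 0" by (auto simp: rp_def)
 qed
 have cong: "dd (rp p) (rp q) = dd p q" if p: "p : I \<times> cell" and q: "q : I \<times> cell" for p q
  using tri[OF rp(1)[OF p] p rp(1)[OF q]] tri[OF p q rp(1)[OF q]] tri[OF p rp(1)[OF p] q]
   tri[OF rp(1)[OF p] rp(1)[OF q] q] rp(2)[OF p] rp(2)[OF q] sym[of "rp p" p] sym[of "rp q" q] by linarith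
 have rp_eq: "rp p = rp q" if p: "p : I \<times> cell" and q: "q : I \<times> cell" and z: "dd p q = 0" for p q
 proof -
  have "dd p r = dd q r" if r: "r : I \<times> cell" for r using tri[OF p q r] tri[OF q p r] z sym[of q p] by simp
  hence "(%r. r : I \<times> cell & dd p r = 0) = (%r. r : I \<times> cell & dd q r = 0)" by auto
  thus ?thesis by (simp add: rp_def)
 qed
 define \<pi> where "\<pi> = (%p. h (rp p))"
 define hi where "hi = inv_into (I \<times> cell) h"
 have hi: "hi (\<pi> p) = rp p" if "p : I \<times> cell" for p using inv_into_f_f[OF h rp(1)[OF that]] by (simp add: hi_def \<pi>_def)
 have dpi: "dd (hi (\<pi> p)) (hi (\<pi> q)) = dd p q" if "p : I \<times> cell" "q : I \<times> cell" for p q using that by (simp add: hi cong)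
 interpret X: Metric_space "\<pi> ` (I \<times> cell)" "%a b. if a : \<pi> ` (I \<times> cell) & b : \<pi> ` (I \<times> cell) then dd (hi a) (hi b) else 0"
 proof
  fix a b c
  show "0 <= (if a : \<pi> ` (I \<times> cell) & b : \<pi> ` (I \<times> cell) then dd (hi a) (hi b) else 0)" using nn dpi by auto
  show "(if a : \<pi> ` (I \<times> cell) & b : \<pi> ` (I \<times> cell) then dd (hi a) (hi b) else 0) =
    (if b : \<pi> ` (I \<times> cell) & a : \<pi> ` (I \<times> cell) then dd (hi b) (hi a) else 0)" using sym by auto
  assume "a : \<pi> ` (I \<times> cell)" "b : \<pi> ` (I \<times> cell)"
  then obtain p q where pq: "p : I \<times> cell" "q : I \<times> cell" "a = \<pi> p" "b = \<pi> q" by blast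
  thus "((if a : \<pi> ` (I \<times> cell) & b : \<pi> ` (I \<times> cell) then dd (hi a) (hi b) else 0) = 0) = (a = b)"
   using dpi[OF pq(1,2)] rp_eq[OF pq(1,2)] self[OF pq(1)] dpi[OF pq(1,1)] by (auto simp: \<pi>_def)
  assume "c : \<pi> ` (I \<times> cell)"
  then obtain r where r: "r : I \<times> cell" "c = \<pi> r" by blast
  show "(if a : \<pi> ` (I \<times> cell) & c : \<pi> ` (I \<times> cell) then dd (hi a) (hi c) else 0)
   <= (if a : \<pi> ` (I \<times> cell) & b : \<pi> ` (I \<times> cell) then dd (hi a) (hi b) else 0) +
    (if b : \<pi> ` (I \<times> cell) & c : \<pi> ` (I \<times> cell) then dd (hi b) (hi c) else 0)"
     using tri[OF pq(1,2) r(1)] dpi[OF pq(1,2)] dpi[OF pq(2) r(1)] dpi[OF pq(1) r(1)] pq r by auto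
 qed
 define X where "X = metric (\<pi> ` (I \<times> cell), %a b. if a : \<pi> ` (I \<times> cell) & b : \<pi> ` (I \<times> cell) then dd (hi a) (hi b) else 0)"
 have "prerealized N c R I nb tr X \<pi>"
 proof
  show "\<pi> ` (I \<times> cell) = mspace X" by (simp add: X_def)
  fix p q assume p: "p : I \<times> cell" and q: "q : I \<times> cell"
  have "mdist X (\<pi> p) (\<pi> q) = dd p q" using dpi[OF p q] p q by (simp add: X_def)
  moreover have "ennreal (dd p q) = (INF l \<in> {l. chain p q l}. ennreal l)"
  proof (rule antisym)
   show "ennreal (dd p q) <= (INF l \<in> {l. chain p q l}. ennreal l)" by (rule INF_greatest) (auto intro: ennreal_leI le)
   show "(INF l \<in> {l. chain p q l}. ennreal l) <= ennreal (dd p q)"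
   proof (rule ennreal_le_epsilon)
    fix e :: real assume e: "e > 0"
    then obtain l where l: "chain p q l" "l < dd p q + e" using less[OF p q] by blast
    have "(INF l \<in> {l. chain p q l}. ennreal l) <= ennreal l" using l by (auto intro: INF_lower)
    also have "... <= ennreal (dd p q + e)" using l by (intro ennreal_leI) simp
    also have "... = ennreal (dd p q) + ennreal e" using nn[OF p q] e by (simp add: ennreal_plus)
    finally show "(INF l \<in> {l. chain p q l}. ennreal l) <= ennreal (dd p q) + ennreal e" .
   qed
  qed
  ultimately show "ennreal (mdist X (\<pi> p) (\<pi> q)) = (INF l \<in> {l. chain p q l}. ennreal l)" by simp
 qed
 thus ?thesis by blast
qed

section \<open>The volume of a polytope and of its facets\<close>

lemma prod_Basis_vec: "(PROD b:(Basis :: (real ^ 'n) set). x .* b) = (PROD i:UNIV. x $ i)"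
proof -
 have B: "(Basis :: (real ^ 'n) set) = (%i. axis i 1) ` UNIV" by (auto simp: Basis_vec_def)
 have inj: "inj (%i. axis i (1::real) :: real ^ 'n)" by (auto simp: inj_on_def axis_eq_axis)
 show ?thesis unfolding B by (subst prod.reindex[OF inj]) (simp add: inner_axis)
qed

lemma emb_measurable [measurable]: "(%(s, x). emb s x) : borel_measurable (lborel \<Otimes>\<^sub>M lborel)"
proof -
 have "continuous_on UNIV (%p :: real \<times> (real ^ 3). emb (fst p) (snd p))"
  by (intro linear_continuous_on linear_conv_bounded_linear[THEN iffD1] linearI) (simp_all add: emb_linear)
 thus ?thesis using borel_measurable_continuous_onI by (fastforce simp: borel_prod[symmetric] case_prod_beta' lborel_prod)
qed

lemma lborel_emb: "lborel = distr (lborel \<Otimes>\<^sub>M lborel) borel (%(s, x). emb s x)"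
proof (rule lborel_eqI)
 fix l u :: "real ^ 4" assume lu: "!!b. b : Basis ==> l.*b <= u.*b"
 have le: "l$i <= u$i" for i using lu[of "axis i 1"] by (auto simp: Basis_vec_def inner_axis)
 have pre: "(%(s, x). emb s x) -` box l u \<inter> space (lborel \<Otimes>\<^sub>M lborel) = box (l$1) (u$1) \<times> box (tail l) (tail u)"
  by (auto simp: mem_box_cart forall_4 forall_3 emb_def tail_def vector_4 space_pair_measure mem_box)
 have "emeasure (distr (lborel \<Otimes>\<^sub>M lborel) borel (%(s, x). emb s x)) (box l u) =
   emeasure (lborel \<Otimes>\<^sub>M lborel) (box (l$1) (u$1) \<times> box (tail l) (tail u))" by (subst emeasure_distr) (auto simp: pre)
 also have "... = emeasure lborel (box (l$1) (u$1)) * emeasure lborel (box (tail l) (tail u))"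
  by (intro lborel.emeasure_pair_measure_Times) auto
 also have "emeasure lborel (box (tail l) (tail u)) = ennreal (PROD b:Basis. (tail u - tail l) .* b)"
 proof (rule emeasure_lborel_box)
  have "ALL i. tail l $ i <= tail u $ i" using le by (simp add: forall_3 tail_def)
  thus "tail l .* b <= tail u .* b" if "b : Basis" for b using that by (auto simp: Basis_vec_def inner_axis)
 qed
 also have "emeasure lborel (box (l$1) (u$1)) = ennreal (u$1 - l$1)" using le by (simp add: emeasure_lborel_box_eq)
 also have "ennreal (u$1 - l$1) * ennreal (PROD b:Basis. (tail u - tail l) .* b) = ennreal (PROD b:Basis. (u - l) .* b)"
 proof -
  show ?thesis using le unfolding UNIV_3 UNIV_4 prod_Basis_vec by (simp add: tail_def mult.assoc ennreal_mult')
 qed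
 finally show "emeasure (distr (lborel \<Otimes>\<^sub>M lborel) borel (%(s, x). emb s x)) (box l u) = ennreal (PROD b:Basis. (u - l) .* b)" .
qed simp

lemma nn_integral_emb:
 fixes f :: "real ^ 4 => ennreal"
 assumes [measurable]: "f : borel_measurable borel" shows "(\<integral>\<^sup>+ x. f x \<partial>lborel) = (\<integral>\<^sup>+ s. (\<integral>\<^sup>+ y. f (emb s y) \<partial>lborel) \<partial>lborel)"
proof -
 have "(\<integral>\<^sup>+ x. f x \<partial>lborel) = (\<integral>\<^sup>+ x. f x \<partial>(distr (lborel \<Otimes>\<^sub>M lborel) borel (%(s, x). emb s x)))" using lborel_emb by simp
 also have "... = (\<integral>\<^sup>+ p. f (case p of (s, x) => emb s x) \<partial>(lborel \<Otimes>\<^sub>M lborel))" by (rule nn_integral_distr) auto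
 also have "... = (\<integral>\<^sup>+ s. (\<integral>\<^sup>+ y. f (emb s y) \<partial>lborel) \<partial>lborel)" by (subst lborel.nn_integral_fst[symmetric]) auto
 finally show ?thesis .
qed

lemma nn_integral_scale:
 fixes f :: "real ^ 3 => ennreal"
 assumes [measurable]: "f : borel_measurable borel" and k: "k > 0"
 shows "(\<integral>\<^sup>+ x. f x \<partial>lborel) = ennreal (k ^ 3) * (\<integral>\<^sup>+ x. f (k *\<^sub>R x) \<partial>lborel)"
proof -
 have "(\<integral>\<^sup>+ x. f x \<partial>lborel) = (\<integral>\<^sup>+ x. f x \<partial>(density (distr lborel borel (%x. 0 + k *\<^sub>R x)) (%_. \<bar>k\<bar>^DIM(real ^ 3))))"
  using lborel_affine[of k "0 :: real ^ 3"] k by simp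
 also have "... = ennreal (k ^ 3) * (\<integral>\<^sup>+ x. f (k *\<^sub>R x) \<partial>lborel)"
  using k by (simp add: nn_integral_density nn_integral_distr nn_integral_cmult)
 finally show ?thesis .
qed

context prism
begin

text \<open>The cone from 0 over the base facet: radially above a point of the cone, the base wall
  is reached no later than any side wall.\<close>

definition cone :: "(real ^ 4) set" where
 "cone = {x : ub. 0 <= x$1 & x$1 <= sqrt a & (ALL n:N. ver n .* x <= x$1)}"

lemma cone_borel: "cone : sets borel"
proof -
 have "cone = ub \<inter> ({x. e0 .* x >= 0} \<inter> {x. e0 .* x <= sqrt a} \<inter> (INT n:N. {x. (ver n - e0) .* x <= 0}))"
  by (auto simp: cone_def inner_e0 inner_diff_left)
 moreover have "closed ({x. e0 .* x >= 0} \<inter> {x. e0 .* x <= sqrt a} \<inter> (INT n:N. {x. (ver n - e0) .* x <= 0}))"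
  by (intro closed_Int closed_INT ballI closed_halfspace_le closed_halfspace_ge)
 ultimately show ?thesis by (metis borel_closed borel_open open_ball sets.Int)
qed

text \<open>A point of the cell belongs to the cone over a facet whose normal is maximal at that
  point, and all these cones are congruent because the symmetries act transitively on the
  facets.\<close>

lemma cap_volume_cone: "kvol cap.cell <= of_nat (card Q) * kvol cone"
proof -
 define B where "B = (%u. SOME B. orth B & B ` Q = Q & B e0 = u)"
 have B: "orth (B u)" "B u ` Q = Q" "B u e0 = u" if "u : Q" for u
  using someI_ex[of "%B. orth B & B ` Q = Q & B e0 = u"] Q_transitive[OF that] unfolding B_def by metis+
 have hB: "hiso (det (matrix (B u))) (B u)" if "u : Q" for u using B(1)[OF that] by (rule hiso.orth)
 have cub: "cone \<subseteq> ub" by (auto simp: cone_def)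
 have sub: "cap.cell \<subseteq> (UN u:Q. B u ` cone)"
 proof
  fix x assume x: "x : cap.cell"
  have "Max ((%u. u.*x) ` Q) : (%u. u.*x) ` Q" using finQ e0Q by (intro Max_in) auto
  then obtain u where u0: "u : Q" "u.*x = Max ((%u. u.*x) ` Q)" by auto
  have u: "u : Q" "!!v. v : Q ==> v.*x <= u.*x" using u0 finQ by auto
  obtain y where y: "x = B u y" using orthogonal_transformation_surj[OF B(1)[OF u(1)]] by (metis surjD)
  have in': "B u v .* x = v.*y" for v using B(1)[OF u(1)] y by (simp add: orthogonal_transformation_def)
  have ux: "u.*x = y$1" using in'[of e0] B(3)[OF u(1)] inner_e0 by simp
  have Qy: "v.*y <= y$1" if "v : Q" for v using u(2)[of "B u v"] in'[of v] ux B(2)[OF u(1)] that by auto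
  obtain n where n: "n : N" using span_N by fastforce
  \<comment> \<open>Opposite sides \<open>ver n\<close> and \<open>ver (- n)\<close> are both
    bounded by the first coordinate; adding the bounds removes \<open>n\<close>.\<close>
  have "(1 - a) * y$1 >= 0" using Qy[OF verQ[OF n]] Qy[OF verQ[OF neg_N[OF n]]] by (simp add: inner_ver algebra_simps)
  hence "y$1 >= 0" using ab by (simp add: zero_le_mult_iff)
  hence "y : cone" using B(1)[OF u(1)] y x u(1) ux Qy verQ by (auto simp: orthogonal_transformation_def cap.cell_def ball01_iff cone_def)
  thus "x : (UN u:Q. B u ` cone)" using u(1) y by blast
 qed
 have bor: "B u ` cone : sets borel" "B u ` cone \<subseteq> ub" if "u : Q" for u
  using hiso_image_borel[OF hB[OF that] cub cone_borel] hiso_ball[OF hB[OF that]] cub by blast+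
 have "kvol cap.cell = emeasure kmeasure cap.cell" by (rule klein_volume_emeasure) (use cap.cell_ub cap.cell_borel in auto)
 also have "... <= emeasure kmeasure (UN u:Q. B u ` cone)" using sub bor finQ by (intro emeasure_mono) auto
 also have "... <= (SUM u:Q. emeasure kmeasure (B u ` cone))" using bor finQ by (intro emeasure_subadditive_finite) auto
 also have "... = (SUM u:Q. kvol cone)"
 proof (intro sum.cong HOL.refl)
  fix u assume u: "u : Q"
  show "emeasure kmeasure (B u ` cone) = kvol cone"
   using klein_volume_emeasure[OF bor(2,1)[OF u]] hiso_volume[OF hB[OF u] cub cone_borel] by simp
 qed
 finally show ?thesis by (simp add: mult.commute)
qed

text \<open>The slope of the cone: its slice at height \<open>s\<close> consists of points of the
  polytope scaled by \<open>kp * s\<close>.\<close>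

definition kp :: real where "kp = sqrt ((1 - a) / a)"

lemma kp: "kp > 0" "c * b * kp = 1 - a" "a * (1 + kp^2 * t) = a + (1 - a) * t"
proof -
 show k: "kp > 0" using ab by (simp add: kp_def)
 have k2: "kp^2 = (1 - a) / a" using ab by (simp add: kp_def)
 have "(c * b * kp)^2 = (a - a^2) * ((1 - a) / a)" using wall k2 by (simp add: power_mult_distrib)
 also have "... = (1 - a)^2" using ab by (simp add: power2_eq_square field_simps)
 finally show "c * b * kp = 1 - a" using k c_pos ab by (simp add: power2_eq_iff_nonneg)
 show "a * (1 + kp^2 * t) = a + (1 - a) * t" unfolding k2 using ab by (simp add: field_simps)
qed

lemma cone_slice:
 assumes "s > 0" "emb s ((kp * s) *\<^sub>R y) : cone" shows "s <= sqrt a" "y : poly"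
proof -
 show "s <= sqrt a" using assms by (simp add: cone_def)
 have "n.*y <= c" if "n : N" for n
 proof -
  have "s * (b * kp * (n.*y)) <= s * (1 - a)" using assms that by (simp add: cone_def inner_ver algebra_simps)
  hence "b * kp * (n.*y) <= b * kp * c" using assms(1) kp(2) by (simp add: mult.commute mult.left_commute)
  thus ?thesis using ab kp(1) by (simp add: mult.assoc)
 qed
 thus "y : poly" by (simp add: poly_def)
qed

text \<open>The slice factor s^3 has been replaced by the larger a s, valid as s^2 <= a, which makes
  the integral elementary. Its value is estimated further, by 1 / r <= 1 and by raising the exponent
  -3/2 of 1 - |y|^2 to the -2 of the three-dimensional density.\<close>

lemma slice_bound:
 assumes y: "norm y < 1"
 shows "(\<integral>\<^sup>+ s. ennreal (kp ^ 3 * a * s * (1 - s^2 * (1 + kp^2 * (norm y)^2)) powr (- 5 / 2)) * indicator {0..sqrt a} s \<partial>lborel)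
  <= ennreal (1 / (3 * sqrt a)) * ennreal ((1 - (norm y)^2) powr (- 2))"
proof -
 define r where "r = 1 + kp^2 * (norm y)^2"
 define Y where "Y = 1 - (norm y)^2"
 have Y: "0 < Y" "Y <= 1" using y by (auto simp: Y_def power_less_one_iff abs_square_less_1)
 have r1: "r >= 1" by (simp add: r_def)
 have q: "1 - a * r = (1 - a) * Y" unfolding r_def kp(3) by (simp add: Y_def algebra_simps)
 have pos: "1 - s^2 * r > 0" if "0 <= s" "s <= sqrt a" for s
 proof -
  have "s^2 <= a" using that ab by (metis power_mono real_sqrt_pow2 less_imp_le)
  hence "s^2 * r <= a * r" using r1 by (intro mult_right_mono) auto
  moreover have "a * r < 1" using q Y ab by (smt (verit) mult_pos_pos)
  ultimately show ?thesis by simp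
 qed
 define F where "F = (%s. kp ^ 3 * a * ((1 - s^2 * r) powr (- 3 / 2) / (3 * r)))"
 have "(\<integral>\<^sup>+ s. ennreal (kp ^ 3 * a * s * (1 - s^2 * r) powr (- 5 / 2)) * indicator {0..sqrt a} s \<partial>lborel) = F (sqrt a) - F 0"
 proof (rule nn_integral_FTC_Icc)
  show "(%s. kp ^ 3 * a * s * (1 - s^2 * r) powr (- 5 / 2)) : borel_measurable borel" by measurable
  show "0 <= sqrt a" using ab by simp
  fix s assume "s : {0..sqrt a}"
  hence s: "0 <= s" "s <= sqrt a" by auto
  show "0 <= kp ^ 3 * a * s * (1 - s^2 * r) powr (- 5 / 2)" using s ab kp(1) by simp
  have e: "(1 - s^2 * r) powr (- 3 / 2 - 1) = (1 - s^2 * r) powr (- 5 / 2)" by simp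
  have "(F has_real_derivative kp ^ 3 * a * ((- 3 / 2 * (1 - s^2 * r) powr (- 3 / 2 - 1) * (- (2 * s * r))) / (3 * r))) (at s)"
   unfolding F_def using pos[OF s] by (auto intro!: derivative_eq_intros)
  also have "kp ^ 3 * a * ((- 3 / 2 * (1 - s^2 * r) powr (- 3 / 2 - 1) * (- (2 * s * r))) / (3 * r))
   = kp ^ 3 * a * s * (1 - s^2 * r) powr (- 5 / 2)" unfolding e using r1 by (simp add: field_simps)
  finally show "DERIV F s :> kp ^ 3 * a * s * (1 - s^2 * r) powr (- 5 / 2)" .
 qed
 also have "ennreal (F (sqrt a) - F 0) <= ennreal (1 / (3 * sqrt a) * Y powr (- 2))"
 proof (rule ennreal_leI)
  have "F (sqrt a) - F 0 <= F (sqrt a)" using kp(1) ab r1 by (simp add: F_def)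
  also have "... = kp ^ 3 * a * ((1 - a) * Y) powr (- 3 / 2) / (3 * r)" using ab by (simp add: F_def q)
  also have "... <= kp ^ 3 * a * ((1 - a) * Y) powr (- 3 / 2) / 3" using r1 ab kp(1)
   by (intro divide_left_mono mult_nonneg_nonneg) auto
  also have "((1 - a) * Y) powr (- 3 / 2) = (1 - a) powr (- 3 / 2) * Y powr (- 3 / 2)" by (simp add: powr_mult)
  also have "(1 - a) powr (- 3 / 2) = 1 / (sqrt (1 - a)) ^ 3"
  proof -
   have "(sqrt (1 - a)) ^ 3 = ((1 - a) powr (1 / 2)) powr 3" using ab by (simp add: powr_half_sqrt powr_numeral)
   also have "... = (1 - a) powr (3 / 2)" by (simp add: powr_powr)
   finally show ?thesis using powr_minus_divide[of "1 - a" "3 / 2"] by simp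
  qed
  also have "kp ^ 3 * a * (1 / (sqrt (1 - a)) ^ 3 * Y powr (- 3 / 2)) / 3 = 1 / (3 * sqrt a) * Y powr (- 3 / 2)"
   using ab by (simp add: kp_def real_sqrt_divide power_divide power3_eq_cube)
  also have "... <= 1 / (3 * sqrt a) * Y powr (- 2)"
  proof -
   have "Y powr (- 3 / 2) <= Y powr (- 2)" using Y by (intro powr_mono') auto
   thus ?thesis using ab by (intro mult_left_mono) auto
  qed
  finally show "F (sqrt a) - F 0 <= 1 / (3 * sqrt a) * Y powr (- 2)" .
 qed
 also have "... = ennreal (1 / (3 * sqrt a)) * ennreal (Y powr (- 2))" using ab by (intro ennreal_mult) auto
 finally show ?thesis by (simp add: r_def Y_def)
qed

text \<open>Rescaling every slice to the polytope and exchanging the integrations leaves, for each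
  point of the facet, the radial integral of \<open>slice_bound\<close>.\<close>

lemma cone_volume: "kvol cone <= ennreal (1 / (3 * sqrt a)) * kvol cell"
proof -
 note [measurable] = cone_borel cell_borel
 define g where "g = (%x :: real ^ 4. ennreal ((1 - (norm x)^2) powr (- 5 / 2)) * indicator cone x)"
 have g [measurable]: "g : borel_measurable borel" unfolding g_def by measurable
 define G where "G = (%s y. indicator {0<..} s * ennreal ((kp * s) ^ 3) * g (emb s ((kp * s) *\<^sub>R y)))"
 have em: "(%p. emb (fst p) ((kp * fst p) *\<^sub>R snd p)) : borel_measurable (lborel \<Otimes>\<^sub>M lborel)"
  using measurable_compose[OF _ emb_measurable, of "%p. (fst p, (kp * fst p) *\<^sub>R snd p)" "lborel \<Otimes>\<^sub>M lborel"]
  by (simp add: case_prod_beta')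
 have [measurable]: "(%(s, y). G s y) : borel_measurable (lborel \<Otimes>\<^sub>M lborel)"
  unfolding G_def case_prod_beta' using measurable_compose[OF em g] by measurable
 have "kvol cone = (\<integral>\<^sup>+ x. g x \<partial>lborel)" by (simp add: klein_volume_def g_def)
 also have "... = (\<integral>\<^sup>+ s. (\<integral>\<^sup>+ y. g (emb s y) \<partial>lborel) \<partial>lborel)" by (rule nn_integral_emb[OF g])
 also have "... = (\<integral>\<^sup>+ s. (\<integral>\<^sup>+ y. G s y \<partial>lborel) \<partial>lborel)"
 proof (rule nn_integral_cong_AE)
  have "AE s in lborel. s ~= (0 :: real)" by (rule AE_lborel_singleton)
  thus "AE s in lborel. (\<integral>\<^sup>+ y. g (emb s y) \<partial>lborel) = (\<integral>\<^sup>+ y. G s y \<partial>lborel)"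
  proof (rule AE_mp, intro AE_I2 impI)
   fix s :: real assume s: "s ~= 0"
   show "(\<integral>\<^sup>+ y. g (emb s y) \<partial>lborel) = (\<integral>\<^sup>+ y. G s y \<partial>lborel)"
   proof (cases "s > 0")
    case True
    have gm: "(%y. g (emb s y)) : borel_measurable borel"
     using measurable_compose[OF measurable_Pair1'[of s] measurable_compose[OF emb_measurable g]] by simp
    have "(\<integral>\<^sup>+ y. g (emb s y) \<partial>lborel) = ennreal ((kp * s) ^ 3) * (\<integral>\<^sup>+ y. g (emb s ((kp * s) *\<^sub>R y)) \<partial>lborel)"
     by (rule nn_integral_scale[OF gm]) (use True kp in simp)
    also have "... = (\<integral>\<^sup>+ y. G s y \<partial>lborel)" unfolding G_def using True by (simp add: nn_integral_cmult)
    finally show ?thesis .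
   next
    case False
    thus ?thesis using s by (simp add: g_def cone_def G_def)
   qed
  qed
 qed
 also have "... = (\<integral>\<^sup>+ y. (\<integral>\<^sup>+ s. G s y \<partial>lborel) \<partial>lborel)" by (rule lborel_pair.Fubini'[symmetric]) simp
 also have "... <= (\<integral>\<^sup>+ y. ennreal (1 / (3 * sqrt a)) * (ennreal ((1 - (norm y)^2) powr (- (real CARD(3) + 1) / 2)) * indicator cell y) \<partial>lborel)"
 proof (rule nn_integral_mono_AE)
  have "AE y in lborel. y ~: sphere (0 :: real ^ 3) 1"
   by (metis negligible_sphere closed_sphere borel_closed negligible_iff_null_sets null_sets_completion_iff sets_lborel AE_not_in)
  thus "AE y in lborel. (\<integral>\<^sup>+ s. G s y \<partial>lborel) <=
    ennreal (1 / (3 * sqrt a)) * (ennreal ((1 - (norm y)^2) powr (- (real CARD(3) + 1) / 2)) * indicator cell y)"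
  proof (rule AE_mp, intro AE_I2 impI)
   fix y :: "real ^ 3" assume y: "y ~: sphere 0 1"
   show "(\<integral>\<^sup>+ s. G s y \<partial>lborel) <=
    ennreal (1 / (3 * sqrt a)) * (ennreal ((1 - (norm y)^2) powr (- (real CARD(3) + 1) / 2)) * indicator cell y)"
   proof (cases "y : poly")
    case True
    hence ny: "norm y < 1" using poly_cball y by force
    hence yc: "y : cell" using True poly_cell by (force simp: mem_ball_0)
    have "G s y <= ennreal (kp ^ 3 * a * s * (1 - s^2 * (1 + kp^2 * (norm y)^2)) powr (- 5 / 2)) * indicator {0..sqrt a} s" for s
    proof (cases "s > 0 & emb s ((kp * s) *\<^sub>R y) : cone")
     case True
     hence s: "0 < s" "s <= sqrt a" using cone_slice by auto
     have "s^2 <= a" using s ab by (metis power_mono real_sqrt_pow2 less_imp_le)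
     hence le: "(kp * s) ^ 3 <= kp ^ 3 * a * s" using s kp(1) by (simp add: power_mult_distrib power3_eq_cube power2_eq_square mult_ac)
     have nm: "(norm (emb s ((kp * s) *\<^sub>R y)))^2 = s^2 * (1 + kp^2 * (norm y)^2)"
     proof -
      show ?thesis unfolding power2_norm_eq_inner emb_inner power2_norm_eq_inner[of y] by (simp add: power2_eq_square algebra_simps)
     qed
     have "G s y = ennreal ((kp * s) ^ 3 * (1 - s^2 * (1 + kp^2 * (norm y)^2)) powr (- 5 / 2))"
      using True by (simp add: G_def g_def nm ennreal_mult'')
     also have "... <= ennreal (kp ^ 3 * a * s * (1 - s^2 * (1 + kp^2 * (norm y)^2)) powr (- 5 / 2))"
      using le by (intro ennreal_leI mult_right_mono) auto
     finally show ?thesis using s by simp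
    next
     case False
     thus ?thesis by (auto simp: G_def g_def)
    qed
    hence "(\<integral>\<^sup>+ s. G s y \<partial>lborel) <= (\<integral>\<^sup>+ s. ennreal (kp ^ 3 * a * s * (1 - s^2 * (1 + kp^2 * (norm y)^2)) powr (- 5 / 2)) * indicator {0..sqrt a} s \<partial>lborel)"
     by (rule nn_integral_mono)
    also have "... <= ennreal (1 / (3 * sqrt a)) * ennreal ((1 - (norm y)^2) powr (- 2))" by (rule slice_bound[OF ny])
    finally show ?thesis using yc by simp
   next
    case False
    hence "G s y = 0" for s using cone_slice(2)[of s y] by (auto simp: G_def g_def indicator_def)
    thus ?thesis by simp
   qed
  qed
 qed
 also have "... = ennreal (1 / (3 * sqrt a)) * kvol cell" unfolding klein_volume_def by (rule nn_integral_cmult) measurable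
 finally show ?thesis .
qed

lemma cap_volume: "kvol cap.cell <= ennreal (real (card Q) / (3 * sqrt a)) * kvol cell"
proof -
 have "kvol cap.cell <= of_nat (card Q) * (ennreal (1 / (3 * sqrt a)) * kvol cell)"
  using cap_volume_cone mult_left_mono[OF cone_volume, of "of_nat (card Q)"] by simp
 also have "... = ennreal (real (card Q) / (3 * sqrt a)) * kvol cell"
 proof -
  have "of_nat (card Q) * ennreal (1 / (3 * sqrt a)) = ennreal (real (card Q) * (1 / (3 * sqrt a)))"
   using ab by (subst ennreal_mult) (auto simp: ennreal_of_nat_eq_real_of_nat)
  thus ?thesis by (simp add: mult.assoc[symmetric])
 qed
 finally show ?thesis .
qed

end

section \<open>The four-dimensional gluing\<close>

definition sdiff :: "'a set => 'a set => 'a set" where "sdiff A B = (A - B) \<union> (B - A)"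

lemma sdiff_simps [simp]: "sdiff A {} = A" "sdiff (sdiff A B) B = A" by (auto simp: sdiff_def)

lemma sdiff_assoc: "sdiff (sdiff A B) C = sdiff A (sdiff B C)" by (auto simp: sdiff_def)
lemma sdiff_comm: "sdiff A B = sdiff B A" by (auto simp: sdiff_def)
lemma sdiff_cancel: "sdiff A B = sdiff A C \<longleftrightarrow> B = C" by (auto simp: sdiff_def)

lemma card_sdiff:
 assumes "finite A" "finite B" shows "card (sdiff A B) + 2 * card (A \<inter> B) = card A + card B"
proof -
 have "card (sdiff A B) = card (A - B) + card (B - A)" unfolding sdiff_def using assms by (intro card_Un_disjoint) auto
 moreover have "card A = card (A - B) + card (A \<inter> B)" using assms card_Int_Diff[of A B] by simp
 moreover have "card B = card (B - A) + card (A \<inter> B)" using assms card_Int_Diff[of B A] by (simp add: Int_commute)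
 ultimately show ?thesis by simp
qed

lemma odd_card_sdiff: "finite A ==> finite B ==> odd (card (sdiff A B)) \<longleftrightarrow> odd (card A) ~= odd (card B)"
 using card_sdiff[of A B] by (metis even_add even_mult_iff even_numeral)

lemma sign_card_sdiff:
 assumes "finite A" "finite B" "odd (card B)" shows "(-1 :: real) ^ card (sdiff A B) = - ((-1) ^ card A)"
  using odd_card_sdiff[OF assms(1,2)] assms(3) by (cases "even (card A)") auto

context capped
begin

text \<open>The multiple of \<open>tail u\<close> lying on exactly those walls of the base cell
  whose side facet is adjacent to the cap \<open>u\<close>. For the 24-cell it is the centre of a
  triangle of the octahedron, for the 120-cell a vertex of the dodecahedron.\<close>

definition z :: "real ^ 4 => real ^ 3" where "z u = (c * b / (a - a * s0)) *\<^sub>R tail u"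
definition spec :: "(real ^ 4) set" where "spec = {u : Q. u$1 = s0}"

lemma as0: "a - a * s0 > 0" "s0 < 1" using s0 ab by auto

lemma specQ: "u : spec ==> u : Q" "u : spec ==> u$1 = s0" by (auto simp: spec_def)

lemma head_ver: "ver n $ 1 = a" by (simp add: ver_def)

lemma z_inner: assumes "u : spec" shows "n .* z u = c * ((ver n .* u - a * s0) / (a - a * s0))"
 using assms by (simp add: z_def inner_ver specQ field_simps)

lemma z_le: assumes "u : spec" "n : N" shows "n .* z u <= c" "n .* z u = c \<longleftrightarrow> ver n .* u = a"
proof -
 have "c * ((ver n .* u - a * s0) / (a - a * s0)) <= c * 1"
  using head_ver[of n] specQ[OF assms(1)] s0 Q_inner[OF verQ[OF assms(2)] specQ(1)[OF assms(1)]] ab c_pos by (intro mult_left_mono) auto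
 thus "n .* z u <= c" by (simp add: z_inner[OF assms(1)])
 show "n .* z u = c \<longleftrightarrow> ver n .* u = a"
 proof
  assume "n .* z u = c"
  hence "c * ((ver n .* u - a * s0) / (a - a * s0)) = c * 1" by (simp only: z_inner[OF assms(1)] mult_1_right)
  hence "(ver n .* u - a * s0) / (a - a * s0) = 1" using c_pos mult_left_cancel[of c] by blast
  thus "ver n .* u = a" by simp
 next
  assume "ver n .* u = a"
  moreover have "a - a * s0 ~= 0" using as0(1) by linarith
  hence "(a - a * s0) / (a - a * s0) = 1" by (rule divide_self)
  ultimately show "n .* z u = c" unfolding z_inner[OF assms(1)] by (simp only: mult_1_right)
 qed
qed

text \<open>After insertion of \<open>wall\<close>, the assumption \<open>spread\<close> is the
  inequality |z u| < 1.\<close>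

lemma z_cell: assumes u: "u : spec" shows "z u : cell"
proof -
 have tu: "tail u .* tail u = 1 - s0^2" using inner_head_tail[of u u] specQ(2)[OF u] Q_unit[OF specQ(1)[OF u]] by (simp add: power2_eq_square)
 have "z u .* z u = (c * b / (a - a * s0))^2 * (1 - s0^2)" unfolding z_def by (simp add: tu power2_eq_square)
 also have "... = (a - a^2) * (1 - s0^2) / (a - a * s0)^2" by (simp add: power_divide power_mult_distrib wall)
 also have "... < 1" using spread by (subst divide_less_eq_1_pos) auto
 finally have "z u : ub" by (simp add: ball01_iff)
 thus ?thesis using z_le(1)[OF u] by (simp add: cell_def)
qed

lemma z_tight: assumes "u : spec" shows "tight (z u) = {n : N. ver n .* u = a}" using z_le(2)[OF assms] by (auto simp: tight_def)

lemma z_inj: assumes "u : spec" "v : spec" "z u = z v" shows "u = v"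
proof -
 have "tail u = tail v" using c_pos ab as0 assms(3) by (simp add: z_def)
 thus ?thesis using specQ(2)[OF assms(1)] specQ(2)[OF assms(2)] emb_simps(3) by metis
qed

lemma z_lft: "linear A ==> z (lft A u) = A (z u)" by (simp add: z_def linear_scale)

end

type_synonym cell_index = "nat \<times> real \<times> nat set"

text \<open>\<open>q\<close> binary digits suffice to encode a colour of a cap at height \<open>s0\<close> by an odd set.\<close>

locale covering = capped N c R \<mu> a b s0 h H t + realized N c R I nb tr M \<pi>
 for N :: "(real ^ 3) set" and c R \<mu> a b s0 :: real and h :: "real ^ 4 => nat" and H t :: nat
  and I :: "nat set" and nb tr and M :: "'a metric" and \<pi> +
 fixes q :: nat and base :: nat
 assumes digits: "3 * 2 ^ t < (2 :: nat) ^ (q - 1)" "q > 0" and base: "base : I"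
  and nice: "i : I ==> u : Q ==> v : Q ==> u$1 = s0 ==> v$1 = s0 ==> u.*v = a ==>
   \<pi> (i, z u) ~= \<pi> (i, z v)"
begin

section \<open>Colouring the points of \<open>M\<close> attached to caps\<close>

definition pts :: "'a set" where "pts = \<pi> ` (I \<times> z ` spec)"
definition edge :: "'a => 'a => bool" where
 "edge p p' \<longleftrightarrow> (EX i:I. EX u:spec. EX v:spec. u.*v = a & p = \<pi> (i, z u) & p' = \<pi> (i, z v))"

lemma finite_spec: "finite spec" using finQ by (simp add: spec_def)

text \<open>Each representative of \<open>p\<close> comes from a set of walls through
  \<open>z u\<close>, so there are at most \<open>2 ^ t\<close>; \<open>special_degree\<close> gives
  at most three neighbours for each.\<close>

lemma edge_degree:
 assumes "p : pts" shows "card {p' : pts. edge p p'} <= 3 * 2 ^ t"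
proof -
 obtain i u where iu: "i : I" "u : spec" "p = \<pi> (i, z u)" using assms by (auto simp: pts_def)
 note zc = z_cell[OF iu(2)]
 obtain r where st: "star i (z u) r" by (rule ex_star[OF iu(1) zc])
 have kb: "z u : KB (z u) (r/3)" using rpos[OF iu(1) zc st] xb[OF iu(1) zc st] by (intro centre_in_KB) auto
 define D where "D = (%w. dev i w (z u))"
 define F where "F = (%w. (%v. \<pi> (fst (D w), z v)) ` {v : Q. v$1 = s0 & (THE u. u : spec & z u = snd (D w)) .* v = a})"
 define G where "G = {w : Pow (tight (z u)). EX u':spec. z u' = snd (D w)}"
 have "{p' : pts. edge p p'} \<subseteq> (UN w:G. F w)"
 proof
  fix p' assume "p' : {p' : pts. edge p p'}"
  then obtain j u' v where j: "j : I" "u' : spec" "v : spec" "u'.*v = a" "p = \<pi> (j, z u')" "p' = \<pi> (j, z v)"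
   by (auto simp: edge_def)
  obtain w where w: "good (z u) r w (z u)" "(j, z u') = dev i w (z u)"
   using iu(3) psi_centre[OF iu(1) zc st] psi_rep[OF iu(1) zc st _ kb] j z_cell[OF j(2)] by (metis SigmaI)
  have Dw: "fst (D w) = j" "snd (D w) = z u'" using w(2) by (auto simp: D_def simp flip: w(2))
  have the': "(THE u. u : spec & z u = z u') = u'" using j(2) z_inj unfolding Dw by auto
  have "p' : F w" using j(3,4) specQ unfolding F_def Dw the' j(6) by simp
  moreover have "w : Pow (tight (z u))" using w(1) by (simp add: good_def)
  hence "w : G" unfolding G_def mem_Collect_eq Dw using j(2) by blast
  ultimately show "p' : (UN w:G. F w)" by blast
 qed
 moreover have finF: "finite (F w)" for w using finQ by (auto simp: F_def)
 moreover have finG: "finite G" using tight_fin by (auto simp: G_def)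
 ultimately have "card {p' : pts. edge p p'} <= card (UN w:G. F w)" by (intro card_mono) auto
 also have "... <= (SUM w:G. card (F w))" by (rule card_UN_le[OF finG])
 also have "... <= (SUM w:G. 3)"
 proof (rule sum_mono)
  fix w assume "w : G"
  then obtain u' where u': "u' : spec" "z u' = snd (D w)" by (auto simp: G_def)
  hence e: "(THE u. u : spec & z u = snd (D w)) = u'" using z_inj by (intro the_equality) auto
  have "card (F w) <= card {v : Q. v$1 = s0 & u'.*v = a}" unfolding F_def e using finQ by (intro card_image_le) auto
  thus "card (F w) <= 3" using special_degree[OF specQ[OF u'(1)]] by simp
 qed
 also have "... <= 3 * card (Pow (tight (z u)))" using card_mono[of "Pow (tight (z u))" G] tight_fin by (auto simp: G_def)
 also have "... <= 3 * 2 ^ t"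
 proof -
  have "(2 :: nat) ^ card (tight (z u)) <= 2 ^ t" using special_tight[OF specQ[OF iu(2)]] by (simp add: z_tight[OF iu(2)])
  thus ?thesis by (simp add: card_Pow tight_fin)
 qed
 finally show ?thesis .
qed

text \<open>The greedy colours 0, ..., 3 * 2^t fit into the 2^(q-1) odd subsets of \<open>q\<close>
  digits. Odd size makes a colour nonempty, as independence needs, and lets the crossing of a cap
  reverse orientation.\<close>

lemma ex_point_colouring:
 obtains f :: "'a => nat set" where "!!p. p : pts ==> f p \<subseteq> {..<q} & odd (card (f p))"
  "!!p p'. p : pts ==> p' : pts ==> edge p p' ==> f p ~= f p'"
proof -
 have fp: "finite pts" unfolding pts_def using finI finite_spec by simp
 have es: "edge y x" if "edge x y" for x y using that unfolding edge_def by (metis inner_commute)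
 have ei: "~ edge x x" for x using nice specQ(1) specQ(2) by (simp add: edge_def)
 obtain f :: "'a => nat" where f: "ALL x:pts. f x <= 3 * 2 ^ t" "ALL x:pts. ALL y:pts. edge x y --> f x ~= f y"
  using greedy_colouring[OF fp edge_degree es ei] by blast
 define odds where "odds = {S. S \<subseteq> {..<q} & odd (card S)}"
 \<comment> \<open>The last digit corrects the parity of an arbitrary set of the other
   digits.\<close>
 define e where "e = (%S. if odd (card S) then S else insert (q - 1) S)"
 have S: "finite S" "q - 1 ~: S" if "S \<subseteq> {..<q - 1}" for S using that finite_subset by auto
 have "e ` Pow {..<q - 1} \<subseteq> odds" using S digits(2) by (force simp: e_def odds_def)
 moreover have "inj_on e (Pow {..<q - 1})"
 proof (rule inj_onI)
  have e: "e X - {q - 1} = X" if "X : Pow {..<q - 1}" for X using that by (auto simp: e_def)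
  fix A B assume "A : Pow {..<q - 1}" "B : Pow {..<q - 1}" "e A = e B"
  thus "A = B" using e by metis
 qed
 moreover have "finite odds" by (auto simp: odds_def)
 ultimately have "2 ^ (q - 1) <= card odds" using card_inj_on_le[of e "Pow {..<q - 1}" odds] by (simp add: card_Pow)
 then obtain k where k: "inj_on k {..(3 :: nat) * 2 ^ t}" "k ` {..3 * 2 ^ t} \<subseteq> odds"
  using digits card_le_inj[of "{..(3 :: nat) * 2 ^ t}" odds] \<open>finite odds\<close> by auto
 show ?thesis
 proof (rule that[of "k \<circ> f"])
  show "(k \<circ> f) p \<subseteq> {..<q} & odd (card ((k \<circ> f) p))" if "p : pts" for p
  proof -
   show ?thesis using k(2) f(1) that by (auto simp: odds_def)
  qed
  show "(k \<circ> f) p ~= (k \<circ> f) p'" if "p : pts" "p' : pts" "edge p p'" for p p'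
   using inj_onD[OF k(1), of "f p" "f p'"] f that by auto
 qed
qed

definition pcol :: "'a => nat set" where
 "pcol = (SOME f. (ALL p:pts. f p \<subseteq> {..<q} & odd (card (f p))) & (ALL p:pts. ALL p':pts. edge p p' --> f p ~= f p'))"

lemma pcol:
 "p : pts ==> pcol p \<subseteq> {..<q} & odd (card (pcol p))" "p : pts ==> p' : pts ==> edge p p' ==> pcol p ~= pcol p'"
proof -
 have "EX f. (ALL p:pts. f p \<subseteq> {..<q} & odd (card (f p))) & (ALL p:pts. ALL p':pts. edge p p' --> f p ~= f p')"
  using ex_point_colouring by metis
 from someI_ex[OF this, folded pcol_def]
 show "p : pts ==> pcol p \<subseteq> {..<q} & odd (card (pcol p))" "p : pts ==> p' : pts ==> edge p p' ==> pcol p ~= pcol p'" by blast+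
qed

text \<open>Caps at height \<open>s0\<close> share the digits below \<open>q\<close>, every other
  cap has a single digit from \<open>q\<close> on; the two kinds of colours are disjoint.\<close>

definition col :: "nat => real ^ 4 => nat set" where
 "col i u = (if u$1 = s0 then pcol (\<pi> (i, z u)) else {q + h u})"

definition caps :: "(real ^ 4) set" where "caps = {u : Q. u$1 ~= 1 & u$1 ~= a}"

lemma capsQ: "u : caps ==> u : Q" by (simp add: caps_def)

lemma spec_pts: "i : I ==> u : spec ==> \<pi> (i, z u) : pts" by (auto simp: pts_def)

lemma col_odd: assumes "i : I" "u : caps" shows "col i u \<subseteq> {..<q + H}" "odd (card (col i u))" "finite (col i u)"
proof -
 show "col i u \<subseteq> {..<q + H}"
 proof (cases "u$1 = s0")
  case True
  hence "pcol (\<pi> (i, z u)) \<subseteq> {..<q}" using assms pcol(1)[OF spec_pts[OF assms(1)]] by (simp add: spec_def caps_def)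
  thus ?thesis using True unfolding col_def by auto
 next
  case False
  thus ?thesis using h_less[of u] assms by (auto simp: col_def caps_def)
 qed
 thus "finite (col i u)" using finite_subset by blast
 show "odd (card (col i u))" using pcol(1)[OF spec_pts[OF assms(1)], of u] assms by (auto simp: col_def caps_def spec_def)
qed

lemma symsD: "A : syms ==> orth A" "A : syms ==> A ` N = N" "A : syms ==> linear A"
 by (auto simp: syms_def orthogonal_transformation_linear)

lemma lft_in_Q: "A : syms ==> u : Q ==> lft A u : Q" using lft_Q[OF symsD(1,2)] by blast

lemma lft_caps: "A : syms ==> u : caps ==> lft A u : caps" using lft_in_Q by (simp add: caps_def)

text \<open>For a special cap adjacent to the side \<open>n\<close> the point \<open>z u\<close>
  lies on the wall \<open>n\<close>, so it and its image are the same point of \<open>M\<close>. For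
  other caps adjacent to a side, \<open>h\<close> depends on the height alone.\<close>

lemma col_step:
 assumes i: "i : I" and n: "n : N" and u: "u : caps" "ver n .* u = a" shows "col (nb i n) (lft (tr i n) u) = col i u"
proof -
 have t: "tr i n : syms" by (rule tr_syms[OF i n])
 show ?thesis
 proof (cases "u$1 = s0")
  case True
  hence s: "u : spec" using u by (simp add: spec_def caps_def)
  show ?thesis using z_le(2)[OF s n] u(2) pi_eq[OF chain_jump1[OF i z_cell[OF s] n]] True by (simp add: col_def z_lft[OF symsD(3)[OF t]])
 next
  case False
  thus ?thesis using h_lft[OF capsQ[OF u(1)] _ n u(2) lft_in_Q[OF t capsQ[OF u(1)]]] u by (simp add: caps_def col_def)
 qed
qed

section \<open>Crossing rules of the four-dimensional gluing\<close>

definition vinv :: "real ^ 4 => real ^ 3" where "vinv u = (1 / b) *\<^sub>R tail u"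

lemma vinv [simp]: "vinv (ver n) = n" using ab by (simp add: vinv_def ver_def)

definition dl :: "(real ^ 3 => real ^ 3) => real" where "dl A = det (matrix (lft A))"

lemma dl_comp: assumes "linear A" "linear B" shows "dl (A \<circ> B) = dl A * dl B"
proof -
 have l: "linear (lft C)" if "linear C" for C
  using that by (intro linearI) (simp_all add: lft_def tail_linear linear_add linear_scale emb_linear)
 have "lft (A \<circ> B) = lft A \<circ> lft B" by (simp add: fun_eq_iff lft_comp)
 thus ?thesis using matrix_compose[OF l[OF assms(2)] l[OF assms(1)]] by (simp add: dl_def det_mul)
qed

lemma dl_sign: assumes "A : syms" shows "dl A = 1 | dl A = -1"
 unfolding dl_def using lft_orth[OF symsD(1)[OF assms]] by (simp add: orthogonal_transformation_matrix det_orthogonal_matrix)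

lemma lft_id [simp]: "lft id = id" "lft (%x. x) = id" by (simp_all add: lft_def fun_eq_iff)

lemma dl_id: "dl id = 1" by (simp add: dl_def matrix_id_mat_1)

text \<open>Crossing a side multiplies \<open>s\<close> by minus the determinant of the gluing map,
  and crossing a cap changes the parity of \<open>v\<close>. Hence \<open>s * (-1) ^ card v\<close>
  obeys the sign rule of an orientable gluing even if \<open>M\<close> is not orientable.\<close>

definition unb :: "cell_index => real ^ 4 => cell_index" where
 "unb p u = (case p of (i, s, v) => if u$1 = 1 then (i, - s, v)
  else if u$1 = a then (nb i (vinv u), - dl (tr i (vinv u)) * s, v)
  else (i, s, sdiff v (col i u)))"

definition utr :: "cell_index => real ^ 4 => real ^ 4 => real ^ 4" where
 "utr p u = (if u$1 = a then lft (tr (fst p) (vinv u)) else id)"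

lemma Q_cases [consumes 1, case_names top side cap]:
 assumes "u : Q" obtains "u = e0" | n where "n : N" "u = ver n" | "u : caps" "u$1 ~= 1" "u$1 ~= a"
  using unit_e0 Q_unit assms vertical_iff caps_def by blast

lemma unb_simps:
 "unb (i, s, v) e0 = (i, - s, v)" "unb (i, s, v) (ver n) = (nb i n, - dl (tr i n) * s, v)"
 "u : caps ==> unb (i, s, v) u = (i, s, sdiff v (col i u))" using ab by (auto simp: unb_def head_ver caps_def)

lemma utr_simps: "utr p e0 = id" "utr (i, s, v) (ver n) = lft (tr i n)" "u : caps ==> utr p u = id"
 using ab by (auto simp: utr_def head_ver caps_def)

definition full :: "cell_index set" where "full = I \<times> {1, -1} \<times> Pow {..<q + H}"
text \<open>Only the cells reachable from \<open>base\<close> are glued, which makes the result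
  connected; the larger set \<open>full\<close> serves for the volume bound.\<close>

definition J :: "cell_index set" where
 "J = {p. (%p p'. p : full & (EX u:Q. p' = unb p u))\<^sup>*\<^sup>* (base, 1, {}) p}"

lemma unb_full: assumes "p : full" "u : Q" shows "unb p u : full"
proof -
 obtain i s v where p: "p = (i, s, v)" "i : I" "s : {1, -1}" "v \<subseteq> {..<q + H}" using assms by (auto simp: full_def)
 from assms(2) show ?thesis
 proof (cases rule: Q_cases)
  case (side n)
  thus ?thesis using p nb_in dl_sign[OF tr_syms[OF p(2) side(1)]] by (auto simp: unb_simps full_def)
 next
  case cap
  thus ?thesis using p col_odd(1)[OF p(2) cap(1)] by (auto simp: unb_simps full_def sdiff_def)
 qed (use p in \<open>auto simp: unb_simps full_def\<close>)
qed

lemma base_full: "(base, 1, {}) : full" using base by (simp add: full_def)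

lemma J_full: assumes "p : J" shows "p : full"
proof -
 have "(%p p'. p : full & (EX u:Q. p' = unb p u))\<^sup>*\<^sup>* (base, 1, {}) p" using assms by (simp add: J_def)
 thus ?thesis by (induction rule: rtranclp_induct) (use base_full unb_full in auto)
qed

lemma J_base: "(base, 1, {}) : J" by (simp add: J_def)

lemma J_unb: assumes "p : J" "u : Q" shows "unb p u : J"
proof -
 have "p : full & (EX u':Q. unb p u = unb p u')" using J_full assms by blast
 with assms(1)[unfolded J_def mem_Collect_eq] show ?thesis unfolding J_def mem_Collect_eq by (rule rtranclp.rtrancl_into_rtrancl)
qed

lemma finite_full: "finite full" "card full = card I * (2 * 2 ^ (q + H))"
 using finI by (simp_all add: full_def card_cartesian_product card_Pow)

lemma J_cases: assumes "p : J" obtains i s v where "p = (i, s, v)" "i : I" "s = 1 | s = -1" "v \<subseteq> {..<q + H}" "finite v"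
proof -
 obtain i s v where p: "p = (i, s, v)" by (metis prod_cases3)
 thus ?thesis using J_full[OF assms] that[OF p] finite_subset[of v "{..<q + H}"] by (simp add: full_def)
qed

sublocale up: pregluing Q "sqrt a" 1 J unb utr
proof
 show "finite J" using finite_subset[OF _ finite_full(1)] J_full by blast
 fix p u assume p: "p : J" and u: "u : Q"
 show "unb p u : J" by (rule J_unb[OF p u])
 obtain i s v where isv: "p = (i, s, v)" "i : I" "s = 1 | s = -1" using J_cases[OF p] .
 show "orth (utr p u)"
  using u by (cases rule: Q_cases) (auto simp: isv utr_simps orthogonal_transformation_id[unfolded id_def] id_def
    intro!: lft_orth tr_orth)
 show "utr p u ` Q = Q" using u
 proof (cases rule: Q_cases)
  case (side n)
  thus ?thesis using lft_Q[OF tr_orth[OF isv(2) side(1)] tr_N[OF isv(2) side(1)]] by (simp add: isv utr_simps)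
 qed (simp_all add: isv utr_simps)
 show "unb (unb p u) (utr p u u) = p" using u
 proof (cases rule: Q_cases)
  case (side n)
  have l: "linear (tr i n)" by (rule symsD(3)[OF tr_syms[OF isv(2) side(1)]])
  let ?n = "tr i n n"
  have n: "?n : N" using syms_N[OF tr_syms[OF isv(2) side(1)] side(1)] .
  have l': "linear (tr (nb i n) ?n)" using symsD(3)[OF tr_syms[OF nb_in[OF isv(2) side(1)] n]] .
  have "tr (nb i n) ?n \<circ> tr i n = id" using tr_tr[OF isv(2) side(1)] by (simp add: fun_eq_iff)
  thus ?thesis using dl_comp[OF l' l] side isv nb_nb[OF isv(2) side(1)]
   by (simp add: dl_id unb_simps utr_simps lft_ver[OF l] mult.assoc[symmetric])
 qed (auto simp: isv unb_simps utr_simps)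
 show "utr (unb p u) (utr p u u) (utr p u x) = x" for x using u
 proof (cases rule: Q_cases)
  case (side n)
  have l: "linear (tr i n)" by (rule symsD(3)[OF tr_syms[OF isv(2) side(1)]])
  show ?thesis unfolding side isv unb_simps utr_simps lft_ver[OF l] using tr_tr[OF isv(2) side(1)] by (simp add: lft_def)
 qed (auto simp: isv unb_simps utr_simps)
qed

lemma ver_adj: assumes "m : N" "n : N" "ver m .* ver n = a" shows "m.*n = c^2"
proof -
 have "a * a + b * b * (m.*n) = a" using assms(3) by (simp add: inner_ver) (simp add: ver_def)
 hence "b^2 * (m.*n) = b^2 * c^2" using wall by (simp add: power2_eq_square mult.commute)
 moreover have "b^2 ~= 0" using ab(3) by simp
 ultimately show ?thesis using mult_left_cancel by blast
qed

lemma up_op: "up.op u ((i, s, v), B) = (unb (i, s, v) (B u), utr (i, s, v) (B u) \<circ> B)" by (simp add: up.op_def)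

text \<open>Two caps commute because symmetric differences do, a cap and an adjacent side by
  \<open>col_step\<close>, and two adjacent sides because the gluing of \<open>M\<close> is
  commutative.\<close>

sublocale up: commuting_gluing Q "sqrt a" 1 J unb utr
proof
 fix p u v assume p: "p : J" and u: "u : Q" and v: "v : Q" and uv: "u.*v = (sqrt a)^2"
 hence uva: "u.*v = a" using ab by simp
 obtain i s w where isw: "p = (i, s, w)" "i : I" "s = 1 | s = -1" using J_cases[OF p] .
 have sc: "up.op (ver n) (up.op v (p, id)) = up.op v (up.op (ver n) (p, id))"
  if n: "n : N" and v: "v : caps" "ver n .* v = a" for n v
 proof -
  show ?thesis using lft_caps[OF tr_syms[OF isw(2) n] v(1)] col_step[OF isw(2) n v] v by (simp add: isw up_op unb_simps utr_simps)
 qed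
 have tc: "up.op e0 (up.op v (p, id)) = up.op v (up.op e0 (p, id))" if "v : Q" for v using that
 proof (cases rule: Q_cases)
  case (side n)
  show ?thesis using symsD(3)[OF tr_syms[OF isw(2) side(1)]] side by (simp add: linear_0 isw up_op unb_simps utr_simps)
 qed (simp_all add: isw up_op unb_simps utr_simps)
 show "up.op u (up.op v (p, id)) = up.op v (up.op u (p, id))" using u
 proof (cases rule: Q_cases)
  case top
  thus ?thesis using tc[OF v] by simp
 next
  case u: (side m)
  show ?thesis using v
  proof (cases rule: Q_cases)
   case top
   thus ?thesis using tc[OF \<open>u : Q\<close>] by simp
  next
   case vn: (side n)
   have mn: "m.*n = c^2" using ver_adj[OF u(1) vn(1)] uva u(2) vn(2) by simp
   have l: "linear (tr i m)" "linear (tr i n)" "tr i m n : N" "tr i n m : N" using symsD(3) tr_syms isw(2) u vn syms_N by blast+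
   have e1: "nb (nb i n) (tr i n m) = nb (nb i m) (tr i m n)"
   "tr (nb i n) (tr i n m) \<circ> tr i n = tr (nb i m) (tr i m n) \<circ> tr i m" using op_comm[OF isw(2) u(1) vn(1) mn] by (auto simp: op_def)
   have "dl (tr (nb i n) (tr i n m)) * dl (tr i n) = dl (tr (nb i m) (tr i m n)) * dl (tr i m)"
    using e1(2) dl_comp l symsD(3) tr_syms isw(2) u vn nb_in by metis
   moreover have "lft (tr (nb i n) (tr i n m)) \<circ> lft (tr i n) = lft (tr (nb i m) (tr i m n)) \<circ> lft (tr i m)"
    using e1(2) by (simp add: lft_def comp_def fun_eq_iff)
   ultimately show ?thesis using e1(1) l by (simp add: isw u vn up_op unb_simps utr_simps lft_ver mult.assoc[symmetric])
  next
   case cap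
   thus ?thesis using sc[OF u(1) cap(1)] uva u by simp
  qed
 next
  case cap
  show ?thesis using v
  proof (cases rule: Q_cases)
   case top
   thus ?thesis using tc[OF \<open>u : Q\<close>] by simp
  next
   case (side n)
   thus ?thesis using sc[OF side(1) cap(1)] uva by (simp add: inner_commute)
  next
   case v: cap
   thus ?thesis using cap by (simp add: isw up_op unb_simps utr_simps sdiff_assoc sdiff_comm[of "col i u"])
  qed
 qed
qed

section \<open>Freeness at the corners\<close>

lemma edgeI: "i : I ==> u : spec ==> v : spec ==> u.*v = a ==> edge (\<pi> (i, z u)) (\<pi> (i, z v))" unfolding edge_def by blast

text \<open>The sum modulo 2 of the colours of the caps in \<open>C\<close>.\<close>

definition odds :: "nat => (real ^ 4) set => nat set" where "odds i C = {k. odd (card {u : C. k : col i u})}"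

lemma odds_empty [simp]: "odds i {} = {}" by (simp add: odds_def)

lemma odds_sdiff: assumes "finite C" "finite D" shows "odds i (sdiff C D) = sdiff (odds i C) (odds i D)"
proof -
 have "odd (card {u : sdiff C D. k : col i u}) \<longleftrightarrow> odd (card {u : C. k : col i u}) ~= odd (card {u : D. k : col i u})" for k
 proof -
  have "{u : sdiff C D. k : col i u} = sdiff {u : C. k : col i u} {u : D. k : col i u}" by (auto simp: sdiff_def)
  thus ?thesis using odd_card_sdiff[of "{u : C. k : col i u}" "{u : D. k : col i u}"] assms by simp
 qed
 thus ?thesis by (auto simp: odds_def sdiff_def)
qed

lemma odds_single: "odds i {u} = col i u"
proof -
 have "{u' : {u}. k : col i u'} = (if k : col i u then {u} else {})" for k by auto
 thus ?thesis by (auto simp: odds_def)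
qed

lemma odds_insert: assumes "finite C" "u ~: C" shows "odds i (insert u C) = sdiff (odds i C) (col i u)"
proof -
 show ?thesis using assms odds_sdiff[of C "{u}" i] by (simp add: sdiff_def odds_single)
qed

text \<open>Caps through one point are pairwise adjacent, and it suffices to study the symmetric
  difference \<open>X\<close>, whose colours sum to 0. A cap outside height \<open>s0\<close> would
  contribute a digit of no other cap of \<open>X\<close>. Among special caps there are no triangles,
  so \<open>X\<close> has at most two members, and their colours are nonempty and different.\<close>

lemma odds_independent:
 assumes i: "i : I" and x: "x : ub" and C: "C \<subseteq> cap.tight x \<inter> caps" and D: "D \<subseteq> cap.tight x \<inter> caps"
  and eq: "odds i C = odds i D" shows "C = D"
proof -
 have fin: "finite C" "finite D" using C D cap.tight_fin finite_subset by blast+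
 define X where "X = sdiff C D"
 have X: "X \<subseteq> cap.tight x" "X \<subseteq> caps" "finite X" using C D fin by (auto simp: X_def sdiff_def)
 have oX: "odds i X = {}" using odds_sdiff[OF fin, of i] eq by (auto simp: X_def sdiff_def)
 have adj: "u.*v = a" if "u : X" "v : X" "u ~= v" for u v
  using cap.tight_orth[OF x, of u v] that X(1) ab by (auto simp: subset_iff)
 have "X \<subseteq> spec"
 proof (rule ccontr)
  assume "~ X \<subseteq> spec"
  then obtain u where u: "u : X" "u$1 ~= s0" using X(2) by (auto simp: spec_def caps_def)
  have "{v : X. q + h u : col i v} = {u}"
  proof (intro equalityI subsetI)
   fix v assume v: "v : {v : X. q + h u : col i v}"
   hence vc: "v : caps" "v : X" using X by auto
   have "v$1 ~= s0"
   proof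
    assume s: "v$1 = s0"
    thus False using vc pcol(1)[OF spec_pts[OF i]] v by (auto simp: spec_def caps_def col_def)
   qed
   thus "v : {u}" using v h_adj[of u v] adj[of u v] u X(2) by (auto simp: col_def caps_def subset_iff)
  qed (use u in \<open>simp add: col_def\<close>)
  hence "q + h u : odds i X" by (simp add: odds_def)
  thus False using oX by simp
 qed
 hence colX: "col i u = pcol (\<pi> (i, z u))" "u : spec" if "u : X" for u using that by (auto simp: col_def spec_def)
 show "C = D"
 proof (rule ccontr)
  assume "C ~= D"
  then obtain u where u: "u : X" by (auto simp: X_def sdiff_def)
  show False
  proof (cases "X = {u}")
   case True
   thus False using oX odds_single pcol(1)[OF spec_pts[OF i colX(2)[OF u]]] colX(1)[OF u] by simp
  next
   case False
   then obtain v where v: "v : X" "v ~= u" using u by blast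
   have "X \<subseteq> {u, v}"
   proof
    fix w assume w: "w : X"
    show "w : {u, v}" using adj u v w special_free[of u v w] colX(2) specQ by auto
   qed
   hence "X = insert v {u}" using u v by blast
   hence "pcol (\<pi> (i, z u)) = pcol (\<pi> (i, z v))" using oX odds_insert[of "{u}" v i] colX by (auto simp: odds_single sdiff_def)
   thus False
    using pcol(2)[OF spec_pts[OF i colX(2)[OF u]] spec_pts[OF i colX(2)[OF v(1)]] edgeI[OF i colX(2)[OF u] colX(2)[OF v(1)]]]
     adj[OF u v(1)] v(2) by auto
  qed
 qed
qed

definition sides :: "(real ^ 4) set => (real ^ 3) set" where "sides w = {n : N. ver n : w}"

text \<open>Projects a point of the cell of \<open>Q\<close> to the base cell so that the sides
  through it become walls through the projection. The freeness of \<open>M\<close> at that point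
  then covers the crossings of sides.\<close>

lemma side_projection:
 assumes x: "x : cap.cell"
 shows "EX y:cell. sides (cap.tight x) \<subseteq> tight y & (sides (cap.tight x) ~= {} --> (EX k. y = k *\<^sub>R tail x))"
proof (cases "sides (cap.tight x) = {}")
 case True
 thus ?thesis using zero_cell by auto
next
 case False
 then obtain n0 where n0: "n0 : N" "ver n0 .* x = sqrt a" by (auto simp: sides_def cap.tight_def)
 define y0 where "y0 = x$1"
 have sa: "sqrt a > 0" "sqrt a < 1" "sqrt a * sqrt a = a" using ab by auto
 have le: "n .* tail x <= (sqrt a - a * y0) / b" if "n : N" for n
  using x verQ[OF that] ab by (auto simp: cap.cell_def inner_ver y0_def le_divide_eq mult.commute)
 have eq: "ver n .* x = sqrt a \<longleftrightarrow> n .* tail x = (sqrt a - a * y0) / b" for n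
  using ab by (auto simp: inner_ver y0_def eq_divide_eq mult.commute)
 define T where "T = (sqrt a - a * y0) / b"
 have "a * y0 <= a * sqrt a" using x e0Q inner_e0(1)[of x] ab by (auto simp: cap.cell_def y0_def)
 also have "... < sqrt a" using ab by simp
 finally have T: "T > 0" "T * b = sqrt a - a * y0" using ab by (auto simp: T_def)
 define k where "k = c / T"
 have k: "k > 0" "k * T = c" using T c_pos by (auto simp: k_def)
 let ?y = "k *\<^sub>R tail x"
 have ny: "n .* ?y <= c" if "n : N" for n using mult_left_mono[OF le[OF that], of k] k by (simp add: T_def)
 \<comment> \<open>The norm bound for the projection comes down to (y0 - sqrt a)^2 >= 0.\<close>
 have "(1 - a) * (1 - y0 * y0) * a <= (sqrt a - a * y0)^2"
 proof -
  have "(sqrt a - a * y0)^2 = a * (1 - sqrt a * y0)^2" using sa(3) by (simp add: power2_eq_square algebra_simps)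
  moreover have "(1 - sqrt a * y0)^2 - (1 - a) * (1 - y0 * y0) = (y0 - sqrt a)^2"
   using sa(3) by (simp add: power2_eq_square algebra_simps)
  hence "(1 - a) * (1 - y0 * y0) <= (1 - sqrt a * y0)^2" by (metis diff_ge_0_iff_ge zero_le_power2)
  ultimately show ?thesis using ab by (simp add: mult.commute)
 qed
 moreover have "c^2 * b^2 = a * (1 - a)" unfolding wall by (simp add: power2_eq_square algebra_simps)
 hence "c^2 * b^2 * (1 - y0 * y0) = (1 - a) * (1 - y0 * y0) * a" by (simp only: mult_ac)
 moreover have "T^2 * b^2 = (sqrt a - a * y0)^2" unfolding T(2)[symmetric] by (simp add: power_mult_distrib)
 ultimately have "c^2 * b^2 * (1 - y0 * y0) <= T^2 * b^2" by (simp only:)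
 hence le1: "k^2 * (1 - y0 * y0) <= 1" using ab unfolding k_def by (simp add: power_divide divide_le_eq_1)
 have "?y .* ?y = k^2 * (tail x .* tail x)" by (simp add: power2_eq_square)
 also have "... < k^2 * (1 - y0 * y0)" using cap.cell_ub[OF x] inner_head_tail[of x x] k by (simp add: ball01_iff y0_def)
 finally have "?y : ub" using le1 by (simp add: ball01_iff)
 hence "?y : cell" using ny by (simp add: cell_def)
 moreover have "sides (cap.tight x) \<subseteq> tight ?y" using eq k by (auto simp: sides_def cap.tight_def T_def tight_def)
 ultimately show ?thesis by blast
qed

lemma col_act:
 assumes i: "i : I" and y: "y : ub" and T: "T \<subseteq> tight y" and u: "u : caps" and adj: "!!n. n : T ==> ver n .* u = a"
 shows "col (fst (act op states T (i, id))) (lft (snd (act op states T (i, id))) u) = col i u"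
proof -
 define o3 where "o3 = (i, id :: real ^ 3 => real ^ 3)"
 have o3: "o3 : states" unfolding o3_def by (rule init_state[OF i])
 show ?thesis unfolding o3_def[symmetric] using op_commuting[OF y] T adj
proof (induction T rule: commuting_induct)
 case empty
 show ?case by (simp add: o3_def)
next
 case (insert n T)
 obtain j A where jA: "act op states T o3 = (j, A)" "j : I" "A : syms"
  using act_in[OF op_commuting[OF y] insert(2) o3] by (auto simp: states_def)
 have e: "act op states (insert n T) o3 = op n (j, A)" using act_insert[OF op_commuting[OF y] insert(2,1,3) o3] jA by simp
 have n: "n : N" using insert(1) tight_N by blast
 have An: "A n : N" by (rule syms_N[OF jA(3) n])
 have "ver (A n) .* lft A u = ver n .* u"
  using lft_orth[OF symsD(1)[OF jA(3)]] by (simp add: orthogonal_transformation_def flip: lft_ver[OF symsD(3)[OF jA(3)]])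
 hence "ver (A n) .* lft A u = a" using insert(5)[of n] by simp
 from col_step[OF jA(2) An lft_caps[OF jA(3) u] this]
 have "col (nb j (A n)) (lft (tr j (A n) \<circ> A) u) = col j (lft A u)" by (simp add: lft_comp)
 also have "... = col i u" using insert(4) insert(5) jA by simp
 finally show ?case unfolding e by (simp only: op_def fst_conv snd_conv)
qed
qed

text \<open>The kinds of crossings act on separate components: only sides move the cell of
  \<open>M\<close> and its labelling, only the base flips the sign by itself, and only caps change
  the colour set. The sides enter with the determinant collected on the way.\<close>

lemma up_act:
 assumes p: "(i, s, v) : J" and x: "x : cap.cell" and w: "w \<subseteq> cap.tight x"
  and y: "y : cell" "sides (cap.tight x) \<subseteq> tight y" shows "act up.op up.states w ((i, s, v), id) =
  ((fst (act op states (sides w) (i, id)),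
   (-1) ^ card (sides w) * dl (snd (act op states (sides w) (i, id))) * (if e0 : w then - s else s),
   sdiff v (odds i (w \<inter> caps))), lft (snd (act op states (sides w) (i, id))))"
proof -
 have xb: "x : ub" and yb: "y : ub" using cap.cell_ub x cell_ub y by auto
 have i: "i : I" using J_full[OF p] by (simp add: full_def)
 note cm = up.op_commuting[OF xb] and cm3 = op_commuting[OF yb]
 define o3 where "o3 = (i, id :: real ^ 3 => real ^ 3)"
 define o4 where "o4 = ((i, s, v), id :: real ^ 4 => real ^ 4)"
 have o3: "o3 : states" unfolding o3_def by (rule init_state[OF i])
 have o4: "o4 : up.states" unfolding o4_def by (rule up.init_state[OF p])
 from cm w show ?thesis unfolding o3_def[symmetric] o4_def[symmetric]
 proof (induction w rule: commuting_induct)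
  case empty
  show ?case by (simp add: sides_def o3_def o4_def dl_def matrix_id_mat_1 fun_eq_iff)
 next
  case (insert u w)
  have uQ: "u : Q" using insert(1) cap.tight_N by blast
  have sw: "sides w \<subseteq> tight y" using insert(2) y(2) by (auto simp: sides_def)
  obtain j A where jA: "act op states (sides w) o3 = (j, A)" "j : I" "A : syms"
   using act_in[OF cm3 sw o3] by (auto simp: states_def)
  have fw: "finite w" "finite (sides w)" using finite_subset[OF insert(2) cap.tight_fin] finN by (auto simp: sides_def)
  have e: "act up.op up.states (insert u w) o4 = up.op u (act up.op up.states w o4)"
   using act_insert[OF cm insert(2,1,3) o4] by simp
  have lA: "linear A" by (rule symsD(3)[OF jA(3)])
  have IH: "act up.op up.states w o4 =
   ((j, (-1) ^ card (sides w) * dl A * (if e0 : w then - s else s), sdiff v (odds i (w \<inter> caps))), lft A)"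
    using insert(4) jA by simp
  show ?case using uQ
  proof (cases rule: Q_cases)
   case top
   show ?thesis using top insert(3) ab jA lA unfolding e IH up_op by (simp add: sides_def ver_def caps_def unb_simps utr_simps linear_0)
  next
   case (side n)
   have se: "sides (insert u w) = insert n (sides w)" "n ~: sides w" "insert u w \<inter> caps = w \<inter> caps" "e0 : insert u w \<longleftrightarrow> e0 : w"
    using side insert(3) ab by (auto simp: sides_def ver_inj caps_def head_ver) (auto simp: ver_def)
   have nt: "n : tight y" using side insert(1) y(2) by (auto simp: sides_def)
   have e3: "act op states (insert n (sides w)) o3 = (nb j (A n), tr j (A n) \<circ> A)"
    using act_insert[OF cm3 sw nt se(2) o3] jA by (simp add: op_def)
   have l': "linear (tr j (A n))" using symsD(3) tr_syms jA side(1) syms_N by blast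
   have d: "dl (tr j (A n) \<circ> A) = dl (tr j (A n)) * dl A" by (rule dl_comp[OF l' lA])
   have lc: "lft (tr j (A n)) \<circ> lft A = lft (tr j (A n) \<circ> A)" by (simp add: fun_eq_iff lft_comp)
   show ?thesis unfolding e IH up_op using side se fw
    by (simp add: unb_simps utr_simps lft_ver[OF lA] e3 d[unfolded comp_def] lc[unfolded comp_def] comp_def)
  next
   case cap
   have se: "sides (insert u w) = sides w" "insert u w \<inter> caps = insert u (w \<inter> caps)" "u ~: w \<inter> caps" "e0 : insert u w \<longleftrightarrow> e0 : w"
    using cap insert(3) by (auto simp: sides_def head_ver caps_def)
   have "ver n .* u = a" if "n : sides w" for n
   proof -
    show ?thesis using that insert(2) cap cap.tight_orth[OF xb _ insert(1)] ab by (fastforce simp: sides_def head_ver)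
   qed
   thus ?thesis using col_act[OF i yb sw cap(1), folded o3_def] jA lft_caps[OF jA(3) cap(1)] se fw unfolding e IH up_op
    by (simp add: unb_simps utr_simps odds_insert sdiff_assoc)
  qed
 qed
qed

text \<open>The caps of \<open>w\<close> are recovered from the colour set by independence, the
  sides from freeness of \<open>M\<close> at the projected point, and the base facet from the
  remaining sign.\<close>

sublocale up: gluing Q "sqrt a" 1 J unb utr
proof
 fix p x w w' assume p: "p : J" and x: "x : cap.cell" and w: "w \<subseteq> cap.tight x" and w': "w' \<subseteq> cap.tight x"
  and eq1: "fst (act up.op up.states w (p, id)) = fst (act up.op up.states w' (p, id))"
  and eq2: "snd (act up.op up.states w (p, id)) x = snd (act up.op up.states w' (p, id)) x"
 obtain i s v where isv: "p = (i, s, v)" "i : I" "s = 1 | s = -1" using J_cases[OF p] .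
 obtain y where y: "y : cell" "sides (cap.tight x) \<subseteq> tight y"
  "sides (cap.tight x) ~= {} --> (EX k. y = k *\<^sub>R tail x)" using side_projection[OF x] by blast
 have yb: "y : ub" using cell_ub y by auto
 have sw: "sides w \<subseteq> tight y" "sides w' \<subseteq> tight y" using w w' y(2) by (auto simp: sides_def)
 obtain j A where jA: "act op states (sides w) (i, id) = (j, A)" "j : I" "A : syms"
  using act_in[OF op_commuting[OF yb] sw(1) init_state[OF isv(2)]] by (auto simp: states_def)
 obtain j' A' where jA': "act op states (sides w') (i, id) = (j', A')" "j' : I" "A' : syms"
  using act_in[OF op_commuting[OF yb] sw(2) init_state[OF isv(2)]] by (auto simp: states_def)
 note act = up_act[OF p[unfolded isv(1)] x w y(1,2), unfolded jA(1) fst_conv snd_conv]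
 note act' = up_act[OF p[unfolded isv(1)] x w' y(1,2), unfolded jA'(1) fst_conv snd_conv]
 have E: "j = j'" "(-1) ^ card (sides w) * dl A * (if e0 : w then - s else s) =
   (-1) ^ card (sides w') * dl A' * (if e0 : w' then - s else s)"
  "sdiff v (odds i (w \<inter> caps)) = sdiff v (odds i (w' \<inter> caps))" "lft A x = lft A' x"
   using eq1 eq2 unfolding isv(1) act act' by auto
 have caps: "w \<inter> caps = w' \<inter> caps"
  using odds_independent[OF isv(2) cap.cell_ub[OF x], of "w \<inter> caps" "w' \<inter> caps"] E(3) w w' by (auto simp: sdiff_cancel)
 have sides: "sides w = sides w'"
 proof (cases "sides (cap.tight x) = {}")
  case True
  thus ?thesis using w w' by (auto simp: sides_def)
 next
  case False
  then obtain k where k: "y = k *\<^sub>R tail x" using y(3) by blast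
  have "A y = A' y" by (metis E(4) lft_head_tail(2) symsD(3) jA(3) jA'(3) linear_scale k)
  thus ?thesis using free[OF isv(2) y(1) sw] jA jA' E(1) by simp
 qed
 hence e: "e0 : w \<longleftrightarrow> e0 : w'" using jA jA' dl_sign[OF jA(3)] E(2) isv(3) by (auto split: if_splits)
 show "w = w'"
 proof (intro set_eqI)
  fix u
  show "u : w \<longleftrightarrow> u : w'"
  proof (cases "u : Q")
   case True
   thus ?thesis
   proof (cases rule: Q_cases)
    case (side n)
    thus ?thesis using sides by (auto simp: sides_def)
   qed (use e caps in auto)
  next
   case False
   thus ?thesis using w w' cap.tight_N by blast
  qed
 qed
qed

section \<open>Orientation, connectedness and volume\<close>

lemma up_sign: "p : J ==> fst (snd p) * (-1) ^ card (snd (snd p)) = 1 | fst (snd p) * (-1) ^ card (snd (snd p)) = (-1 :: real)"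
 using J_full[of p] by (cases "even (card (snd (snd p)))") (auto simp: full_def)

lemma up_sign_step:
 assumes p: "p : J" and u: "u : Q" shows "fst (snd (unb p u)) * (-1) ^ card (snd (snd (unb p u))) =
  - det (matrix (utr p u)) * (fst (snd p) * (-1) ^ card (snd (snd p)))"
proof -
 obtain i s v where isv: "p = (i, s, v)" "i : I" "s = 1 | s = -1" "finite v" using J_cases[OF p] .
 show ?thesis using u
 proof (cases rule: Q_cases)
  case top
  thus ?thesis by (simp add: isv unb_simps utr_simps matrix_id_mat_1)
 next
  case (side n)
  thus ?thesis by (simp add: isv unb_simps utr_simps dl_def)
 next
  case cap
  thus ?thesis using sign_card_sdiff[OF isv(4) col_odd(3,2)[OF isv(2) cap(1)]]
   by (simp add: isv unb_simps utr_simps matrix_id_mat_1)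
 qed
qed

lemma up_move: assumes "p : J" "u : Q" shows "EX l. up.chain (p, 0) (unb p u, 0) l"
proof -
 let ?x = "(sqrt a / 1) *\<^sub>R u"
 note f = cap.facet_centre[OF assms(2)]
 have t: "utr p u : up.syms" by (rule up.tr_syms[OF assms])
 have "up.chain (p, 0) (p, ?x) (kd 0 ?x)" by (rule up.chain_move1[OF assms(1) cap.zero_cell f(1)])
 moreover have "up.chain (p, ?x) (unb p u, utr p u ?x) 0" by (rule up.chain_jump1[OF assms(1) f(1) assms(2) f(2)])
 moreover have "up.chain (unb p u, utr p u ?x) (unb p u, 0) (kd (utr p u ?x) 0)"
  using up.syms_cell[OF t] f(1) by (intro up.chain_move1 J_unb assms cap.zero_cell) auto
 ultimately show ?thesis using up.chain_trans by blast
qed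

lemma up_connected:
 assumes "p : J \<times> cap.cell" "p' : J \<times> cap.cell" shows "EX l. up.chain p p' l"
proof -
 have b: "EX l. up.chain ((base, 1, {}), 0) (p, 0) l" if "p : J" for p
 proof -
  have "(%p p'. p : full & (EX u:Q. p' = unb p u))\<^sup>*\<^sup>* (base, 1, {}) p" using that by (simp add: J_def)
  hence "p : J & (EX l. up.chain ((base, 1, {}), 0) (p, 0) l)"
  proof (induction rule: rtranclp_induct)
   case base
   show ?case using J_base up.chain.refl[OF J_base cap.zero_cell] by blast
  next
   case (step p p')
   then obtain u l where u: "u : Q" "p' = unb p u" and l: "up.chain ((base, 1, {}), 0) (p, 0) l" by blast
   have pJ: "p : J" using step by blast
   obtain l' where "up.chain (p, 0) (p', 0) l'" using up_move[OF pJ u(1)] unfolding u(2)[symmetric] by blast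
   hence "up.chain ((base, 1, {}), 0) (p', 0) (l + l')" by (rule up.chain_trans[OF l])
   thus ?case using J_unb step u by blast
  qed
  thus ?thesis by blast
 qed
 have c: "EX l. up.chain ((base, 1, {}), 0) p l" if p: "p : J \<times> cap.cell" for p
  using p b up.chain_trans up.chain_move1 cap.zero_cell by blast
 obtain l l' where l: "up.chain ((base, 1, {}), 0) p l" "up.chain ((base, 1, {}), 0) p' l'" using c assms by blast
 from up.chain_trans[OF up.chain_sym[OF l(1)] l(2)] show ?thesis by blast
qed

lemma chain_J: "chain p p' l ==> EX s. (fst p, s, {}) : J ==> EX s. (fst p', s, {}) : J"
proof (induction rule: chain.induct)
 case (jump i x u q l)
 then obtain s where "(i, s, {}) : J" by auto
 hence "unb (i, s, {}) (ver u) : J" using J_unb verQ jump by blast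
 thus ?case using jump.IH by (auto simp: unb_simps)
qed auto

text \<open>As \<open>M\<close> is connected, a chain of sides reaches every cell with colour set
  \<open>{}\<close>; a crossing of the base adjusts the sign.\<close>

lemma level_J: assumes i: "i : I" shows "(i, 1, {}) : J"
proof -
 have "mdist M (\<pi> (base, 0)) (\<pi> (i, 0)) < mdist M (\<pi> (base, 0)) (\<pi> (i, 0)) + 1" by simp
 then obtain l where "chain (base, 0) (i, 0) l" by (rule chain_less[rotated 2]) (use base i zero_cell in auto)
 from chain_J[OF this] obtain s where s: "(i, s, {}) : J" using J_base by auto
 thus ?thesis using J_full J_unb[OF s e0Q] by (fastforce simp: full_def unb_simps)
qed

lemma ex_up: "EX (X :: real metric) \<omega>. realized_wo Q (sqrt a) 1 J unb utr X \<omega>"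
proof -
 obtain g :: "nat \<times> (real ^ 4) => real" where g: "inj g" using ex_inj_vec4_real by blast
 define k where "k = (%(p :: cell_index, x :: real ^ 4).
  g (prod_encode (fst p, prod_encode (if fst (snd p) = 1 then 0 else 1, set_encode (snd (snd p)))), x))"
 have "inj_on k (J \<times> cap.cell)"
 proof (rule inj_onI)
  fix r r' assume r: "r : J \<times> cap.cell" "r' : J \<times> cap.cell" and e: "k r = k r'"
  obtain i s v x where r1: "r = ((i, s, v), x)" "s = 1 | s = -1" "finite v" using r(1) by (metis J_cases SigmaE)
  obtain i' s' v' x' where r2: "r' = ((i', s', v'), x')" "s' = 1 | s' = -1" "finite v'" using r(2) by (metis J_cases SigmaE)
  have "(prod_encode (i, prod_encode (if s = 1 then 0 else 1, set_encode v)), x) =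
   (prod_encode (i', prod_encode (if s' = 1 then 0 else 1, set_encode v')), x')"
    by (rule injD[OF g]) (use e in \<open>simp add: k_def r1 r2\<close>)
  hence "i = i'" "x = x'" "(if s = 1 then 0 else 1 :: nat) = (if s' = 1 then 0 else 1)" "set_encode v = set_encode v'" by auto
  moreover have "s = s'" using calculation(3) r1(2) r2(2) by (auto split: if_splits)
  ultimately show "r = r'" using r1 r2 set_encode_eq by auto
 qed
 from up.ex_prerealized[OF this up_connected] obtain X :: "real metric" and \<omega> where "prerealized Q (sqrt a) 1 J unb utr X \<omega>" by blast
 thus ?thesis using up.gluing_axioms by (auto simp: realized_wo_def realized_def gluing_def prerealized_def)
qed

lemma up_volume:
 assumes "realized_wo Q (sqrt a) 1 J unb utr X \<omega>" shows "hyperbolic_volume TYPE(4) X <=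
  ennreal (2 ^ (q + H + 1) * (real (card Q) / (3 * sqrt a))) * hyperbolic_volume TYPE(3) M"
proof -
 interpret X: realized_wo Q "sqrt a" 1 J unb utr X \<omega> by (rule assms)
 have "hyperbolic_volume TYPE(4) X <= of_nat (card J) * kvol cap.cell" by (rule X.volume_le)
 also have "... <= of_nat (card full) * kvol cap.cell"
  using card_mono[OF finite_full(1), of J] J_full by (intro mult_right_mono) (auto simp: subset_iff)
 also have "... <= of_nat (card full) * (ennreal (real (card Q) / (3 * sqrt a)) * kvol cell)"
  by (intro mult_left_mono cap_volume) auto
 also have "... = of_nat (2 * 2 ^ (q + H)) * ennreal (real (card Q) / (3 * sqrt a)) * (of_nat (card I) * kvol cell)"
  unfolding finite_full(2) of_nat_mult by (simp only: mult_ac)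
 also have "... <= of_nat (2 * 2 ^ (q + H)) * ennreal (real (card Q) / (3 * sqrt a)) * hyperbolic_volume TYPE(3) M"
  by (intro mult_left_mono volume_ge) auto
 also have "of_nat (2 * 2 ^ (q + H)) * ennreal (real (card Q) / (3 * sqrt a)) =
  ennreal (2 ^ (q + H + 1) * (real (card Q) / (3 * sqrt a)))"
 proof -
  have *: "of_nat (2 * 2 ^ (q + H)) = ennreal (2 ^ (q + H + 1))" by (simp add: ennreal_of_nat_eq_real_of_nat)
  thus ?thesis unfolding * using ab by (intro ennreal_mult[symmetric]) auto
 qed
 finally show ?thesis .
qed

end

section \<open>The totally geodesic hypersurface\<close>

lemma plen_append:
 "xs ~= [] ==> ys ~= [] ==> plen d (xs @ ys) = plen d xs + d (last xs) (hd ys) + plen d ys"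
proof (induction xs rule: induct_list012)
 case (2 x)
 thus ?case by (cases ys) auto
next
 case (3 x y zs)
 thus ?case by (simp add: add.assoc)
qed simp

lemma (in gluing) star_mono: "star i x r ==> 0 < r' ==> r' <= r ==> star i x r'" unfolding star_def walls_def KB_def by fastforce

locale covered = covering N c R \<mu> a b s0 h H t I nb tr M \<pi> q base + X: realized_wo Q "sqrt a" 1 J unb utr X \<omega>
 for N :: "(real ^ 3) set" and c R \<mu> a b s0 :: real and h :: "real ^ 4 => nat" and H t :: nat
  and I :: "nat set" and nb tr and M :: "'a metric" and \<pi> and q base and X :: "'b metric" and \<omega>
begin

text \<open>The isometric embedding of hyperbolic 3-space onto the base wall of
  \<open>Q\<close>.\<close>

definition floor :: "real ^ 3 => real ^ 4" where "floor y = emb (sqrt a) (sqrt (1 - a) *\<^sub>R y)"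

lemma sq: "sqrt a > 0" "sqrt (1 - a) > 0" "sqrt a * sqrt a = a" "sqrt (1 - a) * sqrt (1 - a) = 1 - a"
 "sqrt a * sqrt (1 - a) = c * b"
proof -
 show "sqrt a > 0" "sqrt (1 - a) > 0" "sqrt a * sqrt a = a" "sqrt (1 - a) * sqrt (1 - a) = 1 - a" using ab by auto
 have "(c * b)^2 = a * (1 - a)" using wall by (simp add: power_mult_distrib power2_eq_square algebra_simps)
 moreover have "c * b >= 0" using c_pos ab by simp
 ultimately have "c * b = sqrt (a * (1 - a))" by (metis abs_of_nonneg real_sqrt_abs)
 thus "sqrt a * sqrt (1 - a) = c * b" by (simp add: real_sqrt_mult)
qed

lemma floor_head [simp]: "floor y $ 1 = sqrt a" "e0 .* floor y = sqrt a" by (simp_all add: floor_def inner_e0)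

lemma floor_inj: "floor y = floor y' \<longleftrightarrow> y = y'" using sq by (simp add: floor_def)

lemma floor_inner: "floor x .* floor y = a + (1 - a) * (x.*y)" using sq by (simp add: floor_def emb_inner mult.assoc[symmetric])

lemma floor_ub: "floor y : ub \<longleftrightarrow> y : ub"
proof -
 have "a + (1 - a) * (y.*y) < 1 \<longleftrightarrow> (1 - a) * (y.*y) < (1 - a) * 1" by auto
 also have "... \<longleftrightarrow> y.*y < 1" using ab by (subst mult_less_cancel_left_pos) auto
 finally show ?thesis by (simp add: ball01_iff floor_inner)
qed

lemma floor_kd: "kd (floor x) (floor y) = kd x y"
proof -
 have "1 - floor x .* floor y = (1 - a) * (1 - x.*y)" for x y by (simp add: floor_inner algebra_simps)
 hence "kch (floor x) (floor y) = ((1 - a) * (1 - x.*y)) / ((sqrt (1 - a) * sqrt (1 - a)) * (hq x * hq y))"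
  by (simp add: kch_def hq_def real_sqrt_mult)
 also have "... = kch x y" unfolding sq(4) using ab by (simp add: kch_def)
 finally show ?thesis by (simp add: klein_dist_eq)
qed

lemma floor_KB: "floor y : KB (floor x) r \<longleftrightarrow> y : KB x r" by (simp add: KB_def floor_ub floor_kd)

lemma floor_surj: assumes "x$1 = sqrt a" obtains y where "x = floor y"
proof
 show "x = floor ((1 / sqrt (1 - a)) *\<^sub>R tail x)" using assms sq(2) emb_simps(3)[of x] by (simp add: floor_def)
qed

lemma ver_floor: "ver n .* floor y - sqrt a = sqrt (1 - a) * b * (n.*y - c)"
proof -
 have "sqrt a - a * sqrt a = sqrt a * (sqrt (1 - a) * sqrt (1 - a))" unfolding sq(4) by (simp add: algebra_simps)
 also have "... = sqrt a * sqrt (1 - a) * sqrt (1 - a)" by (simp only: mult.assoc)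
 also have "... = sqrt (1 - a) * b * c" unfolding sq(5) by (simp only: mult_ac)
 finally have "a * sqrt a - sqrt a = - (sqrt (1 - a) * b * c)" by linarith
 thus ?thesis by (simp add: inner_ver) (simp add: floor_def algebra_simps)
qed

lemma ver_floor_le: "ver n .* floor y <= sqrt a \<longleftrightarrow> n.*y <= c" "ver n .* floor y = sqrt a \<longleftrightarrow> n.*y = c"
proof -
 have k: "0 < sqrt (1 - a) * b" using ab by simp
 have "ver n .* floor y <= sqrt a \<longleftrightarrow> sqrt (1 - a) * b * (n.*y - c) <= 0" using ver_floor[of n y] by linarith
 also have "... \<longleftrightarrow> n.*y <= c" using mult_le_cancel_left_pos[OF k, of "n.*y - c" 0] by simp
 finally show "ver n .* floor y <= sqrt a \<longleftrightarrow> n.*y <= c" .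
 show "ver n .* floor y = sqrt a \<longleftrightarrow> n.*y = c" using ver_floor[of n y] ab by auto
qed

text \<open>A cap has height at most \<open>2 * a - 1\<close>, so |u + e0| <= 2 sqrt a, and it
  cannot meet the base wall in the open ball.\<close>

lemma cap_floor: assumes u: "u : caps" and y: "y : ub" shows "u .* floor y < sqrt a"
proof -
 have "(norm (u + e0))^2 = 2 + 2 * u$1"
  using Q_unit[OF capsQ[OF u]] by (simp add: power2_norm_eq_inner inner_add_left inner_add_right inner_e0)
 also have "... <= (2 * sqrt a)^2" using Q_facts(2)[OF capsQ[OF u]] u by (simp add: caps_def power2_eq_square)
 finally have n: "norm (u + e0) <= 2 * sqrt a" by (rule power2_le_imp_le) (use sq(1) in simp)
 have "(u + e0) .* floor y <= norm (u + e0) * norm (floor y)" by (rule norm_cauchy_schwarz)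
 also have "... <= (2 * sqrt a) * norm (floor y)" using n by (intro mult_right_mono) auto
 also have "... < (2 * sqrt a) * 1" using y floor_ub[of y] sq(1) by (intro mult_strict_left_mono) (auto simp: mem_ball_0)
 finally show ?thesis by (simp add: inner_add_left)
qed

lemma floor_cell: "floor y : cap.cell \<longleftrightarrow> y : cell"
proof
 assume f: "floor y : cap.cell"
 hence "y : ub" using cap.cell_ub floor_ub by blast
 moreover have "n.*y <= c" if "n : N" for n using f verQ[OF that] ver_floor_le by (auto simp: cap.cell_def)
 ultimately show "y : cell" by (simp add: cell_def)
next
 assume y: "y : cell"
 hence yb: "y : ub" by (rule cell_ub)
 have "u .* floor y <= sqrt a" if "u : Q" for u using that
 proof (cases rule: Q_cases)
  case (side n)
  thus ?thesis using y ver_floor_le by (simp add: cell_def)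
 next
  case cap
  thus ?thesis using cap_floor[OF cap(1) yb] by simp
 qed simp
 thus "floor y : cap.cell" using yb floor_ub by (simp add: cap.cell_def)
qed

lemma floor_tight: assumes y: "y : ub" shows "cap.tight (floor y) = insert e0 (ver ` tight y)"
proof
 show "insert e0 (ver ` tight y) \<subseteq> cap.tight (floor y)" using e0Q verQ ver_floor_le by (auto simp: cap.tight_def tight_def)
 show "cap.tight (floor y) \<subseteq> insert e0 (ver ` tight y)"
 proof
  fix u assume u: "u : cap.tight (floor y)"
  hence "u : Q" by (rule cap.tight_N)
  thus "u : insert e0 (ver ` tight y)"
  proof (cases rule: Q_cases)
   case (side n)
   thus ?thesis using u ver_floor_le by (auto simp: cap.tight_def tight_def)
  next
   case cap
   thus ?thesis using u cap_floor[OF cap(1) y] by (simp add: cap.tight_def)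
  qed simp
 qed
qed

lemma sides_ver: "w \<subseteq> N ==> sides (ver ` w) = w" "w \<subseteq> N ==> sides (insert e0 (ver ` w)) = w"
 using ab by (auto simp: sides_def ver_inj) (simp add: ver_def)

text \<open>A side wall is orthogonal to the base wall, so its reflection restricts to the base,
  where it is the reflection in the corresponding wall of the three-dimensional cell.\<close>

lemma hrefl_floor:
 assumes n: "n : N" and y: "y : ub" shows "hrefl (ver n) (sqrt a) (floor y) = floor (hrefl n c y)"
proof -
 have vu: "(sqrt a)^2 < ver n .* ver n" using cap.space_like[OF verQ[OF n]] .
 have vv: "ver n .* ver n = 1" by (rule Q_unit[OF verQ[OF n]])
 define D where "D = n.*n + c^2 - 2 * c * (n.*y)"
 have nn: "n.*n = R" by (rule norm_N[OF n])
 have bR: "b^2 * R = 1 - a^2" using unit by simp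
 have bc: "b^2 * c^2 = a - a^2" using wall by (simp add: mult.commute)
 have vf: "ver n .* floor y = sqrt a + sqrt (1 - a) * b * (n.*y - c)" using ver_floor[of n y] by linarith
 have "2 * sqrt a * (sqrt (1 - a) * b * (n.*y - c)) = 2 * (sqrt a * sqrt (1 - a)) * b * (n.*y - c)" by (simp only: mult_ac)
 also have "... = 2 * c * b^2 * (n.*y) - 2 * (b^2 * c^2)" unfolding sq(5) by (simp add: power2_eq_square algebra_simps)
 finally have e: "2 * sqrt a * (sqrt (1 - a) * b * (n.*y - c)) = 2 * c * b^2 * (n.*y) - 2 * (b^2 * c^2)" .
 have den: "ver n .* ver n + (sqrt a)^2 - 2 * sqrt a * (ver n .* floor y) = b^2 * D"
 proof -
  have "b^2 * D = b^2 * R + b^2 * c^2 - 2 * c * b^2 * (n.*y)" by (simp add: D_def nn algebra_simps)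
  also have "... = 1 + a - 2 * a - (2 * c * b^2 * (n.*y) - 2 * (b^2 * c^2))" unfolding bR bc by (simp add: algebra_simps)
  also have "... = 1 + a - 2 * a - 2 * sqrt a * (sqrt (1 - a) * b * (n.*y - c))" unfolding e ..
  finally have "b^2 * D = 1 + a - 2 * a - 2 * sqrt a * (sqrt (1 - a) * b * (n.*y - c))" .
  moreover have "2 * sqrt a * (sqrt a + sqrt (1 - a) * b * (n.*y - c)) = 2 * a + 2 * sqrt a * (sqrt (1 - a) * b * (n.*y - c))"
   unfolding distrib_left using ab by (simp add: mult.assoc)
  moreover have "(sqrt a)^2 = a" using ab by simp
  ultimately show ?thesis unfolding vv vf by linarith
 qed
 have Dp: "b^2 * D > 0" using hrefl_den_pos[OF vu, of "floor y"] floor_ub y den by simp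
 have RC: "1 - a = b^2 * (R - c^2)" using bR bc by (simp add: algebra_simps)
 have "tail (hrefl (ver n) (sqrt a) (floor y)) = sqrt (1 - a) *\<^sub>R hrefl n c y"
 proof -
  have "tail (hrefl (ver n) (sqrt a) (floor y)) =
   (1 / (b^2 * D)) *\<^sub>R ((1 - a) *\<^sub>R (sqrt (1 - a) *\<^sub>R y) - (2 * (sqrt (1 - a) * b * (n.*y - c))) *\<^sub>R (b *\<^sub>R n))"
    unfolding hrefl_def den unfolding vv vf using ab by (simp add: tail_linear) (simp add: floor_def ver_def)
  also have "... = (1 / (b^2 * D)) *\<^sub>R ((b^2 * sqrt (1 - a)) *\<^sub>R ((R - c^2) *\<^sub>R y - (2 * (n.*y - c)) *\<^sub>R n))"
   unfolding RC[symmetric] by (simp add: scaleR_diff_right RC power2_eq_square mult_ac)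
  also have "... = sqrt (1 - a) *\<^sub>R hrefl n c y" using ab by (simp add: hrefl_def nn D_def)
  finally show ?thesis .
 qed
 moreover have "e0 .* hrefl (ver n) (sqrt a) (floor y) = sqrt a"
 proof -
  have "ver n .* e0 = sqrt a * sqrt a" using sq(3) by (simp add: inner_e0 head_ver)
  from inner_hrefl_orth[OF vu _ this, of "floor y"] show ?thesis using floor_ub[of y] y by simp
 qed
 ultimately show ?thesis using emb_simps(3)[of "hrefl (ver n) (sqrt a) (floor y)"] by (simp add: floor_def inner_e0)
qed

lemma mref_floor:
 assumes x: "x : ub" and w: "w \<subseteq> tight x" and y: "y : ub" shows "cap.mref (ver ` w) (floor y) = floor (mref w y)"
proof -
 have cm: "commuting (%u. hrefl u c) ub (tight x)" by (rule refl_commuting[OF x order.refl])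
 from cm w show ?thesis
 proof (induction w rule: commuting_induct)
  case (insert n w)
  have fx: "floor x : ub" "floor y : ub" using x y floor_ub by auto
  have vt: "ver ` w \<subseteq> cap.tight (floor x)" "ver n : cap.tight (floor x)" "ver n ~: ver ` w"
   using insert floor_tight[OF x] by (auto simp: ver_inj)
  have "cap.mref (ver ` insert n w) (floor y) = hrefl (ver n) (sqrt a) (floor (mref w y))"
   using cap.mref_insert[OF fx(1) order.refl vt fx(2)] insert(4) by simp
  also have "... = floor (hrefl n c (mref w y))" using hrefl_floor mref_ub[OF x order.refl insert(2) y] insert(1) tight_N by blast
  also have "hrefl n c (mref w y) = mref (insert n w) y" using mref_insert[OF x order.refl insert(2,1,3) y] by simp
  finally show ?case .
 qed simp
qed

definition F :: "nat \<times> (real ^ 3) => 'b" where "F p = \<omega> ((fst p, 1, {}), floor (snd p))"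

lemma lft_floor: "linear A ==> lft A (floor y) = floor (A y)" by (simp add: floor_def linear_scale)

text \<open>The cells of signs 1 and -1 share their base facet, hence the sign does not matter for
  points on it.\<close>

lemma floor_jump: assumes "(j, s, {}) : J" "y : cell" shows "\<omega> ((j, s, {}), floor y) = F (j, y)"
 using assms floor_cell up.chain_jump1 e0Q X.pi_eq J_full by (fastforce simp: unb_simps utr_simps full_def F_def)

context
 fixes i y r
 assumes i: "i : I" and y: "y : cell" and st: "star i y r" and st4: "up.star (i, 1, {}) (floor y) r"
begin

lemma iJ: "(i, 1, {}) : J" by (rule level_J[OF i])
lemma yb: "y : ub" by (rule cell_ub[OF y])
lemma fy: "floor y : cap.cell" using y floor_cell by simp
lemma sides_floor: "sides (cap.tight (floor y)) = tight y"
 unfolding floor_tight[OF yb] by (rule sides_ver(2)) (auto dest: tight_N)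

lemma psi_floor:
 assumes g: "good y r w y'" shows "X.psi (i, 1, {}) (floor y) (floor y') = F (dev i w y')"
proof -
 have w: "w \<subseteq> tight y" "y' : KB y r" "mref w y' : cell" "y' : ub" using g by (auto simp: good_def KB_def)
 have sw: "sides (ver ` w) = w" using w(1) tight_N by (intro sides_ver) blast
 have vt: "ver ` w \<subseteq> cap.tight (floor y)" using w(1) floor_tight[OF yb] by auto
 have m: "cap.mref (ver ` w) (floor y') = floor (mref w y')" by (rule mref_floor[OF yb w(1,4)])
 have g4: "up.good (floor y) r (ver ` w) (floor y')" using vt w m floor_cell floor_KB by (simp add: up.good_def)
 obtain j A where jA: "act op states w (i, id) = (j, A)" "j : I" "A : syms"
  using state_in[OF i y star_walls[OF st] w(1)] by (auto simp: states_def)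
 have cw: "ver ` w \<inter> caps = {}" by (auto simp: caps_def head_ver)
 obtain s where s: "act up.op up.states (ver ` w) ((i, 1, {}), id) = ((j, s, {}), lft A)"
  using up_act[OF iJ fy vt y] sides_floor unfolding sw jA(1) cw by auto
 have jJ: "(j, s, {}) : J" using up.state_in[OF iJ fy up.star_walls[OF st4] vt] s by (simp add: up.states_def)
 have lA: "linear A" by (rule symsD(3)[OF jA(3)])
 have "X.psi (i, 1, {}) (floor y) (floor y') = \<omega> (up.dev (i, 1, {}) (ver ` w) (floor y'))" by (rule X.psi_good[OF iJ fy st4 g4])
 also have "up.dev (i, 1, {}) (ver ` w) (floor y') = ((j, s, {}), floor (A (mref w y')))"
  by (simp add: up.dev_def up.pt_def s m lft_floor[OF lA])
 also have "\<omega> ... = F (j, A (mref w y'))" using jJ w(3) syms_cell[OF jA(3)] by (intro floor_jump) auto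
 also have "(j, A (mref w y')) = dev i w y'" by (simp add: dev_def pt_def jA)
 finally show ?thesis .
qed

lemma F_rep:
 assumes p: "p : I \<times> cell" "\<pi> p = \<pi> (i, y)" shows "F p = F (i, y)"
proof -
 have k: "y : KB y (r/3)" using rpos[OF i y st] yb by (intro centre_in_KB) auto
 obtain w where w: "good y r w y" "p = dev i w y" using p(2) psi_centre[OF i y st] psi_rep[OF i y st p(1) k] by auto
 have "F p = X.psi (i, 1, {}) (floor y) (floor y)" using psi_floor[OF w(1)] w(2) by simp
 also have "... = F (dev i {} y)" by (rule psi_floor[OF good_centre[OF i y star_walls[OF st]], symmetric, symmetric]) simp
 finally show ?thesis by (simp add: dev_centre[OF i y star_walls[OF st]])
qed

text \<open>If two base points are identified, one is a sector at the other; its side crossings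
  alone already identify the points in \<open>M\<close>.\<close>

lemma F_inj:
 assumes p: "p : I \<times> cell" "F p = F (i, y)" shows "\<pi> p = \<pi> (i, y)"
proof -
 obtain j y' where jy: "p = (j, y')" "j : I" "y' : cell" using p(1) by auto
 have k: "floor y : KB (floor y) (r/3)" using rpos[OF i y st] yb floor_ub by (intro centre_in_KB) auto
 have "\<omega> ((j, 1, {}), floor y') = X.psi (i, 1, {}) (floor y) (floor y)"
  using p(2) X.psi_centre[OF iJ fy st4] by (simp add: F_def jy)
 then obtain w where w: "up.good (floor y) r w (floor y)" "((j, 1, {}), floor y') = up.dev (i, 1, {}) w (floor y)"
  using level_J[OF jy(2)] jy(3) floor_cell X.psi_rep[OF iJ fy st4 _ k] by blast
 have wt: "w \<subseteq> cap.tight (floor y)" using w(1) by (simp add: up.good_def)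
 have m: "cap.mref w (floor y) = floor y" using cap.mref_centre[OF cap.cell_ub[OF fy] order.refl wt] .
 have sw: "sides w \<subseteq> tight y" using wt sides_floor by (auto simp: sides_def)
 obtain j' A where jA: "act op states (sides w) (i, id) = (j', A)" "j' : I" "A : syms"
  using state_in[OF i y star_walls[OF st] sw] by (auto simp: states_def)
 show ?thesis using up_act[OF iJ fy wt y] sides_floor w(2) lft_floor[OF symsD(3)[OF jA(3)]] jy(1) mref_centre[OF yb order.refl sw] psi_good[OF i y st good_centre[OF i y star_walls[OF st] sw]] psi_centre[OF i y st] unfolding up.dev_def up.pt_def jA(1) m by (simp add: dev_def pt_def jA floor_inj)
qed

text \<open>Embeddedness: in a small chart ball no other sheet of the hypersurface appears. Folding
  multiplies the distance from the base wall by a nonzero factor and the labelling maps keep the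
  first coordinate, so a point glued to some base facet lies on the base wall.\<close>

lemma floor_slice:
 assumes x: "x : KB (floor y) (r/3)" and p: "p : I \<times> cell" "X.psi (i, 1, {}) (floor y) x = F p" shows "x$1 = sqrt a"
proof -
 obtain j y' where jy: "p = (j, y')" "j : I" "y' : cell" using p(1) by auto
 have "\<omega> ((j, 1, {}), floor y') = X.psi (i, 1, {}) (floor y) x" using p(2) by (simp add: F_def jy)
 then obtain w where w: "up.good (floor y) r w x" "((j, 1, {}), floor y') = up.dev (i, 1, {}) w x"
  using level_J[OF jy(2)] jy(3) floor_cell X.psi_rep[OF iJ fy st4 _ x] by blast
 have wt: "w \<subseteq> cap.tight (floor y)" using w(1) by (simp add: up.good_def)
 have xb: "x : ub" using x by (simp add: KB_def)
 have sw: "sides w \<subseteq> tight y" using wt sides_floor by (auto simp: sides_def)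
 obtain j' A where jA: "act op states (sides w) (i, id) = (j', A)" "j' : I" "A : syms"
  using state_in[OF i y star_walls[OF st] sw] by (auto simp: states_def)
 have "floor y' = lft A (cap.mref w x)" using up_act[OF iJ fy wt y] sides_floor w(2) unfolding up.dev_def up.pt_def jA(1) by simp
 hence "cap.mref w x $ 1 = sqrt a" by (metis floor_head(1) lft_head_tail(1))
 moreover have "e0 : cap.tight (floor y)" using floor_tight[OF yb] by simp
 from cap.mref_wall[OF cap.cell_ub[OF fy] order.refl wt this xb]
 obtain k where "k > 0" "e0 .* cap.mref w x - sqrt a = (if e0 : w then - k else k) * (e0 .* x - sqrt a)" by blast
 ultimately show ?thesis by (auto simp: inner_e0 split: if_splits)
qed

end

lemma common_star:
 assumes "i : I" "y : cell" obtains r where "r > 0" "star i y r" "up.star (i, 1, {}) (floor y) r"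
proof -
 have fy: "floor y : cap.cell" using assms floor_cell by simp
 obtain r1 where r1: "star i y r1" by (rule ex_star[OF assms])
 obtain r2 where r2: "up.star (i, 1, {}) (floor y) r2" by (rule up.ex_star[OF level_J[OF assms(1)] fy])
 have pos: "r1 > 0" "r2 > 0" using rpos[OF assms r1] X.rpos[OF level_J[OF assms(1)] fy r2] by auto
 show ?thesis by (rule that[of "min r1 r2"]) (use pos star_mono[OF r1] up.star_mono[OF r2] in auto)
qed

section \<open>The isometry of \<open>M\<close> onto the hypersurface\<close>

definition f :: "'a => 'b" where "f x = F (SOME p. p : I \<times> cell & \<pi> p = x)"

lemma f_pi: assumes "p : I \<times> cell" shows "f (\<pi> p) = F p"
proof -
 have "EX p'. p' : I \<times> cell & \<pi> p' = \<pi> p" using assms by blast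
 from someI_ex[OF this] have *: "(SOME p'. p' : I \<times> cell & \<pi> p' = \<pi> p) : I \<times> cell"
  "\<pi> (SOME p'. p' : I \<times> cell & \<pi> p' = \<pi> p) = \<pi> p" by auto
 obtain i y where iy: "p = (i, y)" "i : I" "y : cell" using assms by auto
 obtain r where r: "star i y r" "up.star (i, 1, {}) (floor y) r" using common_star[OF iy(2,3)] .
 show ?thesis unfolding f_def using F_rep[OF iy(2,3) r *(1)] *(2) iy(1) by simp
qed

definition S :: "'b set" where "S = F ` (I \<times> cell)"

lemma f_S: "f ` mspace M = S" using f_pi pi_surj unfolding S_def by (metis (no_types, lifting) image_cong image_image)

lemma S_sub: "S \<subseteq> mspace X" using X.pi_in level_J floor_cell by (auto simp: S_def F_def)

lemma f_inj: "inj_on f (mspace M)"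
proof (rule inj_onI)
 fix x x' assume "x : mspace M" "x' : mspace M" and e: "f x = f x'"
 then obtain p i y where p: "p : I \<times> cell" "x = \<pi> p" "i : I" "y : cell" "x' = \<pi> (i, y)" by (metis pi_cases SigmaI)
 obtain r where r: "star i y r" "up.star (i, 1, {}) (floor y) r" using common_star[OF p(3,4)] .
 show "x = x'" using e f_pi p F_inj[OF p(3,4) r p(1)] by simp
qed

lemma local_picture:
 assumes "x : mspace M"
 obtains i y r where "i : I" "y : cell" "r > 0" "star i y r" "up.star (i, 1, {}) (floor y) r" "x = \<pi> (i, y)"
  "f x = X.psi (i, 1, {}) (floor y) (floor y)"
  "!!y'. y' : KB y (r/3) ==> f (psi i y y') = X.psi (i, 1, {}) (floor y) (floor y')"
proof -
 obtain i y where iy: "i : I" "y : cell" "x = \<pi> (i, y)" by (rule pi_cases[OF assms])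
 obtain r where r: "r > 0" "star i y r" "up.star (i, 1, {}) (floor y) r" using common_star[OF iy(1,2)] .
 have *: "f (psi i y y') = X.psi (i, 1, {}) (floor y) (floor y')" if "y' : KB y (r/3)" for y'
 proof -
  have g: "good y r (sector y y') y'" by (rule good_sector[OF iy(1,2) star_walls[OF r(2)] KB3[OF iy(1,2) r(2) that]])
  show ?thesis unfolding psi_def using f_pi[OF dev_in[OF iy(1,2) star_walls[OF r(2)] g]] psi_floor[OF iy(1,2) r(2,3) g] by simp
 qed
 have "y : KB y (r/3)" using cell_ub[OF iy(2)] r(1) by (intro centre_in_KB) auto
 hence "f x = X.psi (i, 1, {}) (floor y) (floor y)" using *[of y] psi_centre[OF iy(1,2) r(2)] iy(3) by simp
 thus ?thesis using that iy r * by blast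
qed

lemma hypersurface: "totally_geodesic_hypersurface TYPE(4) X S" unfolding totally_geodesic_hypersurface_def
proof (intro conjI ballI S_sub)
 fix p assume "p : S"
 then obtain i y where iy: "p = F (i, y)" "i : I" "y : cell" by (auto simp: S_def)
 obtain r where r: "r > 0" "star i y r" "up.star (i, 1, {}) (floor y) r" using common_star[OF iy(2,3)] .
 let ?P = "X.psi (i, 1, {}) (floor y)" and ?K = "KB (floor y) (r/3)"
 have iJ: "(i, 1, {}) : J" and fy: "floor y : cap.cell" using level_J iy floor_cell by auto
 note chart = X.psi_chart[OF iJ fy r(3)]
 have inj: "inj_on ?P ?K"
  by (rule inverse_chart(1)[OF open_KB[OF cap.cell_ub[OF fy]] KB_sub X.psi_open[OF iJ fy r(3)] X.psi_dist[OF iJ fy r(3)]])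
 have "floor y : ?K" using r iy cell_ub floor_ub by (intro centre_in_KB) auto
 moreover have "?P (floor y) = p" using X.psi_centre[OF iJ fy r(3)] by (simp add: iy F_def)
 ultimately have pU: "p : ?P ` ?K" by blast
 have mem: "?P x : S \<longleftrightarrow> e0 .* x = sqrt a" if x: "x : ?K" for x
 proof
  assume "?P x : S"
  thus "e0 .* x = sqrt a" using floor_slice[OF iy(2,3) r(2,3) x] by (auto simp: S_def inner_e0)
 next
  assume "e0 .* x = sqrt a"
  then obtain y' where y': "x = floor y'" using floor_surj[of x] by (auto simp: inner_e0)
  hence k: "y' : KB y r" using x floor_KB r(1) by (fastforce simp: KB_def)
  have g: "good y r (sector y y') y'" by (rule good_sector[OF iy(2,3) star_walls[OF r(2)] k])
  show "?P x : S" using psi_floor[OF iy(2,3) r(2,3) g] y' dev_in[OF iy(2,3) star_walls[OF r(2)] g] by (auto simp: S_def)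
 qed
 have inv: "the_inv_into ?K ?P (?P x) = x" if "x : ?K" for x using the_inv_into_f_f[OF inj that] .
 have "the_inv_into ?K ?P ` (?P ` ?K \<inter> S) = ?K \<inter> {x. e0 .* x = sqrt a}" using mem inv by (force simp: image_iff)
 moreover have "the_inv_into ?K ?P ` ?P ` ?K = ?K" using inv by (force simp: image_iff)
 moreover have "e0 ~= 0" by (metis inner_e0(1) emb_simps(1) zero_index zero_neq_one)
 ultimately show "EX U (\<phi> :: 'b => real ^ 4) a b. p : U & hyperbolic_chart X U \<phi> & a ~= 0 & \<phi> ` (U \<inter> S) = \<phi> ` U \<inter> {x. a .* x = b}"
  using pU chart by (intro exI[of _ "?P ` ?K"] exI[of _ "the_inv_into ?K ?P"] exI[of _ e0] exI[of _ "sqrt a"]) simp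
qed

text \<open>Jumps of a chain in \<open>M\<close> do not move the image in \<open>W\<close>, and
  moves are carried to segments of base facets of the same length.\<close>

lemma intrinsic_chain: "chain p q' l ==> intrinsic_dist X S (F p) (F q') <= ennreal l"
proof (induction rule: chain.induct)
 case (refl i x)
 hence "F (i, x) : S" by (auto simp: S_def)
 thus ?case using intrinsic_self[of "F (i, x)" S X] S_sub by auto
next
 case (jump i x u q' l)
 have "F (i, x) = F (nb i u, tr i u x)" by (metis pi_eq[OF chain_jump1] jump chain_ends[OF jump(5)] f_pi SigmaI)
 thus ?case using jump by simp
next
 case (move i x y q' l)
 have "intrinsic_dist X S (\<omega> ((i, 1, {}), floor x)) (\<omega> ((i, 1, {}), floor y)) <= ennreal (kd (floor x) (floor y))"
 proof (rule X.intrinsic_segment[OF level_J[OF move(1)]])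
  show "floor x : cap.cell" "floor y : cap.cell" using move floor_cell by auto
  fix z assume "z : closed_segment (floor x) (floor y)"
  then obtain s where s: "0 <= s" "s <= 1" "z = (1 - s) *\<^sub>R floor x + s *\<^sub>R floor y" by (auto simp: closed_segment_def)
  have "z = floor ((1 - s) *\<^sub>R x + s *\<^sub>R y)" unfolding s floor_def by (simp add: emb_linear[symmetric] algebra_simps)
  moreover have "(1 - s) *\<^sub>R x + s *\<^sub>R y : cell" using convex_cell move s by (intro convexD) auto
  ultimately show "\<omega> ((i, 1, {}), z) : S" using move(1)
   unfolding S_def by (intro image_eqI[of _ _ "(i, (1 - s) *\<^sub>R x + s *\<^sub>R y)"]) (simp_all add: F_def)
 qed
 hence "intrinsic_dist X S (F (i, x)) (F q') <= ennreal (kd x y) + ennreal l"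
  using intrinsic_triangle[of X S "F (i, x)" "F q'" "F (i, y)"] move.IH add_mono by (fastforce simp: F_def floor_kd)
 thus ?case using kd_nonneg[of x y] cell_ub move chain_nonneg[OF move(4)] by (simp add: ennreal_plus)
qed

text \<open>Near each parameter the path stays in one chart, where \<open>f\<close> is isometric.
  Bisection patches finitely many such intervals to a partition whose polygon bounds the distance in
  \<open>M\<close>.\<close>

lemma path_lifts:
 assumes \<gamma>: "pathin (subtopology (mtopology_of X) S) \<gamma>"
 defines "\<eta> \<equiv> %t. inv_into (mspace M) f (\<gamma> t)" shows "ed M (\<eta> 0) (\<eta> 1) <= curve_length X \<gamma>"
proof -
 have bij: "bij_betw f (mspace M) S" using f_inj f_S by (simp add: bij_betw_def)
 have \<gamma>S: "\<gamma> s : S" "\<gamma> s : mspace X" if "s : {0..1}" for s using \<gamma> that unfolding pathin_metric by blast+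
 have \<eta>: "\<eta> s : mspace M" "f (\<eta> s) = \<gamma> s" if "s : {0..1}" for s
  using \<gamma>S(1)[OF that] bij unfolding \<eta>_def by (metis bij_betw_def inv_into_into, metis bij_betw_inv_into_right)
 \<comment> \<open>A partition of \<open>[u, v]\<close> from \<open>u\<close> to \<open>v\<close>
   that witnesses the estimate; concatenation may repeat the common point, which costs
   nothing.\<close>
 define L where "L = (%u v ts. ts ~= [] & sorted ts & set ts \<subseteq> {u..v} & hd ts = u & last ts = v &
   ed M (\<eta> u) (\<eta> v) <= plen (ed X) (map \<gamma> ts))"
 define P where "P = (%u v. 0 <= u & v <= 1 --> (EX ts. L u v ts))"
 have "P 0 1"
 proof (rule Bolzano)
  fix u v w :: real assume uv: "P u v" "P v w" "u <= v" "v <= w"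
  show "P u w" unfolding P_def
  proof
   assume uw: "0 <= u & w <= 1"
   then obtain ts0 ts1 where L: "L u v ts0" "L v w ts1" using uv unfolding P_def by (meson order_trans)
   define ts ts' where "ts = ts0" and "ts' = ts1"
   have ts: "ts ~= []" "sorted ts" "set ts \<subseteq> {u..v}" "hd ts = u" "last ts = v" "ed M (\<eta> u) (\<eta> v) <= plen (ed X) (map \<gamma> ts)"
    and ts': "ts' ~= []" "sorted ts'" "set ts' \<subseteq> {v..w}" "hd ts' = v" "last ts' = w"
     "ed M (\<eta> v) (\<eta> w) <= plen (ed X) (map \<gamma> ts')" using L by (auto simp: L_def ts_def ts'_def)
   have "ed M (\<eta> u) (\<eta> w) <= ed M (\<eta> u) (\<eta> v) + ed M (\<eta> v) (\<eta> w)" using uw uv \<eta> by (intro ed_triangle) auto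
   also have "... <= plen (ed X) (map \<gamma> ts) + plen (ed X) (map \<gamma> ts')" using ts ts' by (intro add_mono)
   also have "... <= plen (ed X) (map \<gamma> (ts @ ts'))" using ts(1) ts'(1) by (simp add: plen_append add_increasing2 add_right_mono)
   finally have "ed M (\<eta> u) (\<eta> w) <= plen (ed X) (map \<gamma> (ts @ ts'))" .
   moreover have "sorted (ts @ ts')" using ts ts' by (fastforce simp: sorted_append)
   moreover have "set (ts @ ts') \<subseteq> {u..w}" using ts ts' uv by fastforce
   ultimately have "L u w (ts @ ts')" using ts ts' by (simp add: L_def)
   thus "EX ts. L u w ts" by blast
  qed
 next
  fix s :: real assume "0 <= s" "s <= 1"
  hence s: "s : {0..1}" by simp
  obtain i y r where iy: "i : I" "y : cell" "r > 0" "star i y r" "up.star (i, 1, {}) (floor y) r" "\<eta> s = \<pi> (i, y)"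
   "f (\<eta> s) = X.psi (i, 1, {}) (floor y) (floor y)"
   "!!y'. y' : KB y (r/3) ==> f (psi i y y') = X.psi (i, 1, {}) (floor y) (floor y')" by (rule local_picture[OF \<eta>(1)[OF s]]) blast
  have iJ: "(i, 1, {}) : J" and fy: "floor y : cap.cell" using level_J iy floor_cell by auto
  have "r/3 > 0" using iy by simp
  then obtain d where d: "d > 0" "!!v. v : {0..1} ==> \<bar>v - s\<bar> < d ==> mdist X (\<gamma> s) (\<gamma> v) < r/3"
   using \<gamma> s unfolding pathin_metric by meson
  have near: "EX y':KB y (r/3). \<eta> v = psi i y y' & \<gamma> v = X.psi (i, 1, {}) (floor y) (floor y')"
   if v: "v : {0..1}" "\<bar>v - s\<bar> < d" for v
  proof -
   have "\<gamma> v : mball_of X (\<omega> ((i, 1, {}), floor y)) (r/3)"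
    using d(2)[OF v] \<gamma>S[OF v(1)] \<gamma>S[OF s] iy(7) \<eta>(2)[OF s] X.psi_centre[OF iJ fy iy(5)] by (simp add: in_mball_of)
   then obtain x where x: "x : KB (floor y) (r/3)" "\<gamma> v = X.psi (i, 1, {}) (floor y) x"
    unfolding X.psi_image[OF iJ fy iy(5), symmetric] by blast
   obtain p where p: "p : I \<times> cell" "\<gamma> v = F p" using \<gamma>S(1)[OF v(1)] by (auto simp: S_def)
   obtain y' where y': "x = floor y'" using floor_slice[OF iy(1,2,4,5) x(1) p(1)] p(2) x(2) floor_surj by auto
   have k: "y' : KB y (r/3)" using x(1) floor_KB y' by simp
   show ?thesis using iy(8)[OF k] x(2) y' psi_in[OF iy(1,2,4) KB3[OF iy(1,2,4) k]] inj_onD[OF f_inj, of "\<eta> v" "psi i y y'"] \<eta>[OF v(1)] k by auto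
  qed
  show "EX d>0. ALL u v. u <= s & s <= v & v - u < d --> P u v"
  proof (intro exI[of _ d] conjI d(1) allI impI)
   fix u v assume uv: "u <= s & s <= v & v - u < d"
   show "P u v" unfolding P_def
   proof
    assume "0 <= u & v <= 1"
    hence "u : {0..1}" "v : {0..1}" "\<bar>u - s\<bar> < d" "\<bar>v - s\<bar> < d" using uv by auto
    then obtain y1 y2 where y12: "y1 : KB y (r/3)" "\<eta> u = psi i y y1" "\<gamma> u = X.psi (i, 1, {}) (floor y) (floor y1)"
     "y2 : KB y (r/3)" "\<eta> v = psi i y y2" "\<gamma> v = X.psi (i, 1, {}) (floor y) (floor y2)" using near by meson
    have "L u v [u, v]" using psi_dist[OF iy(1,2,4) y12(1,4)] X.psi_dist[OF iJ fy iy(5), of "floor y1" "floor y2"] y12 uv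
     by (simp add: floor_KB floor_kd y12(2,3,5,6) L_def ed_def)
    thus "EX ts. L u v ts" by blast
   qed
  qed
 qed simp
 then obtain ts where ts: "sorted ts" "set ts \<subseteq> {0..1}" "ed M (\<eta> 0) (\<eta> 1) <= plen (ed X) (map \<gamma> ts)" by (auto simp: P_def L_def)
 thus ?thesis using plen_le_curve_length[OF ts(1,2), of X \<gamma>] by (meson order_trans)
qed

theorem contains: "contains_as_geodesic_hypersurface TYPE(4) X M" unfolding contains_as_geodesic_hypersurface_def
proof (intro exI[of _ S] exI[of _ f] conjI ballI hypersurface)
 show "bij_betw f (mspace M) S" using f_inj f_S by (simp add: bij_betw_def)
 fix x y assume x: "x : mspace M" and y: "y : mspace M"
 show "ennreal (mdist M x y) = intrinsic_dist X S (f x) (f y)"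
 proof (rule antisym)
  show "ennreal (mdist M x y) <= intrinsic_dist X S (f x) (f y)" unfolding intrinsic_dist_def
  proof (rule INF_greatest)
   fix \<gamma> assume "\<gamma> : {\<gamma>. pathin (subtopology (mtopology_of X) S) \<gamma> & \<gamma> 0 = f x & \<gamma> 1 = f y}"
   hence \<gamma>: "pathin (subtopology (mtopology_of X) S) \<gamma>" "\<gamma> 0 = f x" "\<gamma> 1 = f y" by auto
   show "ennreal (mdist M x y) <= curve_length X \<gamma>"
    using path_lifts[OF \<gamma>(1)] inv_into_f_f[OF f_inj x] inv_into_f_f[OF f_inj y] \<gamma>(2,3) by (simp add: ed_def)
  qed
  obtain p q' where pq: "p : I \<times> cell" "x = \<pi> p" "q' : I \<times> cell" "y = \<pi> q'" using x y pi_surj by blast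
  have "intrinsic_dist X S (F p) (F q') <= (INF l \<in> {l. chain p q' l}. ennreal l)"
   by (rule INF_greatest) (simp add: intrinsic_chain)
  thus "intrinsic_dist X S (f x) (f y) <= ennreal (mdist M x y)" using pq pi_dist[OF pq(1,3)] by (simp add: f_pi)
 qed
qed

end

section \<open>Octahedral and dodecahedral manifolds\<close>

lemma (in covering) ex_hypersurface:
 assumes fin: "hyperbolic_volume TYPE(3) M < \<infinity>"
 shows "EX W :: real metric. complete_finite_volume_hyperbolic TYPE(4) W & orientable_hyperbolic TYPE(4) W &
  contains_as_geodesic_hypersurface TYPE(4) W M &
  hyperbolic_volume TYPE(4) W <= ennreal (2 ^ (q + H + 1) * (real (card Q) / (3 * sqrt a))) * hyperbolic_volume TYPE(3) M"
proof -
 obtain X :: "real metric" and \<omega> where X: "realized_wo Q (sqrt a) 1 J unb utr X \<omega>" using ex_up by blast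
 interpret X: realized_wo Q "sqrt a" 1 J unb utr X \<omega> by (rule X)
 interpret covered N c R \<mu> a b s0 h H t I nb tr M \<pi> q base X \<omega> ..
 note vol = up_volume[OF X]
 have "hyperbolic_volume TYPE(4) X < \<infinity>" using fin by (intro le_less_trans[OF vol]) (simp add: ennreal_mult_less_top)
 moreover have "connected_hyperbolic_manifold TYPE(4) X" using X.hyperbolic_manifold J_base by blast
 moreover have "orientable_hyperbolic TYPE(4) X"
  by (rule X.orientable[of "%p. fst (snd p) * (-1) ^ card (snd (snd p))"]) (use up_sign up_sign_step in auto)
 ultimately show ?thesis using X.complete_X contains vol by (auto simp: complete_finite_volume_hyperbolic_def)
qed

lemma (in realized) identified_once:
 assumes i: "i : I" and x: "x : cell" "x' : cell" and eq: "\<pi> (i, x) = \<pi> (i, x')"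
  and t: "card (tight x) <= 1" and nb: "!!u. u : N ==> nb i u ~= i" shows "x = x'"
proof -
 obtain r where st: "star i x r" by (rule ex_star[OF i x(1)])
 note W = star_walls[OF st]
 have "x : KB x (r/3)" using rpos[OF i x(1) st] cell_ub[OF x(1)] by (intro centre_in_KB) auto
 then obtain w where w: "good x r w x" "(i, x') = dev i w x" using eq psi_centre[OF i x(1) st] psi_rep[OF i x(1) st, of "(i, x')" x] i x by auto
 have wt: "w \<subseteq> tight x" using w(1) by (simp add: good_def)
 have "w = {} | (EX u. u : N & w = {u})"
 proof (cases "w = {}")
  case False
  then obtain u where u: "u : w" by blast
  moreover have "v = v'" if "v : tight x" "v' : tight x" for v v' using card_le_Suc0_iff_eq[OF tight_fin, of x] t that by simp
  ultimately have "w = {u}" "u : N" using wt tight_N by blast+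
  thus ?thesis by blast
 qed simp
 thus ?thesis
 proof
  assume "w = {}"
  thus ?thesis using w(2) dev_centre[OF i x(1) W] by simp
 next
  assume "EX u. u : N & w = {u}"
  then obtain u where u: "u : N" "w = {u}" by blast
  show ?thesis using act_insert[OF op_commuting[OF cell_ub[OF x(1)]], of "{}" u "(i, id)"] wt i w(2) nb[OF u(1)]
   by (simp add: u dev_def pt_def op_def)
 qed
qed

lemma nice_octahedral_hypersurface:
 fixes M :: "'a metric"
 assumes M: "connected_hyperbolic_manifold TYPE(3) M" and nice: "nice_octahedral M" shows "EX W :: real metric.
  complete_finite_volume_hyperbolic TYPE(4) W & orientable_hyperbolic TYPE(4) W &
  contains_as_geodesic_hypersurface TYPE(4) W M &
  hyperbolic_volume TYPE(4) W <= 1844 * hyperbolic_volume TYPE(3) M"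
proof -
 interpret oct: zprism oct_normals pats24 "(1, 0)" "(1, 0)" "(1, 0)" "(3, 0)" "(1, 0)" "(-1, 0)" "(0, 0)" 1 "%x. 0" 1 1
  by (rule oct_zprism)
 have P: "right_angled_ideal_octahedron = oct.poly.poly" using oct_poly unfolding oct.poly.poly_def unfolding oct.N_def by simp
 obtain k \<sigma> g \<pi> where ob: "obtained_by_face_pairing M right_angled_ideal_octahedron k \<sigma> g \<pi>"
  and np: "ALL i<k. ALL F. F facet_of right_angled_ideal_octahedron --> fst (\<sigma> (i, F)) ~= i"
  and fin: "hyperbolic_volume TYPE(3) M < \<infinity>"
   using nice unfolding nice_octahedral_def complete_finite_volume_hyperbolic_def by blast
 obtain nb tr where r: "realized oct.N 1 (ev (3, 0)) {..<k} nb tr M \<pi>" "{..<k} ~= {}"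
  and nb: "!!i u. i < k ==> u : oct.N ==> nb i u = fst (\<sigma> (i, right_angled_ideal_octahedron \<inter> {x. u.*x = 1}))"
   using face_pairing_realized[OF oct.poly.facet_symmetric_axioms P M ob] by metis
 interpret r: realized oct.N 1 "ev (3, 0)" "{..<k}" nb tr M \<pi> by (rule r(1))
 have nbi: "nb i u ~= i" if "i < k" "u : oct.N" for i u
 proof -
  show ?thesis by (metis oct.poly.facets P that np nb[OF that] oct.poly.face_def)
 qed
 \<comment> \<open>With \<open>t = 1\<close> the degree is at most 6, and 6 < 2^3 gives
   \<open>q = 4\<close>; the other caps share one digit.\<close>
 interpret covering oct.N 1 "ev (3, 0)" "ev (1, 0)" "ev (1, 0) / 2" "ev (1, 0) / 2" "ev (-1, 0) / 2" "%u. 0" 1 1 "{..<k}" nb tr M \<pi> 4 0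
 proof
  show "0 : {..<k}" using r(2) by auto
  fix i u v assume *: "i : {..<k}" "u : oct.Q" "v : oct.Q" "u$1 = ev (-1, 0) / 2" "v$1 = ev (-1, 0) / 2" "u.*v = ev (1, 0) / 2"
  have sp: "u : oct.spec" "v : oct.spec" using *(2-5) unfolding oct.spec_def by blast+
  show "\<pi> (i, oct.z u) ~= \<pi> (i, oct.z v)"
  proof
   assume "\<pi> (i, oct.z u) = \<pi> (i, oct.z v)"
   moreover have "card (oct.poly.tight (oct.z u)) <= 1" using oct.special_tight[OF *(2,4)] oct.z_tight[OF sp(1)] by simp
   ultimately have "oct.z u = oct.z v" using r.identified_once[OF *(1) oct.z_cell[OF sp(1)] oct.z_cell[OF sp(2)]] nbi *(1) by auto
   hence "u = v" by (rule oct.z_inj[OF sp])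
   thus False using oct.Q_unit[OF *(2)] *(6) by simp
  qed
 qed auto
 \<comment> \<open>At most 64 copies with at most 24 facets each: 64 * 24 / 2.1 is below
   732.\<close>
 have "2 ^ (4 + 1 + 1) * (real (card oct.Q) / (3 * sqrt (ev (1, 0) / 2))) <= (1844 :: real)"
 proof -
  have "0.7 <= sqrt (1 / 2 :: real)" by (rule real_le_rsqrt) (simp add: power2_eq_square)
  hence "real (card oct.Q) / (3 * sqrt (1 / 2)) <= 24 / (3 * 0.7)" using oct.card_Q zlist_lengths by (intro frac_le) auto
  thus ?thesis by simp
 qed
 hence "ennreal (2 ^ (4 + 1 + 1) * (real (card oct.Q) / (3 * sqrt (ev (1, 0) / 2)))) <= 1844" using ennreal_leI by fastforce
 thus ?thesis using ex_hypersurface[OF fin] by (meson mult_right_mono order_trans zero_le)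
qed

lemma nice_dodecahedral_hypersurface:
 fixes M :: "'a metric"
 assumes M: "connected_hyperbolic_manifold TYPE(3) M" and nice: "nice_dodecahedral M" shows "EX W :: real metric.
  complete_finite_volume_hyperbolic TYPE(4) W & orientable_hyperbolic TYPE(4) W &
  contains_as_geodesic_hypersurface TYPE(4) W M &
  hyperbolic_volume TYPE(4) W <= 13 * 2 ^ 45 * hyperbolic_volume TYPE(3) M"
proof -
 interpret ico: zprism ico_normals pats120 "(0, 1)" "(-1, 1)" "(0, 1)" "(2, 1)" "(-1, 1)" "(1, 0)" "(-1, 1)" "sqrt \<tau>" zcol 25 3
  by (rule ico_zprism)
 have P: "right_angled_dodecahedron = ico.poly.poly"
  using ico_poly unfolding right_angled_dodecahedron_def ico.poly.poly_def unfolding ico.N_def by simp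
 obtain k \<sigma> g \<pi> where ob: "obtained_by_face_pairing M right_angled_dodecahedron k \<sigma> g \<pi>"
  and np: "ALL i<k. inj_on (%x. \<pi> (i, x)) right_angled_dodecahedron"
  and fin: "hyperbolic_volume TYPE(3) M < \<infinity>"
   using nice unfolding nice_dodecahedral_def complete_finite_volume_hyperbolic_def by blast
 obtain nb tr where r: "realized ico.N (sqrt \<tau>) (ev (2, 1)) {..<k} nb tr M \<pi>" "{..<k} ~= {}"
  using face_pairing_realized[OF ico.poly.facet_symmetric_axioms P M ob] by metis
 interpret r: realized ico.N "sqrt \<tau>" "ev (2, 1)" "{..<k}" nb tr M \<pi> by (rule r(1))
 \<comment> \<open>With \<open>t = 3\<close> the degree is at most 24, and 24 < 2^5 gives
   \<open>q = 6\<close>; the other caps use 25 digits.\<close>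
 interpret covering ico.N "sqrt \<tau>" "ev (2, 1)" "ev (-1, 1)" "ev (0, 1) / 2" "ev (-1, 1) / 2" "ev (1, 0) / 2"
  "%u. zcol (ico.rep u)" 25 3 "{..<k}" nb tr M \<pi> 6 0
 proof
  show "0 : {..<k}" using r(2) by auto
  fix i u v assume *: "i : {..<k}" "u : ico.Q" "v : ico.Q" "u$1 = ev (1, 0) / 2" "v$1 = ev (1, 0) / 2" "u.*v = ev (0, 1) / 2"
  have sp: "u : ico.spec" "v : ico.spec" using *(2-5) unfolding ico.spec_def by blast+
  show "\<pi> (i, ico.z u) ~= \<pi> (i, ico.z v)"
  proof
   assume e: "\<pi> (i, ico.z u) = \<pi> (i, ico.z v)"
   have "ico.z u : right_angled_dodecahedron" "ico.z v : right_angled_dodecahedron"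
    using ico.z_cell sp P ico.poly.poly_cell by blast+
   hence "ico.z u = ico.z v" using np e *(1) by (auto dest: inj_onD)
   hence "u = v" by (rule ico.z_inj[OF sp])
   thus False using ico.Q_unit[OF *(2)] *(6) tau_bounds by simp
  qed
 qed auto
 \<comment> \<open>The rough bound \<open>1 / 2\<close> for the offset turns the facet factor into
   80, and 80 * 2^32 is far below the claimed constant.\<close>
 have "2 ^ (6 + 25 + 1) * (real (card ico.Q) / (3 * sqrt (ev (0, 1) / 2))) <= (13 * 2 ^ 45 :: real)"
 proof -
  have "1 / 2 <= sqrt (\<tau> / 2)" using tau_bounds by (intro real_le_rsqrt) (simp add: power2_eq_square)
  hence "real (card ico.Q) / (3 * sqrt (\<tau> / 2)) <= 120 / (3 * (1 / 2))" using ico.card_Q zlist_lengths by (intro frac_le) auto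
  thus ?thesis by simp
 qed
 hence "ennreal (2 ^ (6 + 25 + 1) * (real (card ico.Q) / (3 * sqrt (ev (0, 1) / 2)))) <= ennreal (13 * 2 ^ 45)"
  by (rule ennreal_leI)
 also have "ennreal (13 * 2 ^ 45) = 13 * 2 ^ 45" by (simp add: ennreal_mult ennreal_power[symmetric])
 finally show ?thesis using ex_hypersurface[OF fin] by (meson mult_right_mono order_trans zero_le)
qed

theorem theorem3:
  fixes M :: "'a metric"
  assumes "connected_hyperbolic_manifold TYPE(3) M"
  shows "(nice_dodecahedral M \<longrightarrow>
            (\<exists>W :: real metric.
               complete_finite_volume_hyperbolic TYPE(4) W \<and> orientable_hyperbolic TYPE(4) W \<and>
               contains_as_geodesic_hypersurface TYPE(4) W M \<and>
               hyperbolic_volume TYPE(4) W \<le> 13 * 2 ^ 45 * hyperbolic_volume TYPE(3) M)) \<and>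
         (nice_octahedral M \<longrightarrow>
            (\<exists>W :: real metric.
               complete_finite_volume_hyperbolic TYPE(4) W \<and> orientable_hyperbolic TYPE(4) W \<and>
               contains_as_geodesic_hypersurface TYPE(4) W M \<and>
               hyperbolic_volume TYPE(4) W \<le> 1844 * hyperbolic_volume TYPE(3) M))"
  using nice_dodecahedral_hypersurface[OF assms] nice_octahedral_hypersurface[OF assms] by blast

end
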